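(* Let $f:\overline{\mathbb{C}}\to\overline{\mathbb{C}}$ be a rational map of degree at least $2$ satisfying the Topological Collet-Eckmann condition, let $\mu$ be the unique conformal probability measure of minimal exponent of $f$, and let $\nu_0$ be the unique $f$-invariant probability measure that is absolutely continuous with respect to $\mu$. Then $\nu_0$ is the unique equilibrium state with potential $-\mathrm{HD}(J(f))\ln|f'|$ of $f$.
   Context: Distances, balls, diameters and derivatives on the Riemann sphere $\overline{\mathbb{C}}$ are taken with respect to the spherical metric; $J(f)$ is the Julia set of $f$ and $\mathrm{HD}$ is Hausdorff dimension. Topological Collet-Eckmann (TCE) condition, in its equivalent form of Exponential Shrinking of Components: there exist $\lambda_{\mathrm{Exp}}>1$ and $r_0>0$ such that for every $x\in J(f)$, every integer $n\ge 1$ and every connected component $W$ of $f^{-n}(B(x,r_0))$ we have $\mathrm{diam}(W)\le\lambda_{\mathrm{Exp}}^{-n}$. Conformal measures: for $t>0$, a non-zero finite Borel measure $\mu$ on $\overline{\mathbb{C}}$ is conformal of exponent $t$ for $f$ if for every Borel subset $U$ of $\overline{\mathbb{C}}$ on which $f$ is injective, $\mu(f(U))=\int_U|f'|^t\,d\mu$. The minimal exponent is $\alpha(f)=\inf\{t>0: \text{there is a conformal measure of exponent } t \text{ supported on } J(f)\}$ (attained). Every TCE rational map has exactly one conformal probability measure $\mu$ of exponent $\alpha(f)$, and exactly one invariant probability measure $\nu_0$ absolutely continuous with respect to $\mu$. For an $f$-invariant probability measure $\nu$, $h_\nu$ denotes its metric entropy and $\chi_\nu=\int\ln|f'|\,d\nu$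 its Lyapunov exponent. An $f$-invariant probability measure is an equilibrium state with potential $-\mathrm{HD}(J(f))\ln|f'|$ of $f$ if it is supported on $J(f)$ and maximizes $h_\nu-\mathrm{HD}(J(f))\,\chi_\nu$ among all $f$-invariant probability measures $\nu$ supported on $J(f)$. *)

theory Defs
  imports
    "HOL-Analysis.Analysis"
    "HOL-Probability.Probability"
    "HOL-Computational_Algebra.Polynomial"
begin

section \<open>The Riemann sphere with its spherical metric\<close>

datatype rsphere = Fin complex | Infty

text \<open>Inverse stereographic projection onto the unit sphere of \<open>complex \<times> real\<close>, which is
  isometric to Euclidean three-space.\<close>

fun stereo :: "rsphere \<Rightarrow> complex \<times> real" where
  "stereo (Fin z) = ((2 / (1 + (norm z)\<^sup>2)) *\<^sub>R z, ((norm z)\<^sup>2 - 1) / (1 + (norm z)\<^sup>2))"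
| "stereo Infty = (0, 1)"

lemma one_plus_norm_sq_pos: "1 + (norm z)\<^sup>2 > 0" "1 + (norm z)\<^sup>2 \<noteq> 0"
  for z :: "'a::real_normed_vector"
  by (auto simp: add_pos_nonneg add_nonneg_eq_0_iff)

lemma inner_stereo_self: "stereo x \<bullet> stereo x = 1"
proof (cases x)
  case (Fin z)
  define r where "r = 1 + (norm z)\<^sup>2"
  have r: "r \<noteq> 0" and zz: "z \<bullet> z = r - 1"
    using one_plus_norm_sq_pos[of z] by (auto simp: r_def dot_square_norm)
  have st: "stereo x = ((2 / r) *\<^sub>R z, (r - 2) / r)"
    by (simp add: Fin r_def)
  have "stereo x \<bullet> stereo x = (2 / r) * ((2 / r) * (r - 1)) + ((r - 2) / r) * ((r - 2) / r)"
    by (simp add: st zz)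
  also have "\<dots> = 1" using r by (simp add: field_simps)
  finally show ?thesis .
qed auto

lemma norm_stereo: "norm (stereo x) = 1"
  by (simp add: norm_eq_sqrt_inner inner_stereo_self)

lemma inj_stereo: "stereo x = stereo y \<longleftrightarrow> x = y"
proof
  assume eq: "stereo x = stereo y"
  have third: "snd (stereo (Fin z)) = 1 - 2 / (1 + (norm z)\<^sup>2)" for z
    using one_plus_norm_sq_pos(2)[of z] by (simp add: field_simps)
  have less: "snd (stereo (Fin z)) \<noteq> 1" for z
    using one_plus_norm_sq_pos(2)[of z] by (simp add: third)
  show "x = y"
  proof (cases x; cases y)
    fix z w assume *: "x = Fin z" "y = Fin w"
    have "2 / (1 + (norm z)\<^sup>2) = 2 / (1 + (norm w)\<^sup>2)"
      using eq third[of z] third[of w] * by auto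
    moreover have "2 / (1 + (norm w)\<^sup>2) \<noteq> 0"
      using one_plus_norm_sq_pos(2)[of w] by simp
    moreover have "(2 / (1 + (norm z)\<^sup>2)) *\<^sub>R z = (2 / (1 + (norm w)\<^sup>2)) *\<^sub>R w"
      using eq * by simp
    ultimately show ?thesis using * by (metis scaleR_left_imp_eq)
  qed (use eq less in \<open>auto simp del: stereo.simps(1)\<close>, (metis less snd_conv stereo.simps(2))+)
qed auto

lemma arccos_inner_triangle:
  fixes u v w :: "'a::real_inner"
  assumes u: "norm u = 1" and v: "norm v = 1" and w: "norm w = 1"
  shows "arccos (u \<bullet> w) \<le> arccos (u \<bullet> v) + arccos (v \<bullet> w)"
proof -
  have bd: "\<bar>a \<bullet> b\<bar> \<le> 1" if "norm a = 1" "norm b = 1" for a b :: 'a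
    using Cauchy_Schwarz_ineq2[of a b] that by simp
  define a where "a = arccos (u \<bullet> v)"
  define b where "b = arccos (v \<bullet> w)"
  have ab: "0 \<le> a" "a \<le> pi" "0 \<le> b" "b \<le> pi"
    using bd[OF u v] bd[OF v w] by (auto simp: a_def b_def abs_le_iff intro!: arccos_lbound arccos_ubound)
  have ca: "cos a = u \<bullet> v" and cb: "cos b = v \<bullet> w"
    using bd[OF u v] bd[OF v w] by (auto simp: a_def b_def cos_arccos_abs)
  define p where "p = u - cos a *\<^sub>R v"
  define q where "q = w - cos b *\<^sub>R v"
  have vv: "v \<bullet> v = 1" "u \<bullet> u = 1" "w \<bullet> w = 1"
    using u v w by (auto simp: dot_square_norm)
  have "p \<bullet> p = 1 - (cos a)\<^sup>2"
    unfolding p_def using vv ca by (simp add: inner_diff inner_commute power2_eq_square algebra_simps)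
  then have np: "norm p = sin a"
    using ab by (simp add: norm_eq_sqrt_inner sin_squared_eq[symmetric] sin_ge_zero)
  have "q \<bullet> q = 1 - (cos b)\<^sup>2"
    unfolding q_def using vv cb by (simp add: inner_diff inner_commute power2_eq_square algebra_simps)
  then have nq: "norm q = sin b"
    using ab by (simp add: norm_eq_sqrt_inner sin_squared_eq[symmetric] sin_ge_zero)
  have "u \<bullet> w = cos a * cos b + p \<bullet> q"
    unfolding p_def q_def using vv ca cb by (simp add: inner_diff inner_commute algebra_simps)
  moreover have "p \<bullet> q \<ge> - (sin a * sin b)"
    using Cauchy_Schwarz_ineq2[of p q] np nq by (simp add: abs_le_iff)
  ultimately have le: "cos (a + b) \<le> u \<bullet> w" by (simp add: cos_add)
  show ?thesis
  proof (cases "a + b \<le> pi")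
    case True
    have "arccos (u \<bullet> w) \<le> arccos (cos (a + b))"
      using le bd[OF u w] by (intro arccos_le_arccos) (auto simp: abs_le_iff)
    then show ?thesis using True ab by (simp add: arccos_cos a_def b_def)
  next
    case False
    have "arccos (u \<bullet> w) \<le> pi" using bd[OF u w] by (intro arccos_ubound) (auto simp: abs_le_iff)
    then show ?thesis using False by (simp add: a_def b_def)
  qed
qed

text \<open>Great-circle distance, i.e. the distance of the Riemannian metric
  \<open>2 |dz| / (1 + |z|\<^sup>2)\<close>.\<close>

instantiation rsphere :: metric_space
begin

definition dist_rsphere :: "rsphere \<Rightarrow> rsphere \<Rightarrow> real" where
  "dist_rsphere x y = arccos (stereo x \<bullet> stereo y)"

definition uniformity_rsphere :: "(rsphere \<times> rsphere) filter" where
  "uniformity_rsphere = (INF e\<in>{0 <..}. principal {(x, y). dist x y < e})"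

definition open_rsphere :: "rsphere set \<Rightarrow> bool" where
  "open_rsphere U \<longleftrightarrow> (\<forall>x\<in>U. eventually (\<lambda>(x', y). x' = x \<longrightarrow> y \<in> U) uniformity)"

instance
proof
  fix x y z :: rsphere
  have bd: "\<bar>stereo x \<bullet> stereo y\<bar> \<le> 1"
    using Cauchy_Schwarz_ineq2[of "stereo x" "stereo y"] by (simp add: norm_stereo)
  show "dist x y = 0 \<longleftrightarrow> x = y"
  proof
    assume "dist x y = 0"
    then have "stereo x \<bullet> stereo y = 1"
      using bd cos_arccos_abs[of "stereo x \<bullet> stereo y"] by (simp add: dist_rsphere_def)
    then have "(stereo x - stereo y) \<bullet> (stereo x - stereo y) = 0"
      by (simp add: inner_diff inner_stereo_self inner_commute)
    then show "x = y" by (simp add: inj_stereo)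
  qed (simp add: dist_rsphere_def inner_stereo_self)
  show "dist x y \<le> dist x z + dist y z"
    using arccos_inner_triangle[of "stereo x" "stereo z" "stereo y"]
    by (simp add: dist_rsphere_def norm_stereo inner_commute)
qed (simp_all add: uniformity_rsphere_def open_rsphere_def)

end

section \<open>Rational maps\<close>

text \<open>The value at \<open>Infty\<close> is read off from the coefficients in degree
  \<open>max (degree p) (degree q)\<close>.\<close>

fun rat_eval :: "complex poly \<Rightarrow> complex poly \<Rightarrow> rsphere \<Rightarrow> rsphere" where
  "rat_eval p q (Fin z) = (if poly q z = 0 then Infty else Fin (poly p z / poly q z))"
| "rat_eval p q Infty =
     (let d = max (degree p) (degree q)
      in if coeff q d = 0 then Infty else Fin (coeff p d / coeff q d))"

definition rational_map :: "(rsphere \<Rightarrow> rsphere) \<Rightarrow> nat \<Rightarrow> bool" where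
  "rational_map f d \<longleftrightarrow>
     (\<exists>p q. coprime p q \<and> d = max (degree p) (degree q) \<and> f = rat_eval p q)"

text \<open>The norm \<open>|f'(x)|\<close> of the derivative with respect to the spherical metric. Being stated
  through the metric, it needs no case distinction at \<open>Infty\<close> or at poles; in the affine
  coordinate it is the usual expression, see \<open>sph_deriv_Fin\<close>.\<close>

definition sph_deriv :: "(rsphere \<Rightarrow> rsphere) \<Rightarrow> rsphere \<Rightarrow> real" where
  "sph_deriv f x = Lim (at x) (\<lambda>y. dist (f y) (f x) / dist y x)"

lemma dist_rsphere_arcsin: "dist x y = 2 * arcsin (norm (stereo x - stereo y) / 2)"
  for x y :: rsphere
proof -
  define s where "s = norm (stereo x - stereo y) / 2"
  have s: "0 \<le> s" "s \<le> 1"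
    using norm_triangle_ineq4[of "stereo x" "stereo y"] by (auto simp: s_def norm_stereo)
  define a where "a = arcsin s"
  have a: "0 \<le> a" "a \<le> pi / 2" "sin a = s"
    using s arcsin_le_arcsin[of 0 s] arcsin_bounded[of s] by (auto simp: a_def)
  have "4 * s\<^sup>2 = 2 - 2 * (stereo x \<bullet> stereo y)"
    by (simp add: s_def power_divide power2_norm_eq_inner inner_diff inner_stereo_self inner_commute)
  then have "stereo x \<bullet> stereo y = cos (2 * a)"
    using cos_double_sin[of a] a(3) by simp
  then show ?thesis
    using a by (simp add: dist_rsphere_def arccos_cos a_def s_def)
qed

lemma norm_stereo_diff_Fin:
  "norm (stereo (Fin z) - stereo (Fin w)) / 2 =
     norm (z - w) / sqrt ((1 + (norm z)\<^sup>2) * (1 + (norm w)\<^sup>2))"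
proof -
  define r where "r = 1 + (norm z)\<^sup>2"
  define s where "s = 1 + (norm w)\<^sup>2"
  have r: "r > 0" "z \<bullet> z = r - 1" and s: "s > 0" "w \<bullet> w = s - 1"
    using one_plus_norm_sq_pos[of z] one_plus_norm_sq_pos[of w]
    by (auto simp: r_def s_def dot_square_norm)
  have st: "stereo (Fin z) = ((2 / r) *\<^sub>R z, (r - 2) / r)" "stereo (Fin w) = ((2 / s) *\<^sub>R w, (s - 2) / s)"
    by (simp_all add: r_def s_def)
  have "stereo (Fin z) \<bullet> stereo (Fin w) = (2 / r) * ((2 / s) * (z \<bullet> w)) + ((r - 2) / r) * ((s - 2) / s)"
    unfolding st by simp
  also have "\<dots> = 1 - 2 * ((r - 1) + (s - 1) - 2 * (z \<bullet> w)) / (r * s)"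
    using r s by (simp add: field_simps)
  also have "(r - 1) + (s - 1) - 2 * (z \<bullet> w) = (norm (z - w))\<^sup>2"
    using r(2) s(2) by (simp add: power2_norm_eq_inner inner_diff inner_commute)
  finally have "(norm (stereo (Fin z) - stereo (Fin w)) / 2)\<^sup>2 = (norm (z - w))\<^sup>2 / (r * s)"
    by (simp add: power_divide power2_norm_eq_inner[of "stereo _ - stereo _"] inner_diff inner_stereo_self inner_commute
        del: stereo.simps)
  then have "sqrt ((norm (stereo (Fin z) - stereo (Fin w)) / 2)\<^sup>2) = sqrt ((norm (z - w))\<^sup>2 / (r * s))"
    by simp
  then show ?thesis
    unfolding r_def s_def by (simp add: real_sqrt_divide del: stereo.simps)
qed

lemma tendsto_arcsin_quotient: "((\<lambda>s::real. if s = 0 then 1 else arcsin s / s) \<longlongrightarrow> 1) (nhds 0)"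
proof -
  have "(arcsin has_real_derivative inverse (sqrt (1 - 0\<^sup>2))) (at 0)"
    by (rule DERIV_arcsin) auto
  then have "((\<lambda>s::real. arcsin s / s) \<longlongrightarrow> 1) (at 0)"
    by (simp add: has_field_derivative_iff)
  then have "((\<lambda>s::real. if s = 0 then 1 else arcsin s / s) \<longlongrightarrow> 1) (at 0)"
    by (rule Lim_transform_eventually) (auto simp: eventually_at_filter)
  then show ?thesis
    using tendsto_at_iff_tendsto_nhds[of "\<lambda>s::real. if s = 0 then 1 else arcsin s / s" 0] by simp
qed

lemma tendsto_chordal_0:
  fixes a :: complex
  assumes "(h \<longlongrightarrow> a) F"
  shows "((\<lambda>w. norm (h w - a) / sqrt ((1 + (norm (h w))\<^sup>2) * (1 + (norm a)\<^sup>2))) \<longlongrightarrow> 0) F"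
proof -
  have "((\<lambda>w. norm (h w - a) / sqrt ((1 + (norm (h w))\<^sup>2) * (1 + (norm a)\<^sup>2))) \<longlongrightarrow>
      norm (a - a) / sqrt ((1 + (norm a)\<^sup>2) * (1 + (norm a)\<^sup>2))) F"
    using one_plus_norm_sq_pos(2)[of a] by (intro tendsto_intros assms) auto
  then show ?thesis by simp
qed

lemma isCont_Fin: "isCont Fin z"
proof -
  have "((\<lambda>s::real. arcsin s) \<longlongrightarrow> arcsin 0) (nhds 0)"
    using isCont_arcsin[of 0] tendsto_at_iff_tendsto_nhds[of "arcsin :: real \<Rightarrow> real" 0] by (simp add: isCont_def)
  from filterlim_compose[OF this tendsto_chordal_0[OF tendsto_ident_at[of z UNIV]]]
  have "((\<lambda>w. 2 * arcsin (norm (w - z) / sqrt ((1 + (norm w)\<^sup>2) * (1 + (norm z)\<^sup>2)))) \<longlongrightarrow> 2 * 0) (at z)"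
    by (intro tendsto_mult_left) simp
  then have "((\<lambda>w. dist (Fin w) (Fin z)) \<longlongrightarrow> 0) (at z)"
    unfolding dist_rsphere_arcsin norm_stereo_diff_Fin by simp
  then show ?thesis
    by (simp add: isCont_def tendsto_dist_iff[of Fin])
qed

fun the_Fin :: "rsphere \<Rightarrow> complex" where
  "the_Fin (Fin z) = z"
| "the_Fin Infty = 0"

lemma filterlim_the_Fin:
  "filterlim the_Fin (at z) (at (Fin z))" "eventually (\<lambda>y. y \<noteq> Infty) (at (Fin z))"
proof -
  have ne: "eventually (\<lambda>y. y \<noteq> Infty) (at (Fin z))"
    by (auto simp: eventually_at_topological intro!: exI[of _ "- {Infty}"])
  have lip: "norm (stereo x - stereo y) \<le> dist x y" for x y :: rsphere
  proof -
    define s where "s = norm (stereo x - stereo y) / 2"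
    have s: "0 \<le> s" "s \<le> 1"
      using norm_triangle_ineq4[of "stereo x" "stereo y"] by (auto simp: s_def norm_stereo)
    have "0 \<le> arcsin s" using s arcsin_le_arcsin[of 0 s] by simp
    then have "s \<le> arcsin s" using sin_x_le_x[of "arcsin s"] s by simp
    then show ?thesis by (simp add: dist_rsphere_arcsin s_def)
  qed
  have "((\<lambda>y. dist y (Fin z)) \<longlongrightarrow> 0) (at (Fin z))"
    by (rule tendsto_dist_iff[THEN iffD1, OF tendsto_ident_at])
  then have "((\<lambda>y. dist (stereo y) (stereo (Fin z))) \<longlongrightarrow> 0) (at (Fin z))"
    by (rule tendsto_sandwich[OF _ _ tendsto_const, rotated 2]) (auto simp: dist_norm lip simp del: stereo.simps)
  then have st: "(stereo \<longlongrightarrow> stereo (Fin z)) (at (Fin z))"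
    by (rule tendsto_dist_iff[THEN iffD2])
  have inv: "the_Fin x = (1 / (1 - snd (stereo x))) *\<^sub>R fst (stereo x)" if "x \<noteq> Infty" for x
  proof (cases x)
    case (Fin w)
    define r where "r = 1 + (norm w)\<^sup>2"
    have r: "r \<noteq> 0" using one_plus_norm_sq_pos(2)[of w] by (simp add: r_def)
    have st: "stereo x = ((2 / r) *\<^sub>R w, (r - 2) / r)" by (simp add: Fin r_def)
    have "1 - (r - 2) / r = 2 / r" using r by (simp add: field_simps)
    then show ?thesis using r unfolding st by (simp add: Fin)
  qed (use that in simp)
  have ne1: "1 - snd (stereo (Fin z)) \<noteq> 0"
    using one_plus_norm_sq_pos[of z] by (auto simp: field_simps)
  have "((\<lambda>x. (1 / (1 - snd (stereo x))) *\<^sub>R fst (stereo x)) \<longlongrightarrow>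
      (1 / (1 - snd (stereo (Fin z)))) *\<^sub>R fst (stereo (Fin z))) (at (Fin z))"
    using ne1 by (intro tendsto_intros st)
  then have "((\<lambda>x. (1 / (1 - snd (stereo x))) *\<^sub>R fst (stereo x)) \<longlongrightarrow> z) (at (Fin z))"
    using inv[of "Fin z"] by (simp del: stereo.simps)
  then have "(the_Fin \<longlongrightarrow> z) (at (Fin z))"
    by (rule Lim_transform_eventually) (use ne in \<open>eventually_elim, auto simp: inv\<close>)
  moreover have "eventually (\<lambda>y. the_Fin y \<noteq> z) (at (Fin z))"
    using ne by (auto simp: eventually_at_filter elim!: eventually_mono) (metis rsphere.exhaust the_Fin.simps(1))
  ultimately show "filterlim the_Fin (at z) (at (Fin z))"
    by (simp add: filterlim_at)
  show "eventually (\<lambda>y. y \<noteq> Infty) (at (Fin z))" by (fact ne)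
qed

lemma sph_deriv_Fin:
  assumes g: "(g has_field_derivative D) (at z)"
    and f: "eventually (\<lambda>w. f (Fin w) = Fin (g w)) (nhds z)"
  shows "sph_deriv f (Fin z) = norm D * (1 + (norm z)\<^sup>2) / (1 + (norm (g z))\<^sup>2)"
proof -
  define k where "k = (\<lambda>z w :: complex. norm (z - w) / sqrt ((1 + (norm z)\<^sup>2) * (1 + (norm w)\<^sup>2)))"
  define A where "A = (\<lambda>s::real. if s = 0 then 1 else arcsin s / s)"
  have dist_Fin: "dist (Fin z) (Fin w) = 2 * (A (k z w) * k z w)" for z w
    by (simp add: dist_rsphere_arcsin norm_stereo_diff_Fin A_def k_def del: stereo.simps)
  have fz: "f (Fin z) = Fin (g z)" using f by (rule eventually_nhds_x_imp_x)
  have gc: "(g \<longlongrightarrow> g z) (at z)"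
    using DERIV_isCont[OF g] by (simp add: isCont_def)
  have k1: "((\<lambda>w. k (g w) (g z)) \<longlongrightarrow> 0) (at z)"
    unfolding k_def by (rule tendsto_chordal_0[OF gc])
  have k2: "((\<lambda>w. k w z) \<longlongrightarrow> 0) (at z)"
    unfolding k_def by (rule tendsto_chordal_0) (rule tendsto_ident_at)
  have A: "(A \<longlongrightarrow> 1) (nhds 0)" unfolding A_def by (rule tendsto_arcsin_quotient)
  have A1: "((\<lambda>w. A (k (g w) (g z))) \<longlongrightarrow> 1) (at z)" by (rule filterlim_compose[OF A k1])
  have A2: "((\<lambda>w. A (k w z)) \<longlongrightarrow> 1) (at z)" by (rule filterlim_compose[OF A k2])
  have dq: "((\<lambda>w. norm ((g w - g z) / (w - z))) \<longlongrightarrow> norm D) (at z)"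
    using g by (intro tendsto_norm) (simp add: has_field_derivative_iff)
  have sq': "((\<lambda>w. sqrt ((1 + (norm w)\<^sup>2) * (1 + (norm z)\<^sup>2)) / sqrt ((1 + (norm (g w))\<^sup>2) * (1 + (norm (g z))\<^sup>2)))
      \<longlongrightarrow> sqrt ((1 + (norm z)\<^sup>2) * (1 + (norm z)\<^sup>2)) / sqrt ((1 + (norm (g z))\<^sup>2) * (1 + (norm (g z))\<^sup>2))) (at z)"
    using one_plus_norm_sq_pos(2)[of "g z"] by (intro tendsto_intros gc) auto
  have sq: "((\<lambda>w. sqrt ((1 + (norm w)\<^sup>2) * (1 + (norm z)\<^sup>2)) / sqrt ((1 + (norm (g w))\<^sup>2) * (1 + (norm (g z))\<^sup>2)))
      \<longlongrightarrow> (1 + (norm z)\<^sup>2) / (1 + (norm (g z))\<^sup>2)) (at z)"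
    using sq' by simp
  have "((\<lambda>w. A (k (g w) (g z)) / A (k w z) * (norm ((g w - g z) / (w - z)) *
      (sqrt ((1 + (norm w)\<^sup>2) * (1 + (norm z)\<^sup>2)) / sqrt ((1 + (norm (g w))\<^sup>2) * (1 + (norm (g z))\<^sup>2)))))
      \<longlongrightarrow> 1 / 1 * (norm D * ((1 + (norm z)\<^sup>2) / (1 + (norm (g z))\<^sup>2)))) (at z)"
    by (intro tendsto_intros A1 A2 dq sq) auto
  then have L: "((\<lambda>w. dist (f (Fin w)) (f (Fin z)) / dist (Fin w) (Fin z))
      \<longlongrightarrow> norm D * (1 + (norm z)\<^sup>2) / (1 + (norm (g z))\<^sup>2)) (at z)"
    (is "(_ \<longlongrightarrow> ?L) _")
  proof (rule_tac Lim_transform_eventually)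
    have "eventually (\<lambda>w. f (Fin w) = Fin (g w)) (at z)"
      using f by (simp add: eventually_nhds_conv_at)
    then show "eventually (\<lambda>w. A (k (g w) (g z)) / A (k w z) * (norm ((g w - g z) / (w - z)) *
      (sqrt ((1 + (norm w)\<^sup>2) * (1 + (norm z)\<^sup>2)) / sqrt ((1 + (norm (g w))\<^sup>2) * (1 + (norm (g z))\<^sup>2))))
      = dist (f (Fin w)) (f (Fin z)) / dist (Fin w) (Fin z)) (at z)"
      by eventually_elim (simp add: fz dist_Fin, simp add: k_def norm_divide mult_ac)
  qed simp
  have "((\<lambda>y. dist (f (Fin (the_Fin y))) (f (Fin z)) / dist (Fin (the_Fin y)) (Fin z)) \<longlongrightarrow> ?L) (at (Fin z))"
    by (rule filterlim_compose[OF L filterlim_the_Fin(1)])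
  then have "((\<lambda>y. dist (f y) (f (Fin z)) / dist y (Fin z)) \<longlongrightarrow> ?L) (at (Fin z))"
  proof (rule Lim_transform_eventually)
    have Fin_the_Fin: "Fin (the_Fin y) = y" if "y \<noteq> Infty" for y using that by (cases y) auto
    show "eventually (\<lambda>y. dist (f (Fin (the_Fin y))) (f (Fin z)) / dist (Fin (the_Fin y)) (Fin z)
        = dist (f y) (f (Fin z)) / dist y (Fin z)) (at (Fin z))"
      by (rule eventually_mono[OF filterlim_the_Fin(2)]) (simp add: Fin_the_Fin)
  qed
  moreover have "at (Fin z) \<noteq> bot"
  proof
    assume bot: "at (Fin z) = bot"
    have "filterlim Fin (at (Fin z)) (at z)"
      using isCont_Fin[of z] by (auto simp: filterlim_at isCont_def eventually_at_filter)
    then have "at z = bot" by (metis bot filterlim_def filtermap_bot_iff le_bot)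
    then show False by simp
  qed
  ultimately show ?thesis
    unfolding sph_deriv_def by (intro tendsto_Lim)
qed

section \<open>Julia set and the Topological Collet-Eckmann condition\<close>

definition normal_family_on :: "rsphere set \<Rightarrow> (rsphere \<Rightarrow> rsphere) set \<Rightarrow> bool" where
  "normal_family_on U F \<longleftrightarrow>
     (\<forall>g :: nat \<Rightarrow> rsphere \<Rightarrow> rsphere. range g \<subseteq> F \<longrightarrow>
        (\<exists>r h. strict_mono r \<and>
           (\<forall>K. compact K \<and> K \<subseteq> U \<longrightarrow> uniform_limit K (\<lambda>n. g (r n)) h sequentially)))"

definition Fatou :: "(rsphere \<Rightarrow> rsphere) \<Rightarrow> rsphere set" where
  "Fatou f = \<Union>{U. open U \<and> normal_family_on U (range (\<lambda>n. f ^^ n))}"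

definition Julia :: "(rsphere \<Rightarrow> rsphere) \<Rightarrow> rsphere set" where
  "Julia f = - Fatou f"

text \<open>Topological Collet-Eckmann condition, in the form of Exponential Shrinking of Components.\<close>

definition TCE :: "(rsphere \<Rightarrow> rsphere) \<Rightarrow> bool" where
  "TCE f \<longleftrightarrow>
     (\<exists>lam r0. lam > 1 \<and> r0 > 0 \<and>
        (\<forall>x\<in>Julia f. \<forall>n\<ge>1. \<forall>W\<in>components ((f ^^ n) -` ball x r0).
           diameter W \<le> 1 / lam ^ n))"

section \<open>Hausdorff dimension\<close>

definition hausdorff_content :: "real \<Rightarrow> real \<Rightarrow> 'a::metric_space set \<Rightarrow> ennreal" where
  "hausdorff_content s \<delta> A =
     (INF C \<in> {C :: nat \<Rightarrow> 'a set. A \<subseteq> (\<Union>i. C i) \<and> (\<forall>i. bounded (C i) \<and> diameter (C i) \<le> \<delta>)}.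
        \<Sum>i. ennreal (diameter (C i) powr s))"

definition hausdorff_measure :: "real \<Rightarrow> 'a::metric_space set \<Rightarrow> ennreal" where
  "hausdorff_measure s A = (SUP \<delta>\<in>{0<..}. hausdorff_content s \<delta> A)"

text \<open>Only exponents \<open>s > 0\<close> are used, so that the convention \<open>0 powr 0 = 0\<close> plays no role.\<close>

definition hausdorff_dim :: "'a::metric_space set \<Rightarrow> ennreal" where
  "hausdorff_dim A = (INF s\<in>{s. 0 < s \<and> hausdorff_measure s A = 0}. ennreal s)"

section \<open>Conformal measures\<close>

definition conformal_measure :: "(rsphere \<Rightarrow> rsphere) \<Rightarrow> real \<Rightarrow> rsphere measure \<Rightarrow> bool" where
  "conformal_measure f t \<mu> \<longleftrightarrow>
     t > 0 \<and> sets \<mu> = sets borel \<and> finite_measure \<mu> \<and> emeasure \<mu> UNIV \<noteq> 0 \<and>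
     (\<forall>U\<in>sets borel. inj_on f U \<longrightarrow>
        emeasure \<mu> (f ` U) = (\<integral>\<^sup>+x\<in>U. ennreal (sph_deriv f x powr t) \<partial>\<mu>))"

text \<open>For a closed set \<open>K\<close> this says that the topological support is contained in \<open>K\<close>.\<close>

definition supported_on :: "rsphere measure \<Rightarrow> rsphere set \<Rightarrow> bool" where
  "supported_on \<mu> K \<longleftrightarrow> emeasure \<mu> (- K) = 0"

definition minimal_exponent :: "(rsphere \<Rightarrow> rsphere) \<Rightarrow> real" where
  "minimal_exponent f = Inf {t. t > 0 \<and> (\<exists>\<mu>. conformal_measure f t \<mu> \<and> supported_on \<mu> (Julia f))}"

section \<open>Invariant measures, entropy and equilibrium states\<close>

definition invariant_prob :: "(rsphere \<Rightarrow> rsphere) \<Rightarrow> rsphere measure \<Rightarrow> bool" where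
  "invariant_prob f \<nu> \<longleftrightarrow> sets \<nu> = sets borel \<and> prob_space \<nu> \<and> distr \<nu> borel f = \<nu>"

definition partition_entropy :: "'a measure \<Rightarrow> 'a set set \<Rightarrow> real" where
  "partition_entropy M P = (\<Sum>A\<in>P. - (measure M A * ln (measure M A)))"

text \<open>The join of the pullbacks of \<open>P\<close> under \<open>f ^^ 0, \<dots>, f ^^ (n - 1)\<close>; it may contain the empty
  set, which does not contribute to the entropy.\<close>

definition iterated_join :: "'a measure \<Rightarrow> ('a \<Rightarrow> 'a) \<Rightarrow> 'a set set \<Rightarrow> nat \<Rightarrow> 'a set set" where
  "iterated_join M f P n =
     {(\<Inter>i<n. (f ^^ i) -` A i) \<inter> space M | A. \<forall>i<n. A i \<in> P}"

definition metric_entropy :: "'a measure \<Rightarrow> ('a \<Rightarrow> 'a) \<Rightarrow> ereal" where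
  "metric_entropy M f =
     (SUP P\<in>{P. finite P \<and> P \<subseteq> sets M \<and> partition_on (space M) P}.
        ereal (lim (\<lambda>n. partition_entropy M (iterated_join M f P n) / real n)))"

text \<open>The integral of an extended real function as the difference of the integrals of its positive
  and negative parts (\<open>e2ennreal\<close> maps negative values to 0).\<close>

definition ereal_integral :: "'a measure \<Rightarrow> ('a \<Rightarrow> ereal) \<Rightarrow> ereal" where
  "ereal_integral M g =
     enn2ereal (\<integral>\<^sup>+x. e2ennreal (g x) \<partial>M) - enn2ereal (\<integral>\<^sup>+x. e2ennreal (- g x) \<partial>M)"

text \<open>The library has \<open>ln 0 = 0\<close>, whereas the integrand \<open>ln |f'|\<close> must be \<open>-\<infinity>\<close> at critical
  points.\<close>

definition lyapunov :: "(rsphere \<Rightarrow> rsphere) \<Rightarrow> rsphere measure \<Rightarrow> ereal" where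
  "lyapunov f \<nu> =
     ereal_integral \<nu> (\<lambda>x. if sph_deriv f x = 0 then -\<infinity> else ereal (ln (sph_deriv f x)))"

text \<open>Equilibrium states with potential \<open>- t ln |f'|\<close>.\<close>

definition equilibrium_state :: "(rsphere \<Rightarrow> rsphere) \<Rightarrow> real \<Rightarrow> rsphere measure \<Rightarrow> bool" where
  "equilibrium_state f t \<nu> \<longleftrightarrow>
     invariant_prob f \<nu> \<and> supported_on \<nu> (Julia f) \<and>
     (\<forall>\<nu>'. invariant_prob f \<nu>' \<and> supported_on \<nu>' (Julia f) \<longrightarrow>
        metric_entropy \<nu>' f - ereal t * lyapunov f \<nu>' \<le> metric_entropy \<nu> f - ereal t * lyapunov f \<nu>)"

end

theory Submission
 imports
  Defs
  "HOL-Complex_Analysis.Complex_Analysis"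
  "HOL-Computational_Algebra.Field_as_Ring"
  "HOL-Computational_Algebra.Polynomial_Factorial"
  "HOL-Computational_Algebra.Fundamental_Theorem_Algebra"
begin

text \<open>Exponential shrinking of components makes every invariant measure \<open>\<nu>\<close> on the Julia set \<open>J\<close>
 expanding. By Gibbs' inequality, a subprobability weight on a cover of \<open>J\<close> by sets whose images stay
 small along the orbit bounds the entropy of \<open>\<nu>\<close>. The weights \<open>r powr s\<close> of a Hausdorff cover give
 \<open>h \<le> s * chi\<close> whenever the \<open>s\<close>-dimensional measure of \<open>J\<close> vanishes; the Jacobian of the conformal
 measure \<open>\<mu>\<close> of exponent \<open>\<alpha>\<close> gives \<open>h \<ge> \<alpha> * chi\<close> for absolutely continuous measures. Since \<open>\<mu>\<close> has
 mass at least \<open>c * r powr \<alpha>\<close> on arbitrarily small balls around every point of \<open>J\<close>, the dimension of \<open>J\<close> is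
 \<open>\<alpha>\<close>, and the absolutely continuous measure attains the maximum \<open>0\<close>.

 If \<open>\<nu>\<close> is not absolutely continuous, weight the components of preimages of balls by \<open>\<mu>\<close>: visits to a
 \<open>\<mu>\<close>-null set at times of bounded distortion make these weights exponentially better than needed, so
 \<open>h < \<alpha> * chi\<close>. Two absolutely continuous invariant measures agree, as an invariant set of positive
 measure has full \<open>\<mu>\<close>-measure in a ball around a point of \<open>J\<close>, whose forward images cover all but
 countably many points. That such a measure lives on \<open>J\<close> follows from recurrence: near a recurrent point of the Fatou set some
 iterates would collapse to a point or converge to the identity.\<close>

section \<open>Geometry of the sphere\<close>

text \<open>The obstacle is that critical points may lie on or near the Julia set, so pull-backs
  have no uniform multiplicative distortion. The proof therefore rests on an additive second-order
  estimate with one global constant \<open>M\<close>: along a set whose \<open>n\<close>-th image is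
  small, the stretching at step \<open>i\<close> is at most \<open>D\<close> plus
  \<open>tail (n - i)\<close>, whatever the critical points do. After taking logarithms such
  products are harmless, because \<open>ln (D + \<eta>)\<close> is bounded and its integral tends to
  \<open>chi\<close> as \<eta> tends to 0. Entropy and exponent are compared by integrating sums
  over \<open>n\<close> steps and dividing by \<open>n\<close>; by invariance each step contributes
  the same integral, and errors bounded in \<open>n\<close> disappear. Multiplicative distortion is
  claimed only at \<open>good\<close> times, which have large \<nu>-probability uniformly in
  \<open>n\<close>. The coding argument may mispredict the partition cell at a small proportion of
  times, each at a fixed price; this pays for the last steps of every block, where the pieces are no
  longer small.\<close>

lemma arcsin_bounds:
 assumes "0 \<le> k" "k \<le> 1"
 shows "0 \<le> arcsin k" "arcsin k \<le> pi / 2" "k \<le> arcsin k" "arcsin k \<le> 2 * k" "arcsin k - k \<le> 2 * k\<^sup>2"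
proof -
 define x where "x = arcsin k"
 have x: "0 \<le> x" "x \<le> pi / 2" "sin x = k"
  using assms arcsin_le_arcsin[of 0 k] arcsin_bounded[of k] by (auto simp: x_def)
 then show "0 \<le> arcsin k" "arcsin k \<le> pi / 2" by (auto simp: x_def)
 show "k \<le> arcsin k" using sin_x_le_x[OF x(1)] x by (simp add: x_def)
 have x2: "x < 2" using x(2) pi_half_less_two by linarith
 have s3: "x - x ^ 3 / 6 \<le> sin x"
 proof -
  define h where "h = (\<lambda>x::real. sin x - (x - x ^ 3 / 6))"
  define h1 where "h1 = (\<lambda>x::real. cos x - (1 - x ^ 2 / 2))"
  define h2 where "h2 = (\<lambda>x::real. x - sin x)"
  have h1: "h1 0 \<le> h1 y" if "0 \<le> y" for y
  proof (rule DERIV_nonneg_imp_nondecreasing[OF that])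
   fix t :: real assume "0 \<le> t" "t \<le> y"
   then show "\<exists>d. (h1 has_real_derivative d) (at t) \<and> 0 \<le> d"
    unfolding h1_def by (intro exI[of _ "t - sin t"] conjI) (auto intro!: derivative_eq_intros simp: sin_x_le_x)
  qed
  have "h 0 \<le> h x"
  proof (rule DERIV_nonneg_imp_nondecreasing[OF x(1)])
   fix t :: real assume "0 \<le> t" "t \<le> x"
   then show "\<exists>d. (h has_real_derivative d) (at t) \<and> 0 \<le> d"
    using h1[of t] unfolding h_def by (intro exI[of _ "h1 t"] conjI) (auto intro!: derivative_eq_intros simp: h1_def)
  qed
  then show ?thesis by (simp add: h_def)
 qed
 have "x\<^sup>2 \<le> 3"
 proof -
  have "x \<le> 1.6" using x(2) pi_approx by simp
  then have "x * x \<le> 1.6 * 1.6" using x(1) by (intro mult_mono) auto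
  then show ?thesis by (simp add: power2_eq_square)
 qed
 \<comment> \<open>With the cubic lower bound for the sine this gives \<open>x / 2 \<le> k\<close>,
   which is the factor 2 in \<open>arcsin k \<le> 2 * k\<close>.\<close>
 then have "x ^ 3 \<le> 3 * x" using x(1) mult_right_mono[of "x\<^sup>2" 3 x] by (simp add: power3_eq_cube power2_eq_square)
 then have le2: "x \<le> 2 * k" using s3 x(3) by linarith
 then show "arcsin k \<le> 2 * k" by (simp add: x_def)
 have "x - k \<le> x * x\<^sup>2 / 6" using s3 x(3) by (simp add: power3_eq_cube power2_eq_square)
 also have "... \<le> 2 * x\<^sup>2 / 6" using x x2 by (intro divide_right_mono mult_right_mono) auto
 also have "... \<le> 2 * (2 * k)\<^sup>2 / 6" using le2 x by (intro divide_right_mono mult_left_mono power_mono) auto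
 also have "... \<le> 2 * k\<^sup>2" by (simp add: power_mult_distrib)
 finally show "arcsin k - k \<le> 2 * k\<^sup>2" by (simp add: x_def)
qed

text \<open>Half the Euclidean chord between the stereographic images, that is, the sine of half the
  spherical distance.\<close>

definition chord :: "complex \<Rightarrow> complex \<Rightarrow> real" where
 "chord z w = norm (z - w) / sqrt ((1 + (norm z)\<^sup>2) * (1 + (norm w)\<^sup>2))"

lemma chord_half: "chord z w = norm (stereo (Fin z) - stereo (Fin w)) / 2"
 by (simp add: norm_stereo_diff_Fin chord_def del: stereo.simps)

lemma chord_bounds: "0 \<le> chord z w" "chord z w \<le> 1" "chord z w \<le> norm (z - w)"
proof -
 show "0 \<le> chord z w" by (simp add: chord_half)
 show "chord z w \<le> 1"
  using norm_triangle_ineq4[of "stereo (Fin z)" "stereo (Fin w)"] by (simp add: chord_half norm_stereo del: stereo.simps)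
 have "1 * 1 \<le> (1 + (norm z)\<^sup>2) * (1 + (norm w)\<^sup>2)" by (intro mult_mono) auto
 then have "1 \<le> sqrt ((1 + (norm z)\<^sup>2) * (1 + (norm w)\<^sup>2))" by simp
 then show "chord z w \<le> norm (z - w)"
  by (simp add: chord_def mult_imp_div_pos_le mult_le_cancel_left1)
qed

lemma dist_Fin: "dist (Fin z) (Fin w) = 2 * arcsin (chord z w)"
 by (simp add: dist_rsphere_arcsin norm_stereo_diff_Fin chord_def del: stereo.simps)

lemma chord_le_dist: "norm (stereo x - stereo y) \<le> dist x y" for x y :: rsphere
proof -
 define s where "s = norm (stereo x - stereo y) / 2"
 have s: "0 \<le> s" "s \<le> 1"
  using norm_triangle_ineq4[of "stereo x" "stereo y"] by (auto simp: s_def norm_stereo)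
 show ?thesis using arcsin_bounds(3)[OF s] by (simp add: dist_rsphere_arcsin s_def)
qed

lemma dist_rsphere_le_pi: "dist x y \<le> pi" for x y :: rsphere
proof -
 have "norm (stereo x - stereo y) / 2 \<le> 1"
  using norm_triangle_ineq4[of "stereo x" "stereo y"] by (auto simp: norm_stereo)
 from arcsin_bounds(2)[OF _ this] show ?thesis by (simp add: dist_rsphere_arcsin)
qed

lemma dist_rsphere_less_4: "dist x y < 4" for x y :: rsphere
 using dist_rsphere_le_pi[of x y] pi_less_4 by linarith

lemma bounded_rsphere [simp]: "bounded (S :: rsphere set)"
 unfolding bounded_def using dist_rsphere_le_pi by blast

lemma dist_Fin_le: "dist (Fin z) (Fin w) \<le> 4 * norm (z - w)"
 using arcsin_bounds(4)[OF chord_bounds(1,2), of z w] chord_bounds(3)[of z w] by (simp add: dist_Fin)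

text \<open>On the disc of radius 2 the spherical metric has density at least 2/5, whence the factor
  5/2. Radius 2 leaves room around the closed unit disc, in which \<open>chart_ex\<close> places
  every centre.\<close>

lemma norm_le_dist_Fin:
 assumes "norm z \<le> 2" "norm w \<le> 2"
 shows "norm (z - w) \<le> 5 / 2 * dist (Fin z) (Fin w)"
proof -
 have "(norm z)\<^sup>2 \<le> 2\<^sup>2" "(norm w)\<^sup>2 \<le> 2\<^sup>2" using assms by (intro power_mono; simp)+
 then have "(1 + (norm z)\<^sup>2) * (1 + (norm w)\<^sup>2) \<le> 5 * 5" by (intro mult_mono) auto
 then have s: "sqrt ((1 + (norm z)\<^sup>2) * (1 + (norm w)\<^sup>2)) \<le> 5"
  by (intro real_le_lsqrt) (simp_all add: power2_eq_square)
 have pos: "0 < sqrt ((1 + (norm z)\<^sup>2) * (1 + (norm w)\<^sup>2))"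
  using one_plus_norm_sq_pos(1)[of z] one_plus_norm_sq_pos(1)[of w] by simp
 have "norm (z - w) = chord z w * sqrt ((1 + (norm z)\<^sup>2) * (1 + (norm w)\<^sup>2))"
  using pos unfolding chord_def by (metis less_irrefl nonzero_eq_divide_eq)
 also have "... \<le> chord z w * 5" using s chord_bounds(1) by (intro mult_left_mono) auto
 also have "... \<le> arcsin (chord z w) * 5" using arcsin_bounds(3)[OF chord_bounds(1,2)] by simp
 finally show ?thesis by (simp add: dist_Fin)
qed

text \<open>The factor \<open>2 / (1 + (norm a)\<^sup>2)\<close> is the density of the spherical
  metric at \<open>a\<close>. The error has two sources: the density varies by at most
  \<open>5 * t\<close> on the disc, and replacing \<open>arcsin k\<close> by \<open>k\<close> costs
  at most \<open>4 * t\<close> relative to the Euclidean distance. Doubling \<open>4 + 5\<close>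
  gives 18.\<close>

lemma dist_Fin_approx:
 assumes a: "norm a \<le> 2" and t: "t \<le> 1" and u: "norm (u - a) \<le> t" and v: "norm (v - a) \<le> t"
 shows "\<bar>dist (Fin u) (Fin v) - 2 / (1 + (norm a)\<^sup>2) * norm (u - v)\<bar> \<le> 18 * t * norm (u - v)"
proof -
 define d where "d = norm (u - v)"
 define R where "R = 1 + (norm a)\<^sup>2"
 define P where "P = 1 + (norm u)\<^sup>2"
 define Q where "Q = 1 + (norm v)\<^sup>2"
 have RPQ: "R \<ge> 1" "P \<ge> 1" "Q \<ge> 1" by (auto simp: R_def P_def Q_def)
 have t0: "0 \<le> t" using u norm_ge_zero order_trans by blast
 have near: "\<bar>1 + (norm w)\<^sup>2 - R\<bar> \<le> 5 * t" if "norm (w - a) \<le> t" for w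
 proof -
  have "\<bar>norm w - norm a\<bar> \<le> t" using norm_triangle_ineq3[of w a] that by linarith
  moreover have "norm w + norm a \<le> 5" using norm_triangle_sub[of w a] that a t by linarith
  ultimately have "\<bar>norm w - norm a\<bar> * (norm w + norm a) \<le> t * 5" using t0 by (intro mult_mono) auto
  moreover have "\<bar>norm w - norm a\<bar> * (norm w + norm a) = \<bar>(norm w - norm a) * (norm w + norm a)\<bar>"
   by (simp add: abs_mult)
  ultimately show ?thesis by (simp add: R_def power2_eq_square algebra_simps)
 qed
 have PR: "\<bar>P - R\<bar> \<le> 5 * t" "\<bar>Q - R\<bar> \<le> 5 * t" using near[OF u] near[OF v] by (auto simp: P_def Q_def)
 define S where "S = sqrt (P * Q)"
 have S1: "S \<ge> 1" unfolding S_def using RPQ mult_mono[of 1 P 1 Q] by simp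
 have "min P Q * min P Q \<le> P * Q" "P * Q \<le> max P Q * max P Q"
  using RPQ by (intro mult_mono; simp)+
 then have "min P Q \<le> S" "S \<le> max P Q" using RPQ unfolding S_def
  by (auto intro!: real_le_lsqrt real_le_rsqrt simp: power2_eq_square le_max_iff_disj)
 then have SR: "\<bar>S - R\<bar> \<le> 5 * t" using PR by (auto simp: min_def max_def split: if_splits)
 define k where "k = chord u v"
 have k: "k = d / S" by (simp add: k_def chord_def d_def S_def P_def Q_def)
 have kb: "0 \<le> k" "k \<le> 1" "k \<le> d" using chord_bounds[of u v] by (auto simp: k_def d_def)
 have d0: "0 \<le> d" by (simp add: d_def)
 have dt: "d \<le> 2 * t" using norm_triangle_ineq4[of "u - a" "v - a"] u v by (simp add: d_def)
 have SR0: "1 \<le> S * R" using mult_mono[of 1 S 1 R] S1 RPQ by simp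
 have "1 / S - 1 / R = (R - S) / (S * R)"
  using S1 RPQ by (simp add: diff_frac_eq)
 then have "\<bar>1 / S - 1 / R\<bar> = \<bar>S - R\<bar> / \<bar>S * R\<bar>"
  by (simp only: abs_divide abs_minus_commute)
 also have "... \<le> \<bar>S - R\<bar> / 1"
  using SR0 by (intro divide_left_mono) auto
 finally have SR1: "\<bar>1 / S - 1 / R\<bar> \<le> 5 * t" using SR by simp
 have "k - d / R = d * (1 / S - 1 / R)" by (simp add: k right_diff_distrib)
 then have "\<bar>k - d / R\<bar> = d * \<bar>1 / S - 1 / R\<bar>" using d0 by (simp add: abs_mult)
 then have e1: "\<bar>k - d / R\<bar> \<le> d * (5 * t)" using SR1 d0 by (metis mult_left_mono)
 have "0 \<le> arcsin k - k" "arcsin k - k \<le> 2 * k\<^sup>2" using arcsin_bounds[OF kb(1,2)] by auto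
 moreover have "k\<^sup>2 \<le> d * (2 * t)" unfolding power2_eq_square using kb dt d0 by (intro mult_mono) auto
 ultimately have e2: "\<bar>arcsin k - k\<bar> \<le> d * (4 * t)" by linarith
 have gen: "\<bar>2 * p + 2 * q\<bar> \<le> 2 * a + 2 * b" if "\<bar>p\<bar> \<le> a" "\<bar>q\<bar> \<le> b" for p q a b :: real
  using that by linarith
 have "dist (Fin u) (Fin v) - 2 / R * d = 2 * (arcsin k - k) + 2 * (k - d / R)"
  by (simp add: dist_Fin k_def)
 then have "\<bar>dist (Fin u) (Fin v) - 2 / R * d\<bar> \<le> 2 * (d * (4 * t)) + 2 * (d * (5 * t))"
  using gen[OF e2 e1] by (simp only:)
 then show ?thesis by (simp add: R_def d_def algebra_simps)
qed

text \<open>The closed unit disc is the lower hemisphere, where the height coordinate is at most 0.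
  Height is 1-Lipschitz for the spherical distance, and height 3/5 is exactly the circle of radius
  2.\<close>

lemma dist_rsphere_far:
 assumes "norm a \<le> 1" "dist x (Fin a) < 3 / 5"
 obtains w where "x = Fin w" "norm w < 2"
proof -
 have s: "snd (stereo (Fin w)) = 1 - 2 / (1 + (norm w)\<^sup>2)" for w
  using one_plus_norm_sq_pos(2)[of w] by (simp add: field_simps)
 have a0: "snd (stereo (Fin a)) \<le> 0"
  using power_mono[OF assms(1), of 2] one_plus_norm_sq_pos(1)[of a] by (simp add: divide_le_0_iff)
 have "\<bar>snd (stereo x - stereo (Fin a))\<bar> \<le> norm (stereo x - stereo (Fin a))"
  using norm_snd_le[of "snd (stereo x - stereo (Fin a))" "fst (stereo x - stereo (Fin a))"]
  by (simp only: real_norm_def prod.collapse)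
 also have "... < 3 / 5" using chord_le_dist[of x "Fin a"] assms(2) by linarith
 finally have l: "snd (stereo x) < 3 / 5" using a0 unfolding snd_diff by linarith
 show ?thesis
 proof (cases x)
  case (Fin w)
  have "norm w < 2"
  proof (rule ccontr)
   assume "\<not> norm w < 2"
   then have "2\<^sup>2 \<le> (norm w)\<^sup>2" by (intro power_mono) auto
   then have "2 / (1 + (norm w)\<^sup>2) \<le> 2 / 5" by (intro divide_left_mono) auto
   then show False using l Fin s[of w] by (simp del: stereo.simps)
  qed
  with Fin that show ?thesis by blast
 next
  case Infty then show ?thesis using l by simp
 qed
qed

text \<open>The map \<open>1 / z\<close>. On the sphere it is the half-turn about the real axis
  (\<open>stereo_sinv\<close>), hence an isometry, and it exchanges the two closed
  hemispheres.\<close>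

fun sinv :: "rsphere \<Rightarrow> rsphere" where
 "sinv (Fin z) = (if z = 0 then Infty else Fin (1 / z))"
| "sinv Infty = Fin 0"

lemma sinv_sinv [simp]: "sinv (sinv x) = x" by (cases x) auto

lemma stereo_sinv: "stereo (sinv x) = (cnj (fst (stereo x)), - snd (stereo x))"
proof (cases x)
 case (Fin z)
 show ?thesis
 proof (cases "z = 0")
  case False
  define r where "r = (norm z)\<^sup>2"
  have r: "r > 0" "1 + r > 0" using False by (auto simp: r_def add_pos_pos)
  have n: "(norm (1 / z))\<^sup>2 = 1 / r" by (simp add: r_def norm_divide power_divide)
  have "1 / z = cnj z / of_real r"
   using False complex_norm_square[of z] by (simp add: r_def divide_simps)
  then have c: "1 / z = (1 / r) *\<^sub>R cnj z" by (simp add: scaleR_conv_of_real)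
  have e: "1 / r - 1 = (1 - r) / r" "1 + 1 / r = (1 + r) / r"
   using r by (simp_all add: diff_divide_distrib add_divide_distrib)
  have f: "2 / (1 + 1 / r) * (1 / r) = 2 / (1 + r)" "(1 / r - 1) / (1 + 1 / r) = - ((r - 1) / (1 + r))"
   unfolding e using r by (simp_all add: minus_divide_left)
  have "stereo (Fin (1 / z)) = ((2 / (1 + 1 / r)) *\<^sub>R (1 / z), (1 / r - 1) / (1 + 1 / r))"
   by (simp only: stereo.simps n)
  also have "... = ((2 / (1 + r)) *\<^sub>R cnj z, - ((r - 1) / (1 + r)))"
   by (simp only: c scaleR_scaleR f)
  finally have "stereo (Fin (1 / z)) = ((2 / (1 + r)) *\<^sub>R cnj z, - ((r - 1) / (1 + r)))" .
  then show ?thesis using False Fin by (simp add: r_def)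
 qed (simp add: Fin)
qed auto

lemma dist_sinv [simp]: "dist (sinv x) (sinv y) = dist x y"
using stereo_sinv by (simp add: inner_complex_def dist_rsphere_def inner_prod_def)

lemma continuous_on_sinv: "continuous_on S sinv"
 unfolding continuous_on_iff by auto

lemma continuous_on_Fin: "continuous_on S Fin"
 using isCont_Fin continuous_at_imp_continuous_on by blast

lemma chart_cases:
 obtains a where "norm a \<le> 1" "x = Fin a" | a where "norm a \<le> 1" "x = sinv (Fin a)"
proof (cases x)
 case (Fin z)
 show ?thesis
 proof (cases "norm z \<le> 1")
  case False
  then have "z \<noteq> 0" "norm (1 / z) \<le> 1" by (auto simp: norm_divide divide_le_eq_1)
  then show ?thesis using that(2)[of "1 / z"] Fin by simp
 qed (use Fin that in blast)
next
 case Infty then show ?thesis using that(2)[of 0] by simp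
qed

text \<open>Both charts are isometric involutions and compositions of charts are charts again, so a
  change of chart alters neither distances nor the spherical derivative.\<close>

definition charts :: "(rsphere \<Rightarrow> rsphere) set" where "charts = {id, sinv}"

lemma charts_dist: "A \<in> charts \<Longrightarrow> dist (A x) (A y) = dist x y"
 by (auto simp: charts_def)

lemma charts_invol: "A \<in> charts \<Longrightarrow> A (A x) = x"
 by (auto simp: charts_def)

lemma charts_cont: "A \<in> charts \<Longrightarrow> continuous_on S A"
 by (auto simp: charts_def continuous_on_sinv continuous_on_id)

lemma charts_ball: "A \<in> charts \<Longrightarrow> A ` ball x r = ball (A x) r"
proof (safe)
 fix y assume A: "A \<in> charts"
 { assume "y \<in> ball x r" then show "A y \<in> ball (A x) r" using charts_dist[OF A] by simp }
 assume "y \<in> ball (A x) r"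
 then have "A y \<in> ball x r" using charts_dist[OF A, of x "A y"] charts_invol[OF A] by simp
 then show "y \<in> A ` ball x r" using charts_invol[OF A, of y] by (metis imageI)
qed

lemma chart_ex: obtains A a where "A \<in> charts" "A x = Fin a" "norm a \<le> 1"
 using chart_cases[of x] by (metis charts_def id_apply insert_iff sinv_sinv)

section \<open>Compactness, connectedness and countability of the topology\<close>

lemma compact_rsphere: "compact (UNIV :: rsphere set)"
proof -
 have "compact (Fin ` cball 0 1)" "compact (sinv ` Fin ` cball 0 1)"
  by (intro compact_continuous_image continuous_on_Fin continuous_on_sinv compact_cball)+
 moreover have "x \<in> Fin ` cball 0 1 \<union> sinv ` Fin ` cball 0 1" for x
  by (rule chart_cases[of x]) (metis UNIV_I UnCI image_eqI mem_cball_0)+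
 then have "UNIV = Fin ` cball 0 1 \<union> sinv ` Fin ` cball 0 1" by blast
 ultimately show ?thesis using compact_Un by metis
qed

lemma connected_rsphere: "connected (UNIV :: rsphere set)"
proof -
 have "connected (Fin ` UNIV)" "connected (sinv ` Fin ` UNIV)"
  by (intro connected_continuous_image continuous_on_Fin continuous_on_sinv connected_UNIV)+
 moreover have "Fin 1 \<in> Fin ` UNIV \<inter> sinv ` Fin ` UNIV"
  by (intro IntI image_eqI[of _ sinv "Fin 1"]) auto
 moreover have "x \<in> Fin ` UNIV \<union> sinv ` Fin ` UNIV" for x
  by (rule chart_cases[of x]) (metis UNIV_I UnCI image_eqI mem_cball_0)+
 then have "UNIV = Fin ` UNIV \<union> sinv ` Fin ` UNIV" by blast
 ultimately show ?thesis using connected_Un by (metis empty_iff)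
qed

lemma rsphere_not_open_subset:
 fixes S :: "rsphere set"
 assumes "S \<noteq> {}" "S \<noteq> UNIV" "open S" "closed S" shows "False"
 using connected_rsphere assms connected_clopen by (metis closed_closedin open_openin subtopology_UNIV)

lemma Fin_dist_chart:
 assumes "norm a \<le> 1" "r \<le> 1/2"
 shows "Fin ` ball a (r / 4) \<subseteq> ball (Fin a) r" "ball (Fin a) r \<subseteq> Fin ` (ball a (5 / 2 * r) \<inter> ball 0 2)"
proof -
 show "Fin ` ball a (r / 4) \<subseteq> ball (Fin a) r"
 proof safe
  fix w assume "w \<in> ball a (r / 4)"
  then show "Fin w \<in> ball (Fin a) r" using dist_Fin_le[of a w] by (simp add: dist_norm[of a])
 qed
 show "ball (Fin a) r \<subseteq> Fin ` (ball a (5 / 2 * r) \<inter> ball 0 2)"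
 proof safe
  fix x assume x: "x \<in> ball (Fin a) r"
  then have "dist x (Fin a) < 3 / 5" using assms by (simp add: dist_commute)
  from dist_rsphere_far[OF assms(1) this] obtain w where w: "x = Fin w" "norm w < 2" .
  have "norm (a - w) \<le> 5 / 2 * dist (Fin a) (Fin w)" by (rule norm_le_dist_Fin) (use assms w in auto)
  with x w show "x \<in> Fin ` (ball a (5 / 2 * r) \<inter> ball 0 2)"
   by (auto simp: dist_norm[of a] intro!: imageI)
 qed
qed

text \<open>Read in the plane, a small spherical ball is a sublevel set of a quadratic function
  whose leading coefficient \<open>1 - c\<close> is positive, hence convex. The constant
  \<open>s\<close> is the chord length that corresponds to distance \<open>r\<close>.\<close>

lemma connected_ball_rsphere:
 assumes "r \<le> 1 / 2" shows "connected (ball (x::rsphere) r)"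
proof (cases "0 < r")
 case r0: True
 obtain A a where A: "A \<in> charts" "A x = Fin a" "norm a \<le> 1" by (rule chart_ex)
 define s where "s = sin (r / 2)"
 have s0: "0 \<le> s" using r0 assms pi_gt3 by (auto simp: s_def intro!: sin_ge_zero)
 have s12: "s \<le> 1 / 4" using sin_x_le_x[of "r / 2"] r0 assms by (simp add: s_def)
 define c where "c = s\<^sup>2 * (1 + (norm a)\<^sup>2)"
 have "s\<^sup>2 \<le> (1 / 4)\<^sup>2" "(norm a)\<^sup>2 \<le> 1\<^sup>2" using s0 s12 A(3) by (intro power_mono; simp)+
 then have "c \<le> (1 / 4)\<^sup>2 * (1 + 1)" unfolding c_def by (intro mult_mono) auto
 then have c1: "c < 1" by (simp add: power2_eq_square)
 have char: "Fin w \<in> ball (Fin a) r \<longleftrightarrow> (1 - c) * (norm w)\<^sup>2 - 2 * (a \<bullet> w) + (norm a)\<^sup>2 < c" for w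
 proof -
  have "Fin w \<in> ball (Fin a) r \<longleftrightarrow> arcsin (chord a w) < r / 2" by (simp add: dist_Fin) linarith
  also have "... \<longleftrightarrow> chord a w < s"
  proof -
   have "r / 2 \<le> pi / 2" using assms pi_gt3 by linarith
   have as: "r / 2 = arcsin s" using r0 \<open>r / 2 \<le> pi / 2\<close> by (simp add: s_def arcsin_sin)
   have "chord a w < s \<longleftrightarrow> arcsin (chord a w) < arcsin s"
    using chord_bounds[of a w] s0 s12 by (intro arcsin_less_mono[symmetric]) auto
   then show ?thesis by (simp only: as)
  qed
  also have "... \<longleftrightarrow> (chord a w)\<^sup>2 < s\<^sup>2"
   using s0 chord_bounds(1)[of a w] by (metis power2_less_imp_less power_strict_mono zero_less_numeral)
  also have "(chord a w)\<^sup>2 = (norm (a - w))\<^sup>2 / ((1 + (norm a)\<^sup>2) * (1 + (norm w)\<^sup>2))"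
   using one_plus_norm_sq_pos(1)[of a] one_plus_norm_sq_pos(1)[of w] by (simp add: chord_def power_divide)
  also have "... < s\<^sup>2 \<longleftrightarrow> (norm (a - w))\<^sup>2 < s\<^sup>2 * ((1 + (norm a)\<^sup>2) * (1 + (norm w)\<^sup>2))"
   using one_plus_norm_sq_pos(1)[of a] one_plus_norm_sq_pos(1)[of w] by (intro pos_divide_less_eq) auto
  also have "s\<^sup>2 * ((1 + (norm a)\<^sup>2) * (1 + (norm w)\<^sup>2)) = c + c * (norm w)\<^sup>2" by (simp add: c_def algebra_simps)
  also have "(norm (a - w))\<^sup>2 = (norm a)\<^sup>2 + (norm w)\<^sup>2 - 2 * (a \<bullet> w)"
   by (simp add: power2_norm_eq_inner inner_diff inner_commute)
  finally show ?thesis by (simp add: algebra_simps)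
 qed
 define D where "D = {w. (1 - c) * (norm w)\<^sup>2 - 2 * (a \<bullet> w) + (norm a)\<^sup>2 < c}"
 have "ball (Fin a) r = Fin ` D"
  using Fin_dist_chart(2)[OF A(3) assms] char by (auto simp: D_def)
 moreover have "connected D"
 proof -
  have cs: "convex_on UNIV (\<lambda>w::complex. (norm w)\<^sup>2)"
  proof (rule convex_onI)
   fix t :: real and x y :: complex assume t: "0 < t" "t < 1"
   have "(norm ((1 - t) *\<^sub>R x + t *\<^sub>R y))\<^sup>2 = (1 - t) * (norm x)\<^sup>2 + t * (norm y)\<^sup>2 - t * (1 - t) * (norm (x - y))\<^sup>2"
    unfolding power2_norm_eq_inner by (simp add: inner_add inner_diff inner_commute algebra_simps)
   then show "(norm ((1 - t) *\<^sub>R x + t *\<^sub>R y))\<^sup>2 \<le> (1 - t) * (norm x)\<^sup>2 + t * (norm y)\<^sup>2"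
    using t by simp
  qed simp
  have "convex D" unfolding convex_alt
  proof safe
   fix x y :: complex and t :: real assume xy: "x \<in> D" "y \<in> D" and t: "0 \<le> t" "t \<le> 1"
   have q: "(norm ((1 - t) *\<^sub>R x + t *\<^sub>R y))\<^sup>2 \<le> (1 - t) * (norm x)\<^sup>2 + t * (norm y)\<^sup>2"
    using convex_onD[OF cs t(1) t(2)] by simp
   have "(1 - c) * (norm ((1 - t) *\<^sub>R x + t *\<^sub>R y))\<^sup>2 \<le> (1 - c) * ((1 - t) * (norm x)\<^sup>2 + t * (norm y)\<^sup>2)"
    using q c1 by (intro mult_left_mono) auto
   moreover have "(1 - t) * ((1 - c) * (norm x)\<^sup>2 - 2 * (a \<bullet> x) + (norm a)\<^sup>2) + t * ((1 - c) * (norm y)\<^sup>2 - 2 * (a \<bullet> y) + (norm a)\<^sup>2) < c"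
    using xy t by (intro convex_bound_lt) (auto simp: D_def)
   ultimately show "(1 - t) *\<^sub>R x + t *\<^sub>R y \<in> D"
    unfolding D_def by (simp add: inner_add algebra_simps)
  qed
  then show ?thesis by (rule convex_connected)
 qed
 ultimately have "connected (ball (A x) r)"
  using A connected_continuous_image[OF continuous_on_Fin] by metis
 then have "connected (A ` ball (A x) r)"
  using connected_continuous_image charts_cont[OF A(1)] by blast
 then show ?thesis using charts_ball[OF A(1), of "A x" r] charts_invol[OF A(1)] by simp
qed (simp add: ball_empty not_less)

instance rsphere :: heine_borel
proof
 fix X :: "nat \<Rightarrow> rsphere"
 show "\<exists>l r. strict_mono (r :: nat \<Rightarrow> nat) \<and> (X \<circ> r) \<longlonglongrightarrow> l"
  using compact_rsphere unfolding compact_eq_seq_compact_metric seq_compact_def by (metis UNIV_I)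
qed

text \<open>Balls with centres in a countable dense subset of the plane form a basis; a
  neighbourhood of \<open>Infty\<close> is seen to contain finite points by moving it to 0 with
  \<open>sinv\<close>.\<close>

instance rsphere :: second_countable_topology
proof
 obtain D :: "complex set" where D: "countable D" "\<And>X. \<lbrakk>open X; X \<noteq> {}\<rbrakk> \<Longrightarrow> \<exists>d\<in>D. d \<in> X"
  using countable_dense_setE by metis
 have dense: "\<exists>d\<in>D. Fin d \<in> X" if X: "open X" "x \<in> X" for X x
 proof -
  have ex: "\<exists>z. Fin z \<in> X"
  proof (cases x)
   case Infty
   define V where "V = (sinv \<circ> Fin) -` X"
   have "open V" unfolding V_def
    by (intro open_vimage X continuous_on_compose continuous_on_Fin continuous_on_sinv)
   moreover have "0 \<in> V" using X Infty by (simp add: V_def)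
   ultimately obtain e where e: "e > 0" "ball 0 e \<subseteq> V" by (meson openE)
   define w :: complex where "w = of_real (e / 2)"
   have "w \<noteq> 0" "w \<in> V" using e by (auto simp: w_def subset_eq)
   then show ?thesis by (auto simp: V_def)
  qed (use X in auto)
  have "open (Fin -` X)" by (intro open_vimage X continuous_on_Fin)
  with ex D(2)[of "Fin -` X"] show ?thesis by auto
 qed
 define B where "B = (\<lambda>(d, n). ball (Fin d) (1 / real (Suc n))) ` (D \<times> UNIV)"
 have "countable B" unfolding B_def using D(1) by auto
 moreover have "topological_basis B"
 proof (rule topological_basisI)
  show "open b" if "b \<in> B" for b using that by (auto simp: B_def)
  fix X :: "rsphere set" and x assume X: "open X" "x \<in> X"
  then obtain e where e: "e > 0" "ball x e \<subseteq> X" by (meson openE)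
  obtain n where n: "1 / real (Suc n) < e / 2" using e(1) by (metis half_gt_zero nat_approx_posE)
  obtain d where d: "d \<in> D" "Fin d \<in> ball x (1 / real (Suc n))"
   using dense[of "ball x (1 / real (Suc n))" x] by auto
  have "ball (Fin d) (1 / real (Suc n)) \<subseteq> ball x e"
  proof
   fix y assume "y \<in> ball (Fin d) (1 / real (Suc n))"
   then show "y \<in> ball x e" using d(2) n dist_triangle[of x y "Fin d"] by simp
  qed
  then show "\<exists>b\<in>B. x \<in> b \<and> b \<subseteq> X"
   using d e by (intro bexI[of _ "ball (Fin d) (1 / real (Suc n))"]) (auto simp: B_def dist_commute)
 qed
 ultimately show "\<exists>B::rsphere set set. countable B \<and> open = generate_topology B"
  using topological_basis_imp_subbasis by blast
qed

instance rsphere :: polish_space ..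

section \<open>Holomorphic self-maps of the sphere\<close>

lemma isCont_the_Fin: "isCont the_Fin (Fin z)"
 using filterlim_the_Fin(1)[of z] by (simp add: isCont_def filterlim_at)

lemma open_image_Fin: assumes "open U" shows "open (Fin ` U)"
proof (subst open_subopen, safe)
 fix z assume z: "z \<in> U"
 have "(the_Fin \<longlongrightarrow> the_Fin (Fin z)) (nhds (Fin z))"
  using isCont_the_Fin[unfolded isCont_def] tendsto_at_iff_tendsto_nhds by blast
 from topological_tendstoD[OF this assms] z have "eventually (\<lambda>y. the_Fin y \<in> U) (nhds (Fin z))"
  by simp
 moreover have "eventually (\<lambda>y. y \<noteq> Infty) (nhds (Fin z))"
  using filterlim_the_Fin(2)[of z] by (simp add: eventually_nhds_conv_at)
 ultimately have "eventually (\<lambda>y. the_Fin y \<in> U \<and> y \<noteq> Infty) (nhds (Fin z))" by eventually_elim auto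
 then obtain T where "open T" "Fin z \<in> T" "\<And>y. y \<in> T \<Longrightarrow> the_Fin y \<in> U \<and> y \<noteq> Infty"
  by (auto simp: eventually_nhds)
 moreover have "y \<in> Fin ` U" if "the_Fin y \<in> U \<and> y \<noteq> Infty" for y
  using that by (cases y) auto
 ultimately show "\<exists>T. open T \<and> Fin z \<in> T \<and> T \<subseteq> Fin ` U" by blast
qed

lemma open_charts: "A \<in> charts \<Longrightarrow> open U \<Longrightarrow> open (A ` U)"
proof -
 assume A: "A \<in> charts" and U: "open U"
 have "A ` U = A -` U" using charts_invol[OF A] by (auto simp: image_iff) metis
 then show ?thesis using open_vimage[OF U charts_cont[OF A]] by simp
qed

lemma charts_comp: "A \<in> charts \<Longrightarrow> B \<in> charts \<Longrightarrow> A \<circ> B \<in> charts"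
 by (auto simp: charts_def fun_eq_iff)

lemma id_in_charts [simp]: "id \<in> charts" by (simp add: charts_def)

lemma Fin_the_Fin: "x \<noteq> Infty \<Longrightarrow> Fin (the_Fin x) = x" by (cases x) auto

text \<open>\<open>F\<close> read in the charts \<open>B\<close> at the source and \<open>A\<close> at the target.\<close>

definition cr :: "(rsphere \<Rightarrow> rsphere) \<Rightarrow> (rsphere \<Rightarrow> rsphere) \<Rightarrow> (rsphere \<Rightarrow> rsphere) \<Rightarrow> complex \<Rightarrow> complex" where
 "cr A F B z = the_Fin (A (F (B (Fin z))))"

text \<open>At points sent to \<open>Infty\<close> the representation \<open>cr\<close> has the
  default value 0, so differentiability is demanded only elsewhere. Continuity is demanded
  separately; it keeps nearby values inside the chart.\<close>

definition sph_hol :: "(rsphere \<Rightarrow> rsphere) \<Rightarrow> bool" where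
 "sph_hol F \<longleftrightarrow> continuous_on UNIV F \<and>
   (\<forall>A\<in>charts. \<forall>B\<in>charts. \<forall>z. A (F (B (Fin z))) \<noteq> Infty \<longrightarrow> cr A F B field_differentiable (at z))"

lemma sph_hol_cont: "sph_hol F \<Longrightarrow> continuous_on S F"
 unfolding sph_hol_def using continuous_on_subset by blast

lemma sph_hol_chart:
 assumes "sph_hol F" "A \<in> charts" "B \<in> charts" "A (F (B (Fin z))) \<noteq> Infty"
 shows "eventually (\<lambda>w. A (F (B (Fin w))) = Fin (cr A F B w)) (nhds z)"
  "(cr A F B has_field_derivative deriv (cr A F B) z) (at z)"
proof -
 have "continuous_on UNIV (\<lambda>w. A (F (B (Fin w))))"
  using continuous_on_compose2[OF charts_cont[OF assms(2), of UNIV] continuous_on_compose2[OF sph_hol_cont[OF assms(1), of UNIV]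
   continuous_on_compose2[OF charts_cont[OF assms(3), of UNIV] continuous_on_Fin[of UNIV]]]] by auto
 then have "open ((\<lambda>w. A (F (B (Fin w)))) -` (- {Infty}))" by (intro open_vimage) auto
 then have "eventually (\<lambda>w. w \<in> (\<lambda>w. A (F (B (Fin w)))) -` (- {Infty})) (nhds z)"
  using assms(4) by (intro eventually_nhds_in_open) auto
 then show "eventually (\<lambda>w. A (F (B (Fin w))) = Fin (cr A F B w)) (nhds z)"
  by eventually_elim (use Fin_the_Fin in \<open>auto simp: cr_def\<close>)
 show "(cr A F B has_field_derivative deriv (cr A F B) z) (at z)"
  using assms by (simp add: sph_hol_def field_differentiable_derivI)
qed

lemma sph_hol_holomorphic:
 assumes "sph_hol F" "A \<in> charts" "B \<in> charts" "\<And>z. z \<in> S \<Longrightarrow> A (F (B (Fin z))) \<noteq> Infty"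
 shows "cr A F B holomorphic_on S"
 unfolding holomorphic_on_def using assms field_differentiable_at_within by (fastforce simp: sph_hol_def)

text \<open>The intermediate chart \<open>C\<close> is chosen so that the middle point is finite;
  then the classical chain rule applies in a neighbourhood.\<close>

lemma cr_chain:
 assumes F: "sph_hol F" and G: "sph_hol G" and ABC: "A \<in> charts" "B \<in> charts" "C \<in> charts"
  and w: "C (G (B (Fin z))) = Fin w" and b: "A (F (G (B (Fin z)))) \<noteq> Infty"
 shows "(cr A (F \<circ> G) B has_field_derivative deriv (cr A F C) w * deriv (cr C G B) z) (at z)"
proof -
 have Cw: "C (Fin w) = G (B (Fin z))" using w charts_invol[OF ABC(3)] by metis
 have u: "eventually (\<lambda>z. C (G (B (Fin z))) = Fin (cr C G B z)) (nhds z)"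
   "(cr C G B has_field_derivative deriv (cr C G B) z) (at z)"
  using sph_hol_chart[OF G ABC(3,2)] w by auto
 have w': "cr C G B z = w" using w by (simp add: cr_def)
 have v: "(cr A F C has_field_derivative deriv (cr A F C) w) (at w)"
  using sph_hol_chart(2)[OF F ABC(1,3), of w] b Cw by simp
 have "((\<lambda>z. cr A F C (cr C G B z)) has_field_derivative deriv (cr A F C) w * deriv (cr C G B) z) (at z)"
  using DERIV_chain2[of "cr A F C" _ "cr C G B" z] v u(2) w' by simp
 moreover have "eventually (\<lambda>z. cr A F C (cr C G B z) = cr A (F \<circ> G) B z) (nhds z)"
  using u(1)
 proof eventually_elim
  case (elim y)
  have "C (Fin (cr C G B y)) = G (B (Fin y))" using elim charts_invol[OF ABC(3)] by metis
  then show ?case by (simp add: cr_def)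
 qed
 ultimately show ?thesis by (subst DERIV_cong_ev[OF refl _ refl, symmetric])
qed

lemma sph_hol_comp:
 assumes F: "sph_hol F" and G: "sph_hol G" shows "sph_hol (F \<circ> G)"
 unfolding sph_hol_def
proof (intro conjI ballI allI impI)
 show "continuous_on UNIV (F \<circ> G)"
  by (intro continuous_on_compose sph_hol_cont assms)
 fix A B z assume AB: "A \<in> charts" "B \<in> charts" and b: "A ((F \<circ> G) (B (Fin z))) \<noteq> Infty"
 obtain C w where "C \<in> charts" "C (G (B (Fin z))) = Fin w" by (rule chart_ex)
 from cr_chain[OF F G AB this] b show "cr A (F \<circ> G) B field_differentiable at z"
  by (auto simp: field_differentiable_def)
qed

lemma sph_hol_charts: assumes "A \<in> charts" shows "sph_hol A"
 unfolding sph_hol_def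
proof (intro conjI ballI allI impI)
 show "continuous_on UNIV A" by (rule charts_cont[OF assms])
 fix A' B z assume AB: "A' \<in> charts" "B \<in> charts" and b: "A' (A (B (Fin z))) \<noteq> Infty"
 have "A' \<circ> (A \<circ> B) \<in> charts" using AB assms charts_comp by metis
 then consider "\<And>x. A' (A (B x)) = x" | "\<And>x. A' (A (B x)) = sinv x"
  by (auto simp: charts_def fun_eq_iff)
 then show "cr A' A B field_differentiable at z"
 proof cases
  case 1 then have "cr A' A B = (\<lambda>z. z)" by (simp add: cr_def fun_eq_iff)
  then show ?thesis by simp
 next
  case 2
  then have z: "z \<noteq> 0" using b by auto
  have "cr A' A B = (\<lambda>z. 1 / z)" using 2 by (auto simp: cr_def fun_eq_iff)
  then show ?thesis using z by (auto intro!: derivative_intros)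
 qed
qed

lemma sph_hol_funpow: "sph_hol F \<Longrightarrow> sph_hol (F ^^ n)"
proof (induction n)
 case 0 show ?case using sph_hol_charts[OF id_in_charts] by (simp only: funpow_0 id_def[symmetric] funpow.simps)
qed (simp add: sph_hol_comp)

section \<open>The spherical derivative in charts\<close>

lemma at_charts: "A \<in> charts \<Longrightarrow> at (A x) = filtermap A (at x)"
proof -
 assume A: "A \<in> charts"
 show ?thesis unfolding filter_eq_iff eventually_filtermap eventually_at
  using charts_dist[OF A] charts_invol[OF A] by (metis UNIV_I)
qed

lemma sph_deriv_charts:
 assumes "A \<in> charts" "B \<in> charts"
 shows "sph_deriv (A \<circ> F \<circ> B) x = sph_deriv F (B x)"
 unfolding sph_deriv_def Topological_Spaces.Lim_def at_charts[OF assms(2)] filterlim_filtermap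
 using charts_dist assms by (simp add: o_def)

lemma sph_deriv_cr:
 assumes "sph_hol F" "A \<in> charts" "B \<in> charts" "A (F (B (Fin z))) = Fin b"
 shows "sph_deriv F (B (Fin z)) = norm (deriv (cr A F B) z) * (1 + (norm z)\<^sup>2) / (1 + (norm b)\<^sup>2)"
proof -
 have "A (F (B (Fin z))) \<noteq> Infty" using assms by simp
 note * = sph_hol_chart[OF assms(1-3) this]
 have "sph_deriv (A \<circ> F \<circ> B) (Fin z) = norm (deriv (cr A F B) z) * (1 + (norm z)\<^sup>2) / (1 + (norm (cr A F B z))\<^sup>2)"
  by (rule sph_deriv_Fin[OF *(2)]) (use *(1) in simp)
 then show ?thesis using assms by (simp add: sph_deriv_charts cr_def)
qed

lemma sph_deriv_nonneg: "sph_hol F \<Longrightarrow> 0 \<le> sph_deriv F x"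
proof -
 assume F: "sph_hol F"
 obtain B a where B: "B \<in> charts" "B x = Fin a" by (rule chart_ex)
 obtain A b where A: "A \<in> charts" "A (F x) = Fin b" by (rule chart_ex)
 have x: "x = B (Fin a)" using B charts_invol by metis
 show ?thesis using sph_deriv_cr[OF F A(1) B(1), of a b] A by (simp add: x)
qed

text \<open>The conformal factor at the middle point occurs once in a numerator and once in a
  denominator and cancels.\<close>

lemma sph_deriv_comp:
 assumes F: "sph_hol F" and G: "sph_hol G"
 shows "sph_deriv (F \<circ> G) x = sph_deriv F (G x) * sph_deriv G x"
proof -
 obtain B a where B: "B \<in> charts" "B x = Fin a" by (rule chart_ex)
 obtain C w where C: "C \<in> charts" "C (G x) = Fin w" by (rule chart_ex)
 obtain A b where A: "A \<in> charts" "A (F (G x)) = Fin b" by (rule chart_ex)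
 have x: "x = B (Fin a)" using B charts_invol by metis
 have gx: "G x = C (Fin w)" using C charts_invol by metis
 have d: "deriv (cr A (F \<circ> G) B) a = deriv (cr A F C) w * deriv (cr C G B) a"
  by (rule DERIV_imp_deriv[OF cr_chain]) (use F G A B C x in auto)
 have "sph_deriv (F \<circ> G) x = norm (deriv (cr A (F \<circ> G) B) a) * (1 + (norm a)\<^sup>2) / (1 + (norm b)\<^sup>2)"
  unfolding x by (rule sph_deriv_cr[OF sph_hol_comp[OF F G] A(1) B(1)]) (use A x in simp)
 moreover have "sph_deriv F (G x) = norm (deriv (cr A F C) w) * (1 + (norm w)\<^sup>2) / (1 + (norm b)\<^sup>2)"
  unfolding gx by (rule sph_deriv_cr[OF F A(1) C(1)]) (use A gx in simp)
 moreover have "sph_deriv G x = norm (deriv (cr C G B) a) * (1 + (norm a)\<^sup>2) / (1 + (norm w)\<^sup>2)"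
  unfolding x by (rule sph_deriv_cr[OF G C(1) B(1)]) (use C x in simp)
 ultimately show ?thesis using one_plus_norm_sq_pos(2)[of w] by (simp add: d norm_mult)
qed

lemma sph_deriv_funpow:
 assumes "sph_hol F" shows "sph_deriv (F ^^ n) x = (\<Prod>i<n. sph_deriv F ((F ^^ i) x))"
proof (induction n)
 case 0
 have "sph_deriv (id \<circ> id \<circ> id) x = 1"
 proof -
  obtain B a where B: "B \<in> charts" "B x = Fin a" by (rule chart_ex)
  have x: "x = B (Fin a)" using B charts_invol by metis
  have c: "cr B id B = (\<lambda>z. z)" using charts_invol[OF B(1)] by (simp add: cr_def fun_eq_iff)
  show ?thesis unfolding o_id x
   by (subst sph_deriv_cr[OF sph_hol_charts[OF id_in_charts] B(1) B(1), where b = a])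
     (use charts_invol[OF B(1)] one_plus_norm_sq_pos(2)[of a] c in auto)
 qed
 then have "sph_deriv id x = 1" by (simp only: o_id)
 then show ?case by (simp add: id_def)
next
 case (Suc n)
 then show ?case using sph_deriv_comp[OF assms sph_hol_funpow[OF assms], of n x] by (simp add: mult.commute o_def)
qed

text \<open>A normal form for local arguments: in suitable charts \<open>F\<close> becomes a bounded
  holomorphic function on a Euclidean disc. The factors 1/4 and 5/2 are the comparison constants of
  the spherical and Euclidean metrics from \<open>Fin_dist_chart\<close>.\<close>

lemma sph_hol_local:
 assumes F: "sph_hol F" and r: "0 < r" "r \<le> 1 / 2" and s: "s \<le> 1 / 2" and sub: "F ` ball x r \<subseteq> ball (F x) s"
 obtains A B a b where "A \<in> charts" "B \<in> charts" "norm a \<le> 1" "norm b \<le> 1" "x = B (Fin a)" "F x = A (Fin b)"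
  "cr A F B holomorphic_on ball a (r / 4)" "cr A F B a = b"
  "\<And>z. z \<in> ball a (r / 4) \<Longrightarrow> F (B (Fin z)) = A (Fin (cr A F B z))"
  "\<And>z. z \<in> ball a (r / 4) \<Longrightarrow> cr A F B z \<in> ball b (5 / 2 * s) \<inter> ball 0 2"
  "\<And>y. y \<in> ball x r \<Longrightarrow> \<exists>z. y = B (Fin z) \<and> norm (z - a) \<le> 5 / 2 * dist y x"
  "\<And>z. z \<in> ball a (r / 4) \<Longrightarrow> B (Fin z) \<in> ball x r"
proof -
 obtain B a where B: "B \<in> charts" "B x = Fin a" "norm a \<le> 1" by (rule chart_ex)
 obtain A b where A: "A \<in> charts" "A (F x) = Fin b" "norm b \<le> 1" by (rule chart_ex)
 have x: "x = B (Fin a)" and fx: "F x = A (Fin b)" using A B charts_invol by metis+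
 have in_ball: "B (Fin z) \<in> ball x r" if "z \<in> ball a (r / 4)" for z
 using Fin_dist_chart(1) B(3) r(2) that x charts_dist B(1) by fastforce
 have key: "\<exists>w. A (F (B (Fin z))) = Fin w \<and> w \<in> ball b (5 / 2 * s) \<inter> ball 0 2" if "z \<in> ball a (r / 4)" for z
 proof -
  have "F (B (Fin z)) \<in> ball (F x) s" using in_ball[OF that] sub by blast
  then have "A (F (B (Fin z))) \<in> ball (Fin b) s"
   using charts_dist[OF A(1), of "F x"] A(2) by (metis mem_ball)
  then show ?thesis using Fin_dist_chart(2)[OF A(3) s] by blast
 qed
 have hol: "cr A F B holomorphic_on ball a (r / 4)"
  by (rule sph_hol_holomorphic[OF F A(1) B(1)]) (use key in fastforce)
 show ?thesis
 proof (rule that[OF A(1) B(1) B(3) A(3) x fx hol])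
  show "cr A F B a = b" using x A(2) by (simp add: cr_def)
  fix z assume z: "z \<in> ball a (r / 4)"
  show "B (Fin z) \<in> ball x r" by (rule in_ball[OF z])
  obtain w where w: "A (F (B (Fin z))) = Fin w" "w \<in> ball b (5 / 2 * s) \<inter> ball 0 2" using key[OF z] by blast
  then show "cr A F B z \<in> ball b (5 / 2 * s) \<inter> ball 0 2" by (simp add: cr_def)
  show "F (B (Fin z)) = A (Fin (cr A F B z))" using w(1) charts_invol[OF A(1)] by (metis cr_def the_Fin.simps(1))
 next
  fix y assume y: "y \<in> ball x r"
  then have "B y \<in> ball (Fin a) r" using B charts_dist[OF B(1), of x y] by simp
  then obtain z where z: "B y = Fin z" "norm z < 2" using Fin_dist_chart(2)[OF B(3) r(2)] by auto
  have "norm (z - a) \<le> 5 / 2 * dist (Fin z) (Fin a)" by (rule norm_le_dist_Fin) (use z B in auto)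
  also have "dist (Fin z) (Fin a) = dist y x" using z B charts_dist[OF B(1)] by metis
  finally show "\<exists>z. y = B (Fin z) \<and> norm (z - a) \<le> 5 / 2 * dist y x"
   using z charts_invol[OF B(1)] by metis
 qed
qed

text \<open>The Cauchy estimate on the disc of radius \<open>r / 8\<close> with values within
  \<open>5 / 2 * s\<close> gives \<open>20 * s / r\<close>; the quotient of the conformal factors is
  at most 2 because the source point lies in the unit disc.\<close>

lemma Cauchy_sphere:
 assumes F: "sph_hol F" and r: "0 < r" "r \<le> 1 / 2" and s: "s \<le> 1 / 2" and sub: "F ` ball x r \<subseteq> ball (F x) s"
 shows "sph_deriv F x \<le> 40 * s / r"
proof -
 obtain A B a b where L: "A \<in> charts" "B \<in> charts" "norm a \<le> 1" "norm b \<le> 1" "x = B (Fin a)" "F x = A (Fin b)"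
  "cr A F B holomorphic_on ball a (r / 4)" "cr A F B a = b"
  "\<And>z. z \<in> ball a (r / 4) \<Longrightarrow> cr A F B z \<in> ball b (5 / 2 * s) \<inter> ball 0 2"
  using sph_hol_local[OF assms] by metis
 have bd: "cmod ((deriv ^^ 1) (cr A F B) a) \<le> fact 1 * (5 / 2 * s) / (r / 8) ^ 1"
 proof (rule Cauchy_higher_deriv_bound)
  have sub: "cball a (r / 8) \<subseteq> ball a (r / 4)" "ball a (r / 8) \<subseteq> ball a (r / 4)" using r by auto
  show "cr A F B holomorphic_on ball a (r / 8)" using L(7) sub holomorphic_on_subset by blast
  show "continuous_on (cball a (r / 8)) (cr A F B)"
   using L(7) sub holomorphic_on_subset holomorphic_on_imp_continuous_on by blast
  show "\<And>w. w \<in> ball a (r / 8) \<Longrightarrow> cr A F B w \<in> ball b (5 / 2 * s)" using L(9) sub by blast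
 qed (use r in auto)
 have "F x \<in> ball (F x) s" using sub r by (meson centre_in_ball image_eqI subsetD)
 then have s0: "0 < s" by simp
 have d: "cmod (deriv (cr A F B) a) \<le> 20 * s / r" using bd by (simp add: field_simps)
 have "sph_deriv F x = norm (deriv (cr A F B) a) * ((1 + (norm a)\<^sup>2) / (1 + (norm b)\<^sup>2))"
  using sph_deriv_cr[OF F L(1,2), of a b] L charts_invol[OF L(1)] by simp
 also have "... \<le> (20 * s / r) * (2 / 1)"
  using d power_mono[OF L(3), of 2] s0 r by (intro mult_mono frac_le) auto
 also have "... = 40 * s / r" by simp
 finally show ?thesis .
qed

text \<open>A Taylor estimate with a constant that is uniform on the sphere, stated for two points
  \<open>u\<close>, \<open>v\<close> near a third point \<open>w\<close>. The error is additive, so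
  it remains meaningful when \<open>w\<close> is critical.\<close>

lemma sphere_second_order:
 assumes F: "sph_hol F"
 obtains M where "0 < M" "\<And>w u v \<rho>. dist u w \<le> \<rho> \<Longrightarrow> dist v w \<le> \<rho> \<Longrightarrow>
   \<bar>dist (F u) (F v) - sph_deriv F w * dist u v\<bar> \<le> M * \<rho> * dist u v"
proof -
 have "uniformly_continuous_on UNIV F"
  by (rule compact_uniformly_continuous[OF sph_hol_cont[OF F] compact_rsphere])
 from this[unfolded uniformly_continuous_on_def, rule_format, of "1 / 2"]
 obtain r' where r': "r' > 0" "\<And>x y. dist y x < r' \<Longrightarrow> dist (F y) (F x) < 1 / 2" by auto
 define r where "r = min r' (1 / 2)"
 have r: "0 < r" "r \<le> 1 / 2" "\<And>x y. dist y x < r \<Longrightarrow> dist (F y) (F x) < 1 / 2"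
  using r' by (auto simp: r_def)
 \<comment> \<open>\<open>C1\<close> and \<open>C2\<close> are the Cauchy bounds for the first two
   derivatives of a function of modulus at most 2 on discs of radius \<open>r / 16\<close>;
   \<open>C3\<close> is a Lipschitz constant.\<close>
 define C1 where "C1 = 32 / r"
 define C2 where "C2 = 1024 / r\<^sup>2"
 define C3 where "C3 = C1 + C2"
 have C: "C1 > 0" "C2 > 0" "C3 > 0" using r by (auto simp: C1_def C2_def C3_def add_pos_pos)
 \<comment> \<open>The summands belong to the metric at the image point, the Taylor remainder in the
   plane, and the metric at the source point. The later factor 25/4 is the square of 5/2, the price
   of returning to spherical distances twice.\<close>
 define K1 where "K1 = 18 * C3 * C3 + 2 * C2 + 36 * C1"
 \<comment> \<open>Below this radius the points stay well inside the chart disc, and their images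
   stay within distance 1 of \<open>b\<close>, as \<open>dist_Fin_approx\<close> requires.\<close>
 define p where "p = min (r / 40) (2 / (5 * (C3 + 1)))"
 have p: "0 < p" "p \<le> r / 40" "p \<le> 2 / (5 * (C3 + 1))" using r C by (auto simp: p_def)
 have small: "sph_deriv F w \<le> 2 * C1 \<and>
   \<bar>dist (F u) (F v) - sph_deriv F w * dist u v\<bar> \<le> (K1 * 25 / 4) * \<rho> * dist u v"
  if uv: "dist u w \<le> \<rho>" "dist v w \<le> \<rho>" and \<rho>: "\<rho> \<le> p" for w u v \<rho>
 proof -
  have \<rho>0: "0 \<le> \<rho>" using uv(1) zero_le_dist order_trans by blast
  have sub: "F ` ball w r \<subseteq> ball (F w) (1 / 2)" using r(3) by (auto simp: dist_commute)
  obtain A B a b where L: "A \<in> charts" "B \<in> charts" "norm a \<le> 1" "norm b \<le> 1" "w = B (Fin a)" "F w = A (Fin b)"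
   "cr A F B holomorphic_on ball a (r / 4)" "cr A F B a = b"
   "\<And>z. z \<in> ball a (r / 4) \<Longrightarrow> F (B (Fin z)) = A (Fin (cr A F B z))"
   "\<And>z. z \<in> ball a (r / 4) \<Longrightarrow> cr A F B z \<in> ball b (5 / 2 * (1 / 2)) \<inter> ball 0 2"
   "\<And>y. y \<in> ball w r \<Longrightarrow> \<exists>z. y = B (Fin z) \<and> norm (z - a) \<le> 5 / 2 * dist y w"
   by (rule sph_hol_local[OF F r(1,2) order_refl sub]) blast
  define g where "g = cr A F B"
  note g = L(7-10)[folded g_def]
  have "\<rho> < r" using \<rho> p r by linarith
  then have "u \<in> ball w r" "v \<in> ball w r" using uv by (auto simp: dist_commute)
  then obtain u' v' where u': "u = B (Fin u')" "norm (u' - a) \<le> 5 / 2 * dist u w"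
   and v': "v = B (Fin v')" "norm (v' - a) \<le> 5 / 2 * dist v w" using L(11) by meson
  define t where "t = 5 / 2 * \<rho>"
  have t0: "0 \<le> t" using \<rho>0 by (simp add: t_def)
  have ut: "norm (u' - a) \<le> t" "norm (v' - a) \<le> t" using u' v' uv by (auto simp: t_def)
  have "t \<le> 5 / 2 * (2 / (5 * (C3 + 1)))" using \<rho> p by (simp add: t_def)
  also have "... = 1 / (C3 + 1)" using C by (simp add: divide_simps)
  finally have "t * (C3 + 1) \<le> 1" using C by (simp add: pos_le_divide_eq)
  then have t: "t \<le> 1" "C3 * t \<le> 1" "t < r / 8"
   using t0 C \<rho> p r mult_nonneg_nonneg[of C3 t] by (auto simp: t_def algebra_simps)
  have cb: "cball a t \<subseteq> ball a (r / 8)" "cball a t \<subseteq> ball a (r / 4)" using t r by auto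
  have hb: "cmod ((deriv ^^ n) g z) \<le> fact n * 2 / (r / 16) ^ n" if "z \<in> ball a (r / 8)" "n > 0" for z n
  proof (rule Cauchy_higher_deriv_bound)
   have sub: "cball z (r / 16) \<subseteq> ball a (r / 4)"
   proof
    fix y assume "y \<in> cball z (r / 16)"
    then show "y \<in> ball a (r / 4)" using that(1) dist_triangle[of a y z] r(1) by auto
   qed
   then have sub': "ball z (r / 16) \<subseteq> ball a (r / 4)" by auto
   show "g holomorphic_on ball z (r / 16)" using g(1) sub' holomorphic_on_subset by blast
   show "continuous_on (cball z (r / 16)) g"
    using g(1) sub holomorphic_on_subset holomorphic_on_imp_continuous_on by blast
   show "\<And>w. w \<in> ball z (r / 16) \<Longrightarrow> g w \<in> ball 0 2" using g(4) sub' by blast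
  qed (use r that in auto)
  have der: "(g has_field_derivative deriv g z) (at z)" if "z \<in> ball a (r / 4)" for z
   using holomorphic_derivI[OF g(1) open_ball that] .
  have hol': "deriv g holomorphic_on ball a (r / 4)" by (rule holomorphic_deriv[OF g(1) open_ball])
  have g1a: "cmod (deriv g a) \<le> C1" using hb[of a 1] r by (simp add: C1_def)
  have g2: "cmod (deriv g z - deriv g a) \<le> C2 * t" if "z \<in> cball a t" for z
  proof -
   have "cmod (deriv g z - deriv g a) \<le> C2 * cmod (z - a)"
   proof (rule field_differentiable_bound[of "cball a t" "deriv g" "deriv (deriv g)"])
    fix y assume y: "y \<in> cball a t"
    show "(deriv g has_field_derivative deriv (deriv g) y) (at y within cball a t)"
     using holomorphic_derivI[OF hol' open_ball] y cb has_field_derivative_at_within by blast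
    have "cmod ((deriv ^^ 2) g y) \<le> fact 2 * 2 / (r / 16) ^ 2" by (rule hb) (use y cb in auto)
    then show "cmod (deriv (deriv g) y) \<le> C2"
     by (simp add: numeral_2_eq_2 C2_def power2_eq_square field_simps)
   qed (use that t0 in auto)
   also have "... \<le> C2 * t" using that C by (intro mult_left_mono) (auto simp: dist_norm norm_minus_commute)
   finally show ?thesis .
  qed
  define e where "e = norm (u' - v')"
  define G where "G = norm (g u' - g v')"
  have lin: "cmod ((g y - deriv g a * y) - (g y' - deriv g a * y')) \<le> C2 * t * cmod (y - y')"
   if "y \<in> cball a t" "y' \<in> cball a t" for y y'
  proof (rule field_differentiable_bound[of "cball a t" _ "\<lambda>z. deriv g z - deriv g a"])
   fix z assume z: "z \<in> cball a t"
   show "((\<lambda>y. g y - deriv g a * y) has_field_derivative deriv g z - deriv g a) (at z within cball a t)"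
    by (rule DERIV_subset[where s = UNIV]) (use der z cb in \<open>auto intro!: derivative_eq_intros\<close>)
   show "cmod (deriv g z - deriv g a) \<le> C2 * t" by (rule g2[OF z])
  qed (use that in auto)
  have Gd: "\<bar>norm (g y - g y') - norm (deriv g a) * norm (y - y')\<bar> \<le> C2 * t * norm (y - y')"
   if "y \<in> cball a t" "y' \<in> cball a t" for y y'
  proof -
   have "(g y - deriv g a * y) - (g y' - deriv g a * y') = (g y - g y') - deriv g a * (y - y')"
    by (simp add: algebra_simps)
   then have "cmod ((g y - g y') - deriv g a * (y - y')) \<le> C2 * t * cmod (y - y')"
    using lin[OF that] by (simp only:)
   then show ?thesis
    using norm_triangle_ineq3[of "g y - g y'" "deriv g a * (y - y')"] unfolding norm_mult by linarith
  qed
  have C2t: "C2 * t \<le> C2" using C t by simp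
  have Glip: "norm (g y - g y') \<le> C3 * norm (y - y')" if "y \<in> cball a t" "y' \<in> cball a t" for y y'
  proof -
   have "norm (g y - g y') \<le> norm (deriv g a) * norm (y - y') + C2 * t * norm (y - y')"
    using Gd[OF that] by linarith
   also have "... \<le> C1 * norm (y - y') + C2 * norm (y - y')"
    using g1a C2t by (intro add_mono mult_right_mono) auto
   finally show ?thesis by (simp add: C3_def algebra_simps)
  qed
  have mem: "u' \<in> cball a t" "v' \<in> cball a t" "a \<in> cball a t"
   using ut t0 by (auto simp: dist_norm norm_minus_commute)
  have ge: "G \<le> C3 * e" using Glip[OF mem(1,2)] by (simp add: G_def e_def)
  have gb: "norm (g y - b) \<le> C3 * t" if "y \<in> cball a t" for y
  proof -
   have "norm (g y - b) \<le> C3 * norm (y - a)" using Glip[OF that mem(3)] g(2) by simp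
   also have "... \<le> C3 * t" using that C by (intro mult_left_mono) (auto simp: dist_norm norm_minus_commute)
   finally show ?thesis .
  qed
  define \<alpha> where "\<alpha> = 2 / (1 + (norm a)\<^sup>2)"
  define \<beta> where "\<beta> = 2 / (1 + (norm b)\<^sup>2)"
  define D where "D = sph_deriv F w"
  have ab: "0 < \<alpha>" "\<beta> \<le> 2" "0 < \<beta>" "1 \<le> \<alpha>"
   using one_plus_norm_sq_pos(1)[of a] one_plus_norm_sq_pos(1)[of b] power_mono[OF L(3), of 2]
   by (auto simp: \<alpha>_def \<beta>_def divide_simps)
  have Deq: "D * \<alpha> = norm (deriv g a) * \<beta>"
  using L(5, 6) charts_invol sph_deriv_cr F L(1,2) one_plus_norm_sq_pos(2) by (fastforce simp: D_def g_def \<alpha>_def \<beta>_def)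
  have D0: "0 \<le> D" unfolding D_def by (rule sph_deriv_nonneg[OF F])
  have "D * 1 \<le> D * \<alpha>" using ab D0 by (intro mult_left_mono) auto
  also have "... \<le> C1 * 2" unfolding Deq using g1a ab C by (intro mult_mono) auto
  finally have D1: "D \<le> 2 * C1" by simp
  define x where "x = dist (F u) (F v)"
  define y where "y = dist u v"
  have "F u = A (Fin (g u'))" "F v = A (Fin (g v'))" using g(3) mem cb u' v' by auto
  then have x: "x = dist (Fin (g u')) (Fin (g v'))" using charts_dist[OF L(1)] by (simp add: x_def)
  have y: "y = dist (Fin u') (Fin v')" using charts_dist[OF L(2)] u' v' by (simp add: y_def)
  have e1: "\<bar>x - \<beta> * G\<bar> \<le> 18 * (C3 * t) * G"
   unfolding x \<beta>_def G_def using gb mem t L(4) by (intro dist_Fin_approx) auto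
  have e2: "\<bar>y - \<alpha> * e\<bar> \<le> 18 * t * e"
   unfolding y \<alpha>_def e_def using ut t L(3) by (intro dist_Fin_approx) auto
  have e3: "\<bar>G - norm (deriv g a) * e\<bar> \<le> C2 * t * e" using Gd[OF mem(1,2)] by (simp add: G_def e_def)
  have nu: "norm u' \<le> 2" "norm v' \<le> 2"
   using ut t L(3) norm_triangle_sub[of u' a] norm_triangle_sub[of v' a] by linarith+
  have ey: "e \<le> 5 / 2 * y" unfolding e_def y by (rule norm_le_dist_Fin[OF nu])
  have b1: "\<bar>x - \<beta> * G\<bar> \<le> 18 * C3 * C3 * (t * e)"
  proof -
   have "18 * (C3 * t) * G \<le> 18 * (C3 * t) * (C3 * e)" using ge C t0 by (intro mult_left_mono) auto
   then show ?thesis using e1 by (simp add: algebra_simps)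
  qed
  have b2: "\<bar>\<beta> * G - \<beta> * (norm (deriv g a) * e)\<bar> \<le> 2 * C2 * (t * e)"
  proof -
   have "\<bar>\<beta> * G - \<beta> * (norm (deriv g a) * e)\<bar> = \<beta> * \<bar>G - norm (deriv g a) * e\<bar>"
    using ab by (simp add: right_diff_distrib[symmetric] abs_mult)
   also have "... \<le> 2 * (C2 * t * e)" using e3 ab by (intro mult_mono) auto
   finally show ?thesis by simp
  qed
  have b3: "\<bar>D * (\<alpha> * e) - D * y\<bar> \<le> 36 * C1 * (t * e)"
  proof -
   have "\<bar>D * (\<alpha> * e) - D * y\<bar> = D * \<bar>y - \<alpha> * e\<bar>"
    using D0 by (simp add: right_diff_distrib[symmetric] abs_mult abs_minus_commute)
   also have "... \<le> 2 * C1 * (18 * t * e)" using e2 D1 C by (intro mult_mono) auto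
   finally show ?thesis by simp
  qed
  have "\<beta> * (norm (deriv g a) * e) = D * (\<alpha> * e)" using Deq by (simp add: mult_ac)
  then have "\<bar>x - D * y\<bar> \<le> 18 * C3 * C3 * (t * e) + 2 * C2 * (t * e) + 36 * C1 * (t * e)"
   using b1 b2 b3 by linarith
  also have "... = K1 * t * e" by (simp add: K1_def algebra_simps)
  also have "... \<le> K1 * t * (5 / 2 * y)" using ey C t0 by (intro mult_left_mono) (auto simp: K1_def)
  finally have "\<bar>x - D * y\<bar> \<le> (K1 * 25 / 4) * \<rho> * y" by (simp add: t_def)
  then show ?thesis using D1 by (simp add: x_def y_def D_def)
 qed
 have K: "K1 > 0" using C by (simp add: K1_def add_pos_pos)
 define M1 where "M1 = K1 * 25 / 4"
 have M1: "M1 > 0" using K by (simp add: M1_def)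
 \<comment> \<open>A global Lipschitz constant. It settles the radii above \<open>p\<close>, where
   the error term is so large that the trivial bound is enough.\<close>
 define L where "L = 2 * C1 + M1 * p + 4 / p"
 have lip: "dist (F u) (F v) \<le> L * dist u v" for u v
 proof (cases "dist u v \<le> p")
  case True
  have "\<bar>dist (F u) (F v) - sph_deriv F u * dist u v\<bar> \<le> M1 * p * dist u v"
   using small[of u u p v] True p(1) by (simp add: dist_commute M1_def)
  then have "dist (F u) (F v) \<le> (sph_deriv F u + M1 * p) * dist u v"
   unfolding distrib_right by linarith
  also have "... \<le> L * dist u v"
  proof (rule mult_right_mono)
   have "sph_deriv F u \<le> 2 * C1" using small[of u u p u] p(1) by simp
   moreover have "0 < 4 / p" using p(1) by simp
   ultimately show "sph_deriv F u + M1 * p \<le> L" unfolding L_def by linarith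
  qed simp
  finally show ?thesis .
 next
  case False
  have "dist (F u) (F v) \<le> 4" using dist_rsphere_less_4 less_imp_le by blast
  also have "... \<le> 4 / p * dist u v" using False p(1) by (simp add: field_simps)
  also have "... \<le> L * dist u v" using C M1 p(1) by (intro mult_right_mono) (auto simp: L_def)
  finally show ?thesis .
 qed
 have L0: "L > 0" using C M1 p by (simp add: L_def add_pos_pos)
 define M where "M = M1 + (L + 2 * C1) / p"
 show ?thesis
 proof (rule that[of M])
  show "0 < M" using M1 L0 C p by (simp add: M_def add_pos_pos)
  fix w u v :: rsphere and \<rho> :: real assume uv: "dist u w \<le> \<rho>" "dist v w \<le> \<rho>"
  have \<rho>0: "0 \<le> \<rho>" using uv(1) zero_le_dist order_trans by blast
  show "\<bar>dist (F u) (F v) - sph_deriv F w * dist u v\<bar> \<le> M * \<rho> * dist u v"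
  proof (cases "\<rho> \<le> p")
   case True
   have "\<bar>dist (F u) (F v) - sph_deriv F w * dist u v\<bar> \<le> M1 * \<rho> * dist u v"
    using small[OF uv True] by (simp add: M1_def)
   also have "... \<le> M * \<rho> * dist u v" using \<rho>0 L0 C p by (intro mult_right_mono) (auto simp: M_def)
   finally show ?thesis .
  next
   case False
   have D: "0 \<le> sph_deriv F w" "sph_deriv F w \<le> 2 * C1"
    using small[of w w p w] p(1) sph_deriv_nonneg[OF F] by auto
   have "\<bar>dist (F u) (F v) - sph_deriv F w * dist u v\<bar> \<le> \<bar>dist (F u) (F v)\<bar> + \<bar>sph_deriv F w * dist u v\<bar>"
    by (rule abs_triangle_ineq4)
   also have "... \<le> L * dist u v + 2 * C1 * dist u v"
    using lip[of u v] D mult_right_mono[OF D(2), of "dist u v"] by auto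
   also have "... = ((L + 2 * C1) / p) * p * dist u v" using p by (simp add: field_simps)
   also have "... \<le> ((L + 2 * C1) / p) * \<rho> * dist u v"
    using False L0 C p by (intro mult_right_mono mult_left_mono) auto
   also have "... \<le> M * \<rho> * dist u v" using \<rho>0 M1 by (intro mult_right_mono) (auto simp: M_def)
   finally show ?thesis .
  qed
 qed
qed

section \<open>Rational maps as holomorphic maps\<close>

lemma coprime_no_common_root:
 fixes p q :: "complex poly"
 assumes "coprime p q" shows "\<not> (poly p z = 0 \<and> poly q z = 0)"
proof
 assume "poly p z = 0 \<and> poly q z = 0"
 then have "[:-z, 1:] dvd p" "[:-z, 1:] dvd q" by (auto simp: poly_eq_0_iff_dvd)
 with assms have "is_unit [:-z, 1:]" by (rule coprime_common_divisor)
 then show False by (auto simp: is_unit_iff_degree)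
qed

text \<open>The polynomial \<open>z ^ d * p (1 / z)\<close>. Numerator and denominator must be
  reversed at the same degree \<open>d\<close>, whereas \<open>reflect_poly\<close> reverses at the
  degree of \<open>p\<close>; the monomial makes up the difference.\<close>

definition rev_poly :: "nat \<Rightarrow> complex poly \<Rightarrow> complex poly" where
 "rev_poly d p = monom 1 (d - degree p) * reflect_poly p"

lemma poly_rev_poly:
 assumes "degree p \<le> d"
 shows "z \<noteq> 0 \<Longrightarrow> poly (rev_poly d p) z = z ^ d * poly p (1 / z)" "poly (rev_poly d p) 0 = coeff p d"
proof -
 assume z: "z \<noteq> 0"
 have "z ^ (d - degree p) * z ^ degree p = z ^ d" using assms by (simp add: power_add[symmetric])
 then show "poly (rev_poly d p) z = z ^ d * poly p (1 / z)"
  using z by (simp add: rev_poly_def poly_monom poly_reflect_poly_nz inverse_eq_divide mult.assoc[symmetric])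
next
 show "poly (rev_poly d p) 0 = coeff p d"
  using assms by (cases "d = degree p") (auto simp: rev_poly_def poly_monom coeff_eq_0)
qed

lemma rat_eval_chart:
 assumes cop: "coprime p q" and B: "B \<in> charts"
 obtains P Q where "\<And>z. \<not> (poly P z = 0 \<and> poly Q z = 0)"
  "\<And>z. rat_eval p q (B (Fin z)) = (if poly Q z = 0 then Infty else Fin (poly P z / poly Q z))"
proof (cases "B = id")
 case True
 then show ?thesis using that[of p q] coprime_no_common_root[OF cop] by simp
next
 case False
 then have B: "B = sinv" using B by (simp add: charts_def)
 define d where "d = max (degree p) (degree q)"
 have deg: "degree p \<le> d" "degree q \<le> d" by (auto simp: d_def)
 have nz: "\<not> (coeff p d = 0 \<and> coeff q d = 0)"
 proof (cases "d = 0")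
  case True
  then have "p = [:coeff p 0:]" "q = [:coeff q 0:]" using deg by (auto elim: degree_eq_zeroE)
  then show ?thesis using cop True by (metis coprime_0_left_iff is_unit_pCons_iff pCons_0_0 not_is_unit_0)
 next
  case False then show ?thesis by (auto simp: d_def max_def split: if_splits)
 qed
 show ?thesis
 proof (rule that[of "rev_poly d p" "rev_poly d q"])
  fix z
  show "\<not> (poly (rev_poly d p) z = 0 \<and> poly (rev_poly d q) z = 0)"
   using coprime_no_common_root[OF cop, of "1 / z"] nz by (cases "z = 0") (auto simp: poly_rev_poly[OF deg(1)] poly_rev_poly[OF deg(2)])
  show "rat_eval p q (B (Fin z)) =
    (if poly (rev_poly d q) z = 0 then Infty else Fin (poly (rev_poly d p) z / poly (rev_poly d q) z))"
   by (cases "z = 0") (auto simp: B poly_rev_poly[OF deg(1)] poly_rev_poly[OF deg(2)] d_def[symmetric] Let_def)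
 qed
qed

lemma eventually_at_Fin:
 assumes "eventually (\<lambda>z. P (Fin z)) (at z)" shows "eventually P (at (Fin z))"
proof -
 have "eventually (\<lambda>y. P (Fin (the_Fin y))) (at (Fin z))"
  using filterlim_the_Fin(1)[of z] assms by (rule eventually_compose_filterlim[rotated])
 with filterlim_the_Fin(2)[of z] show ?thesis by eventually_elim (simp add: Fin_the_Fin)
qed

lemma isCont_Fin_compose: "isCont (\<lambda>w. g (Fin w)) z \<Longrightarrow> isCont g (Fin z)"
 unfolding isCont_def tendsto_def using eventually_at_Fin by fast

lemma isCont_rat_chart:
 assumes "\<And>z. \<not> (poly P z = 0 \<and> poly Q z = 0)"
 shows "isCont (\<lambda>z. if poly Q z = 0 then Infty else Fin (poly P z / poly Q z)) z" (is "isCont ?h z")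
proof -
 have ev: "eventually (\<lambda>w. poly R w \<noteq> 0) (nhds z)" if "poly R z \<noteq> 0" for R :: "complex poly"
 proof -
  have "open ((\<lambda>w. poly R w) -` (- {0}))" by (intro open_vimage continuous_intros)
  from eventually_nhds_in_open[OF this, of z] that show ?thesis by simp
 qed
 have cF: "isCont (\<lambda>w. Fin (poly A w / poly B w)) z" if "poly B z \<noteq> 0" for A B :: "complex poly"
  by (rule isCont_o2[OF _ isCont_Fin]) (use that in \<open>auto intro!: continuous_intros\<close>)
 show ?thesis
 proof (cases "poly Q z = 0")
  case False
  have "eventually (\<lambda>w. ?h w = Fin (poly P w / poly Q w)) (nhds z)"
   using ev[OF False] by eventually_elim simp
  from isCont_cong[OF this] cF[OF False] show ?thesis by blast
 next
  case True
  then have Pz: "poly P z \<noteq> 0" using assms by blast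
  have evh: "eventually (\<lambda>w. ?h w = sinv (Fin (poly Q w / poly P w))) (nhds z)"
   using ev[OF Pz] by eventually_elim auto
  have "isCont (\<lambda>w. sinv (Fin (poly Q w / poly P w))) z"
   by (rule isCont_o2[OF cF[OF Pz]]) (use continuous_on_sinv[of UNIV] in \<open>simp add: continuous_on_eq_continuous_at\<close>)
  with isCont_cong[OF evh] show ?thesis by blast
 qed
qed

lemma sph_hol_rat_eval:
 assumes cop: "coprime p q" shows "sph_hol (rat_eval p q)"
 unfolding sph_hol_def
proof (intro conjI ballI allI impI)
 have "isCont (rat_eval p q) x" for x
 proof -
  obtain B a where B: "B \<in> charts" "B x = Fin a" by (rule chart_ex)
  obtain P Q where PQ: "\<And>z. \<not> (poly P z = 0 \<and> poly Q z = 0)"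
   "\<And>z. rat_eval p q (B (Fin z)) = (if poly Q z = 0 then Infty else Fin (poly P z / poly Q z))"
   by (rule rat_eval_chart[OF cop B(1)]) blast
  have "isCont (\<lambda>y. rat_eval p q (B y)) (Fin a)"
   by (rule isCont_Fin_compose) (use isCont_rat_chart[OF PQ(1), of a] PQ(2) in simp)
  then have "isCont (\<lambda>y. rat_eval p q (B (B y))) x"
   using isCont_o2[of x B "\<lambda>y. rat_eval p q (B y)"] charts_cont[OF B(1), of UNIV] B(2)
   by (simp add: continuous_on_eq_continuous_at)
  then show ?thesis by (simp add: charts_invol[OF B(1)])
 qed
 then show "continuous_on UNIV (rat_eval p q)" by (simp add: continuous_on_eq_continuous_at)
 fix A B z assume AB: "A \<in> charts" "B \<in> charts" and ne: "A (rat_eval p q (B (Fin z))) \<noteq> Infty"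
 obtain P Q where PQ: "\<And>z. \<not> (poly P z = 0 \<and> poly Q z = 0)"
  "\<And>z. rat_eval p q (B (Fin z)) = (if poly Q z = 0 then Infty else Fin (poly P z / poly Q z))"
  by (rule rat_eval_chart[OF cop AB(2)]) blast
 have ev: "eventually (\<lambda>w. poly R w \<noteq> 0) (nhds z)" if "poly R z \<noteq> 0" for R :: "complex poly"
 proof -
  have "open ((\<lambda>w. poly R w) -` (- {0}))" by (intro open_vimage continuous_intros)
  from eventually_nhds_in_open[OF this, of z] that show ?thesis by simp
 qed
 have dF: "(\<lambda>w. poly R w / poly S w) field_differentiable at z" if "poly S z \<noteq> 0" for R S :: "complex poly"
  using DERIV_divide[OF poly_DERIV poly_DERIV that] by (auto simp: field_differentiable_def)
 have trans: "u field_differentiable at z" if "v field_differentiable at z" "eventually (\<lambda>w. u w = v w) (nhds z)" for u v :: "complex \<Rightarrow> complex"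
  using that unfolding field_differentiable_def by (metis DERIV_cong_ev)
 from AB(1) consider "A = id" | "A = sinv" by (auto simp: charts_def)
 then show "cr A (rat_eval p q) B field_differentiable at z"
 proof cases
  case 1
  then have Qz: "poly Q z \<noteq> 0" using ne PQ(2) by auto
  show ?thesis by (rule trans[OF dF[OF Qz, of P]]) (use ev[OF Qz] in \<open>eventually_elim, simp add: cr_def PQ 1\<close>)
 next
  case 2
  then have Pz: "poly P z \<noteq> 0" using ne PQ(1,2)[of z] by auto
  show ?thesis by (rule trans[OF dF[OF Pz, of Q]]) (use ev[OF Pz] in \<open>eventually_elim, simp add: cr_def PQ 2\<close>)
 qed
qed

section \<open>Fibres, critical points and openness of a rational map\<close>

locale rational =
 fixes f :: "rsphere \<Rightarrow> rsphere" and d :: nat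
 assumes rational: "rational_map f d" and deg: "2 \<le> d"
begin

abbreviation fn where "fn n \<equiv> f ^^ n"

definition pq where "pq = (SOME (p, q). coprime p q \<and> d = max (degree p) (degree q) \<and> f = rat_eval p q)"

definition num where "num = fst pq"
definition den where "den = snd pq"

lemma pq: "coprime num den" "d = max (degree num) (degree den)" "f = rat_eval num den"
proof -
 have "\<exists>x. case x of (a, b) \<Rightarrow> coprime a b \<and> d = max (degree a) (degree b) \<and> f = rat_eval a b"
  using rational by (auto simp: rational_map_def)
 then have "case pq of (a, b) \<Rightarrow> coprime a b \<and> d = max (degree a) (degree b) \<and> f = rat_eval a b"
  unfolding pq_def by (rule someI_ex)
 then show "coprime num den" "d = max (degree num) (degree den)" "f = rat_eval num den"
  by (auto simp: num_def den_def split: prod.splits)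
qed

lemma f_Fin: "f (Fin z) = (if poly den z = 0 then Infty else Fin (poly num z / poly den z))"
 using fun_cong[OF pq(3), of "Fin z"] by simp

lemma f_Infty: "f Infty = (if coeff den d = 0 then Infty else Fin (coeff num d / coeff den d))"
 using fun_cong[OF pq(3), of Infty] by (simp add: Let_def pq(2)[symmetric])

lemma hol: "sph_hol f" using sph_hol_rat_eval[OF pq(1)] pq(3) by simp

lemma hol_pow: "sph_hol (fn n)" by (rule sph_hol_funpow[OF hol])

lemma nonconst_pencil: "num - smult w den \<noteq> 0" "den \<noteq> 0"
proof -
 show den: "den \<noteq> 0"
 proof
  assume "den = 0"
  then have "is_unit num" using pq(1) by simp
  then show False using pq(2) deg \<open>den = 0\<close> by (cases "num = 0") (auto simp: is_unit_iff_degree)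
 qed
 show "num - smult w den \<noteq> 0"
 proof
  assume "num - smult w den = 0"
  then have num: "num = smult w den" by simp
  then have "den dvd num" by (simp add: dvd_smult)
  then have "is_unit den" using pq(1) by (metis coprime_common_divisor dvd_refl)
  then have "degree den = 0" using den by (auto simp: is_unit_iff_degree)
  moreover have "degree num = 0" using num calculation degree_smult_le[of w den] by simp
  ultimately show False using pq(2) deg by simp
 qed
qed

text \<open>The finite preimages are roots of one nonzero polynomial of degree at most
  \<open>d\<close>; \<open>Infty\<close> is counted separately, whence \<open>Suc d\<close>.\<close>

lemma fiber: "finite (f -` {y})" "card (f -` {y}) \<le> Suc d"
proof -
 define R where "R = (case y of Infty \<Rightarrow> den | Fin w \<Rightarrow> num - smult w den)"
 have R: "R \<noteq> 0" "degree R \<le> d"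
  using nonconst_pencil pq(2) degree_diff_le_max[of num "smult (the_Fin y) den"] degree_smult_le[of "the_Fin y" den]
  by (auto simp: R_def split: rsphere.splits)
 have sub: "f -` {y} \<subseteq> insert Infty (Fin ` {z. poly R z = 0})"
 proof
  fix x assume x: "x \<in> f -` {y}"
  show "x \<in> insert Infty (Fin ` {z. poly R z = 0})"
  proof (cases x)
   case (Fin z)
   then have "poly R z = 0" using x by (auto simp: f_Fin R_def split: rsphere.splits if_splits)
   then show ?thesis using Fin by simp
  qed simp
 qed
 have fin: "finite {z. poly R z = 0}" by (rule poly_roots_finite[OF R(1)])
 show "finite (f -` {y})" by (rule finite_subset[OF sub]) (use fin in simp)
 have "card (f -` {y}) \<le> card (insert Infty (Fin ` {z. poly R z = 0}))"
  by (rule card_mono[OF _ sub]) (use fin in simp)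
 also have "... \<le> Suc (card {z. poly R z = 0})"
  using fin by (intro order_trans[OF card_insert_le_m1] ) (auto intro: card_image_le)
 also have "card {z. poly R z = 0} \<le> d" using card_poly_roots_bound[OF R(1)] R(2) by linarith
 finally show "card (f -` {y}) \<le> Suc d" by simp
qed

text \<open>The numerator of the derivative of \<open>num / den\<close>; finite critical points that
  are not poles are among its roots.\<close>

definition wronskian where "wronskian = pderiv num * den - num * pderiv den"

text \<open>If it vanished, coprimality would make \<open>num\<close> and \<open>den\<close> divide
  their own derivatives, and both would be constant.\<close>

lemma wronskian_nonzero: "wronskian \<noteq> 0"
proof
 assume "wronskian = 0"
 then have eq: "pderiv num * den = num * pderiv den" by (simp add: wronskian_def)
 have "num dvd pderiv num * den" unfolding eq by simp
 then have "num dvd pderiv num" using pq(1) by (metis coprime_dvd_mult_left_iff)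
 have "den dvd num * pderiv den" unfolding eq[symmetric] by simp
 then have "den dvd pderiv den" using pq(1) by (metis coprime_commute coprime_dvd_mult_right_iff)
 have deg0: "degree r = 0" if "r dvd pderiv r" for r :: "complex poly"
 using that by simp
 show False using deg0[OF \<open>num dvd pderiv num\<close>] deg0[OF \<open>den dvd pderiv den\<close>] pq(2) deg by simp
qed

lemma sph_deriv_zero_imp:
 assumes "sph_deriv f (Fin z) = 0" "poly den z \<noteq> 0" shows "poly wronskian z = 0"
proof -
 define g where "g = (\<lambda>w. poly num w / poly den w)"
 have op: "open ((\<lambda>w. poly den w) -` (- {0}))" by (intro open_vimage continuous_intros)
 have "eventually (\<lambda>w. w \<in> (\<lambda>w. poly den w) -` (- {0})) (nhds z)"
  by (rule eventually_nhds_in_open[OF op]) (use assms in auto)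
 then have ev: "eventually (\<lambda>w. f (Fin w) = Fin (g w)) (nhds z)"
  by eventually_elim (simp add: f_Fin g_def)
 have der: "(g has_field_derivative (poly (pderiv num) z * poly den z - poly num z * poly (pderiv den) z) / (poly den z * poly den z)) (at z)"
  unfolding g_def by (rule DERIV_divide[OF poly_DERIV poly_DERIV assms(2)])
 have "norm ((poly (pderiv num) z * poly den z - poly num z * poly (pderiv den) z) / (poly den z * poly den z)) = 0"
  using sph_deriv_Fin[OF der ev] assms(1) one_plus_norm_sq_pos(2)[of z] one_plus_norm_sq_pos(2)[of "g z"]
  by (simp del: norm_eq_zero)
 then show ?thesis using assms(2) by (simp add: wronskian_def)
qed

lemma finite_crit: "finite {x. sph_deriv f x = 0}"
proof (rule finite_subset)
 show "{x. sph_deriv f x = 0} \<subseteq> insert Infty (Fin ` ({z. poly den z = 0} \<union> {z. poly wronskian z = 0}))"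
 proof safe
  fix x assume "sph_deriv f x = 0" "x \<notin> Fin ` ({z. poly den z = 0} \<union> {z. poly wronskian z = 0})"
  then show "x = Infty" using sph_deriv_zero_imp by (cases x) auto
 qed
 show "finite (insert Infty (Fin ` ({z. poly den z = 0} \<union> {z. poly wronskian z = 0})))"
  using poly_roots_finite nonconst_pencil(2) wronskian_nonzero by auto
qed

text \<open>Take a point \<open>a\<close> that is neither a pole nor a root of the Wronskian, with
  value \<open>w\<close>. If \<open>f\<close> were injective, \<open>num - smult w den\<close> would
  have \<open>a\<close> as its only root and full degree at least 2, so \<open>a\<close> would be a
  multiple root and the Wronskian would vanish there.\<close>

lemma not_inj: "\<not> inj f"
proof
 assume inj: "inj f"
 have "{z. poly den z = 0} \<union> {z. poly wronskian z = 0} \<noteq> UNIV"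
  using poly_roots_finite[OF nonconst_pencil(2)] poly_roots_finite[OF wronskian_nonzero] infinite_UNIV_char_0
  by (metis finite_UnI)
 then obtain a where a: "poly den a \<noteq> 0" "poly wronskian a \<noteq> 0" by blast
 define w where "w = poly num a / poly den a"
 define R where "R = num - smult w den"
 have R0: "R \<noteq> 0" using nonconst_pencil(1) by (simp add: R_def)
 have fa: "f (Fin a) = Fin w" using a by (simp add: f_Fin w_def)
 have only: "z = a" if "poly R z = 0" for z
 proof -
  have "poly den z \<noteq> 0" using that coprime_no_common_root[OF pq(1), of z] by (auto simp: R_def)
  then have "f (Fin z) = Fin w" using that by (simp add: f_Fin R_def)
  then show ?thesis using fa inj by (metis injD rsphere.inject)
 qed
 have "f Infty \<noteq> f (Fin a)" using inj by (metis injD rsphere.distinct(1))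
 have "coeff R d \<noteq> 0"
 proof
  assume "coeff R d = 0"
  then have c: "coeff num d = w * coeff den d" by (simp add: R_def)
  have "coeff num d \<noteq> 0 \<or> coeff den d \<noteq> 0"
  proof -
   have "d = degree num \<or> d = degree den" using pq(2) by (metis max_def)
   moreover have "\<not> 2 \<le> degree (0 :: complex poly)" by simp
   ultimately show ?thesis using deg by (metis leading_coeff_0_iff)
  qed
  then have "coeff den d \<noteq> 0" using c by auto
  then have "f Infty = Fin w" using c by (simp add: f_Infty)
  then show False using \<open>f Infty \<noteq> f (Fin a)\<close> fa by simp
 qed
 then have degR: "degree R \<ge> 2" using deg le_degree by (metis order_trans)
 obtain S where S: "R = [:-a, 1:] ^ order a R * S" "\<not> [:-a, 1:] dvd S"
  using order_decomp[OF R0] by blast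
 have "poly S z \<noteq> 0" for z
 proof
  assume z: "poly S z = 0"
  then have "poly R z = 0" by (subst S(1)) simp
  then have "z = a" by (rule only)
  then show False using z S(2) by (simp add: poly_eq_0_iff_dvd)
 qed
 then have "degree S = 0" using alg_closed_imp_poly_has_root[of S] by auto
 moreover have "S \<noteq> 0" using S(2) by auto
 ultimately have "degree R = order a R"
  by (subst S(1)) (simp add: degree_mult_eq degree_power_eq)
 then have "[:-a, 1:] ^ 2 dvd R" using degR by (metis S(1) dvd_triv_left dvd_trans le_imp_power_dvd)
 then obtain T where T: "R = [:-a, 1:] ^ 2 * T" by (auto elim: dvdE)
 have "poly (pderiv R) a = 0"
  unfolding T power2_eq_square mult.assoc by (simp only: pderiv_mult poly_add poly_mult) simp
 then have "poly (pderiv num) a = w * poly (pderiv den) a" by (simp add: R_def pderiv_diff pderiv_smult)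
 then have "poly wronskian a = 0" using a(1) by (simp add: wronskian_def w_def)
 then show False using a(2) by simp
qed

text \<open>In charts this is the open mapping theorem; finiteness of the fibres excludes a constant
  representation.\<close>

lemma open_map: assumes "open U" shows "open (f ` U)"
proof (subst open_subopen, safe)
 fix x assume x: "x \<in> U"
 obtain e0 where e0: "e0 > 0" "ball x e0 \<subseteq> U" using assms x by (meson openE)
 have "isCont f x" using sph_hol_cont[OF hol, of UNIV] by (simp add: continuous_on_eq_continuous_at)
 then obtain e1 where e1: "e1 > 0" "f ` ball x e1 \<subseteq> ball (f x) (1/2)"
  unfolding continuous_at_ball by (elim allE[of _ "1 / 2"]) auto
 define e where "e = min (min e0 e1) (1/2)"
 have e: "0 < e" "e \<le> 1/2" "ball x e \<subseteq> U" "f ` ball x e \<subseteq> ball (f x) (1/2)" using e0 e1 by (auto simp: e_def)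
 obtain A B a b where L: "A \<in> charts" "B \<in> charts" "x = B (Fin a)" "f x = A (Fin b)"
  "cr A f B holomorphic_on ball a (e / 4)" "cr A f B a = b"
  "\<And>z. z \<in> ball a (e / 4) \<Longrightarrow> f (B (Fin z)) = A (Fin (cr A f B z))"
  "\<And>z. z \<in> ball a (e / 4) \<Longrightarrow> B (Fin z) \<in> ball x e"
  using sph_hol_local[OF hol e(1,2) order_refl e(4)] by metis
 have "\<not> cr A f B constant_on ball a (e / 4)"
 proof
  assume "cr A f B constant_on ball a (e / 4)"
  then obtain c where "\<And>z. z \<in> ball a (e / 4) \<Longrightarrow> cr A f B z = c" by (auto simp: constant_on_def)
  then have "(\<lambda>z. B (Fin z)) ` ball a (e / 4) \<subseteq> f -` {A (Fin c)}" using L(7) by auto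
  then have "finite ((\<lambda>z. B (Fin z)) ` ball a (e / 4))" using fiber(1) finite_subset by blast
  moreover have "inj_on (\<lambda>z. B (Fin z)) (ball a (e / 4))"
   by (rule inj_onI) (metis charts_invol[OF L(2)] rsphere.inject)
  ultimately have "finite (ball a (e / 4))" by (rule finite_imageD)
  then show False using e(1) by (metis finite_imp_not_open centre_in_ball divide_pos_pos empty_iff open_ball zero_less_numeral)
 qed
 then have "open (cr A f B ` ball a (e / 4))"
  by (intro open_mapping_thm[OF L(5) open_ball connected_ball open_ball order_refl])
 then have "open (A ` Fin ` cr A f B ` ball a (e / 4))"
  by (intro open_charts[OF L(1)] open_image_Fin)
 moreover have "f x \<in> A ` Fin ` cr A f B ` ball a (e / 4)" using L(3,4,6) e(1) by force
 moreover have "A ` Fin ` cr A f B ` ball a (e / 4) \<subseteq> f ` U"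
 proof safe
  fix z assume z: "z \<in> ball a (e / 4)"
  then show "A (Fin (cr A f B z)) \<in> f ` U" using L(7)[OF z] L(8)[OF z] e(3) by (metis imageI subsetD)
 qed
 ultimately show "\<exists>T. open T \<and> f x \<in> T \<and> T \<subseteq> f ` U" by blast
qed

lemma open_map_pow: "open U \<Longrightarrow> open (fn n ` U)"
proof (induction n)
 case (Suc n)
 then have "open (f ` (fn n ` U))" using open_map by blast
 then show ?case by (simp add: image_comp)
qed simp

end

section \<open>Expansion on the Julia set\<close>

text \<open>If no point had distance in the given range, the ball would coincide with a smaller
  closed ball and so be open and closed. It is not the whole sphere, since its radius is at most 1
  while 0 and \<open>Infty\<close> are at distance pi.\<close>

lemma rsphere_point_at:
 fixes w :: rsphere
 assumes "s < r" "r \<le> 1" obtains y where "y \<in> ball w r" "s \<le> dist w y" | "r \<le> 0"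
proof (cases "0 < r \<and> (\<forall>y \<in> ball w r. dist w y < s)")
 case True
 then have eq: "ball w r = cball w s" using assms(1) by auto
 have "dist (Fin 0) Infty = pi" by (simp add: dist_rsphere_def)
 then have "dist w (Fin 0) \<ge> 1 \<or> dist w Infty \<ge> 1"
  using dist_triangle[of "Fin 0" Infty w] pi_gt3 by (simp add: dist_commute) linarith
 then have "ball w r \<noteq> UNIV" using assms(2) by (metis UNIV_I mem_ball not_le order_trans)
 then show ?thesis
  using rsphere_not_open_subset[of "ball w r"] True eq by (metis centre_in_ball closed_cball empty_iff open_ball)
next
 case False then show ?thesis using that by force
qed

lemma rsphere_compact: "closed S \<Longrightarrow> compact S" for S :: "rsphere set"
 using compact_Int_closed[OF compact_rsphere, of S] by simp

context rational
begin

lemma cont: "continuous_on S f" by (rule sph_hol_cont[OF hol])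

lemma cont_pow: "continuous_on S (fn n)" by (rule sph_hol_cont[OF hol_pow])

section \<open>Pulled-back components and forward invariance of the Julia set\<close>

definition pcomp :: "nat \<Rightarrow> rsphere set \<Rightarrow> rsphere \<Rightarrow> rsphere set" where
 "pcomp n B x = connected_component_set (fn n -` B) x"

lemma open_vimage_pow: "open B \<Longrightarrow> open (fn n -` B)"
 by (rule open_vimage[OF _ cont_pow])

lemma pcomp_sub: "pcomp n B x \<subseteq> fn n -` B"
 by (simp add: pcomp_def connected_component_subset)

lemma pcomp_self: "fn n x \<in> B \<Longrightarrow> x \<in> pcomp n B x"
 by (simp add: pcomp_def)

lemma pcomp_connected: "connected (pcomp n B x)"
 by (simp add: pcomp_def)

lemma pcomp_maximal: "connected S \<Longrightarrow> x \<in> S \<Longrightarrow> fn n ` S \<subseteq> B \<Longrightarrow> S \<subseteq> pcomp n B x"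
 unfolding pcomp_def by (rule connected_component_maximal) auto

lemma pcomp_eq: "y \<in> pcomp n B x \<Longrightarrow> pcomp n B y = pcomp n B x"
 unfolding pcomp_def by (metis connected_component_eq)

lemma pcomp_open: assumes "open B" shows "open (pcomp n B x)"
proof (subst open_subopen, safe)
 fix y assume y: "y \<in> pcomp n B x"
 then have "y \<in> fn n -` B" using pcomp_sub by blast
 then obtain e where e: "e > 0" "ball y e \<subseteq> fn n -` B" using open_vimage_pow[OF assms] by (meson openE)
 have "ball y (min e (1/2)) \<subseteq> pcomp n B y"
  by (rule pcomp_maximal[OF connected_ball_rsphere]) (use e in auto)
 then show "\<exists>T. open T \<and> y \<in> T \<and> T \<subseteq> pcomp n B x"
  using e pcomp_eq[OF y] by (intro exI[of _ "ball y (min e (1/2))"]) auto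
qed

text \<open>The image is open, and it is closed relative to \<open>B\<close>: a boundary point of
  the component that is mapped into \<open>B\<close> could be added to the component without losing
  connectedness. A connected \<open>B\<close> is therefore covered.\<close>

lemma pcomp_onto:
 assumes B: "open B" "connected B" and x: "fn n x \<in> B"
 shows "fn n ` pcomp n B x = B"
proof (rule ccontr)
 let ?W = "pcomp n B x"
 assume ne: "fn n ` ?W \<noteq> B"
 have sub: "fn n ` ?W \<subseteq> B" using pcomp_sub[of n B x] by auto
 have op: "open (fn n ` ?W)" by (intro open_map_pow pcomp_open B)
 have clo: "B \<inter> closure (fn n ` ?W) \<subseteq> fn n ` ?W"
 proof
  fix y assume y: "y \<in> B \<inter> closure (fn n ` ?W)"
  have "compact (closure ?W)" by (rule rsphere_compact) simp
  then have "compact (fn n ` closure ?W)" by (intro compact_continuous_image cont_pow)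
  then have "closed (fn n ` closure ?W)" by (rule compact_imp_closed)
  then have "closure (fn n ` ?W) \<subseteq> fn n ` closure ?W"
   by (intro closure_minimal image_mono closure_subset)
  then obtain w where w: "w \<in> closure ?W" "y = fn n w" using y by auto
  have "connected (insert w ?W)"
   by (rule connected_intermediate_closure[OF pcomp_connected[of n B x]]) (use w closure_subset in auto)
  then have "insert w ?W \<subseteq> ?W"
   by (rule pcomp_maximal) (use pcomp_self[OF x] w y sub in auto)
  then show "y \<in> fn n ` ?W" using w by auto
 qed
 have fxW: "fn n x \<in> fn n ` ?W" using pcomp_self[of n x B] x by auto
 obtain y where y: "y \<in> B" "y \<notin> fn n ` ?W" using ne sub by blast
 have "\<not> connected B"
  unfolding connected_def not_not
  by (intro exI[of _ "fn n ` ?W"] exI[of _ "- closure (fn n ` ?W)"])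
    (use op clo y fxW x sub closure_subset[of "fn n ` ?W"] in auto)
 then show False using B by simp
qed

abbreviation J where "J \<equiv> Julia f"

lemma closed_J: "closed J"
 unfolding Julia_def Fatou_def by (auto simp: closed_def)

lemma compact_J: "compact J"
 by (rule rsphere_compact[OF closed_J])

lemma J_forward: assumes "x \<in> J" shows "f x \<in> J"
proof (rule ccontr)
 assume "f x \<notin> J"
 then obtain U where U: "open U" "normal_family_on U (range (\<lambda>n. f ^^ n))" "f x \<in> U"
  by (auto simp: Julia_def Fatou_def)
 have "open (f -` U)" by (rule open_vimage[OF U(1) cont])
 moreover have "normal_family_on (f -` U) (range (\<lambda>n. f ^^ n))"
  unfolding normal_family_on_def
 proof (intro allI impI)
  fix g :: "nat \<Rightarrow> rsphere \<Rightarrow> rsphere" assume "range g \<subseteq> range (\<lambda>n. f ^^ n)"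
  then have "\<forall>k. \<exists>n. g k = f ^^ n" by auto
  then obtain N where N: "\<And>k. g k = f ^^ N k" by metis
  show "\<exists>r h. strict_mono r \<and> (\<forall>K. compact K \<and> K \<subseteq> f -` U \<longrightarrow> uniform_limit K (\<lambda>n. g (r n)) h sequentially)"
  \<comment> \<open>To compare with iterates at \<open>f x\<close>, one application of
    \<open>f\<close> has to be split off, which fails for the exponent 0. Either this exponent
    recurs and a constant subsequence serves, or it is avoided by a shift.\<close>
  proof (cases "infinite {k. N k = 0}")
   case True
   from infinite_enumerate[OF this] obtain r :: "nat \<Rightarrow> nat" where r: "strict_mono r" "\<And>n. r n \<in> {k. N k = 0}"
    by blast
   have "uniform_limit K (\<lambda>n. g (r n)) id sequentially" for K
    using r(2) by (auto simp: N uniform_limit_iff)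
   then show ?thesis using r(1) by blast
  next
   case False
   then have "finite {k. N k = 0}" by simp
   then obtain m where m: "\<And>k. N k = 0 \<Longrightarrow> k < m"
    using finite_nat_set_iff_bounded by auto
   define g' where "g' k = f ^^ (N (k + m) - 1)" for k
   have "range g' \<subseteq> range (\<lambda>n. f ^^ n)" by (auto simp: g'_def)
   then obtain r h where r: "strict_mono (r :: nat \<Rightarrow> nat)"
    and h: "\<And>K. compact K \<Longrightarrow> K \<subseteq> U \<Longrightarrow> uniform_limit K (\<lambda>n. g' (r n)) h sequentially"
    using U(2) unfolding normal_family_on_def by metis
   have geq: "g (k + m) x = g' k (f x)" for k x
   proof -
    have "N (k + m) \<noteq> 0" using m[of "k + m"] by auto
    then have "f ^^ N (k + m) = f ^^ Suc (N (k + m) - 1)" by simp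
    then show ?thesis by (simp add: N g'_def funpow_Suc_right del: funpow.simps)
   qed
   have "uniform_limit K (\<lambda>n. g (r n + m)) (h \<circ> f) sequentially" if K: "compact K" "K \<subseteq> f -` U" for K
   proof -
    have "uniform_limit (f ` K) (\<lambda>n. g' (r n)) h sequentially"
     by (rule h) (use K cont compact_continuous_image in auto)
    then show ?thesis unfolding uniform_limit_iff geq by simp
   qed
   then show ?thesis using r
    by (intro exI[of _ "\<lambda>n. r n + m"] exI[of _ "h \<circ> f"]) (auto simp: strict_mono_def)
  qed
 qed
 ultimately show False using assms U(3) by (auto simp: Julia_def Fatou_def)
qed

lemma J_pow: "x \<in> J \<Longrightarrow> fn n x \<in> J"
 by (induction n) (auto intro: J_forward)

section \<open>Uniform first and second order bounds for \<open>f\<close>\<close>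

definition M where "M = (SOME M. 0 < M \<and> (\<forall>w u v \<rho>. dist u w \<le> \<rho> \<longrightarrow> dist v w \<le> \<rho> \<longrightarrow>
   \<bar>dist (f u) (f v) - sph_deriv f w * dist u v\<bar> \<le> M * \<rho> * dist u v))"

abbreviation D where "D \<equiv> sph_deriv f"

lemma M: "0 < M" "dist u w \<le> \<rho> \<Longrightarrow> dist v w \<le> \<rho> \<Longrightarrow> \<bar>dist (f u) (f v) - D w * dist u v\<bar> \<le> M * \<rho> * dist u v"
proof -
 have "\<exists>M. 0 < M \<and> (\<forall>w u v \<rho>. dist u w \<le> \<rho> \<longrightarrow> dist v w \<le> \<rho> \<longrightarrow>
   \<bar>dist (f u) (f v) - D w * dist u v\<bar> \<le> M * \<rho> * dist u v)"
  by (rule sphere_second_order[OF hol]) metis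
 from someI_ex[OF this] show "0 < M" "dist u w \<le> \<rho> \<Longrightarrow> dist v w \<le> \<rho> \<Longrightarrow> \<bar>dist (f u) (f v) - D w * dist u v\<bar> \<le> M * \<rho> * dist u v"
  unfolding M_def[symmetric] by blast+
qed

lemma D_nonneg: "0 \<le> D x" by (rule sph_deriv_nonneg[OF hol])

lemma dist_f_upper: "dist u w \<le> \<rho> \<Longrightarrow> dist v w \<le> \<rho> \<Longrightarrow> dist (f u) (f v) \<le> (D w + M * \<rho>) * dist u v"
 using M(2)[of u w \<rho> v] by (simp add: distrib_right abs_le_iff)

lemma dist_f_lower: "dist u w \<le> \<rho> \<Longrightarrow> dist v w \<le> \<rho> \<Longrightarrow> (D w - M * \<rho>) * dist u v \<le> dist (f u) (f v)"
 using M(2)[of u w \<rho> v] by (simp add: left_diff_distrib abs_le_iff)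

text \<open>Apply the second-order estimate to one short pair \<open>u\<close>, \<open>v\<close>
  twice, with reference points \<open>u\<close> and \<open>w\<close>; divide by the length of the
  pair and let it tend to 0.\<close>

lemma D_lipschitz: "\<bar>D u - D w\<bar> \<le> M * dist u w"
proof (rule field_le_epsilon)
 fix e :: real assume e: "e > 0"
 define s where "s = min (1 / 2) (e / (2 * M))"
 have s: "0 < s" "s \<le> 1 / 2" "M * s \<le> e / 2"
  using e M(1) by (auto simp: s_def min_def field_simps)
 obtain v where v: "v \<in> ball u s" "s / 2 \<le> dist u v"
  by (rule rsphere_point_at[of "s / 2" s u]) (use s in auto)
 define t where "t = dist u v"
 have t: "0 < t" "t < s" using v s by (auto simp: t_def)
 have 1: "\<bar>dist (f u) (f v) - D u * t\<bar> \<le> M * t * t"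
  using M(2)[of u u t v] by (simp add: t_def dist_commute)
 have 2: "\<bar>dist (f u) (f v) - D w * t\<bar> \<le> M * (dist u w + t) * t"
  using M(2)[of u w "dist u w + t" v] dist_triangle[of v w u] by (simp add: t_def dist_commute)
 have "\<bar>D u * t - D w * t\<bar> \<le> M * t * t + M * (dist u w + t) * t" using 1 2 by linarith
 moreover have "\<bar>D u * t - D w * t\<bar> = \<bar>D u - D w\<bar> * t"
  using t(1) by (simp add: abs_mult left_diff_distrib[symmetric])
 ultimately have "\<bar>D u - D w\<bar> * t \<le> (M * dist u w + 2 * (M * t)) * t"
  by (simp add: algebra_simps)
 then have "\<bar>D u - D w\<bar> \<le> M * dist u w + 2 * (M * t)" using t(1) by (rule mult_right_le_imp_le)
 also have "M * t \<le> M * s" using t M(1) by (intro mult_left_mono) auto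
 finally show "\<bar>D u - D w\<bar> \<le> M * dist u w + e" using s(3) by linarith
qed

lemma D_cont: "continuous_on S D"
proof -
 have "M-lipschitz_on S D" by (rule lipschitz_onI) (use D_lipschitz M(1) in \<open>auto simp: dist_real_def\<close>)
 then show ?thesis by (rule lipschitz_on_continuous_on)
qed

text \<open>The floor 1 makes the powers of \<open>L\<close> increasing; 4 exceeds the diameter of
  the sphere.\<close>

definition L where "L = max 1 (D Infty + 4 * M)"

lemma L: "1 \<le> L" "D x \<le> L" "dist (f u) (f v) \<le> L * dist u v"
proof -
 show "1 \<le> L" by (simp add: L_def)
 have "dist x Infty \<le> 4" for x using dist_rsphere_less_4[of x Infty] by simp
 note b = this
 have "M * dist x Infty \<le> M * 4" using M(1) b by (intro mult_left_mono) auto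
 then show "D x \<le> L" using D_lipschitz[of x Infty] by (simp add: L_def)
 have "dist (f u) (f v) \<le> (D Infty + M * 4) * dist u v" by (rule dist_f_upper[OF b b])
 also have "... \<le> L * dist u v" by (intro mult_right_mono) (auto simp: L_def)
 finally show "dist (f u) (f v) \<le> L * dist u v" .
qed

lemma dist_pow_le: "dist (fn n u) (fn n v) \<le> L ^ n * dist u v"
proof (induction n)
 case (Suc n)
 have "dist ((f ^^ Suc n) u) ((f ^^ Suc n) v) \<le> L * dist (fn n u) (fn n v)" using L(3) by simp
 also have "... \<le> L * (L ^ n * dist u v)" using Suc L(1) by (intro mult_left_mono) auto
 finally show ?case by simp
qed simp

end

locale tce_map = rational +
 assumes tce: "TCE f"
begin

definition lr where "lr = (SOME (l, r). l > 1 \<and> r > 0 \<and> (\<forall>x\<in>Julia f. \<forall>n\<ge>1. \<forall>W\<in>components (fn n -` ball x r). diameter W \<le> 1 / l ^ n))"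
definition lam :: real where "lam = fst lr"
text \<open>The cap 1/4 makes balls of this radius connected.\<close>

definition r0 :: real where "r0 = min (snd lr) (1 / 4)"

lemma lam: "lam > 1" and r0: "0 < r0" "r0 \<le> 1 / 4"
 and shrink0: "x \<in> J \<Longrightarrow> n \<ge> 1 \<Longrightarrow> W \<in> components (fn n -` ball x (snd lr)) \<Longrightarrow> diameter W \<le> 1 / lam ^ n"
proof -
 have "\<exists>z. case z of (l, r) \<Rightarrow> l > 1 \<and> r > 0 \<and> (\<forall>x\<in>Julia f. \<forall>n\<ge>1. \<forall>W\<in>components (fn n -` ball x r). diameter W \<le> 1 / l ^ n)"
  using tce unfolding TCE_def by simp
 then have "case lr of (l, r) \<Rightarrow> l > 1 \<and> r > 0 \<and> (\<forall>x\<in>Julia f. \<forall>n\<ge>1. \<forall>W\<in>components (fn n -` ball x r). diameter W \<le> 1 / l ^ n)"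
  unfolding lr_def by (rule someI_ex)
 then show "lam > 1" "0 < r0" "r0 \<le> 1 / 4"
  "x \<in> J \<Longrightarrow> n \<ge> 1 \<Longrightarrow> W \<in> components (fn n -` ball x (snd lr)) \<Longrightarrow> diameter W \<le> 1 / lam ^ n"
  by (auto simp: lam_def r0_def split: prod.splits)
qed

text \<open>The constant 4 extends the estimate to \<open>n = 0\<close>, about which
  \<open>TCE\<close> is silent: the sphere has diameter below 4. Any connected set with small image
  lies in one component, so no component has to be named.\<close>

lemma shrink:
 assumes x: "x \<in> J" and S: "connected S" "fn n ` S \<subseteq> ball x r0" and uv: "u \<in> S" "v \<in> S"
 shows "dist u v \<le> 4 / lam ^ n"
proof (cases "n = 0")
 case True then show ?thesis using dist_rsphere_less_4[of u v] by simp
next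
 case False
 have "S \<subseteq> fn n -` ball x (snd lr)" using S(2) by (auto simp: r0_def)
 then obtain W where W: "W \<in> components (fn n -` ball x (snd lr))" "S \<subseteq> W"
  using exists_component_superset[OF _ _ S(1)] uv(1) by blast
 have "dist u v \<le> diameter W" using W uv by (intro diameter_bounded_bound) auto
 also have "... \<le> 1 / lam ^ n" using shrink0[OF x _ W(1)] False by simp
 also have "... \<le> 4 / lam ^ n" using lam by (intro divide_right_mono) auto
 finally show ?thesis .
qed

lemma shrink_mid:
 assumes x: "x \<in> J" and S: "connected S" "fn n ` S \<subseteq> ball x r0" and uv: "u \<in> S" "v \<in> S" and j: "j \<le> n"
 shows "dist (fn j u) (fn j v) \<le> 4 / lam ^ (n - j)"
proof (rule shrink[OF x, of "fn j ` S"])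
 show "connected (fn j ` S)" by (intro connected_continuous_image cont_pow S)
 have "fn (n - j) (fn j y) = fn n y" for y
  using j by (metis add.commute comp_apply funpow_add le_add_diff_inverse)
 then show "fn (n - j) ` fn j ` S \<subseteq> ball x r0" using S(2) by (auto simp: image_subset_iff)
qed (use uv in auto)

text \<open>The component of the preimage that contains \<open>x\<close> is smaller than
  \<open>r\<close>, hence lies in the ball, and it is mapped onto the large ball by
  \<open>pcomp_onto\<close>.\<close>

lemma expand:
 assumes x: "x \<in> J" and n: "4 / lam ^ n < r"
 shows "ball (fn n x) r0 \<subseteq> fn n ` ball x r"
proof -
 let ?B = "ball (fn n x) r0"
 have B: "connected ?B" using r0 by (intro connected_ball_rsphere) auto
 have xB: "fn n x \<in> ?B" using r0 by simp
 have sub: "fn n ` pcomp n ?B x \<subseteq> ?B" using pcomp_sub by blast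
 have "pcomp n ?B x \<subseteq> ball x r"
 proof
  fix y assume "y \<in> pcomp n ?B x"
  then have "dist x y \<le> 4 / lam ^ n"
   by (intro shrink[OF J_pow[OF x] pcomp_connected sub pcomp_self[OF xB]])
  then show "y \<in> ball x r" using n by simp
 qed
 then show ?thesis using pcomp_onto[OF open_ball B xB] by blast
qed

lemma lam_pow_tendsto: "(\<lambda>n. 4 / lam ^ n) \<longlonglongrightarrow> 0"
 by (rule LIMSEQ_divide_realpow_zero[OF lam])

lemma lam_small: assumes "0 < e" obtains n where "\<And>m. m \<ge> n \<Longrightarrow> 4 / lam ^ m < e"
 using order_tendstoD(2)[OF lam_pow_tendsto assms] by (auto simp: eventually_sequentially)

end

subsection \<open>Forward images of open sets meeting the Julia set\<close>

text \<open>Schottky's theorem bounds \<open>h\<close> on the half disc when \<open>h 0\<close> lies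
  in the unit disc, and Cauchy's estimate turns the bound into a Lipschitz constant. Otherwise pass
  to \<open>1 / h\<close>, which omits the same values and has the same spherical distances.\<close>

lemma Schottky_equicontinuous:
 obtains C where "0 < C" "\<And>h z. \<lbrakk>h holomorphic_on cball 0 1; \<And>z. z \<in> cball 0 1 \<Longrightarrow> h z \<noteq> 0 \<and> h z \<noteq> 1; norm z < 1 / 4\<rbrakk>
  \<Longrightarrow> dist (Fin (h z)) (Fin (h 0)) \<le> C * norm z"
proof -
 define K where "K = exp (pi * exp (pi * (2 + 2 * 1 + 12 * (1 / 2) / (1 - 1 / 2))))"
 have bounded: "dist (Fin (h z)) (Fin (h 0)) \<le> (16 * (K + 1)) * norm z"
  if h: "h holomorphic_on cball 0 1" "\<And>z. z \<in> cball 0 1 \<Longrightarrow> h z \<noteq> 0 \<and> h z \<noteq> 1" and z: "norm z < 1 / 4" and h0: "norm (h 0) \<le> 1"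
  for h z
 proof -
  have K: "norm (h w) \<le> K" if "norm w \<le> 1 / 2" for w
   unfolding K_def by (rule Schottky[OF h(1) h0]) (use h(2) that in auto)
  have "cmod (h z - h 0) \<le> 4 * (K + 1) * cmod (z - 0)"
  proof (rule field_differentiable_bound[of "ball 0 (1 / 4)" h "deriv h"])
   fix w :: complex assume w: "w \<in> ball 0 (1 / 4)"
   have op: "h holomorphic_on ball 0 1" using h(1) holomorphic_on_subset by (metis ball_subset_cball)
   show "(h has_field_derivative deriv h w) (at w within ball 0 (1 / 4))"
    using holomorphic_derivI[OF op open_ball, of w] w has_field_derivative_at_within by force
   have sub: "cball w (1 / 4) \<subseteq> cball 0 (1 / 2)"
   proof
    fix y assume "y \<in> cball w (1 / 4)"
    then show "y \<in> cball 0 (1 / 2)" using w dist_triangle[of 0 y w] by simp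
   qed
   have sub1: "cball w (1 / 4) \<subseteq> cball 0 1" by (rule order_trans[OF sub subset_cball]) simp
   have "cmod ((deriv ^^ 1) h w) \<le> fact 1 * (K + 1) / (1 / 4) ^ 1"
   proof (rule Cauchy_higher_deriv_bound)
    show "h holomorphic_on ball w (1 / 4)" using h(1) sub1 holomorphic_on_subset ball_subset_cball by blast
    show "continuous_on (cball w (1 / 4)) h"
     using h(1) sub1 holomorphic_on_subset holomorphic_on_imp_continuous_on by blast
    fix y assume "y \<in> ball w (1 / 4)"
    then have "norm (h y) \<le> K" using K sub ball_subset_cball by (metis mem_cball_0 subsetD)
    then show "h y \<in> ball 0 (K + 1)" by simp
   qed auto
   then show "cmod (deriv h w) \<le> 4 * (K + 1)" by simp
  qed (use z in auto)
  then have "4 * cmod (h z - h 0) \<le> (16 * (K + 1)) * cmod z" by (simp add: algebra_simps)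
  with dist_Fin_le[of "h z" "h 0"] show ?thesis by (rule order_trans)
 qed
 show ?thesis
 proof (rule that[of "16 * (K + 1)"])
  show "0 < 16 * (K + 1)" by (simp add: K_def add_pos_pos)
  fix h :: "complex \<Rightarrow> complex" and z :: complex assume h: "h holomorphic_on cball 0 1" "\<And>z. z \<in> cball 0 1 \<Longrightarrow> h z \<noteq> 0 \<and> h z \<noteq> 1" and z: "norm z < 1 / 4"
  show "dist (Fin (h z)) (Fin (h 0)) \<le> 16 * (K + 1) * norm z"
  proof (cases "norm (h 0) \<le> 1")
   case True show ?thesis by (rule bounded[OF h z True])
  next
   case False
   have "(\<lambda>z. 1 / h z) holomorphic_on cball 0 1" using h by (intro holomorphic_intros) auto
   moreover have "1 / h w \<noteq> 0 \<and> 1 / h w \<noteq> 1" if "w \<in> cball 0 1" for w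
    using h(2)[OF that] by simp
   moreover have "norm (1 / h 0) \<le> 1" using False by (simp add: norm_divide divide_le_eq_1)
   ultimately have "dist (Fin (1 / h z)) (Fin (1 / h 0)) \<le> 16 * (K + 1) * norm z" using z by (intro bounded) auto
   moreover have "h z \<noteq> 0" "h 0 \<noteq> 0" using h(2)[of z] h(2)[of 0] z by auto
   then have "dist (Fin (h z)) (Fin (h 0)) = dist (Fin (1 / h z)) (Fin (1 / h 0))"
    using dist_sinv[of "Fin (h z)" "Fin (h 0)"] by simp
   ultimately show ?thesis by simp
  qed
 qed
qed

text \<open>The Moebius map taking three points to 0, 1 and \<open>Infty\<close>, together with its
  inverse; it normalizes three omitted values for Schottky's theorem.\<close>

lemma sphere_cross_ratio:
 assumes "a \<noteq> b" "b \<noteq> c" "a \<noteq> c"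
 obtains T S where "sph_hol T" "sph_hol S" "\<And>x. S (T x) = x" "T (Fin a) = Fin 0" "T (Fin b) = Fin 1" "T (Fin c) = Infty"
proof -
 define k where "k = (b - c) / (b - a)"
 have k: "k \<noteq> 0" using assms by (simp add: k_def)
 have unit: "is_unit [:e:]" if "e \<noteq> 0" for e :: complex using that by (simp add: is_unit_iff_degree)
 have cop1: "coprime [:- k * a, k:] [:- c, 1:]"
 proof (rule coprimeI)
  fix g assume "g dvd [:- k * a, k:]" "g dvd [:- c, 1:]"
  then have "g dvd [:- k * a, k:] - smult k [:- c, 1:]" by (intro dvd_diff dvd_smult)
  moreover have "[:- k * a, k:] - smult k [:- c, 1:] = [:k * (c - a):]" by (simp add: algebra_simps)
  ultimately show "is_unit g" using unit[of "k * (c - a)"] k assms dvd_unit_imp_unit by (metis eq_iff_diff_eq_0 mult_eq_0_iff)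
 qed
 have cop2: "coprime [:- k * a, c:] [:- k, 1:]"
 proof (rule coprimeI)
  fix g assume "g dvd [:- k * a, c:]" "g dvd [:- k, 1:]"
  then have "g dvd [:- k * a, c:] - smult c [:- k, 1:]" by (intro dvd_diff dvd_smult)
  moreover have "[:- k * a, c:] - smult c [:- k, 1:] = [:k * (c - a):]" by (simp add: algebra_simps)
  ultimately show "is_unit g" using unit[of "k * (c - a)"] k assms dvd_unit_imp_unit by (metis eq_iff_diff_eq_0 mult_eq_0_iff)
 qed
 define T where "T = rat_eval [:- k * a, k:] [:- c, 1:]"
 define S where "S = rat_eval [:- k * a, c:] [:- k, 1:]"
 have TF: "T (Fin w) = (if w = c then Infty else Fin (k * (w - a) / (w - c)))" for w
  by (auto simp: T_def algebra_simps)
 have TI: "T Infty = Fin k" using k by (simp add: T_def Let_def)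
 have SF: "S (Fin w) = (if w = k then Infty else Fin ((c * w - k * a) / (w - k)))" for w
  by (auto simp: S_def algebra_simps)
 have SI: "S Infty = Fin c" by (simp add: S_def Let_def)
 show ?thesis
 proof (rule that[of T S])
  show "sph_hol T" "sph_hol S" unfolding T_def S_def by (intro sph_hol_rat_eval cop1 cop2)+
  show "T (Fin a) = Fin 0" "T (Fin c) = Infty" using assms by (auto simp: TF)
  show "T (Fin b) = Fin 1" using assms by (auto simp: TF k_def)
  fix x show "S (T x) = x"
  proof (cases x)
   case (Fin w)
   show ?thesis
   proof (cases "w = c")
    case False
    define t where "t = k * (w - a) / (w - c)"
    have tk: "t - k = k * (c - a) / (w - c)" using False by (simp add: t_def field_simps)
    then have "t \<noteq> k" using k assms False by (metis divide_eq_0_iff eq_iff_diff_eq_0 mult_eq_0_iff)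
    moreover have "c * t - k * a = w * (k * (c - a) / (w - c))" using False by (simp add: t_def field_simps)
    then have "(c * t - k * a) / (t - k) = w" using tk \<open>t \<noteq> k\<close> by (metis eq_iff_diff_eq_0 nonzero_mult_div_cancel_right)
    ultimately show ?thesis using Fin False by (simp add: TF SF t_def[symmetric])
   qed (simp add: Fin TF SI)
  qed (simp add: TI SF)
 qed
qed

context tce_map
begin

text \<open>If three finite points were omitted by all images of \<open>U\<close>, the iterates
  would be equicontinuous at \<open>x\<close>. But \<open>expand\<close> says that arbitrarily small
  balls around \<open>x\<close> are eventually stretched over a ball of radius
  \<open>r0\<close>.\<close>

lemma forward_images_cocountable:
 assumes U: "open U" and x: "x \<in> U" "x \<in> J"
 shows "countable (- (\<Union>n. (fn n) ` U))"
proof (rule ccontr)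
 let ?E = "- (\<Union>n. (fn n) ` U)"
 assume "uncountable ?E"
 then have inf: "infinite (?E - {Infty})" using countable_finite by (metis finite_Diff2 finite.emptyI finite_insert)
 then obtain X where "X \<subseteq> ?E - {Infty}" "finite X" "card X = 3" using infinite_arbitrarily_large by blast
 then obtain a b c where abc: "a \<noteq> b" "b \<noteq> c" "a \<noteq> c" "Fin a \<in> ?E" "Fin b \<in> ?E" "Fin c \<in> ?E"
  unfolding card_3_iff by (metis Diff_iff insert_subset rsphere.exhaust singletonI)
 obtain T S where T: "sph_hol T" "sph_hol S" "\<And>x. S (T x) = x" "T (Fin a) = Fin 0" "T (Fin b) = Fin 1" "T (Fin c) = Infty"
  by (rule sphere_cross_ratio[OF abc(1-3)]) blast
 obtain C where C: "C > 0" "\<And>h z. \<lbrakk>h holomorphic_on cball 0 1; \<And>z. z \<in> cball 0 1 \<Longrightarrow> h z \<noteq> 0 \<and> h z \<noteq> 1; norm z < 1 / 4\<rbrakk>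
  \<Longrightarrow> dist (Fin (h z)) (Fin (h 0)) \<le> C * norm z" by (rule Schottky_equicontinuous) blast
 obtain B p where B: "B \<in> charts" "B x = Fin p" by (rule chart_ex)
 have xB: "x = B (Fin p)" using B charts_invol by metis
 have "open ((\<lambda>z. B (Fin z)) -` U)"
  by (intro open_vimage U continuous_on_compose2[OF charts_cont[OF B(1), of UNIV] continuous_on_Fin]) auto
 then obtain e where e: "e > 0" "ball p e \<subseteq> (\<lambda>z. B (Fin z)) -` U" using x xB by (metis openE vimageI)
 define s where "s = e / 2"
 have s: "s > 0" "\<And>z::complex. norm z \<le> 1 \<Longrightarrow> B (Fin (p + s * z)) \<in> U"
 proof -
  show "s > 0" using e by (simp add: s_def)
  fix z :: complex assume "norm z \<le> 1"
  then have "norm (s * z) \<le> s" using e by (simp add: norm_mult s_def)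
  also have "... < e" using e by (simp add: s_def)
  finally have "p + s * z \<in> ball p e" by (simp add: dist_norm)
  then show "B (Fin (p + s * z)) \<in> U" using e(2) by blast
 qed
 have Tn: "\<exists>w. T y = Fin w \<and> w \<noteq> 0 \<and> w \<noteq> 1" if "y \<noteq> Fin a" "y \<noteq> Fin b" "y \<noteq> Fin c" for y
 proof -
  have "T y \<noteq> T (Fin a)" "T y \<noteq> T (Fin b)" "T y \<noteq> T (Fin c)" using T(3) that by metis+
  then show ?thesis using T(4-6) by (cases "T y") auto
 qed
 have eq: "dist (T (fn n (B (Fin (p + s * z))))) (T (fn n x)) \<le> C * norm z" if z: "norm z < 1 / 4" for n and z :: complex
 proof -
  define F where "F = T \<circ> fn n"
  have F: "sph_hol F" unfolding F_def by (rule sph_hol_comp[OF T(1) hol_pow])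
  have val: "\<exists>v. F (B (Fin (p + s * w))) = Fin v \<and> v \<noteq> 0 \<and> v \<noteq> 1" if "norm w \<le> 1" for w :: complex
  proof -
   define y where "y = fn n (B (Fin (p + s * w)))"
   have "y \<notin> ?E" using s(2)[OF that] by (auto simp: y_def)
   then have "y \<noteq> Fin a" "y \<noteq> Fin b" "y \<noteq> Fin c" using abc(4-6) by blast+
   from Tn[OF this] show ?thesis by (simp add: F_def y_def)
  qed
  define h where "h w = cr id F B (p + s * w)" for w :: complex
  have Fh: "F (B (Fin (p + s * w))) = Fin (h w)" "h w \<noteq> 0 \<and> h w \<noteq> 1" if "norm w \<le> 1" for w :: complex
   using val[OF that] by (auto simp: h_def cr_def)
  have "h holomorphic_on cball 0 1"
  proof -
   have "cr id F B holomorphic_on (\<lambda>w::complex. p + s * w) ` cball 0 1"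
   proof (rule sph_hol_holomorphic[OF F id_in_charts B(1)])
    fix z assume "z \<in> (\<lambda>w::complex. p + s * w) ` cball 0 1"
    then obtain w :: complex where "norm w \<le> 1" "z = p + s * w" by auto
    then show "id (F (B (Fin z))) \<noteq> Infty" using val[of w] by auto
   qed
   then have "(cr id F B \<circ> (\<lambda>w::complex. p + s * w)) holomorphic_on cball 0 1"
    by (intro holomorphic_on_compose holomorphic_intros)
   then show ?thesis by (simp add: h_def[abs_def] o_def)
  qed
  then have "dist (Fin (h z)) (Fin (h 0)) \<le> C * norm z"
   by (rule C(2)) (use Fh z in auto)
  then show ?thesis using Fh(1)[of z] Fh(1)[of 0] z by (simp add: F_def xB)
 qed
 \<comment> \<open>Equicontinuity has been obtained for \<open>T\<close> composed with the iterates;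
   uniform continuity of the inverse \<open>S\<close> brings it back to the iterates.\<close>
 have "uniformly_continuous_on UNIV S"
  by (rule compact_uniformly_continuous[OF sph_hol_cont[OF T(2)] compact_rsphere])
 from this[unfolded uniformly_continuous_on_def, rule_format, of "r0 / 2"]
 obtain \<delta> where \<delta>: "\<delta> > 0" "\<And>u v. dist v u < \<delta> \<Longrightarrow> dist (S v) (S u) < r0 / 2" using r0 by auto
 define t where "t = min (1 / 4) (\<delta> / C)"
 have t: "t > 0" "\<And>z::complex. norm z < t \<Longrightarrow> norm z < 1 / 4" "\<And>z::complex. norm z < t \<Longrightarrow> C * norm z < \<delta>"
  using \<delta> C by (auto simp: t_def field_simps)
 have "open (B ` Fin ` ball p (s * t))" by (intro open_charts B open_image_Fin) simp
 moreover have "x \<in> B ` Fin ` ball p (s * t)" using xB s t by auto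
 ultimately obtain e' where e': "e' > 0" "ball x e' \<subseteq> B ` Fin ` ball p (s * t)" by (meson openE)
 obtain n where n: "4 / lam ^ n < e'" using lam_small[OF e'(1)] by blast
 obtain y where y: "y \<in> ball (fn n x) r0" "r0 / 2 \<le> dist (fn n x) y"
  by (rule rsphere_point_at[of "r0 / 2" r0 "fn n x"]) (use r0 in auto)
 obtain u where u: "u \<in> ball x e'" "y = fn n u" using expand[OF x(2) n] y by blast
 then obtain v where v: "u = B (Fin v)" "v \<in> ball p (s * t)" using e'(2) by blast
 define z where "z = (v - p) / s"
 have z: "v = p + s * z" using s by (simp add: z_def)
 have zt: "norm z < t" using v(2) s by (simp add: z_def norm_divide dist_norm norm_minus_commute field_simps)
 have "dist (T (fn n u)) (T (fn n x)) \<le> C * norm z"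
  using eq[OF t(2)[OF zt], of n] by (simp add: v(1) z[symmetric])
 also have "... < \<delta>" by (rule t(3)[OF zt])
 finally have "dist (T (fn n u)) (T (fn n x)) < \<delta>" .
 then have "dist (fn n u) (fn n x) < r0 / 2" using \<delta>(2) T(3) by metis
 then show False using y u by (simp add: dist_commute)
qed

end

section \<open>Entropy estimates\<close>

text \<open>Fekete's lemma; the limit is the infimum. The term \<open>a 0\<close>, which need not
  vanish, goes into the bounded error.\<close>

lemma subadditive_limit:
 fixes a :: "nat \<Rightarrow> real"
 assumes sub: "\<And>m n. a (m + n) \<le> a m + a n" and nonneg: "\<And>n. 0 \<le> a n"
 obtains l where "(\<lambda>n. a n / real n) \<longlonglongrightarrow> l" "\<And>n. 0 < n \<Longrightarrow> l \<le> a n / real n"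
proof -
 define l where "l = Inf ((\<lambda>n. a n / real n) ` {1..})"
 have bdd: "bdd_below ((\<lambda>n. a n / real n) ` {1..})" using nonneg by (intro bdd_belowI[of _ 0]) auto
 have le: "l \<le> a n / real n" if "0 < n" for n
  unfolding l_def by (rule cInf_lower[OF _ bdd]) (use that in auto)
 have mult: "a (k * m) \<le> real k * a m + a 0" for k m
 proof (induction k)
  case (Suc k)
  have "a (Suc k * m) \<le> a m + a (k * m)" using sub[of m "k * m"] by simp
  then show ?case using Suc by (simp add: algebra_simps)
 qed simp
 have "(\<lambda>n. a n / real n) \<longlonglongrightarrow> l"
 proof (rule LIMSEQ_I)
  fix e :: real assume e: "0 < e"
  have "\<exists>y\<in>(\<lambda>n. a n / real n) ` {1..}. y < l + e / 2"
   unfolding l_def by (rule cInf_lessD) (use e in auto)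
  then obtain m where m: "m \<ge> 1" "a m / real m < l + e / 2" by auto
  define C where "C = Max (a ` {..<m}) + a 0"
  have C: "a r + a 0 \<le> C" if "r < m" for r using that by (simp add: C_def)
  obtain N where N: "real N > 2 * C / e" "N \<ge> 1" by (metis le_max_iff_disj max.strict_coboundedI1 nle_le of_nat_less_iff reals_Archimedean2 less_le_trans of_nat_le_iff)
  show "\<exists>no. \<forall>n\<ge>no. norm (a n / real n - l) < e"
  proof (intro exI[of _ N] allI impI)
   fix n assume n: "n \<ge> N"
   have n0: "real n > 0" using n N by simp
   have "a n = a (n mod m + (n div m) * m)" by (simp add: mod_div_mult_eq)
   also have "... \<le> a (n mod m) + (real (n div m) * a m + a 0)" using sub[of "n mod m" "(n div m) * m"] mult[of "n div m" m] by linarith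
   also have "... \<le> C + real (n div m) * a m" using C[of "n mod m"] m(1) by simp
   also have "real (n div m) * a m = real (n div m * m) * (a m / real m)" using m(1) by simp
   also have "... \<le> real n * (a m / real m)"
   proof (rule mult_right_mono)
    show "real (n div m * m) \<le> real n" unfolding of_nat_le_iff by (rule div_times_less_eq_dividend)
   qed (use nonneg[of m] in simp)
   finally have "a n \<le> C + real n * (a m / real m)" by simp
   then have "a n / real n \<le> (C + real n * (a m / real m)) / real n" using n0 by (intro divide_right_mono) auto
   also have "... = C / real n + a m / real m" using n0 by (simp add: add_divide_distrib)
   also have "C / real n < e / 2"
   proof -
    have "2 * C / e < real n" using N n by (meson less_le_trans of_nat_le_iff)
    then show ?thesis using e n0 by (simp add: field_simps)
   qed
   finally have "a n / real n < l + e" using m(2) by linarith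
   then show "norm (a n / real n - l) < e" using le[of n] n N by simp
  qed
 qed
 with le show ?thesis by (rule that[rotated])
qed

section \<open>Finite partitions, coding and metric entropy\<close>

locale inv_measure =
 fixes f :: "rsphere \<Rightarrow> rsphere" and \<nu> :: "rsphere measure"
 assumes inv: "invariant_prob f \<nu>" and cont_f: "continuous_on UNIV f"
begin

lemma sets_nu [measurable_cong, simp]: "sets \<nu> = sets borel" and distr_nu: "distr \<nu> borel f = \<nu>"
 using inv by (auto simp: invariant_prob_def)

lemma space_nu [simp]: "space \<nu> = UNIV" using sets_eq_imp_space_eq[OF sets_nu] by simp

sublocale prob_space \<nu> using inv by (auto simp: invariant_prob_def)

lemma prob_UNIV [simp]: "prob UNIV = 1" using prob_space by simp

lemma meas_f [measurable]: "f \<in> borel_measurable borel" using cont_f by (rule borel_measurable_continuous_onI)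

lemma meas_pow [measurable]: "(f ^^ n) \<in> borel_measurable borel"
 by (induction n) (auto intro: measurable_comp simp: id_def)

lemma distr_pow: "distr \<nu> borel (f ^^ n) = \<nu>"
proof (induction n)
 case 0 show ?case by (simp add: id_def) (metis distr_id2 sets_nu id_def distr_cong space_nu)
next
 case (Suc n)
 have "distr \<nu> borel (f ^^ Suc n) = distr (distr \<nu> borel (f ^^ n)) borel f"
  by (subst distr_distr) (auto simp: o_def)
 then show ?case by (simp only: Suc distr_nu)
qed

lemma measure_pow: "A \<in> sets borel \<Longrightarrow> prob ((f ^^ n) -` A) = prob A"
 using measure_distr[of "f ^^ n" \<nu> borel A] by (simp add: distr_pow)

lemma integrable_pow:
 assumes "integrable \<nu> (g :: rsphere \<Rightarrow> real)" shows "integrable \<nu> (\<lambda>x. g ((f ^^ n) x))"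
 using integrable_distr[of "f ^^ n" \<nu> borel g] assms by (simp add: distr_pow)

lemma integral_pow:
 assumes "g \<in> borel_measurable borel" shows "(\<integral>x. g ((f ^^ n) x) \<partial>\<nu>) = (\<integral>x. (g x :: real) \<partial>\<nu>)"
 using integral_distr[of "f ^^ n" \<nu> borel g] assms by (simp add: distr_pow)

lemma AE_pow: "AE x in \<nu>. Q x \<Longrightarrow> AE x in \<nu>. Q ((f ^^ n) x)"
 by (rule AE_distrD[of "f ^^ n" \<nu> borel Q]) (simp_all only: distr_pow, simp)

definition part :: "rsphere set set \<Rightarrow> bool" where
 "part P \<longleftrightarrow> finite P \<and> P \<subseteq> sets borel \<and> disjoint P \<and> \<Union>P = UNIV"

definition cell :: "rsphere set set \<Rightarrow> rsphere \<Rightarrow> rsphere set" where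
 "cell P x = (THE A. A \<in> P \<and> x \<in> A)"

lemma cell: assumes "part P" shows "cell P x \<in> P" "x \<in> cell P x" "A \<in> P \<Longrightarrow> x \<in> A \<Longrightarrow> cell P x = A"
proof -
 have ex: "\<exists>!A. A \<in> P \<and> x \<in> A"
 proof (rule ex_ex1I)
  show "\<exists>A. A \<in> P \<and> x \<in> A" using assms by (auto simp: part_def)
  show "\<And>A B. A \<in> P \<and> x \<in> A \<Longrightarrow> B \<in> P \<and> x \<in> B \<Longrightarrow> A = B" using assms by (auto simp: part_def disjoint_def)
 qed
 from theI'[OF ex] show "cell P x \<in> P" "x \<in> cell P x" by (auto simp: cell_def)
 with ex show "A \<in> P \<Longrightarrow> x \<in> A \<Longrightarrow> cell P x = A" by blast
qed

lemma part_sum: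
 assumes P: "part P" and g: "integrable \<nu> (g :: rsphere \<Rightarrow> real)"
 shows "(\<integral>x. g x \<partial>\<nu>) = (\<Sum>A\<in>P. \<integral>x. indicator A x * g x \<partial>\<nu>)"
proof -
 have 1: "g x = (\<Sum>A\<in>P. indicator A x * g x)" for x
 proof -
  have "(\<Sum>A\<in>P. indicator A x * g x) = (\<Sum>A\<in>{cell P x}. indicator A x * g x)"
   using P cell[OF P] by (intro sum.mono_neutral_right) (auto simp: part_def indicator_def)
  then show ?thesis using cell[OF P] by simp
 qed
 have "(\<integral>x. g x \<partial>\<nu>) = (\<integral>x. (\<Sum>A\<in>P. indicator A x * g x) \<partial>\<nu>)" using 1 by simp
 also have "... = (\<Sum>A\<in>P. \<integral>x. indicator A x * g x \<partial>\<nu>)"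
 proof (rule Bochner_Integration.integral_sum)
  fix A assume "A \<in> P"
  then have "A \<in> sets \<nu>" using P by (auto simp: part_def)
  from integrable_real_mult_indicator[OF this g] show "integrable \<nu> (\<lambda>x. indicator A x * g x)"
   by (simp only: mult.commute)
 qed
 finally show ?thesis .
qed

lemma integrable_indicator_const: "A \<in> sets \<nu> \<Longrightarrow> integrable \<nu> (\<lambda>x. indicator A x * (c::real))"
 by (intro integrable_mult_left integrable_real_indicator) (auto simp: less_top[symmetric])

text \<open>Gibbs' inequality: on each cell apply \<open>ln t \<le> t - 1\<close> to the quotient of
  the proposed weight and the true probability. The function \<open>G\<close> bounds the code length
  of almost every point, so its integral bounds the entropy.\<close>

lemma gibbs:
 assumes Q: "part Q" and q: "\<And>A. A \<in> Q \<Longrightarrow> 0 \<le> q A" "(\<Sum>A\<in>Q. q A) \<le> 1"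
  and G: "integrable \<nu> G" and le: "AE x in \<nu>. 0 < q (cell Q x) \<and> - ln (q (cell Q x)) \<le> G x"
 shows "partition_entropy \<nu> Q \<le> (\<integral>x. G x \<partial>\<nu>)"
proof -
 have fin: "finite Q" and sets: "A \<in> Q \<Longrightarrow> A \<in> sets \<nu>" for A using Q by (auto simp: part_def)
 have step: "- (prob A * ln (prob A)) \<le> (\<integral>x. indicator A x * G x \<partial>\<nu>) + (q A - prob A)" if A: "A \<in> Q" for A
 proof (cases "prob A = 0")
  case True
  then have "AE x in \<nu>. x \<notin> A" using sets[OF A] by (simp add: AE_iff_measurable[OF _ refl] emeasure_eq_measure)
  then have "(\<integral>x. indicator A x * G x \<partial>\<nu>) = (\<integral>x. 0 \<partial>\<nu>)"
   by (intro integral_cong_AE) (use sets[OF A] G in \<open>auto elim!: eventually_mono\<close>)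
  then show ?thesis using True q(1)[OF A] by simp
 next
  case False
  then have pos: "prob A > 0" using measure_nonneg[of \<nu> A] by linarith
  have ae: "AE x in \<nu>. x \<in> A \<longrightarrow> 0 < q A \<and> - ln (q A) \<le> G x"
   using le by eventually_elim (use cell(3)[OF Q A] in auto)
  have qA: "0 < q A"
  proof (rule ccontr)
   assume "\<not> 0 < q A"
   then have "AE x in \<nu>. x \<notin> A" using ae by auto
   then show False using pos sets[OF A] by (simp add: AE_iff_measurable[OF _ refl] emeasure_eq_measure)
  qed
  have "prob A * (- ln (q A)) = (\<integral>x. indicator A x * (- ln (q A)) \<partial>\<nu>)" using sets[OF A] by simp
  also have "... \<le> (\<integral>x. indicator A x * G x \<partial>\<nu>)"
  proof (rule integral_mono_AE)
   show "integrable \<nu> (\<lambda>x. indicator A x * (- ln (q A)))" by (rule integrable_indicator_const[OF sets[OF A]])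
   show "integrable \<nu> (\<lambda>x. indicator A x * G x)"
    using integrable_real_mult_indicator[OF sets[OF A] G] by (simp only: mult.commute)
   show "AE x in \<nu>. indicator A x * (- ln (q A)) \<le> indicator A x * G x"
    using ae by eventually_elim (auto simp: indicator_def)
  qed
  finally have 1: "prob A * (- ln (q A)) \<le> (\<integral>x. indicator A x * G x \<partial>\<nu>)" .
  have "ln (q A / prob A) \<le> q A / prob A - 1" using qA pos by (intro ln_le_minus_one) simp
  then have "prob A * ln (q A / prob A) \<le> prob A * (q A / prob A - 1)" using pos by (intro mult_left_mono) auto
  also have "... = q A - prob A" using pos by (simp add: field_simps)
  finally have "prob A * (ln (q A) - ln (prob A)) \<le> q A - prob A" using qA pos by (simp add: ln_div)
  then show ?thesis using 1 by (simp add: algebra_simps)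
 qed
 have "partition_entropy \<nu> Q \<le> (\<Sum>A\<in>Q. (\<integral>x. indicator A x * G x \<partial>\<nu>) + (q A - prob A))"
  unfolding partition_entropy_def by (intro sum_mono step)
 also have "... = (\<integral>x. G x \<partial>\<nu>) + ((\<Sum>A\<in>Q. q A) - (\<Sum>A\<in>Q. prob A))"
  by (simp add: sum.distrib sum_subtractf part_sum[OF Q G])
 also have "(\<Sum>A\<in>Q. prob A) = 1"
 proof -
  have "(\<Sum>A\<in>Q. prob A) = prob (\<Union>A\<in>Q. A)"
   by (rule finite_measure_finite_Union[symmetric]) (use Q in \<open>auto simp: part_def disjoint_def disjoint_family_on_def\<close>)
  also have "... = 1" using Q prob_space by (simp add: part_def)
  finally show ?thesis .
 qed
 finally show ?thesis using q(2) by linarith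
qed

definition join :: "rsphere set set \<Rightarrow> nat \<Rightarrow> rsphere set set" where "join P n = iterated_join \<nu> f P n"

text \<open>The restriction turns words into elements of \<open>PiE\<close>, so that a sum over
  words of a product of letter weights factors.\<close>

definition word :: "rsphere set set \<Rightarrow> nat \<Rightarrow> rsphere \<Rightarrow> nat \<Rightarrow> rsphere set" where
 "word P n x = restrict (\<lambda>i. cell P ((f ^^ i) x)) {..<n}"

definition atom :: "nat \<Rightarrow> (nat \<Rightarrow> rsphere set) \<Rightarrow> rsphere set" where
 "atom n a = (\<Inter>i<n. (f ^^ i) -` a i)"

lemma join_eq: "join P n = atom n ` (PiE {..<n} (\<lambda>_. P))"
proof (intro equalityI subsetI)
 fix X assume "X \<in> join P n"
 then obtain a where a: "X = atom n a" "\<And>i. i < n \<Longrightarrow> a i \<in> P"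
  by (auto simp: join_def iterated_join_def atom_def)
 have "X = atom n (restrict a {..<n})" by (simp add: a atom_def)
 then show "X \<in> atom n ` (PiE {..<n} (\<lambda>_. P))" using a(2) by auto
next
 fix X assume "X \<in> atom n ` (PiE {..<n} (\<lambda>_. P))"
 then show "X \<in> join P n" by (auto simp: join_def iterated_join_def atom_def)
qed

lemma word_PiE: "part P \<Longrightarrow> word P n x \<in> PiE {..<n} (\<lambda>_. P)"
 using cell by (auto simp: word_def)

lemma in_atom_word: "part P \<Longrightarrow> x \<in> atom n (word P n x)"
 using cell by (auto simp: word_def atom_def)

lemma in_atom_eq:
 assumes "part P" "a \<in> PiE {..<n} (\<lambda>_. P)" "x \<in> atom n a" shows "a = word P n x"
proof
 fix i show "a i = word P n x i"
  using assms cell(3)[OF assms(1), of "a i" "(f ^^ i) x"] by (cases "i < n") (auto simp: word_def atom_def PiE_def extensional_def)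
qed

lemma part_join: assumes P: "part P" shows "part (join P n)"
 unfolding part_def
proof (intro conjI)
 show "finite (join P n)" unfolding join_eq using P by (intro finite_imageI finite_PiE) (auto simp: part_def)
 show "join P n \<subseteq> sets borel"
 proof -
  have "atom n a \<in> sets borel" if "a \<in> PiE {..<n} (\<lambda>_. P)" for a
  proof (cases "n = 0")
   case False
   then show ?thesis unfolding atom_def using that P
    by (intro sets.finite_INT) (auto intro!: measurable_sets_borel[OF meas_pow] simp: part_def)
  qed (simp add: atom_def)
  then show ?thesis by (auto simp: join_eq)
 qed
 show "disjoint (join P n)"
 proof (rule disjointI)
  fix X Y assume "X \<in> join P n" "Y \<in> join P n" and ne: "X \<noteq> Y"
  then obtain a b where ab: "a \<in> PiE {..<n} (\<lambda>_. P)" "b \<in> PiE {..<n} (\<lambda>_. P)" "X = atom n a" "Y = atom n b"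
   by (auto simp: join_eq)
  show "X \<inter> Y = {}"
  proof (rule ccontr)
   assume "X \<inter> Y \<noteq> {}"
   then obtain x where "x \<in> atom n a" "x \<in> atom n b" using ab by auto
   then have "a = b" using in_atom_eq[OF P] ab(1,2) by metis
   then show False using ne ab by simp
  qed
 qed
 show "\<Union> (join P n) = UNIV"
 proof safe
  fix x show "x \<in> \<Union> (join P n)"
   unfolding join_eq
   by (rule UnionI[of "atom n (word P n x)"]) (intro imageI word_PiE[OF P] in_atom_word[OF P])+
 qed simp
qed

lemma cell_join: "part P \<Longrightarrow> cell (join P n) x = atom n (word P n x)"
 by (rule cell(3)[OF part_join]) (auto simp: join_eq word_PiE in_atom_word)

text \<open>Weights are placed on words instead of atoms, since words form a product space. Words
  with empty atoms are dropped, and distinct words with nonempty atoms have distinct atoms, so the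
  total weight does not grow.\<close>

lemma coding:
 assumes P: "part P" and W: "\<And>a. 0 \<le> W a" "(\<Sum>a\<in>PiE {..<n} (\<lambda>_. P). W a) \<le> 1"
  and G: "integrable \<nu> G" and le: "AE x in \<nu>. 0 < W (word P n x) \<and> - ln (W (word P n x)) \<le> G x"
 shows "partition_entropy \<nu> (join P n) \<le> (\<integral>x. G x \<partial>\<nu>)"
proof -
 define q where "q A = (if A = {} then 0 else W (word P n (SOME x. x \<in> A)))" for A
 have fin: "finite (PiE {..<n} (\<lambda>_. P))" using P by (intro finite_PiE) (auto simp: part_def)
 have qa: "q (atom n a) = W a" if "a \<in> PiE {..<n} (\<lambda>_. P)" "atom n a \<noteq> {}" for a
 proof -
  have "(SOME x. x \<in> atom n a) \<in> atom n a" using that by (intro some_in_eq[THEN iffD2])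
  then show ?thesis using in_atom_eq[OF P that(1)] that(2) by (simp add: q_def)
 qed
 show ?thesis
 proof (rule gibbs[OF part_join[OF P] _ _ G, of n q])
  show "0 \<le> q A" for A using W by (simp add: q_def)
  let ?S = "{a \<in> PiE {..<n} (\<lambda>_. P). atom n a \<noteq> {}}"
  have "(\<Sum>A\<in>join P n. q A) = (\<Sum>A\<in>join P n - {{}}. q A)"
   using part_join[OF P] by (intro sum.mono_neutral_right) (auto simp: part_def q_def)
  also have "join P n - {{}} = atom n ` ?S" by (auto simp: join_eq)
  also have "(\<Sum>A\<in>atom n ` ?S. q A) = (\<Sum>a\<in>?S. q (atom n a))"
  proof (rule sum.reindex[unfolded o_def])
   show "inj_on (atom n) ?S"
   proof (rule inj_onI)
    fix a b assume ab: "a \<in> ?S" "b \<in> ?S" "atom n a = atom n b"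
    then obtain x where x: "x \<in> atom n a" "x \<in> atom n b" by auto
    have "a = word P n x" by (rule in_atom_eq[OF P _ x(1)]) (use ab in simp)
    moreover have "b = word P n x" by (rule in_atom_eq[OF P _ x(2)]) (use ab in simp)
    ultimately show "a = b" by simp
   qed
  qed
  also have "... = (\<Sum>a\<in>?S. W a)" using qa by (intro sum.cong) auto
  also have "... \<le> (\<Sum>a\<in>PiE {..<n} (\<lambda>_. P). W a)" using fin W by (intro sum_mono2) auto
  finally show "(\<Sum>A\<in>join P n. q A) \<le> 1" using W(2) by linarith
  have "q (cell (join P n) x) = W (word P n x)" for x
   unfolding cell_join[OF P] by (rule qa[OF word_PiE[OF P]]) (use in_atom_word[OF P, of x n] in auto)
  then show "AE x in \<nu>. 0 < q (cell (join P n) x) \<and> - ln (q (cell (join P n) x)) \<le> G x" using le by simp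
 qed
qed

lemma entropy_info:
 assumes Q: "part Q" shows "integrable \<nu> (\<lambda>x. - ln (prob (cell Q x)))" "(\<integral>x. - ln (prob (cell Q x)) \<partial>\<nu>) = partition_entropy \<nu> Q"
  "AE x in \<nu>. 0 < prob (cell Q x)"
proof -
 have fin: "finite Q" and sets: "A \<in> Q \<Longrightarrow> A \<in> sets \<nu>" for A using Q by (auto simp: part_def)
 have eq: "- ln (prob (cell Q x)) = (\<Sum>A\<in>Q. indicator A x * (- ln (prob A)))" for x
 proof -
  have "(\<Sum>A\<in>Q. indicator A x * (- ln (prob A))) = (\<Sum>A\<in>{cell Q x}. indicator A x * (- ln (prob A)))"
   using Q cell[OF Q] by (intro sum.mono_neutral_right) (auto simp: part_def indicator_def)
  then show ?thesis using cell[OF Q] by simp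
 qed
 have int: "integrable \<nu> (\<lambda>x. indicator A x * (- ln (prob A)))" if "A \<in> Q" for A by (rule integrable_indicator_const[OF sets[OF that]])
 show "integrable \<nu> (\<lambda>x. - ln (prob (cell Q x)))" unfolding eq by (intro Bochner_Integration.integrable_sum int)
 show "(\<integral>x. - ln (prob (cell Q x)) \<partial>\<nu>) = partition_entropy \<nu> Q"
  unfolding eq using sets by (subst Bochner_Integration.integral_sum[OF int]) (auto simp: partition_entropy_def intro!: sum.cong)
 have "AE x in \<nu>. \<forall>A\<in>Q. prob A = 0 \<longrightarrow> x \<notin> A"
 proof (rule AE_finite_allI[OF fin])
  fix A assume A: "A \<in> Q"
  show "AE x in \<nu>. prob A = 0 \<longrightarrow> x \<notin> A"
   using sets[OF A] by (cases "prob A = 0") (auto simp: AE_iff_measurable[OF _ refl] emeasure_eq_measure)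
 qed
 then show "AE x in \<nu>. 0 < prob (cell Q x)"
  by eventually_elim (metis Q cell(1,2) measure_nonneg order_less_le)
qed

lemma entropy_nonneg: "part Q \<Longrightarrow> 0 \<le> partition_entropy \<nu> Q"
 unfolding partition_entropy_def
proof (intro sum_nonneg)
 fix A
 have "prob A * ln (prob A) \<le> 0"
 proof (cases "prob A = 0")
  case False
  then have "0 < prob A" using measure_nonneg[of \<nu> A] by linarith
  then have "ln (prob A) \<le> 0" using prob_le_1[of A] by simp
  then show ?thesis by (intro mult_nonneg_nonpos) auto
 qed simp
 then show "0 \<le> - (prob A * ln (prob A))" by simp
qed

text \<open>Code a long word by coding its two halves independently: the weight is the product of
  the probabilities of the halves, so the code lengths add. Invariance identifies the integral of
  the second length with an entropy.\<close>

lemma entropy_subadditive: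
 assumes P: "part P"
 shows "partition_entropy \<nu> (join P (m + n)) \<le> partition_entropy \<nu> (join P m) + partition_entropy \<nu> (join P n)"
proof -
 define I where "I k x = - ln (prob (cell (join P k) x))" for k x
 define sh where "sh a = restrict (\<lambda>i. a (i + m)) {..<n}" for a :: "nat \<Rightarrow> rsphere set"
 define W where "W a = prob (atom m (restrict a {..<m})) * prob (atom n (sh a))" for a
 have fin: "finite (PiE {..<k} (\<lambda>_. P))" for k :: nat using P by (intro finite_PiE) (auto simp: part_def)
 have tot: "(\<Sum>a\<in>PiE {..<k} (\<lambda>_. P). prob (atom k a)) \<le> 1" for k
 proof -
  have "(\<Sum>a\<in>PiE {..<k} (\<lambda>_. P). prob (atom k a)) = prob (\<Union>a\<in>PiE {..<k} (\<lambda>_. P). atom k a)"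
  proof (rule finite_measure_finite_Union[symmetric, OF fin])
   show "atom k ` (PiE {..<k} (\<lambda>_. P)) \<subseteq> sets \<nu>" using part_join[OF P, of k] by (simp add: part_def join_eq)
   show "disjoint_family_on (atom k) (PiE {..<k} (\<lambda>_. P))"
    unfolding disjoint_family_on_def
   proof (intro ballI impI)
    fix a b assume ab: "a \<in> PiE {..<k} (\<lambda>_. P)" "b \<in> PiE {..<k} (\<lambda>_. P)" "a \<noteq> b"
    show "atom k a \<inter> atom k b = {}"
    proof (rule ccontr)
     assume "atom k a \<inter> atom k b \<noteq> {}"
     then obtain x where x: "x \<in> atom k a" "x \<in> atom k b" by auto
     show False using in_atom_eq[OF P ab(1) x(1)] in_atom_eq[OF P ab(2) x(2)] ab(3) by simp
    qed
   qed
  qed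
  then show ?thesis using prob_le_1 by metis
 qed
 have "partition_entropy \<nu> (join P (m + n)) \<le> (\<integral>x. I m x + I n ((f ^^ m) x) \<partial>\<nu>)"
 proof (rule coding[OF P, of W])
  show "0 \<le> W a" for a by (simp add: W_def)
  have inj: "inj_on (\<lambda>a. (restrict a {..<m}, sh a)) (PiE {..<m + n} (\<lambda>_. P))"
  proof (rule inj_onI)
   fix a b assume ab: "a \<in> PiE {..<m + n} (\<lambda>_. P)" "b \<in> PiE {..<m + n} (\<lambda>_. P)" "(restrict a {..<m}, sh a) = (restrict b {..<m}, sh b)"
   show "a = b"
   proof
    fix i
    consider "i < m" | "m \<le> i" "i < m + n" | "i \<ge> m + n" by linarith
    then show "a i = b i"
    proof cases
     case 1 then show ?thesis using ab(3) by (metis lessThan_iff prod.inject restrict_apply')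
    next
     case 2
     then have "sh a (i - m) = a i" "sh b (i - m) = b i" by (auto simp: sh_def)
     then show ?thesis using ab(3) by simp
    next
     case 3 then show ?thesis using ab(1,2) by (auto simp: PiE_def extensional_def)
    qed
   qed
  qed
  have "(\<Sum>a\<in>PiE {..<m + n} (\<lambda>_. P). W a) =
    (\<Sum>(b, c)\<in>(\<lambda>a. (restrict a {..<m}, sh a)) ` (PiE {..<m + n} (\<lambda>_. P)). prob (atom m b) * prob (atom n c))"
   by (subst sum.reindex[OF inj]) (simp add: W_def)
  also have "... \<le> (\<Sum>(b, c)\<in>PiE {..<m} (\<lambda>_. P) \<times> PiE {..<n} (\<lambda>_. P). prob (atom m b) * prob (atom n c))"
   using fin by (intro sum_mono2) (auto simp: sh_def)
  also have "... = (\<Sum>a\<in>PiE {..<m} (\<lambda>_. P). prob (atom m a)) * (\<Sum>a\<in>PiE {..<n} (\<lambda>_. P). prob (atom n a))"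
   by (simp add: sum_product sum.cartesian_product)
  also have "... \<le> 1 * 1" by (intro mult_mono tot) (auto intro!: sum_nonneg)
  finally show "(\<Sum>a\<in>PiE {..<m + n} (\<lambda>_. P). W a) \<le> 1" by simp
  show "integrable \<nu> (\<lambda>x. I m x + I n ((f ^^ m) x))"
   unfolding I_def by (intro Bochner_Integration.integrable_add entropy_info part_join P integrable_pow[of "\<lambda>x. - ln (prob (cell (join P n) x))"])
  have w: "restrict (word P (m + n) x) {..<m} = word P m x" "sh (word P (m + n) x) = word P n ((f ^^ m) x)" for x
   by (auto simp: word_def sh_def funpow_add fun_eq_iff)
  have "AE x in \<nu>. 0 < prob (cell (join P m) x) \<and> 0 < prob (cell (join P n) ((f ^^ m) x))"
   using entropy_info(3)[OF part_join[OF P], of m] AE_pow[OF entropy_info(3)[OF part_join[OF P], of n], of m] by eventually_elim auto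
  then show "AE x in \<nu>. 0 < W (word P (m + n) x) \<and> - ln (W (word P (m + n) x)) \<le> I m x + I n ((f ^^ m) x)"
   by eventually_elim (auto simp: W_def w I_def cell_join[OF P] ln_mult)
 qed
 also have "... = (\<integral>x. I m x \<partial>\<nu>) + (\<integral>x. I n ((f ^^ m) x) \<partial>\<nu>)"
  unfolding I_def by (intro Bochner_Integration.integral_add entropy_info part_join P integrable_pow[of "\<lambda>x. - ln (prob (cell (join P n) x))"])
 also have "(\<integral>x. I n ((f ^^ m) x) \<partial>\<nu>) = (\<integral>x. I n x \<partial>\<nu>)"
  by (rule integral_pow) (use borel_measurable_integrable[OF entropy_info(1)[OF part_join[OF P], of n]] in \<open>simp add: I_def\<close>)
 finally show ?thesis unfolding I_def by (simp only: entropy_info(2)[OF part_join[OF P]])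
qed

definition ent :: "rsphere set set \<Rightarrow> real" where
 "ent P = lim (\<lambda>n. partition_entropy \<nu> (join P n) / real n)"

lemma ent: assumes "part P"
 shows "(\<lambda>n. partition_entropy \<nu> (join P n) / real n) \<longlonglongrightarrow> ent P"
  "0 < n \<Longrightarrow> ent P \<le> partition_entropy \<nu> (join P n) / real n"
proof -
 obtain l where "(\<lambda>n. partition_entropy \<nu> (join P n) / real n) \<longlonglongrightarrow> l"
  "\<And>n. 0 < n \<Longrightarrow> l \<le> partition_entropy \<nu> (join P n) / real n"
  by (rule subadditive_limit[of "\<lambda>n. partition_entropy \<nu> (join P n)"])
    (use entropy_subadditive[OF assms] entropy_nonneg[OF part_join[OF assms]] in blast)+
 then show "(\<lambda>n. partition_entropy \<nu> (join P n) / real n) \<longlonglongrightarrow> ent P"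
  "0 < n \<Longrightarrow> ent P \<le> partition_entropy \<nu> (join P n) / real n"
  by (auto simp: ent_def limI)
qed

lemma metric_entropy_eq: "metric_entropy \<nu> f = (SUP P\<in>{P. part P \<and> {} \<notin> P}. ereal (ent P))"
 unfolding metric_entropy_def ent_def join_def
 by (intro SUP_cong) (auto simp: part_def partition_on_def)

lemma metric_entropy_le:
 assumes "\<And>P. part P \<Longrightarrow> ent P \<le> c" shows "metric_entropy \<nu> f \<le> ereal c"
 unfolding metric_entropy_eq by (intro SUP_least) (use assms in auto)

lemma metric_entropy_nonneg: "0 \<le> metric_entropy \<nu> f"
proof -
 have p: "part {UNIV}" by (simp add: part_def disjoint_def)
 have "0 \<le> ent {UNIV}"
  by (rule LIMSEQ_le_const[OF ent(1)[OF p]]) (use entropy_nonneg[OF part_join[OF p]] in \<open>auto intro!: divide_nonneg_nonneg\<close>)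
 then have "0 \<le> ereal (ent {UNIV})" by simp
 also have "ereal (ent {UNIV}) \<le> metric_entropy \<nu> f"
  unfolding metric_entropy_eq by (intro SUP_upper) (use p in auto)
 finally show ?thesis .
qed

text \<open>The supremum defining entropy runs over partitions without an empty cell, so such a cell
  is deleted first; this changes no entropy.\<close>

lemma metric_entropy_ge:
 assumes P: "part P" and le: "\<And>n. real n * c - C \<le> partition_entropy \<nu> (join P n)"
 shows "ereal c \<le> metric_entropy \<nu> f"
proof -
 have "c \<le> ent P"
 proof (rule LIMSEQ_le[OF _ ent(1)[OF P]])
  show "(\<lambda>n. c - C / real n) \<longlonglongrightarrow> c" by (auto intro!: tendsto_eq_intros lim_const_over_n)
  show "\<exists>N. \<forall>n\<ge>N. c - C / real n \<le> partition_entropy \<nu> (join P n) / real n"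
  proof (intro exI[of _ 1] allI impI)
   fix n :: nat assume n: "1 \<le> n"
   have "c - C / real n = (real n * c - C) / real n" using n by (simp add: field_simps)
   also have "... \<le> partition_entropy \<nu> (join P n) / real n" using le by (intro divide_right_mono) auto
   finally show "c - C / real n \<le> partition_entropy \<nu> (join P n) / real n" .
  qed
 qed
 moreover have P': "part (P - {{}})" using P by (auto simp: part_def disjoint_def)
 moreover have "ent (P - {{}}) = ent P"
 proof -
  have "partition_entropy \<nu> (join (P - {{}}) n) = partition_entropy \<nu> (join P n)" for n
  proof -
   have c: "cell (P - {{}}) x = cell P x" for x
    using cell(1,2)[OF P', of x] by (intro cell(3)[OF P, symmetric]) auto
   have "cell (join (P - {{}}) n) = cell (join P n)"
    using P P' by (intro ext) (simp add: cell_join word_def c)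
   then show ?thesis using entropy_info(2)[OF part_join[OF P], of n] entropy_info(2)[OF part_join[OF P'], of n] by simp
  qed
  then show ?thesis by (simp add: ent_def)
 qed
 ultimately show ?thesis
  unfolding metric_entropy_eq by (intro SUP_upper2[of "P - {{}}"]) auto
qed

end

context inv_measure
begin

lemma compact_approx:
 assumes "B \<in> sets borel" "0 < e"
 obtains K where "K \<subseteq> B" "compact K" "prob B - e < prob K"
proof -
 have fin: "emeasure \<nu> X \<noteq> \<infinity>" for X by simp
 have "emeasure \<nu> B = (SUP K\<in>{K. K \<subseteq> B \<and> compact K}. emeasure \<nu> K)"
  by (rule inner_regular[OF sets_nu _ assms(1)]) simp
 show ?thesis
 proof (cases "prob B < e")
  case True
  show ?thesis by (rule that[of "{}"]) (use True in auto)
 next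
  case False
  have "ennreal (prob B - e) < ennreal (prob B)"
   using False assms(2) by (intro ennreal_lessI) (auto simp: not_less measure_nonneg intro: less_le_trans)
  also have "... = (SUP K\<in>{K. K \<subseteq> B \<and> compact K}. emeasure \<nu> K)"
   using \<open>emeasure \<nu> B = _\<close> by (simp add: emeasure_eq_measure)
  finally obtain K where K: "K \<subseteq> B" "compact K" "ennreal (prob B - e) < emeasure \<nu> K"
   by (auto simp: less_SUP_iff)
  then have "prob B - e < prob K"
   using False by (simp add: emeasure_eq_measure ennreal_less_iff)
  with K show ?thesis by (intro that)
 qed
qed

text \<open>The atom of a point is coded by a member of the cover and the times at which the orbit leaves
 the compact cores of the partition.\<close>

lemma cover_bound:
 assumes P: "part P" and eps: "0 < eps"
 obtains \<delta> C where "0 < \<delta>" "0 \<le> C"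
  "\<And>n (I :: 'i set) V (w :: 'i \<Rightarrow> real) G K. \<lbrakk>finite I; \<And>i. i \<in> I \<Longrightarrow> 0 \<le> w i; sum w I \<le> 1; integrable \<nu> G;
   AE x in \<nu>. \<exists>i\<in>I. x \<in> V i \<and> 0 < w i \<and> - ln (w i) \<le> G x;
   \<And>i. i \<in> I \<Longrightarrow> card {j\<in>{..<n}. \<exists>u\<in>V i. \<exists>v\<in>V i. \<delta> \<le> dist ((f ^^ j) u) ((f ^^ j) v)} \<le> K\<rbrakk> \<Longrightarrow>
   partition_entropy \<nu> (join P n) \<le> (\<integral>x. G x \<partial>\<nu>) + real n * eps + C * real K"
proof -
 have fin: "finite P" and setsP: "\<And>A. A \<in> P \<Longrightarrow> A \<in> sets borel" using P by (auto simp: part_def)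
 define p where "p = real (card P)"
 have "P \<noteq> {}" using P by (auto simp: part_def)
 then have p1: "1 \<le> p" using fin by (simp add: p_def Suc_leI card_gt_0_iff)
 \<comment> \<open>The probability reserved for a wrong guess of a letter. A correct guess then
   costs at most \<open>eps / 2\<close>, and an arbitrary letter costs at most
   \<open>C\<close>.\<close>
 define \<kappa> where "\<kappa> = min (1 / 2) (1 - exp (- (eps / 2)))"
 have \<kappa>: "0 < \<kappa>" "\<kappa> \<le> 1 / 2" "exp (- (eps / 2)) \<le> 1 - \<kappa>" using eps min.cobounded1[of "1 / 2" "1 - exp (- (eps / 2))"] min.cobounded2[of "1 / 2" "1 - exp (- (eps / 2))"]
  unfolding \<kappa>_def by (auto simp: min_less_iff_conj)
 have \<kappa>1: "- ln (1 - \<kappa>) \<le> eps / 2" using \<kappa>(3) \<kappa>(2) by (metis exp_gt_zero ln_exp ln_mono minus_le_iff)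
 define C where "C = ln (p / \<kappa>)"
 have "1 \<le> p / \<kappa>" using p1 \<kappa> by (simp add: field_simps)
 then have C0: "0 \<le> C" by (simp add: C_def)
 \<comment> \<open>The mass outside the compact cores is made so small that visits there cost at
   most \<open>eps / 2\<close> per step on average.\<close>
 define h where "h = eps / (2 * (C + 1))"
 have h: "0 < h" "C * h \<le> eps / 2" using C0 eps by (auto simp: h_def field_simps)
 have "\<exists>K. K \<subseteq> A \<and> compact K \<and> prob A - h / p < prob K" if "A \<in> P" for A
  by (rule compact_approx[OF setsP[OF that], of "h / p"]) (use h p1 in auto)
 then obtain K where K: "\<And>A. A \<in> P \<Longrightarrow> K A \<subseteq> A" "\<And>A. A \<in> P \<Longrightarrow> compact (K A)"
  "\<And>A. A \<in> P \<Longrightarrow> prob A - h / p < prob (K A)" by metis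
 have Kb: "K A \<in> sets borel" if "A \<in> P" for A using K(2)[OF that] by (simp add: borel_compact)
 define Z where "Z = UNIV - (\<Union>A\<in>P. K A)"
 have Zb [measurable]: "Z \<in> sets borel" unfolding Z_def using fin Kb by (intro sets.Diff sets.finite_UN) auto
 have Z: "prob Z \<le> h"
 proof -
  have "Z \<subseteq> (\<Union>A\<in>P. A - K A)"
  using cell(1,2) P by (fastforce simp: Z_def)
  then have "prob Z \<le> prob (\<Union>A\<in>P. A - K A)"
   using fin setsP Kb by (intro finite_measure_mono) (auto intro!: sets.finite_UN sets.Diff)
  also have "... \<le> (\<Sum>A\<in>P. prob (A - K A))"
   using fin setsP Kb by (intro finite_measure_subadditive_finite) auto
  also have "... \<le> (\<Sum>A\<in>P. h / p)"
  proof (rule sum_mono)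
   fix A assume A: "A \<in> P"
   have "prob (A - K A) = prob A - prob (K A)"
    using A setsP Kb K by (intro finite_measure_Diff) auto
   then show "prob (A - K A) \<le> h / p" using K(3)[OF A] by simp
  qed
  also have "... = h" using p1 by (simp add: p_def)
  finally show ?thesis .
 qed
 have "\<exists>d>0. \<forall>u\<in>K A. \<forall>v\<in>K B. d \<le> dist u v" if "A \<in> P" "B \<in> P" "A \<noteq> B" for A B
 proof (rule separate_compact_closed)
  show "compact (K A)" "closed (K B)" using K(2) that compact_imp_closed by auto
  have "A \<inter> B = {}" using P that by (auto simp: part_def disjoint_def)
  then show "K A \<inter> K B = {}" using K(1) that by blast
 qed
 then obtain d where d: "\<And>A B. A \<in> P \<Longrightarrow> B \<in> P \<Longrightarrow> A \<noteq> B \<Longrightarrow> 0 < d A B"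
  "\<And>A B u v. A \<in> P \<Longrightarrow> B \<in> P \<Longrightarrow> A \<noteq> B \<Longrightarrow> u \<in> K A \<Longrightarrow> v \<in> K B \<Longrightarrow> d A B \<le> dist u v" by metis
 define S where "S = insert 1 ((\<lambda>(A, B). d A B) ` {(A, B). A \<in> P \<and> B \<in> P \<and> A \<noteq> B})"
 have "{(A, B). A \<in> P \<and> B \<in> P \<and> A \<noteq> B} \<subseteq> P \<times> P" by auto
 then have finS: "finite S" unfolding S_def using fin finite_subset by blast
 define \<delta> where "\<delta> = Min S"
 have \<delta>0: "0 < \<delta>" unfolding \<delta>_def using finS d(1) by (subst Min_gr_iff) (auto simp: S_def)
 have \<delta>: "A = B" if "A \<in> P" "B \<in> P" "u \<in> K A" "v \<in> K B" "dist u v < \<delta>" for A B u v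
 proof (rule ccontr)
  assume ne: "A \<noteq> B"
  have "\<delta> \<le> d A B" unfolding \<delta>_def using that ne by (intro Min_le finS) (auto simp: S_def)
  then show False using d(2)[OF that(1,2) ne that(3,4)] that(5) by linarith
 qed
 show ?thesis
 proof (rule that[OF \<delta>0 C0])
  fix n and I :: "'i set" and V :: "'i \<Rightarrow> rsphere set" and w :: "'i \<Rightarrow> real" and G and N :: nat
  assume I: "finite I" "\<And>i. i \<in> I \<Longrightarrow> 0 \<le> w i" "sum w I \<le> 1" and G: "integrable \<nu> G"
   and cov: "AE x in \<nu>. \<exists>i\<in>I. x \<in> V i \<and> 0 < w i \<and> - ln (w i) \<le> G x"
   and bad: "\<And>i. i \<in> I \<Longrightarrow> card {j\<in>{..<n}. \<exists>u\<in>V i. \<exists>v\<in>V i. \<delta> \<le> dist ((f ^^ j) u) ((f ^^ j) v)} \<le> N"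
  define bd where "bd i = {j\<in>{..<n}. \<exists>u\<in>V i. \<exists>v\<in>V i. \<delta> \<le> dist ((f ^^ j) u) ((f ^^ j) v)}" for i
  define good where "good i j A \<longleftrightarrow> A \<in> P \<and> (\<exists>u\<in>V i. (f ^^ j) u \<in> K A)" for i j A
  \<comment> \<open>The guess for time \<open>j\<close>: a cell whose core is met by the
    \<open>j\<close>-th image of the cover member.\<close>
  define main where "main i j = (if \<exists>A. good i j A then SOME A. good i j A else SOME A. A \<in> P)" for i j
  have mainP: "main i j \<in> P" for i j
  proof (cases "\<exists>A. good i j A")
   case True
   then have "good i j (SOME A. good i j A)" by (rule someI_ex)
   then show ?thesis unfolding main_def if_P[OF True] by (blast dest: good_def[THEN iffD1])
  next
   case False
   have "\<exists>A. A \<in> P" using \<open>P \<noteq> {}\<close> by blast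
   from someI_ex[OF this] show ?thesis using False by (simp add: main_def)
  qed
  define q where "q i j A = (if A = main i j then 1 - \<kappa> else 0) + \<kappa> / p" for i j A
  have q0: "0 < q i j A" for i j A using \<kappa> p1 by (auto simp: q_def add_nonneg_pos)
  have qsum: "(\<Sum>A\<in>P. q i j A) = 1" for i j
   using fin mainP p1 by (simp add: q_def sum.distrib p_def[symmetric])
  \<comment> \<open>A mixture of product distributions on words: a cover member is drawn according
    to \<open>w\<close>, then each letter independently according to \<open>q\<close>.\<close>
  define W where "W a = (\<Sum>i\<in>I. w i * (\<Prod>j<n. q i j (a j)))" for a
  have W0: "0 \<le> W a" for a unfolding W_def using I(2) q0 by (intro sum_nonneg mult_nonneg_nonneg prod_nonneg) (auto simp: less_imp_le)
  have Wsum: "(\<Sum>a\<in>PiE {..<n} (\<lambda>_. P). W a) \<le> 1"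
  proof -
   have "(\<Sum>a\<in>PiE {..<n} (\<lambda>_. P). W a) = (\<Sum>i\<in>I. w i * (\<Sum>a\<in>PiE {..<n} (\<lambda>_. P). \<Prod>j<n. q i j (a j)))"
    unfolding W_def by (subst sum.swap) (simp add: sum_distrib_left)
   also have "... = (\<Sum>i\<in>I. w i * (\<Prod>j<n. \<Sum>A\<in>P. q i j A))"
    using fin by (subst prod_sum_PiE) auto
   also have "... = sum w I" by (simp add: qsum)
   finally show ?thesis using I(3) by simp
  qed
  define G' where "G' x = G x + (real n * (eps / 2) + C * real N) + C * (\<Sum>j<n. indicator Z ((f ^^ j) x))" for x
  have intZ: "integrable \<nu> (\<lambda>x. indicator Z ((f ^^ j) x) :: real)" for j
   by (rule integrable_pow) (auto simp: less_top[symmetric])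
  have "partition_entropy \<nu> (join P n) \<le> (\<integral>x. G' x \<partial>\<nu>)"
  proof (rule coding[OF P W0 Wsum])
   show "integrable \<nu> G'" unfolding G'_def
    by (intro Bochner_Integration.integrable_add G integrable_mult_right Bochner_Integration.integrable_sum intZ) auto
   show "AE x in \<nu>. 0 < W (word P n x) \<and> - ln (W (word P n x)) \<le> G' x"
    using cov
   proof eventually_elim
    case (elim x)
    then obtain i where i: "i \<in> I" "x \<in> V i" "0 < w i" "- ln (w i) \<le> G x" by blast
    define a where "a = word P n x"
    have a: "a j = cell P ((f ^^ j) x)" if "j < n" for j using that by (simp add: a_def word_def)
    have cost: "- ln (q i j (a j)) \<le> eps / 2 + C * (indicator (bd i) j + indicator Z ((f ^^ j) x))" if j: "j < n" for j
    proof (cases "j \<in> bd i \<or> (f ^^ j) x \<in> Z")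
     case True
     have "\<kappa> / p \<le> q i j (a j)" using \<kappa> by (simp add: q_def)
     moreover have "0 < \<kappa> / p" using \<kappa> p1 by simp
     ultimately have "ln (\<kappa> / p) \<le> ln (q i j (a j))" by (intro ln_mono)
     moreover have "ln (\<kappa> / p) = - C" using \<kappa> p1 by (simp add: C_def ln_div)
     ultimately have "- ln (q i j (a j)) \<le> C * 1" by simp
     also have "... \<le> C * (indicator (bd i) j + indicator Z ((f ^^ j) x))"
      using True C0 by (intro mult_left_mono) (auto simp: indicator_def)
     finally show ?thesis using eps by simp
    next
     case False
     then obtain A where A: "A \<in> P" "(f ^^ j) x \<in> K A" by (auto simp: Z_def)
     have ga: "good i j A" using A i(2) by (auto simp: good_def)
     then have "good i j (main i j)" unfolding main_def using someI_ex[of "good i j"] by auto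
     then obtain u where u: "u \<in> V i" "(f ^^ j) u \<in> K (main i j)" by (auto simp: good_def)
     \<comment> \<open>Points in different cores are at least \<delta> apart, so at a time that is
       not bad the guess is the true cell.\<close>
     have "dist ((f ^^ j) x) ((f ^^ j) u) < \<delta>" using False j i(2) u(1) by (auto simp: bd_def not_le)
     from \<delta>[OF A(1) mainP A(2) u(2) this] have "A = main i j" .
     moreover have "a j = A" unfolding a[OF j] by (rule cell(3)[OF P A(1)]) (use A K(1) in blast)
     ultimately have "1 - \<kappa> \<le> q i j (a j)" using \<kappa> p1 by (simp add: q_def)
     then have "ln (1 - \<kappa>) \<le> ln (q i j (a j))" using \<kappa> by (intro ln_mono) auto
     then show ?thesis using \<kappa>1 False by simp
    qed
    define Q where "Q = (\<Prod>j<n. q i j (a j))"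
    have Q0: "0 < Q" unfolding Q_def using q0 by (intro prod_pos) auto
    have "ln Q = (\<Sum>j<n. ln (q i j (a j)))" unfolding Q_def by (rule ln_prod) (simp, metis q0 less_irrefl)
    then have "- ln Q \<le> (\<Sum>j<n. eps / 2 + C * (indicator (bd i) j + indicator Z ((f ^^ j) x)))"
     using cost by (simp add: sum_negf[symmetric] del: sum_negf) (intro sum_mono, auto)
    also have "... = real n * (eps / 2) + C * ((\<Sum>j<n. indicator (bd i) j) + (\<Sum>j<n. indicator Z ((f ^^ j) x)))"
     by (simp add: sum.distrib sum_distrib_left[symmetric])
    also have "(\<Sum>j<n. indicator (bd i) j) = real (card (bd i))"
    proof -
     have "{..<n} \<inter> bd i = bd i" by (auto simp: bd_def)
     then show ?thesis by (simp add: indicator_def sum_of_bool_eq)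
    qed
    also have "real n * (eps / 2) + C * (real (card (bd i)) + (\<Sum>j<n. indicator Z ((f ^^ j) x))) \<le>
      real n * (eps / 2) + C * (real N + (\<Sum>j<n. indicator Z ((f ^^ j) x)))"
     using bad[OF i(1)] C0 by (intro add_left_mono mult_left_mono add_right_mono) (auto simp: bd_def)
    finally have lQ: "- ln Q \<le> real n * (eps / 2) + C * (real N + (\<Sum>j<n. indicator Z ((f ^^ j) x)))" .
    have "w i * Q \<le> W a" unfolding W_def Q_def
     by (rule member_le_sum[OF i(1), of "\<lambda>i. w i * (\<Prod>j<n. q i j (a j))"])
       (use I q0 in \<open>auto intro!: mult_nonneg_nonneg prod_nonneg simp: less_imp_le\<close>)
    moreover have wQ: "0 < w i * Q" using i(3) Q0 by simp
    ultimately have "0 < W a" "ln (w i * Q) \<le> ln (W a)" by (auto intro: ln_mono)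
    then show ?case using i Q0 lQ by (simp add: a_def[symmetric] ln_mult G'_def algebra_simps)
   qed
  qed
  also have "... = (\<integral>x. G x \<partial>\<nu>) + (real n * (eps / 2) + C * real N) + C * (\<Sum>j<n. prob Z)"
  using integral_pow G intZ by (simp add: G'_def)
  also have "... \<le> (\<integral>x. G x \<partial>\<nu>) + (real n * (eps / 2) + C * real N) + real n * (eps / 2)"
  proof -
   have "C * prob Z \<le> C * h" using Z C0 by (intro mult_left_mono)
   then have "C * prob Z \<le> eps / 2" using h by linarith
   then have "real n * (C * prob Z) \<le> real n * (eps / 2)" by (intro mult_left_mono) auto
   then show ?thesis by (simp add: algebra_simps)
  qed
  also have "... = (\<integral>x. G x \<partial>\<nu>) + real n * eps + C * real N" by (simp add: algebra_simps)
  finally show "partition_entropy \<nu> (join P n) \<le> (\<integral>x. G x \<partial>\<nu>) + real n * eps + C * real N" .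
 qed
qed

end

section \<open>Lyapunov exponents\<close>

text \<open>The usual last step of the entropy estimates: an error bounded in \<open>n\<close>
  vanishes after division by \<open>n\<close>.\<close>

lemma le_of_linear_le:
 fixes c e :: real assumes "\<And>n::nat. real n * c \<le> real n * e + C" shows "c \<le> e"
proof (rule LIMSEQ_le)
 show "(\<lambda>n. c) \<longlonglongrightarrow> c" by simp
 show "(\<lambda>n. e + C / real n) \<longlonglongrightarrow> e" by (auto intro!: tendsto_eq_intros lim_const_over_n)
 show "\<exists>N. \<forall>n\<ge>N. c \<le> e + C / real n"
 proof (intro exI[of _ 1] allI impI)
  fix n :: nat assume n: "1 \<le> n"
  have "real n * c \<le> real n * (e + C / real n)" using assms[of n] n by (simp add: distrib_left)
  then show "c \<le> e + C / real n" using n by simp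
 qed
qed

lemma le_of_eps: "(\<And>e::real. 0 < e \<Longrightarrow> a \<le> b + C * e) \<Longrightarrow> 0 \<le> C \<Longrightarrow> a \<le> b"
proof (rule field_le_epsilon)
 fix e :: real assume h: "\<And>e. 0 < e \<Longrightarrow> a \<le> b + C * e" "0 \<le> C" "0 < e"
 have "C * (e / (C + 1)) \<le> e" using h(2,3) by (simp add: field_simps)
 moreover have "0 < e / (C + 1)" using h by simp
 ultimately show "a \<le> b + e" using h(1)[of "e / (C + 1)"] by linarith
qed

context tce_map
begin

text \<open>Bounds the variation of \<open>D\<close> on a set whose \<open>k\<close>-th image is small.\<close>

definition tail where "tail k = 4 * M / lam ^ k"

lemma tail: "0 < tail k" "tail k \<le> 4 * M" "tail \<longlonglongrightarrow> 0"
proof -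
 show "0 < tail k" using M(1) lam by (simp add: tail_def)
 show "tail k \<le> 4 * M" using M(1) lam by (simp add: tail_def divide_le_eq one_le_power mult_le_cancel_left1)
 show "tail \<longlonglongrightarrow> 0" unfolding tail_def by (rule LIMSEQ_divide_realpow_zero[OF lam])
qed

lemma tail_small: assumes "0 < e" obtains k where "\<And>m. k \<le> m \<Longrightarrow> tail m < e"
 using order_tendstoD(2)[OF tail(3) assms] by (auto simp: eventually_sequentially)

text \<open>At step \<open>i\<close> the image has size at most \<open>4 / lam ^ (n - i)\<close>, so
  the second-order estimate adds at most \<open>tail (n - i)\<close> to the derivative. Any point
  \<open>w\<close> of the set may serve as the reference orbit.\<close>

lemma expansion_upper:
 assumes y: "y \<in> J" and S: "connected S" "fn n ` S \<subseteq> ball y r0" and w: "w \<in> S" "u \<in> S" "v \<in> S"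
  and m: "m \<le> n"
 shows "dist (fn m u) (fn m v) \<le> (\<Prod>i<m. D (fn i w) + tail (n - i)) * dist u v"
 using m
proof (induction m)
 case (Suc m)
 let ?P = "\<Prod>i<m. D (fn i w) + tail (n - i)"
 have d: "dist (fn m a) (fn m w) \<le> 4 / lam ^ (n - m)" if "a \<in> S" for a
  by (rule shrink_mid[OF y S that w(1)]) (use Suc.prems in simp)
 have "dist ((f ^^ Suc m) u) ((f ^^ Suc m) v) \<le> (D (fn m w) + M * (4 / lam ^ (n - m))) * dist (fn m u) (fn m v)"
  using dist_f_upper[OF d[OF w(2)] d[OF w(3)]] by simp
 also have "... = (D (fn m w) + tail (n - m)) * dist (fn m u) (fn m v)" by (simp add: tail_def mult.commute)
 also have "... \<le> (D (fn m w) + tail (n - m)) * (?P * dist u v)"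
  using Suc D_nonneg tail(1)[of "n - m"] by (intro mult_left_mono) (auto intro: add_nonneg_nonneg less_imp_le)
 finally show ?case by (simp add: mult_ac)
qed simp

text \<open>The component at \<open>x\<close> has diameter at most \<open>4 / lam ^ n\<close>, yet
  its image contains a point at distance \<open>r0 / 2\<close> from that of \<open>x\<close>. The
  corrected product must account for this stretching, whence
  \<open>lam ^ n * (r0 / 8)\<close>.\<close>

lemma sum_tail_lower:
 assumes x: "x \<in> J"
 shows "real n * ln lam + ln (r0 / 8) \<le> (\<Sum>i<n. ln (D (fn i x) + tail (n - i)))"
proof -
 let ?B = "ball (fn n x) r0" let ?W = "pcomp n ?B x"
 have B: "open ?B" "connected ?B" using r0 by (auto intro: connected_ball_rsphere)
 have xB: "fn n x \<in> ?B" using r0 by simp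
 obtain y where y: "y \<in> ?B" "r0 / 2 \<le> dist (fn n x) y"
  by (rule rsphere_point_at[of "r0 / 2" r0 "fn n x"]) (use r0 in auto)
 have W: "connected ?W" "fn n ` ?W \<subseteq> ball (fn n x) r0" "x \<in> ?W"
  using pcomp_connected pcomp_sub pcomp_self[OF xB] by blast+
 obtain u where u: "u \<in> ?W" "y = fn n u" using y(1) pcomp_onto[OF B xB] by blast
 define P where "P = (\<Prod>i<n. D (fn i x) + tail (n - i))"
 have pos: "0 < D (fn i x) + tail (n - i)" for i using D_nonneg tail(1) by (intro add_nonneg_pos)
 have P0: "0 < P" unfolding P_def by (intro prod_pos) (use pos in auto)
 have "r0 / 2 \<le> P * dist x u"
  unfolding P_def using expansion_upper[OF J_pow[OF x] W(1,2) W(3) W(3) u(1) order_refl] y(2) unfolding u(2) by linarith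
 also have "... \<le> P * (4 / lam ^ n)"
  using shrink[OF J_pow[OF x] W(1,2) W(3) u(1)] P0 by (intro mult_left_mono) auto
 finally have "lam ^ n * (r0 / 8) \<le> P" using lam by (simp add: field_simps)
 then have "ln (lam ^ n * (r0 / 8)) \<le> ln P" using lam r0 by (intro ln_mono) auto
 moreover have "ln (lam ^ n * (r0 / 8)) = real n * ln lam + ln (r0 / 8)"
  using lam r0 by (subst ln_mult) (auto simp: ln_realpow)
 moreover have "ln P = (\<Sum>i<n. ln (D (fn i x) + tail (n - i)))"
  unfolding P_def by (rule ln_prod) (use pos in \<open>auto simp: less_le\<close>)
 ultimately show ?thesis by simp
qed

end

section \<open>Regularized logarithms and the Lyapunov exponent\<close>

locale julia_measure = tce_map f d + inv_measure f \<nu> for f d \<nu> +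
 assumes supp: "supported_on \<nu> (Julia f)"
begin

lemma AE_J: "AE x in \<nu>. x \<in> J"
 by (rule AE_I[of _ _ "- J"]) (use supp closed_J in \<open>auto simp: supported_on_def intro: borel_closed\<close>)

lemma D_meas [measurable]: "D \<in> borel_measurable borel"
 by (rule borel_measurable_continuous_onI[OF D_cont])

text \<open>The logarithm of the derivative regularized at critical points. It is bounded, so it can
  be integrated before \<open>ln D\<close> is known to be integrable.\<close>

definition le where "le \<eta> x = ln (D x + \<eta>)"

lemma le_meas [measurable]: "le \<eta> \<in> borel_measurable borel"
 unfolding le_def by measurable

lemma le_bounds: "0 < \<eta> \<Longrightarrow> ln \<eta> \<le> le \<eta> x" "0 < \<eta> \<Longrightarrow> le \<eta> x \<le> ln (L + \<eta>)"
 unfolding le_def using D_nonneg[of x] L(2)[of x] by (auto intro!: ln_mono add_nonneg_pos)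

lemma le_mono: "0 < \<eta> \<Longrightarrow> \<eta> \<le> \<eta>' \<Longrightarrow> le \<eta> x \<le> le \<eta>' x"
 unfolding le_def using D_nonneg[of x] by (auto intro!: ln_mono add_nonneg_pos)

lemma le_int: assumes "0 < \<eta>" shows "integrable \<nu> (le \<eta>)"
proof (rule integrable_const_bound[of _ "\<bar>ln \<eta>\<bar> + \<bar>ln (L + \<eta>)\<bar>"], intro AE_I2)
 fix x show "norm (le \<eta> x) \<le> \<bar>ln \<eta>\<bar> + \<bar>ln (L + \<eta>)\<bar>"
  using le_bounds[OF assms, of x] unfolding real_norm_def abs_le_iff by linarith
qed simp

definition E where "E \<eta> = (\<integral>x. le \<eta> x \<partial>\<nu>)"

lemma E_pow: "(\<integral>x. le \<eta> (fn i x) \<partial>\<nu>) = E \<eta>"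
 unfolding E_def by (rule integral_pow) simp

lemma le_int_pow: "0 < \<eta> \<Longrightarrow> integrable \<nu> (\<lambda>x. le \<eta> (fn i x))"
 by (rule integrable_pow[OF le_int])

text \<open>The correction \<open>tail (n - i)\<close> exceeds \<eta> only in a fixed number of last
  steps, and each of these costs at most a constant.\<close>

lemma sum_E_tail: assumes \<eta>: "0 < \<eta>"
 obtains C where "\<And>n. (\<Sum>i<n. E (tail (n - i))) \<le> real n * E \<eta> + C"
proof -
 obtain k where k: "\<And>m. k \<le> m \<Longrightarrow> tail m < \<eta>" by (rule tail_small[OF \<eta>]) blast
 define c where "c = \<bar>ln (L + 4 * M)\<bar> + \<bar>E \<eta>\<bar>"
 have c0: "0 \<le> c" by (simp add: c_def)
 have t: "E (tail m) \<le> E \<eta> + (if m < k then c else 0)" for m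
 proof (cases "m < k")
  case True
  have "E (tail m) \<le> ln (L + 4 * M)"
   unfolding E_def
  proof (rule integral_le_const[OF le_int[OF tail(1)]], intro AE_I2)
   fix x have "le (tail m) x \<le> ln (L + tail m)" by (rule le_bounds(2)[OF tail(1)])
   also have "... \<le> ln (L + 4 * M)" using tail(1,2)[of m] L(1) by (intro ln_mono) auto
   finally show "le (tail m) x \<le> ln (L + 4 * M)" .
  qed
  then show ?thesis using True by (simp add: c_def)
 next
  case False
  have "E (tail m) \<le> E \<eta>"
   unfolding E_def using k[of m] False tail(1)[of m]
   by (intro integral_mono le_int \<eta> le_mono) auto
  then show ?thesis using False by simp
 qed
 have "(\<Sum>i<n. E (tail (n - i))) \<le> real n * E \<eta> + real k * c" for n
 proof -
  have "(\<Sum>i<n. E (tail (n - i))) \<le> (\<Sum>i<n. E \<eta> + (if n - i < k then c else 0))" by (intro sum_mono t)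
  also have "... = real n * E \<eta> + (\<Sum>i<n. if n - i < k then c else 0)" by (simp add: sum.distrib)
  also have "(\<Sum>i<n. if n - i < k then c else 0) = real (card {i\<in>{..<n}. n - i < k}) * c"
   by (simp add: sum.If_cases Int_def)
  also have "card {i\<in>{..<n}. n - i < k} \<le> card {n - k..<n}" by (rule card_mono) auto
  then have "real (card {i\<in>{..<n}. n - i < k}) * c \<le> real k * c"
   using c0 by (intro mult_right_mono) auto
  finally show ?thesis by simp
 qed
 then show ?thesis by (rule that)
qed

lemma E_ge: assumes \<eta>: "0 < \<eta>" shows "ln lam \<le> E \<eta>"
proof -
 obtain C where C: "\<And>n. (\<Sum>i<n. E (tail (n - i))) \<le> real n * E \<eta> + C" by (rule sum_E_tail[OF \<eta>]) blast
 show ?thesis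
 proof (rule le_of_linear_le)
  fix n :: nat
  have "real n * ln lam + ln (r0 / 8) = (\<integral>x. real n * ln lam + ln (r0 / 8) \<partial>\<nu>)" by simp
  also have "... \<le> (\<integral>x. (\<Sum>i<n. le (tail (n - i)) (fn i x)) \<partial>\<nu>)"
  proof (rule integral_mono_AE)
   show "integrable \<nu> (\<lambda>x. \<Sum>i<n. le (tail (n - i)) (fn i x))"
    by (intro Bochner_Integration.integrable_sum le_int_pow tail)
   show "AE x in \<nu>. real n * ln lam + ln (r0 / 8) \<le> (\<Sum>i<n. le (tail (n - i)) (fn i x))"
    using AE_J by eventually_elim (use sum_tail_lower in \<open>simp add: le_def\<close>)
  qed simp
  also have "... = (\<Sum>i<n. E (tail (n - i)))"
   by (subst Bochner_Integration.integral_sum) (auto simp: E_pow intro: le_int_pow tail)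
  also have "... \<le> real n * E \<eta> + C" by (rule C)
  finally show "real n * ln lam \<le> real n * E \<eta> + (C - ln (r0 / 8))" by linarith
 qed
qed

definition seq :: "nat \<Rightarrow> real" where "seq n = 1 / real (Suc n)"

lemma seq: "0 < seq n" "seq n \<le> 1" "seq \<longlonglongrightarrow> 0" "m \<le> n \<Longrightarrow> seq n \<le> seq m"
proof -
 show "0 < seq n" "seq n \<le> 1" by (auto simp: seq_def)
 show "seq \<longlonglongrightarrow> 0" unfolding seq_def by (rule LIMSEQ_Suc[OF lim_1_over_n])
 show "m \<le> n \<Longrightarrow> seq n \<le> seq m" unfolding seq_def by (intro divide_left_mono) auto
qed

text \<open>On the critical set the regularized logarithm equals \<open>ln \<eta>\<close>. If this
  set had positive mass, \<open>E \<eta>\<close> would tend to minus infinity, against the uniform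
  lower bound \<open>ln lam\<close>.\<close>

lemma AE_D_pos: "AE x in \<nu>. 0 < D x"
proof -
 define Z where "Z = {x. D x = 0}"
 have Z [measurable]: "Z \<in> sets borel" unfolding Z_def by measurable
 have "prob Z * (ln (L + 1) - ln (seq n)) \<le> ln (L + 1) - ln lam" for n
 proof -
  have "prob Z * (ln (L + 1) - ln (seq n)) = (\<integral>x. indicator Z x * (ln (L + 1) - ln (seq n)) \<partial>\<nu>)" by simp
  also have "... \<le> (\<integral>x. ln (L + 1) - le (seq n) x \<partial>\<nu>)"
  proof (rule integral_mono)
   show "integrable \<nu> (\<lambda>x. indicator Z x * (ln (L + 1) - ln (seq n)))" by (rule integrable_indicator_const) simp
   show "integrable \<nu> (\<lambda>x. ln (L + 1) - le (seq n) x)" by (intro Bochner_Integration.integrable_diff le_int seq) auto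
   fix x
   have "le (seq n) x \<le> ln (L + seq n)" by (rule le_bounds(2)[OF seq(1)])
   also have "... \<le> ln (L + 1)" using seq(1,2)[of n] L(1) by (intro ln_mono) auto
   finally show "indicator Z x * (ln (L + 1) - ln (seq n)) \<le> ln (L + 1) - le (seq n) x"
    by (auto simp: indicator_def Z_def le_def)
  qed
  also have "... = ln (L + 1) - E (seq n)" using le_int[OF seq(1)] by (simp add: E_def)
  also have "... \<le> ln (L + 1) - ln lam" using E_ge[OF seq(1)] by simp
  finally show ?thesis .
 qed
 note b = this
 have "prob Z = 0"
 proof (rule ccontr)
  assume "prob Z \<noteq> 0"
  then have pos: "0 < prob Z" using measure_nonneg[of \<nu> Z] by linarith
  obtain n :: nat where n: "real n > exp ((ln (L + 1) - ln lam) / prob Z)" using reals_Archimedean2 by blast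
  have "(ln (L + 1) - ln lam) / prob Z = ln (exp ((ln (L + 1) - ln lam) / prob Z))" by simp
  also have "... < ln (real (Suc n))" using n by (subst ln_less_cancel_iff) auto
  also have "... = - ln (seq n)" by (simp add: seq_def ln_div)
  finally have "ln (L + 1) - ln lam < prob Z * (- ln (seq n))" using pos by (simp add: field_simps)
  moreover have "0 \<le> prob Z * ln (L + 1)" using L(1) by simp
  ultimately show False using b[of n] by (simp add: right_diff_distrib)
 qed
 then have "AE x in \<nu>. x \<notin> Z" by (simp add: AE_iff_measurable[OF _ refl] emeasure_eq_measure)
 then show ?thesis by eventually_elim (use D_nonneg in \<open>auto simp: Z_def less_le\<close>)
qed

definition chi where "chi = (\<integral>x. ln (D x) \<partial>\<nu>)"

text \<open>The regularized logarithms decrease to \<open>ln D\<close> almost everywhere, and their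
  integrals are bounded below by \<open>ln lam\<close>; monotone convergence gives both
  claims.\<close>

lemma ln_D: "integrable \<nu> (\<lambda>x. ln (D x))" and E_tendsto: "(\<lambda>n. E (seq n)) \<longlonglongrightarrow> chi"
proof -
 have dec: "decseq (\<lambda>n. E (seq n))"
  unfolding decseq_def E_def by (intro allI impI integral_mono le_int seq le_mono) auto
 have "convergent (\<lambda>n. E (seq n))"
  by (rule decseq_convergent[OF dec, of "ln lam"]) (use E_ge[OF seq(1)] in \<open>auto simp: convergent_def\<close>)
 then obtain c where c: "(\<lambda>n. E (seq n)) \<longlonglongrightarrow> c" by (auto simp: convergent_def)
 have mono: "AE x in \<nu>. mono (\<lambda>n. - le (seq n) x)"
  by (intro AE_I2 monoI) (use le_mono seq in auto)
 have lim: "AE x in \<nu>. (\<lambda>n. - le (seq n) x) \<longlonglongrightarrow> - ln (D x)"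
  using AE_D_pos
 proof eventually_elim
  case (elim x)
  have "(\<lambda>n. ln (D x + seq n)) \<longlonglongrightarrow> ln (D x + 0)" using elim by (intro tendsto_intros seq) auto
  then show ?case by (intro tendsto_minus) (simp add: le_def)
 qed
 have int: "integrable \<nu> (\<lambda>x. - le (seq n) x)" for n by (intro integrable_minus le_int seq)
 have ilim: "(\<lambda>n. \<integral>x. - le (seq n) x \<partial>\<nu>) \<longlonglongrightarrow> - c"
  using tendsto_minus[OF c] by (simp add: E_def)
 have m: "(\<lambda>x. - ln (D x)) \<in> borel_measurable \<nu>" by measurable
 from integrable_monotone_convergence[OF int mono lim ilim m] integral_monotone_convergence[OF int mono lim ilim m]
 have *: "integrable \<nu> (\<lambda>x. - ln (D x))" "(\<integral>x. - ln (D x) \<partial>\<nu>) = - c" by auto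
 show "integrable \<nu> (\<lambda>x. ln (D x))" using *(1) by simp
 then have "chi = c" using *(2) by (simp add: chi_def)
 with c show "(\<lambda>n. E (seq n)) \<longlonglongrightarrow> chi" by simp
qed

lemma chi_ge: "ln lam \<le> chi"
 by (rule LIMSEQ_le_const[OF E_tendsto]) (use E_ge[OF seq(1)] in auto)

lemma chi_pos: "0 < chi"
proof -
 have "0 < ln lam" using lam by simp
 then show ?thesis using chi_ge by linarith
qed

lemma E_close: assumes "0 < e" obtains \<eta> where "0 < \<eta>" "E \<eta> \<le> chi + e"
proof -
 have "eventually (\<lambda>n. E (seq n) < chi + e) sequentially" using order_tendstoD(2)[OF E_tendsto] assms by simp
 then obtain n where "E (seq n) < chi + e" by (auto simp: eventually_sequentially)
 then show ?thesis using that[of "seq n"] seq(1) by simp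
qed

lemma sum_E_tail_chi: assumes "0 < e"
 obtains C where "\<And>n. (\<Sum>i<n. E (tail (n - i))) \<le> real n * (chi + e) + C"
proof -
 obtain \<eta> where \<eta>: "0 < \<eta>" "E \<eta> \<le> chi + e" by (rule E_close[OF assms])
 obtain C where C: "\<And>n. (\<Sum>i<n. E (tail (n - i))) \<le> real n * E \<eta> + C" by (rule sum_E_tail[OF \<eta>(1)]) blast
 have "(\<Sum>i<n. E (tail (n - i))) \<le> real n * (chi + e) + C" for n
  using C[of n] mult_left_mono[OF \<eta>(2), of "real n"] by linarith
 then show ?thesis by (rule that)
qed

lemma lyapunov_eq: "lyapunov f \<nu> = ereal chi"
proof -
 define g where "g x = (if D x = 0 then -\<infinity> else ereal (ln (D x)))" for x
 have ae: "AE x in \<nu>. g x = ereal (ln (D x))" using AE_D_pos by eventually_elim (simp add: g_def)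
 have 1: "(\<integral>\<^sup>+x. e2ennreal (g x) \<partial>\<nu>) = (\<integral>\<^sup>+x. ennreal (ln (D x)) \<partial>\<nu>)"
  by (rule nn_integral_cong_AE) (use ae in eventually_elim, simp add: ennreal.rep_eq e2ennreal_ereal)
 have 2: "(\<integral>\<^sup>+x. e2ennreal (- g x) \<partial>\<nu>) = (\<integral>\<^sup>+x. ennreal (- ln (D x)) \<partial>\<nu>)"
  by (rule nn_integral_cong_AE) (use ae in eventually_elim, simp add: e2ennreal_ereal)
 have fin: "(\<integral>\<^sup>+x. ennreal (ln (D x)) \<partial>\<nu>) \<noteq> \<infinity>" "(\<integral>\<^sup>+x. ennreal (- ln (D x)) \<partial>\<nu>) \<noteq> \<infinity>"
  using ln_D by (auto simp: real_integrable_def)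
 have e: "enn2ereal a = ereal (enn2real a)" if "a \<noteq> \<infinity>" for a
  using that by (cases a) auto
 have "lyapunov f \<nu> = ereal_integral \<nu> g" unfolding lyapunov_def g_def ..
 also have "... = ereal (enn2real (\<integral>\<^sup>+x. ennreal (ln (D x)) \<partial>\<nu>) - enn2real (\<integral>\<^sup>+x. ennreal (- ln (D x)) \<partial>\<nu>))"
  unfolding ereal_integral_def 1 2 using e[OF fin(1)] e[OF fin(2)] by simp
 also have "... = ereal chi" unfolding chi_def by (simp add: real_lebesgue_integral_def[OF ln_D])
 finally show ?thesis .
qed

end

section \<open>Entropy is at most dimension times exponent\<close>

lemma sum_lessThan_concat: "(\<Sum>j<a. g j) + (\<Sum>t<b. g (a + t)) = (\<Sum>t<a + b. g t :: real)" for a b :: nat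
 by (induction b) (auto simp: add.assoc[symmetric])

text \<open>Arbitrary covering sets are turned into balls centred in \<open>A\<close>. A set of
  diameter \<open>t\<close> is replaced by a ball of radius \<open>2 * t\<close> plus a positive
  padding, which is essential for one-point sets of diameter 0.\<close>

lemma hausdorff_null_cover:
 fixes A :: "rsphere set"
 assumes s: "0 < s" and null: "hausdorff_measure s A = 0" and \<theta>: "0 < \<theta>"
 obtains x :: "nat \<Rightarrow> rsphere" and r where "\<And>k. 0 < r k" "\<And>k. r k \<le> \<theta>" "\<And>k. x k \<in> A \<or> A = {}"
  "A \<subseteq> (\<Union>k. ball (x k) (r k))" "\<And>F. finite F \<Longrightarrow> (\<Sum>k\<in>F. r k powr s) \<le> 1 / 2"
proof (cases "A = {}")
 case True
 define r where "r k = min \<theta> ((1 / 4 * (1 / 2) ^ k) powr (1 / s))" for k :: nat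
 have r: "0 < r k" "r k \<le> \<theta>" for k using \<theta> by (auto simp: r_def)
 have "r k powr s \<le> 1 / 4 * (1 / 2) ^ k" for k
 proof -
  have "r k powr s \<le> ((1 / 4 * (1 / 2) ^ k) powr (1 / s)) powr s"
   using s r(1)[of k] by (intro powr_mono2) (auto simp: r_def)
  then show ?thesis using s by (simp add: powr_powr)
 qed
 note rs = this
 have "(\<Sum>k\<in>F. r k powr s) \<le> 1 / 2" if F: "finite F" for F
 proof -
  have "(\<Sum>k\<in>F. r k powr s) \<le> (\<Sum>k\<in>F. 1 / 4 * (1 / 2) ^ k)" by (intro sum_mono rs)
  also have "... \<le> (\<Sum>k. 1 / 4 * (1 / 2) ^ k)"
   by (rule sum_le_suminf[OF _ F]) (auto intro!: summable_mult summable_geometric)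
  also have "... = 1 / 2" by (subst suminf_mult) (auto simp: suminf_geometric)
  finally show ?thesis .
 qed
 then show ?thesis using that[of r "\<lambda>_. Infty"] r True by auto
next
 case ne: False
 have "hausdorff_content s (\<theta> / 4) A \<le> hausdorff_measure s A"
  unfolding hausdorff_measure_def by (rule SUP_upper) (use \<theta> in simp)
 then have c0: "hausdorff_content s (\<theta> / 4) A = 0" using null by simp
 \<comment> \<open>The covering diameters contribute at most \<open>4 powr s * e\<close>, which is
   1/4; the padding contributes the other 1/4.\<close>
 define e where "e = 1 / (4 * 4 powr s)"
 have e: "0 < e" by (simp add: e_def)
 have "hausdorff_content s (\<theta> / 4) A < ennreal e" using c0 e by simp
 then obtain C :: "nat \<Rightarrow> rsphere set" where C: "A \<subseteq> (\<Union>i. C i)" "\<And>i. diameter (C i) \<le> \<theta> / 4"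
  "(\<Sum>i. ennreal (diameter (C i) powr s)) < ennreal e"
  unfolding hausdorff_content_def INF_less_iff by auto
 have sumC: "(\<Sum>k\<in>F. diameter (C k) powr s) \<le> e" if F: "finite F" for F
 proof -
  have "ennreal (\<Sum>k\<in>F. diameter (C k) powr s) = (\<Sum>k\<in>F. ennreal (diameter (C k) powr s))" by simp
  also have "... \<le> (\<Sum>i. ennreal (diameter (C i) powr s))" by (rule sum_le_suminf) (use F in auto)
  finally have "ennreal (\<Sum>k\<in>F. diameter (C k) powr s) < ennreal e" using C(3) by (rule le_less_trans)
  then show ?thesis using e by (simp add: ennreal_less_iff sum_nonneg)
 qed
 \<comment> \<open>Chosen so that the powers of \<open>2 * \<tau> k\<close> are dominated by a
   geometric series with sum 1/4. The radius is at most \<open>4 * diameter (C k)\<close> or at most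
   \<open>2 * \<tau> k\<close>.\<close>
 define \<tau> where "\<tau> k = min (\<theta> / 4) ((1 / 8 * (1 / 2) ^ k) powr (1 / s) / 2)" for k :: nat
 have \<tau>: "0 < \<tau> k" "\<tau> k \<le> \<theta> / 4" for k using \<theta> by (auto simp: \<tau>_def)
 define r where "r k = 2 * diameter (C k) + \<tau> k" for k
 have dia: "0 \<le> diameter (C k)" for k by (rule diameter_ge_0) simp
 have r: "0 < r k" "r k \<le> \<theta>" for k
  using \<tau>[of k] C(2)[of k] dia[of k] \<theta> by (auto simp: r_def)
 define x where "x k = (if C k \<inter> A = {} then SOME a. a \<in> A else SOME a. a \<in> C k \<inter> A)" for k
 have xA: "x k \<in> A" "C k \<inter> A \<noteq> {} \<Longrightarrow> x k \<in> C k" for k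
  using some_in_eq[of A] some_in_eq[of "C k \<inter> A"] ne by (auto simp: x_def some_in_eq)
 have rs: "r k powr s \<le> 4 powr s * diameter (C k) powr s + 1 / 8 * (1 / 2) ^ k" for k
 proof (cases "\<tau> k \<le> 2 * diameter (C k)")
  case True
  have "r k powr s \<le> (4 * diameter (C k)) powr s"
   using True r(1)[of k] s by (intro powr_mono2) (auto simp: r_def)
  also have "... = 4 powr s * diameter (C k) powr s" using dia by (simp add: powr_mult)
  finally show ?thesis by (simp add: add_increasing2)
 next
  case False
  have "r k powr s \<le> (2 * \<tau> k) powr s"
   using False r(1)[of k] s by (intro powr_mono2) (auto simp: r_def)
  also have "... \<le> ((1 / 8 * (1 / 2) ^ k) powr (1 / s)) powr s"
   using \<tau>(1)[of k] s by (intro powr_mono2) (auto simp: \<tau>_def)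
  also have "... = 1 / 8 * (1 / 2) ^ k" using s by (simp add: powr_powr)
  finally show ?thesis by (simp add: add_increasing)
 qed
 show ?thesis
 proof (rule that[of r x])
  show "A \<subseteq> (\<Union>k. ball (x k) (r k))"
  proof
   fix a assume a: "a \<in> A"
   then obtain k where k: "a \<in> C k" using C(1) by blast
   then have "x k \<in> C k" using xA(2) a by blast
   then have "dist (x k) a \<le> diameter (C k)" using k by (intro diameter_bounded_bound) auto
   then have "dist (x k) a < r k" using \<tau>(1)[of k] dia[of k] by (simp add: r_def)
   then show "a \<in> (\<Union>k. ball (x k) (r k))" by auto
  qed
  fix F :: "nat set" assume F: "finite F"
  have "(\<Sum>k\<in>F. r k powr s) \<le> (\<Sum>k\<in>F. 4 powr s * diameter (C k) powr s + 1 / 8 * (1 / 2) ^ k)" by (intro sum_mono rs)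
  also have "... = 4 powr s * (\<Sum>k\<in>F. diameter (C k) powr s) + (\<Sum>k\<in>F. 1 / 8 * (1 / 2) ^ k)"
   by (simp add: sum.distrib sum_distrib_left)
  also have "... \<le> 4 powr s * e + 1 / 4"
  proof (rule add_mono)
   show "4 powr s * (\<Sum>k\<in>F. diameter (C k) powr s) \<le> 4 powr s * e" by (intro mult_left_mono sumC F) auto
   have "(\<Sum>k\<in>F. 1 / 8 * (1 / 2) ^ k) \<le> (\<Sum>k. 1 / 8 * (1 / 2) ^ k :: real)"
    by (rule sum_le_suminf[OF _ F]) (auto intro!: summable_mult summable_geometric)
   also have "... = 1 / 4" by (subst suminf_mult) (auto simp: suminf_geometric)
   finally show "(\<Sum>k\<in>F. 1 / 8 * (1 / 2) ^ k) \<le> (1 / 4 :: real)" .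
  qed
  also have "... = 1 / 2" by (simp add: e_def)
  finally show "(\<Sum>k\<in>F. r k powr s) \<le> 1 / 2" .
 qed (use r xA in auto)
qed

context julia_measure
begin

text \<open>Each ball of a fine Hausdorff cover is followed until it first escapes to scale
  \<open>r1\<close>. By then its radius has been stretched by roughly the derivative along the
  orbit, so the weight \<open>r powr s\<close> costs about \<open>s\<close> times the sum of
  \<open>ln D\<close>. Longer orbits are coded by concatenating balls. Since the weights of all
  balls sum to at most 1/2, the words of length \<open>n\<close> weigh at most
  \<open>(1 / 2) ^ n\<close>.\<close>

lemma entropy_le_dimension_aux:
 assumes s: "0 < s" and null: "hausdorff_measure s J = 0" and P: "part P" and eps: "0 < eps"
 shows "ent P \<le> s * chi + (2 * s + 2) * eps"
proof -
 obtain h where h: "0 < h" "E h \<le> chi + eps" by (rule E_close[OF eps])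
 obtain kh where kh: "\<And>m. kh \<le> m \<Longrightarrow> tail m < h" by (rule tail_small[OF h(1)]) blast
 obtain \<delta> C where \<delta>: "0 < \<delta>" and C: "0 \<le> C" and cover:
  "\<And>n (I :: nat list set) V w G K. \<lbrakk>finite I; \<And>i. i \<in> I \<Longrightarrow> 0 \<le> w i; sum w I \<le> 1; integrable \<nu> G;
   AE x in \<nu>. \<exists>i\<in>I. x \<in> V i \<and> 0 < w i \<and> - ln (w i) \<le> G x;
   \<And>i. i \<in> I \<Longrightarrow> card {j\<in>{..<n}. \<exists>u\<in>V i. \<exists>v\<in>V i. \<delta> \<le> dist (fn j u) (fn j v)} \<le> K\<rbrakk> \<Longrightarrow>
   partition_entropy \<nu> (join P n) \<le> (\<integral>x. G x \<partial>\<nu>) + real n * eps + C * real K"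
  by (rule cover_bound[OF P eps]) blast
 obtain k\<delta> where k\<delta>: "\<And>m. k\<delta> \<le> m \<Longrightarrow> 4 / lam ^ m < \<delta>" by (rule lam_small[OF \<delta>]) blast
 \<comment> \<open>One more iterate multiplies distances by at most \<open>L\<close>, so at the
   escape time the image still lies in a ball of radius \<open>r0\<close> and
   \<open>shrink_mid\<close> applies.\<close>
 define r1 where "r1 = r0 / (2 * L)"
 have r1: "0 < r1" "L * r1 < r0" "r1 < r0"
  using r0 L(1) by (auto simp: r1_def field_simps)
 define A where "A = real kh * (\<bar>ln (L + 4 * M)\<bar> + \<bar>ln h\<bar>) + \<bar>ln r1\<bar>"
 have A: "0 \<le> A" by (simp add: A_def)
 \<comment> \<open>A lower bound for block lengths. It makes the fixed cost of a block, and the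
   price of its bad times, at most \<open>eps\<close> per unit of time.\<close>
 obtain N0 :: nat where N0: "real N0 > A / eps" "real N0 > C * real k\<delta> / eps" "N0 > 0"
 proof -
  obtain N1 :: nat where "real N1 > max (A / eps) (C * real k\<delta> / eps)" using reals_Archimedean2 by blast
  then show ?thesis using that[of "Suc N1"] by simp
 qed
 \<comment> \<open>A ball of radius at most \<theta> cannot grow to scale \<open>r1\<close> within
   \<open>N0\<close> steps.\<close>
 define \<theta> where "\<theta> = r1 / (L ^ N0)"
 have \<theta>: "0 < \<theta>" "L ^ N0 * \<theta> = r1" using r1 L(1) by (auto simp: \<theta>_def)
 obtain x r where xr: "\<And>k. 0 < r k" "\<And>k. r k \<le> \<theta>" "\<And>k. x k \<in> J \<or> J = {}"
  "J \<subseteq> (\<Union>k::nat. ball (x k) (r k))" "\<And>F. finite F \<Longrightarrow> (\<Sum>k\<in>F. r k powr s) \<le> 1 / 2"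
  by (rule hausdorff_null_cover[OF s null \<theta>(1)]) blast
 have "J \<noteq> {}"
 using AE_J by auto
 then have xJ: "x k \<in> J" for k using xr(3) by blast
 obtain I where I: "finite I" "J \<subseteq> (\<Union>k\<in>I. ball (x k) (r k))"
  using compactE_image[OF compact_J, of UNIV "\<lambda>k. ball (x k) (r k)"] xr(4) by auto
 define B where "B k = ball (x k) (r k)" for k
 have "L ^ N0 \<ge> 1" using L(1) by simp
 then have "1 * \<theta> \<le> L ^ N0 * \<theta>" using \<theta>(1) by (intro mult_right_mono) auto
 then have r_small: "r k \<le> 1 / 2" for k using xr(2)[of k] \<theta>(2) r1 r0 by simp
 have Bconn: "connected (B k)" for k unfolding B_def by (rule connected_ball_rsphere[OF r_small])
 have "\<exists>m. \<not> fn m ` B k \<subseteq> ball (fn m (x k)) r1" for k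
 proof -
  obtain m where m: "4 / lam ^ m < r k" using lam_small[OF xr(1)] by blast
  obtain y where y: "y \<in> ball (fn m (x k)) r0" "r1 \<le> dist (fn m (x k)) y"
   by (rule rsphere_point_at[OF r1(3), of "fn m (x k)"]) (use r0 in auto)
  have "y \<in> fn m ` B k" using expand[OF xJ[of k] m] y(1) unfolding B_def by blast
  then show ?thesis using y(2) by (intro exI[of _ m]) auto
 qed
 note ex = this
 define nn where "nn k = (LEAST m. \<not> fn m ` B k \<subseteq> ball (fn m (x k)) r1)" for k
 have nn1: "\<not> (f ^^ nn k) ` B k \<subseteq> ball ((f ^^ nn k) (x k)) r1" for k
  unfolding nn_def by (rule LeastI_ex[OF ex])
 have nn2: "fn m ` B k \<subseteq> ball (fn m (x k)) r1" if "m < nn k" for m k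
  using not_less_Least[OF that[unfolded nn_def]] by simp
 have nnN: "N0 < nn k" for k
 proof (rule ccontr)
  assume "\<not> N0 < nn k"
  then have le: "nn k \<le> N0" by simp
  have "(f ^^ nn k) ` B k \<subseteq> ball ((f ^^ nn k) (x k)) r1"
  proof (safe, unfold mem_ball)
   fix u assume u: "u \<in> B k"
   have "dist ((f ^^ nn k) (x k)) ((f ^^ nn k) u) \<le> L ^ nn k * dist (x k) u" by (rule dist_pow_le)
   also have "... \<le> L ^ N0 * dist (x k) u" using le L(1) by (intro mult_right_mono power_increasing) auto
   also have "... < L ^ N0 * r k" using u L(1) by (intro mult_strict_left_mono) (auto simp: B_def)
   also have "... \<le> L ^ N0 * \<theta>" using xr(2) L(1) by (intro mult_left_mono) auto
   finally show "dist ((f ^^ nn k) (x k)) ((f ^^ nn k) u) < r1" using \<theta>(2) by simp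
  qed
  then show False using nn1 by blast
 qed
 have nn3: "(f ^^ nn k) ` B k \<subseteq> ball ((f ^^ nn k) (x k)) r0" for k
 proof (safe, unfold mem_ball)
  fix u assume u: "u \<in> B k"
  obtain m where m: "nn k = Suc m" using nnN[of k] by (cases "nn k") auto
  have "dist ((f ^^ nn k) (x k)) ((f ^^ nn k) u) \<le> L * dist (fn m (x k)) (fn m u)" unfolding m using L(3) by simp
  also have "dist (fn m (x k)) (fn m u) < r1" using nn2[of m k] m u by auto
  then have "L * dist (fn m (x k)) (fn m u) \<le> L * r1" using L(1) by (intro mult_left_mono) auto
  finally show "dist ((f ^^ nn k) (x k)) ((f ^^ nn k) u) < r0" using r1 by simp
 qed
 define c1 where "c1 = \<bar>ln (L + 4 * M)\<bar> + \<bar>ln h\<bar>"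
 have word_cost: "- ln (r k) \<le> (\<Sum>j<nn k. le h (fn j z) + eps)" if z: "z \<in> B k" for k z
 proof -
  define n where "n = nn k"
  obtain u where u: "u \<in> B k" "r1 \<le> dist (fn n (x k)) (fn n u)"
   using nn1[of k] unfolding n_def image_subset_iff mem_ball by (meson not_less)
  have xB: "x k \<in> B k" using xr(1) by (simp add: B_def)
  define Q where "Q = (\<Prod>j<n. D (fn j z) + tail (n - j))"
  have pos: "0 < D (fn j z) + tail (n - j)" for j using D_nonneg tail(1) by (intro add_nonneg_pos)
  have Q0: "0 < Q" unfolding Q_def by (intro prod_pos) (use pos in auto)
  have "r1 \<le> Q * dist (x k) u"
   using expansion_upper[OF J_pow[OF xJ] Bconn nn3 z xB u(1) order_refl] u(2) unfolding Q_def n_def by linarith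
  also have "... \<le> Q * r k" using u(1) Q0 by (intro mult_left_mono) (auto simp: B_def)
  finally have "ln r1 \<le> ln (Q * r k)" using r1 by (intro ln_mono) auto
  then have "- ln (r k) \<le> ln Q - ln r1" using Q0 xr(1)[of k] by (simp add: ln_mult)
  also have "ln Q = (\<Sum>j<n. le (tail (n - j)) (fn j z))"
   unfolding Q_def le_def by (rule ln_prod) (use pos in \<open>auto simp: less_le\<close>)
  also have "... \<le> (\<Sum>j<n. le h (fn j z) + (if n - j < kh then c1 else 0))"
  proof (rule sum_mono)
   fix j
   show "le (tail (n - j)) (fn j z) \<le> le h (fn j z) + (if n - j < kh then c1 else 0)"
   proof (cases "n - j < kh")
    case True
    have "le (tail (n - j)) (fn j z) \<le> ln (L + tail (n - j))" by (rule le_bounds(2)[OF tail(1)])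
    also have "... \<le> ln (L + 4 * M)" using tail(1,2)[of "n - j"] L(1) by (intro ln_mono) auto
    finally show ?thesis using True le_bounds(1)[OF h(1), of "fn j z"] by (simp add: c1_def)
   next
    case False
    then show ?thesis using le_mono[OF tail(1) less_imp_le[OF kh]] by simp
   qed
  qed
  also have "... = (\<Sum>j<n. le h (fn j z)) + real (card {j\<in>{..<n}. n - j < kh}) * c1"
   by (simp add: sum.distrib sum.If_cases Int_def)
  also have "card {j\<in>{..<n}. n - j < kh} \<le> card {n - kh..<n}" by (rule card_mono) auto
  then have "real (card {j\<in>{..<n}. n - j < kh}) * c1 \<le> real kh * c1"
   by (intro mult_right_mono) (auto simp: c1_def)
  finally have "- ln (r k) \<le> (\<Sum>j<n. le h (fn j z)) + A" by (simp add: A_def c1_def)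
  also have "A \<le> real n * eps"
  proof -
   have "A \<le> real N0 * eps" using N0(1) eps by (simp add: field_simps)
   also have "... \<le> real n * eps" using nnN[of k] eps by (intro mult_right_mono) (auto simp: n_def)
   finally show ?thesis .
  qed
  finally show ?thesis by (simp add: sum.distrib n_def)
 qed
 \<comment> \<open>The points whose orbit enters the listed balls successively, each at the escape
   time of the preceding one.\<close>
 define V where "V = rec_list UNIV (\<lambda>k _ W. B k \<inter> (f ^^ nn k) -` W)"
 have V: "V [] = UNIV" "\<And>k ks. V (k # ks) = B k \<inter> (f ^^ nn k) -` V ks" by (simp_all add: V_def)
 define T where "T ks = sum_list (map nn ks)" for ks
 define w where "w ks = prod_list (map (\<lambda>k. r k powr s) ks)" for ks
 have w0: "0 < w ks" for ks by (induction ks) (use xr(1) in \<open>auto simp: w_def less_imp_neq[symmetric]\<close>)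
 have wcost: "- ln (w ks) \<le> s * (\<Sum>t<T ks. le h (fn t z) + eps)" if "z \<in> V ks" for ks z
  using that
 proof (induction ks arbitrary: z)
  case (Cons k ks)
  then have z: "z \<in> B k" "(f ^^ nn k) z \<in> V ks" by (auto simp: V)
  have "- ln (w (k # ks)) = s * (- ln (r k)) + - ln (w ks)"
   using xr(1)[of k] w0[of ks] by (simp add: w_def ln_mult ln_powr)
  also have "... \<le> s * (\<Sum>j<nn k. le h (fn j z) + eps) + s * (\<Sum>t<T ks. le h (fn t ((f ^^ nn k) z)) + eps)"
   using Cons.IH[OF z(2)] word_cost[OF z(1)] s by (intro add_mono mult_left_mono) auto
  also have "... = s * ((\<Sum>j<nn k. le h (fn j z) + eps) + (\<Sum>t<T ks. le h (fn (nn k + t) z) + eps))"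
   by (simp add: distrib_left funpow_add add.commute[of "nn k"])
  also have "(\<Sum>j<nn k. le h (fn j z) + eps) + (\<Sum>t<T ks. le h (fn (nn k + t) z) + eps) = (\<Sum>t<nn k + T ks. le h (fn t z) + eps)"
   by (rule sum_lessThan_concat)
  finally show ?case by (simp add: T_def)
 qed (simp add: w_def T_def)
 \<comment> \<open>Inside a block the image has diameter at least \<delta> only during the last
   \<open>k\<delta>\<close> steps before escape, so bad times are counted by the number of
   blocks.\<close>
 have bad: "card {j\<in>{..<T ks}. \<exists>u\<in>V ks. \<exists>v\<in>V ks. \<delta> \<le> dist (fn j u) (fn j v)} \<le> k\<delta> * length ks" for ks
 proof (induction ks)
  case (Cons k ks)
  define bd where "bd ks = {j\<in>{..<T ks}. \<exists>u\<in>V ks. \<exists>v\<in>V ks. \<delta> \<le> dist (fn j u) (fn j v)}" for ks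
  have "bd (k # ks) \<subseteq> {nn k - k\<delta>..<nn k} \<union> (\<lambda>j. nn k + j) ` bd ks"
  proof
   fix j assume "j \<in> bd (k # ks)"
   then obtain u v where uv: "u \<in> V (k # ks)" "v \<in> V (k # ks)" "\<delta> \<le> dist (fn j u) (fn j v)" and j: "j < nn k + T ks"
    by (auto simp: bd_def T_def)
   show "j \<in> {nn k - k\<delta>..<nn k} \<union> (\<lambda>j. nn k + j) ` bd ks"
   proof (cases "j < nn k")
    case True
    have "dist (fn j u) (fn j v) \<le> 4 / lam ^ (nn k - j)"
     by (rule shrink_mid[OF J_pow[OF xJ] Bconn nn3]) (use uv True in \<open>auto simp: V\<close>)
    then have "nn k - j < k\<delta>" using k\<delta>[of "nn k - j"] uv(3) by (metis not_le order.strict_trans2)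
    then show ?thesis using True by auto
   next
    case False
    define i where "i = j - nn k"
    have ji: "j = nn k + i" using False by (simp add: i_def)
    have "fn j y = fn i ((f ^^ nn k) y)" for y by (simp add: ji funpow_add add.commute[of "nn k"])
    then have "i \<in> bd ks" using uv j ji by (auto simp: bd_def V)
    then show ?thesis using ji by simp
   qed
  qed
  then have "card (bd (k # ks)) \<le> card ({nn k - k\<delta>..<nn k} \<union> (\<lambda>j. nn k + j) ` bd ks)"
   by (rule card_mono[rotated]) (auto simp: bd_def)
  also have "... \<le> card {nn k - k\<delta>..<nn k} + card ((\<lambda>j. nn k + j) ` bd ks)" by (rule card_Un_le)
  also have "... \<le> k\<delta> + card (bd ks)" by (intro add_mono card_image_le) (auto simp: bd_def)
  also have "... \<le> k\<delta> + k\<delta> * length ks" using Cons by (simp add: bd_def)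
  finally show ?case by (simp add: bd_def)
 qed (simp add: T_def)
 define nmax where "nmax = Max (nn ` I)"
 have nmax: "nn k \<le> nmax" if "k \<in> I" for k using that I(1) by (simp add: nmax_def)
 \<comment> \<open>Cut the orbit greedily until time \<open>N\<close> is reached. Blocks are longer
   than \<open>N0\<close>, which bounds their number, and the last one overshoots by at most
   \<open>nmax\<close>.\<close>
 have parse: "\<exists>ks\<in>lists I. z \<in> V ks \<and> N \<le> T ks \<and> T ks \<le> N + nmax \<and> length ks \<le> N div N0 + 1 \<and> ks \<noteq> []" if "z \<in> J" for N z
  using that
 proof (induction N arbitrary: z rule: less_induct)
  case (less N)
  obtain k where k: "k \<in> I" "z \<in> B k" using I(2) less.prems by (auto simp: B_def)
  show ?case
  proof (cases "N \<le> nn k")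
   case True
   then show ?thesis using k nmax[OF k(1)] by (intro bexI[of _ "[k]"]) (auto simp: V T_def)
  next
   case False
   have "N - nn k < N" using nnN[of k] False by simp
   from less.IH[OF this J_pow[OF less.prems, of "nn k"]] obtain ks where ks: "ks \<in> lists I" "(f ^^ nn k) z \<in> V ks"
    "N - nn k \<le> T ks" "T ks \<le> N - nn k + nmax" "length ks \<le> (N - nn k) div N0 + 1" by blast
   have "(N - nn k) div N0 \<le> (N - N0) div N0" using nnN[of k] by (intro div_le_mono) simp
   moreover have "N div N0 = Suc ((N - N0) div N0)"
    using False nnN[of k] N0(3) by (intro le_div_geq) auto
   ultimately have "length ks + 1 \<le> N div N0 + 1" using ks(5) by linarith
   then show ?thesis using ks k False by (intro bexI[of _ "k # ks"]) (auto simp: V T_def)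
  qed
 qed
 define Wd where "Wd N = {ks \<in> lists I. length ks \<le> N div N0 + 1 \<and> ks \<noteq> [] \<and> N \<le> T ks}" for N
 have finW: "finite {ks \<in> lists I. length ks \<le> K}" for K
  using finite_lists_length_le[OF I(1), of K] by (simp add: lists_eq_set Collect_conj_eq[symmetric])
 have lensum: "(\<Sum>ks\<in>{ks \<in> lists I. length ks = n}. w ks) \<le> (1 / 2) ^ n" for n
 proof (induction n)
  case 0
  have "{ks \<in> lists I. length ks = 0} = {[]}" by auto
  then show ?case by (simp add: w_def)
 next
  case (Suc n)
  have eq: "{ks \<in> lists I. length ks = Suc n} = (\<lambda>(k, ks). k # ks) ` (I \<times> {ks \<in> lists I. length ks = n})"
   by (auto simp: length_Suc_conv image_iff)
  have "(\<Sum>ks\<in>{ks \<in> lists I. length ks = Suc n}. w ks) = (\<Sum>(k, ks)\<in>I \<times> {ks \<in> lists I. length ks = n}. r k powr s * w ks)"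
   unfolding eq by (subst sum.reindex) (auto simp: inj_on_def w_def case_prod_unfold)
  also have "... = (\<Sum>k\<in>I. r k powr s) * (\<Sum>ks\<in>{ks \<in> lists I. length ks = n}. w ks)"
   by (simp add: sum_product sum.cartesian_product)
  also have "... \<le> (1 / 2) * (1 / 2) ^ n"
   by (rule mult_mono[OF xr(5)[OF I(1)] Suc]) (auto intro: sum_nonneg less_imp_le[OF w0])
  finally show ?case by simp
 qed
 \<comment> \<open>The list is nonempty, so the geometric series starts at length 1 and its sum
   stays below 1.\<close>
 have wsum: "sum w (Wd N) \<le> 1" for N
 proof -
  define K where "K = N div N0 + 1"
  have "sum w (Wd N) \<le> sum w (\<Union>n\<in>{1..K}. {ks \<in> lists I. length ks = n})"
  proof (rule sum_mono2)
   show "finite (\<Union>n\<in>{1..K}. {ks \<in> lists I. length ks = n})"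
    by (rule finite_subset[OF _ finW[of K]]) auto
   show "Wd N \<subseteq> (\<Union>n\<in>{1..K}. {ks \<in> lists I. length ks = n})" by (auto simp: Wd_def K_def Suc_le_eq)
  qed (use w0 in \<open>auto intro: less_imp_le\<close>)
  also have "... = (\<Sum>n\<in>{1..K}. \<Sum>ks\<in>{ks \<in> lists I. length ks = n}. w ks)"
   by (rule sum.UNION_disjoint) (auto intro: finite_subset[OF _ finW])
  also have "... \<le> (\<Sum>n\<in>{1..K}. (1 / 2) ^ n)" by (intro sum_mono lensum)
  also have "... \<le> 1"
  proof -
   have "(\<Sum>n\<in>{1..K}. (1 / 2 :: real) ^ n) = 1 - (1 / 2) ^ K" by (induction K) auto
   then show ?thesis by simp
  qed
  finally show ?thesis .
 qed
 \<comment> \<open>The price per step of the overshoot beyond \<open>N\<close>, which takes at most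
   \<open>nmax\<close> steps.\<close>
 define c3 where "c3 = \<bar>ln (L + h)\<bar> + eps"
 define H where "H N z = s * ((\<Sum>t<N. le h (fn t z) + eps) + real nmax * c3)" for N z
 have intH: "integrable \<nu> (H N)" for N
  unfolding H_def by (intro integrable_mult_right Bochner_Integration.integrable_add Bochner_Integration.integrable_sum le_int_pow h) auto
 have bound: "partition_entropy \<nu> (join P N) \<le> (\<integral>z. H N z \<partial>\<nu>) + real N * eps + C * real (k\<delta> * (N div N0 + 1))" for N
 proof (rule cover[of "Wd N" w "H N" V])
  show "finite (Wd N)" by (rule finite_subset[OF _ finW[of "N div N0 + 1"]]) (auto simp: Wd_def)
  show "AE z in \<nu>. \<exists>ks\<in>Wd N. z \<in> V ks \<and> 0 < w ks \<and> - ln (w ks) \<le> H N z"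
   using AE_J
  proof eventually_elim
   case (elim z)
   from parse[OF this, of N] obtain ks where ks: "ks \<in> lists I" "z \<in> V ks" "N \<le> T ks" "T ks \<le> N + nmax" "length ks \<le> N div N0 + 1" "ks \<noteq> []" by blast
   have "(\<Sum>t<T ks. le h (fn t z) + eps) = (\<Sum>t<N. le h (fn t z) + eps) + (\<Sum>t\<in>{N..<T ks}. le h (fn t z) + eps)"
    using sum.atLeastLessThan_concat[of 0 N "T ks" "\<lambda>t. le h (fn t z) + eps"] ks(3) by (simp add: atLeast0LessThan)
   also have "(\<Sum>t\<in>{N..<T ks}. le h (fn t z) + eps) \<le> (\<Sum>t\<in>{N..<T ks}. c3)"
   proof (rule sum_mono)
    fix t show "le h (fn t z) + eps \<le> c3"
     using le_bounds(2)[OF h(1), of "fn t z"] unfolding c3_def by linarith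
   qed
   also have "... \<le> real nmax * c3" using ks(3,4) eps by (auto simp: c3_def intro!: mult_right_mono)
   finally have "s * (\<Sum>t<T ks. le h (fn t z) + eps) \<le> H N z" unfolding H_def using s by (intro mult_left_mono) auto
   with wcost[OF ks(2)] have "- ln (w ks) \<le> H N z" by linarith
   with ks w0 show ?case by (auto simp: Wd_def)
  qed
  fix ks assume ks: "ks \<in> Wd N"
  have "card {j\<in>{..<N}. \<exists>u\<in>V ks. \<exists>v\<in>V ks. \<delta> \<le> dist (fn j u) (fn j v)} \<le>
    card {j\<in>{..<T ks}. \<exists>u\<in>V ks. \<exists>v\<in>V ks. \<delta> \<le> dist (fn j u) (fn j v)}"
   by (rule card_mono) (use ks in \<open>auto simp: Wd_def\<close>)
  also have "... \<le> k\<delta> * length ks" by (rule bad)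
  also have "... \<le> k\<delta> * (N div N0 + 1)" using ks by (intro mult_left_mono) (auto simp: Wd_def)
  finally show "card {j\<in>{..<N}. \<exists>u\<in>V ks. \<exists>v\<in>V ks. \<delta> \<le> dist (fn j u) (fn j v)} \<le> k\<delta> * (N div N0 + 1)" .
 qed (use w0 wsum intH in \<open>auto intro: less_imp_le\<close>)
 have EH: "(\<integral>z. H N z \<partial>\<nu>) = s * (real N * (E h + eps) + real nmax * c3)" for N
  unfolding H_def using le_int_pow[OF h(1)] by (simp add: Bochner_Integration.integral_sum E_pow)
 have entN: "real N * ent P \<le> partition_entropy \<nu> (join P N)" for N
 proof (cases "N = 0")
  case False then show ?thesis using ent(2)[OF P, of N] by (simp add: field_simps)
 qed (use entropy_nonneg[OF part_join[OF P]] in simp)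
 show ?thesis
 proof (rule le_of_linear_le)
  fix N :: nat
  have "C * real (k\<delta> * (N div N0 + 1)) = (C * real k\<delta>) * real (N div N0) + C * real k\<delta>"
   by (simp add: algebra_simps)
  also have "(C * real k\<delta>) * real (N div N0) \<le> (real N0 * eps) * real (N div N0)"
   using N0(2) eps by (intro mult_right_mono) (auto simp: field_simps)
  also have "... = real (N0 * (N div N0)) * eps" by simp
  also have "... \<le> real N * eps" using eps by (intro mult_right_mono) (auto simp del: of_nat_mult simp: times_div_less_eq_dividend)
  finally have 1: "C * real (k\<delta> * (N div N0 + 1)) \<le> real N * eps + C * real k\<delta>" by simp
  have "real N * E h \<le> real N * (chi + eps)" using h(2) by (intro mult_left_mono) auto
  then have 2: "s * (real N * (E h + eps) + real nmax * c3) \<le> s * (real N * (chi + eps + eps) + real nmax * c3)"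
   using s by (intro mult_left_mono) (auto simp: algebra_simps)
  have "real N * ent P \<le> s * (real N * (chi + eps + eps) + real nmax * c3) + real N * eps + (real N * eps + C * real k\<delta>)"
   using entN[of N] bound[of N] EH[of N] 1 2 by linarith
  then show "real N * ent P \<le> real N * (s * chi + (2 * s + 2) * eps) + (s * (real nmax * c3) + C * real k\<delta>)"
   by (simp add: algebra_simps)
 qed
qed

lemma entropy_le_dimension:
 assumes s: "0 < s" and null: "hausdorff_measure s J = 0"
 shows "metric_entropy \<nu> f \<le> ereal (s * chi)"
proof (rule metric_entropy_le)
 fix P assume P: "part P"
 show "ent P \<le> s * chi"
  by (rule le_of_eps[of _ _ "2 * s + 2"]) (use entropy_le_dimension_aux[OF s null P] s in auto)
qed

end

section \<open>Change of variables for conformal measures\<close>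

context rational
begin

section \<open>Injectivity away from critical points\<close>

definition crit where "crit = {x. D x = 0}"

lemma finite_crit': "finite crit" using finite_crit by (simp add: crit_def)

lemma inj_ball: "\<rho> \<le> D x / (2 * M) \<Longrightarrow> inj_on f (ball x \<rho>)"
proof (rule inj_onI, rule ccontr)
 fix u v assume \<rho>: "\<rho> \<le> D x / (2 * M)" and uv: "u \<in> ball x \<rho>" "v \<in> ball x \<rho>" "f u = f v" "u \<noteq> v"
 have "(D x - M * \<rho>) * dist u v \<le> dist (f u) (f v)"
  by (rule dist_f_lower) (use uv in \<open>auto simp: dist_commute\<close>)
 moreover have "0 < \<rho>" using uv(1) by (metis mem_ball not_less order.strict_trans1 zero_le_dist)
 moreover have "2 * (M * \<rho>) \<le> D x" using \<rho> M(1) by (simp add: field_simps)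
 moreover have "0 < M * \<rho>" using M(1) \<open>0 < \<rho>\<close> by simp
 ultimately have "0 < D x - M * \<rho>" "(D x - M * \<rho>) * dist u v \<le> 0" using uv(3) by auto
 then show False using uv(4) by (simp add: mult_le_0_iff)
qed

text \<open>Injectivity on \<open>B\<close> lets the image commute with complements relative to
  \<open>B\<close>, so induction over the sigma-algebra goes through from the open sets, whose
  images are open.\<close>

lemma image_borel:
 assumes B: "open B" "inj_on f B" and A: "A \<in> sets borel" shows "f ` (A \<inter> B) \<in> sets borel"
proof -
 have "A \<in> sigma_sets UNIV {S. open S}" using A by (simp add: borel_def)
 then show ?thesis
 proof induction
  case (Basic a) then show ?case using B by (intro borel_open open_map open_Int) auto
 next
  case (Compl a)
  have "f ` ((UNIV - a) \<inter> B) = f ` B - f ` (a \<inter> B)" using B(2) by (auto simp: inj_on_def)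
  then show ?case using Compl open_map[OF B(1)] by auto
 next
  case (Union a)
  have "f ` (\<Union> (range a) \<inter> B) = (\<Union>i. f ` (a i \<inter> B))" by auto
  then show ?case using Union by auto
 qed simp
qed

text \<open>Every noncritical point has a ball on which \<open>f\<close> is injective. The Lindelof
  property leaves countably many, and they are made disjoint.\<close>

lemma injective_pieces:
 obtains U :: "nat \<Rightarrow> rsphere set" and B :: "nat \<Rightarrow> rsphere set"
 where "\<And>k. U k \<in> sets borel" "\<And>k. U k \<subseteq> B k" "\<And>k. open (B k)" "\<And>k. inj_on f (B k)"
  "disjoint_family U" "(\<Union>k. U k) = - crit"
proof -
 define F where "F = (\<lambda>x. ball x (D x / (2 * M))) ` (- crit)"
 have "\<And>S. S \<in> F \<Longrightarrow> open S" by (auto simp: F_def)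
 then obtain F' where F': "F' \<subseteq> F" "countable F'" "\<Union>F' = \<Union>F" by (rule Lindelof) blast
 define B where "B = (\<lambda>k. from_nat_into (insert {} F') k)"
 have rB: "range B = insert {} F'" unfolding B_def using F'(2) by (intro range_from_nat_into) auto
 have B: "open (B k)" "inj_on f (B k)" for k
 proof -
  have "B k \<in> insert {} F'" using rB by blast
  then have "B k = {} \<or> B k \<in> F" using F'(1) by blast
  then show "open (B k)" "inj_on f (B k)" using inj_ball by (auto simp: F_def)
 qed
 have cov: "- crit \<subseteq> (\<Union>k. B k)"
 proof
  fix x assume x: "x \<in> - crit"
  then have "0 < D x" using D_nonneg[of x] by (auto simp: crit_def less_le)
  then have "x \<in> ball x (D x / (2 * M))" using M(1) by simp
  then have "x \<in> \<Union>F" using x unfolding F_def by blast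
  then show "x \<in> (\<Union>k. B k)" using F'(3) rB by auto
 qed
 define U where "U k = disjointed B k - crit" for k
 have crit_b: "crit \<in> sets borel" using finite_crit' by (intro borel_closed finite_imp_closed)
 have "range B \<subseteq> sets borel" using B(1) by auto
 then have dB: "disjointed B k \<in> sets borel" for k using sets.range_disjointed_sets by blast
 show ?thesis
 proof (rule that[of U B])
  show "U k \<in> sets borel" for k using dB crit_b by (auto simp: U_def)
  show "U k \<subseteq> B k" for k using disjointed_subset[of B k] by (auto simp: U_def)
  show "disjoint_family U" using disjoint_family_disjointed[of B] by (fastforce simp: disjoint_family_on_def U_def)
  show "(\<Union>k. U k) = - crit" using UN_disjointed_eq[of B] cov by (auto simp: U_def)
 qed (use B in auto)
qed

definition Dn where "Dn n x = (\<Prod>j<n. D (fn j x))"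

lemma Dn_eq: "Dn n x = sph_deriv (fn n) x" by (simp add: Dn_def sph_deriv_funpow[OF hol])

lemma Dn_nonneg: "0 \<le> Dn n x" unfolding Dn_def by (intro prod_nonneg) (use D_nonneg in auto)

lemma Dn_Suc: "Dn (Suc n) x = D (fn n x) * Dn n x" by (simp add: Dn_def)

lemma meas_f' [measurable]: "f \<in> borel_measurable borel" using cont by (rule borel_measurable_continuous_onI)

lemma meas_pow' [measurable]: "fn n \<in> borel_measurable borel" using cont_pow by (rule borel_measurable_continuous_onI)

lemma D_meas' [measurable]: "D \<in> borel_measurable borel"
 by (rule borel_measurable_continuous_onI[OF D_cont])

lemma Dn_meas [measurable]: "Dn n \<in> borel_measurable borel"
 unfolding Dn_def by measurable

end

locale conformal = tce_map f d for f d +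
 fixes \<mu> :: "rsphere measure" and \<alpha> :: real
 assumes conf: "conformal_measure f \<alpha> \<mu>" and prob: "prob_space \<mu>"
begin

lemma \<alpha>: "0 < \<alpha>" and sets_mu [measurable_cong, simp]: "sets \<mu> = sets borel"
 and conf_eq: "\<And>U. U \<in> sets borel \<Longrightarrow> inj_on f U \<Longrightarrow> emeasure \<mu> (f ` U) = (\<integral>\<^sup>+x\<in>U. ennreal (D x powr \<alpha>) \<partial>\<mu>)"
 using conf by (auto simp: conformal_measure_def)

lemma space_mu [simp]: "space \<mu> = UNIV" using sets_eq_imp_space_eq[OF sets_mu] by simp

sublocale P: prob_space \<mu> by (rule prob)

text \<open>Conformality applied to a one-point set: where the derivative vanishes, the image point
  has mass 0.\<close>

lemma fcrit_null: "emeasure \<mu> (f ` X) = 0" if "X \<subseteq> crit"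
proof -
 have fin: "finite X" using that finite_crit' finite_subset by blast
 have "emeasure \<mu> {f x} = 0" if "x \<in> X" for x
 proof -
  have "emeasure \<mu> (f ` {x}) = (\<integral>\<^sup>+y\<in>{x}. ennreal (D y powr \<alpha>) \<partial>\<mu>)" by (rule conf_eq) auto
  also have "... = (\<integral>\<^sup>+y. 0 \<partial>\<mu>)"
   by (rule nn_integral_cong) (use that \<open>X \<subseteq> crit\<close> \<alpha> in \<open>auto simp: crit_def indicator_def\<close>)
  finally show ?thesis by simp
 qed
 then have "(\<Union>x\<in>X. {f x}) \<in> null_sets \<mu>"
  using fin by (intro null_sets_UN') (auto simp: countable_finite null_sets_def)
 then have "emeasure \<mu> (\<Union>x\<in>X. {f x}) = 0" by (simp only: null_sets_def mem_Collect_eq)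
 moreover have "f ` X = (\<Union>x\<in>X. {f x})" by auto
 ultimately show ?thesis by simp
qed

lemma atom_image: "emeasure \<mu> {f x} = ennreal (D x powr \<alpha>) * emeasure \<mu> {x}"
proof -
 have "emeasure \<mu> (f ` {x}) = (\<integral>\<^sup>+y\<in>{x}. ennreal (D y powr \<alpha>) \<partial>\<mu>)" by (rule conf_eq) auto
 also have "... = (\<integral>\<^sup>+y. ennreal (D x powr \<alpha>) * indicator {x} y \<partial>\<mu>)"
  by (rule nn_integral_cong) (auto simp: indicator_def)
 also have "... = ennreal (D x powr \<alpha>) * emeasure \<mu> {x}" by (subst nn_integral_cmult_indicator) auto
 finally show ?thesis by simp
qed

lemma change_of_variables_inj:
 assumes B: "open B" "inj_on f B" and A: "A \<in> sets borel" "A \<subseteq> B" and h: "h \<in> borel_measurable borel"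
 shows "(\<integral>\<^sup>+x\<in>A. h (f x) * ennreal (D x powr \<alpha>) \<partial>\<mu>) = (\<integral>\<^sup>+y\<in>f ` A. h y \<partial>\<mu>)"
proof -
 have fA: "f ` A \<in> sets borel" using image_borel[OF B A(1)] A(2) by (simp add: Int_absorb2)
 define M1 where "M1 = distr (density \<mu> (\<lambda>x. ennreal (D x powr \<alpha>) * indicator A x)) borel f"
 define M2 where "M2 = density \<mu> (indicator (f ` A))"
 have [measurable]: "A \<in> sets borel" "f ` A \<in> sets borel" "h \<in> borel_measurable borel" using A fA h by auto
 have "M1 = M2"
 proof (rule measure_eqI)
  show "sets M1 = sets M2" by (simp add: M1_def M2_def)
  fix X assume "X \<in> sets M1"
  then have X [measurable]: "X \<in> sets borel" by (simp add: M1_def)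
  have fX [measurable]: "f -` X \<in> sets borel" using measurable_sets_borel[OF meas_f' X] .
  have "emeasure M1 X = (\<integral>\<^sup>+x. ennreal (D x powr \<alpha>) * indicator A x * indicator (f -` X) x \<partial>\<mu>)"
   unfolding M1_def by (subst emeasure_distr) (auto simp: emeasure_density)
  also have "... = (\<integral>\<^sup>+x\<in>f -` X \<inter> A. ennreal (D x powr \<alpha>) \<partial>\<mu>)"
   by (rule nn_integral_cong) (auto simp: indicator_def)
  also have "... = emeasure \<mu> (f ` (f -` X \<inter> A))"
   by (rule conf_eq[symmetric]) (use A B in \<open>auto intro: inj_on_subset\<close>)
  also have "f ` (f -` X \<inter> A) = f ` A \<inter> X" by auto
  also have "emeasure \<mu> (f ` A \<inter> X) = emeasure M2 X"
   unfolding M2_def by (subst emeasure_density) (auto simp: indicator_inter_arith[symmetric])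
  finally show "emeasure M1 X = emeasure M2 X" .
 qed
 then have "(\<integral>\<^sup>+y. h y \<partial>M1) = (\<integral>\<^sup>+y. h y \<partial>M2)" by simp
 then show ?thesis
  unfolding M1_def M2_def by (simp add: nn_integral_distr nn_integral_density mult_ac)
qed

definition pieces where "pieces = (SOME UB. (\<forall>k::nat. fst UB k \<in> sets borel \<and> fst UB k \<subseteq> snd UB k \<and> open (snd UB k) \<and> inj_on f (snd UB k))
  \<and> disjoint_family (fst UB) \<and> (\<Union>k. fst UB k) = - crit)"
definition U where "U = fst pieces"
definition BU where "BU = snd pieces"

lemma U: "U k \<in> sets borel" "U k \<subseteq> BU k" "open (BU k)" "inj_on f (BU k)" "disjoint_family U" "(\<Union>k. U k) = - crit"
proof -
 obtain U' B' where "\<And>k. U' k \<in> sets borel" "\<And>k. U' k \<subseteq> B' k" "\<And>k. open (B' k)" "\<And>k. inj_on f (B' k)"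
  "disjoint_family U'" "(\<Union>k::nat. U' k) = - crit" by (rule injective_pieces) blast
 then have "\<exists>UB. (\<forall>k::nat. fst UB k \<in> sets borel \<and> fst UB k \<subseteq> snd UB k \<and> open (snd UB k) \<and> inj_on f (snd UB k))
  \<and> disjoint_family (fst UB) \<and> (\<Union>k. fst UB k) = - crit" by (intro exI[of _ "(U', B')"]) simp
 from someI_ex[OF this] show "U k \<in> sets borel" "U k \<subseteq> BU k" "open (BU k)" "inj_on f (BU k)" "disjoint_family U" "(\<Union>k. U k) = - crit"
  unfolding pieces_def[symmetric] U_def BU_def by blast+
qed

lemma U_inj: "inj_on f (U k)" using U(2,4) inj_on_subset by blast

lemma image_AU: "A \<in> sets borel \<Longrightarrow> f ` (A \<inter> U k) \<in> sets borel"
 using image_borel[OF U(3,4), of "A \<inter> U k" k] U(1,2)[of k] by (simp add: Int_assoc Int_absorb2)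

lemma change_of_variables:
 assumes A [measurable]: "A \<in> sets borel" and h [measurable]: "h \<in> borel_measurable borel"
 shows "(\<integral>\<^sup>+x\<in>A. h (f x) * ennreal (D x powr \<alpha>) \<partial>\<mu>) = (\<Sum>k. \<integral>\<^sup>+y\<in>f ` (A \<inter> U k). h y \<partial>\<mu>)"
proof -
 have Um [measurable]: "U k \<in> sets borel" for k by (rule U)
 have pt: "h (f x) * ennreal (D x powr \<alpha>) * indicator A x = (\<Sum>k. h (f x) * ennreal (D x powr \<alpha>) * indicator (A \<inter> U k) x)" for x
 proof (cases "x \<in> crit")
  case True
  then have "x \<notin> U k" for k using U(6) by blast
  \<comment> \<open>The derivative is 0 here and \<open>0 powr \<alpha> = 0\<close>, so critical
    points contribute nothing although no piece contains them.\<close>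
  then show ?thesis using True \<alpha> by (simp add: crit_def)
 next
  case False
  then obtain k where k: "x \<in> U k" using U(6) by blast
  have "x \<notin> U j" if "j \<noteq> k" for j using U(5) k that by (auto simp: disjoint_family_on_def)
  then have "(\<lambda>j. h (f x) * ennreal (D x powr \<alpha>) * indicator (A \<inter> U j) x) =
    (\<lambda>j. if j = k then h (f x) * ennreal (D x powr \<alpha>) * indicator A x else 0)"
   using k by (auto simp: fun_eq_iff indicator_def)
  then show ?thesis using suminf_finite[of "{k}" "\<lambda>j. if j = k then h (f x) * ennreal (D x powr \<alpha>) * indicator A x else 0"] by simp
 qed
 have "(\<integral>\<^sup>+x\<in>A. h (f x) * ennreal (D x powr \<alpha>) \<partial>\<mu>) = (\<Sum>k. \<integral>\<^sup>+x\<in>A \<inter> U k. h (f x) * ennreal (D x powr \<alpha>) \<partial>\<mu>)"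
  unfolding pt by (rule nn_integral_suminf) measurable
 also have "... = (\<Sum>k. \<integral>\<^sup>+y\<in>f ` (A \<inter> U k). h y \<partial>\<mu>)"
  by (intro suminf_cong change_of_variables_inj[OF U(3,4)]) (use U(2) in auto)
 finally show ?thesis .
qed

lemma image_bound:
 assumes A: "A \<in> sets borel" "f ` A \<in> sets borel" and h [measurable]: "h \<in> borel_measurable borel"
 shows "(\<integral>\<^sup>+y\<in>f ` A. h y \<partial>\<mu>) \<le> (\<integral>\<^sup>+x\<in>A. h (f x) * ennreal (D x powr \<alpha>) \<partial>\<mu>)"
proof -
 have [measurable]: "f ` (A \<inter> U k) \<in> sets borel" for k by (rule image_AU[OF A(1)])
 have "(\<integral>\<^sup>+y\<in>f ` A. h y \<partial>\<mu>) \<le> (\<integral>\<^sup>+y. (\<Sum>k. h y * indicator (f ` (A \<inter> U k)) y) \<partial>\<mu>)"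
 proof (rule nn_integral_mono_AE)
  have "emeasure \<mu> (f ` crit) = 0" by (rule fcrit_null) simp
  moreover have "f ` crit \<in> sets \<mu>" using finite_crit' by (simp add: borel_closed finite_imp_closed)
  ultimately have "AE y in \<mu>. y \<notin> f ` crit" by (rule AE_not_in[OF null_setsI])
  then show "AE y in \<mu>. h y * indicator (f ` A) y \<le> (\<Sum>k. h y * indicator (f ` (A \<inter> U k)) y)"
  proof eventually_elim
   case (elim y)
   show ?case
   proof (cases "y \<in> f ` A")
    case True
    then obtain x where x: "x \<in> A" "y = f x" by auto
    then have "x \<notin> crit" using elim by auto
    then obtain k where k: "x \<in> U k" using U(6) by blast
    have "h y * indicator (f ` A) y = (\<Sum>j\<in>{k}. h y * indicator (f ` (A \<inter> U j)) y)" using x k by (auto simp: indicator_def)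
    also have "... \<le> (\<Sum>j. h y * indicator (f ` (A \<inter> U j)) y)" by (rule sum_le_suminf) auto
    finally show ?thesis .
   qed simp
  qed
 qed
 also have "... = (\<Sum>k. \<integral>\<^sup>+y\<in>f ` (A \<inter> U k). h y \<partial>\<mu>)" by (rule nn_integral_suminf) measurable
 also have "... = (\<integral>\<^sup>+x\<in>A. h (f x) * ennreal (D x powr \<alpha>) \<partial>\<mu>)" by (rule change_of_variables[OF A(1) h, symmetric])
 finally show ?thesis .
qed

text \<open>The left side counts each value once for every piece of \<open>A\<close> containing a
  preimage. The count is at most 1 if \<open>f\<close> is injective on \<open>A\<close>, and at most
  the size of a fibre in general.\<close>

lemma multiplicity_bound:
 assumes A [measurable]: "A \<in> sets borel" and h [measurable]: "h \<in> borel_measurable borel"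
  and N: "inj_on f A \<Longrightarrow> 1 \<le> N" "Suc d \<le> N \<or> inj_on f A"
 shows "(\<integral>\<^sup>+x\<in>A. h (f x) * ennreal (D x powr \<alpha>) \<partial>\<mu>) \<le> of_nat N * (\<integral>\<^sup>+y. h y \<partial>\<mu>)"
proof -
 have [measurable]: "f ` (A \<inter> U k) \<in> sets borel" for k by (rule image_AU[OF A])
 have "(\<integral>\<^sup>+x\<in>A. h (f x) * ennreal (D x powr \<alpha>) \<partial>\<mu>) = (\<Sum>k. \<integral>\<^sup>+y\<in>f ` (A \<inter> U k). h y \<partial>\<mu>)"
  by (rule change_of_variables[OF A h])
 also have "... = (\<integral>\<^sup>+y. (\<Sum>k. h y * indicator (f ` (A \<inter> U k)) y) \<partial>\<mu>)" by (rule nn_integral_suminf[symmetric]) measurable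
 also have "... \<le> (\<integral>\<^sup>+y. of_nat N * h y \<partial>\<mu>)"
 proof (rule nn_integral_mono)
  fix y
  define K where "K = {k. y \<in> f ` (A \<inter> U k)}"
  define g where "g k = (SOME x. x \<in> A \<inter> U k \<and> f x = y)" for k
  have g: "g k \<in> A \<inter> U k" "f (g k) = y" if "k \<in> K" for k
   using someI_ex[of "\<lambda>x. x \<in> A \<inter> U k \<and> f x = y"] that by (auto simp: K_def g_def)
  have inj: "inj_on g K"
  proof (rule inj_onI)
   fix j k assume jk: "j \<in> K" "k \<in> K" "g j = g k"
   then have "g j \<in> U j \<inter> U k" using g(1)[OF jk(1)] g(1)[OF jk(2)] by auto
   then show "j = k" using U(5) by (auto simp: disjoint_family_on_def)
  qed
  have sub: "g ` K \<subseteq> f -` {y} \<inter> A" using g by auto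
  have fin: "finite (f -` {y} \<inter> A)" using fiber(1) by blast
  have finK: "finite K" using finite_imageD[OF finite_subset[OF sub fin] inj] .
  have "card K = card (g ` K)" using inj by (simp add: card_image)
  also have "... \<le> card (f -` {y} \<inter> A)" by (rule card_mono[OF fin sub])
  also have "... \<le> N"
  proof (cases "inj_on f A")
   case True
   have "card (f -` {y} \<inter> A) \<le> 1"
    by (rule card_le_Suc0_iff_eq[OF fin, THEN iffD2, folded One_nat_def]) (use True in \<open>auto simp: inj_on_def\<close>)
   then show ?thesis using N(1)[OF True] by simp
  next
   case False
   have "card (f -` {y} \<inter> A) \<le> card (f -` {y})" by (rule card_mono[OF fiber(1)]) auto
   also have "... \<le> Suc d" by (rule fiber(2))
   also have "... \<le> N" using N(2) False by simp
   finally show ?thesis .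
  qed
  finally have cK: "card K \<le> N" .
  have "(\<Sum>k. h y * indicator (f ` (A \<inter> U k)) y) = (\<Sum>k\<in>K. h y * indicator (f ` (A \<inter> U k)) y)"
   by (rule suminf_finite[OF finK]) (auto simp: K_def)
  also have "... = (\<Sum>k\<in>K. h y)" by (rule sum.cong) (auto simp: K_def)
  also have "... = of_nat (card K) * h y" by simp
  also have "... \<le> of_nat N * h y" using cK by (intro mult_right_mono) auto
  finally show "(\<Sum>k. h y * indicator (f ` (A \<inter> U k)) y) \<le> of_nat N * h y" .
 qed
 also have "... = of_nat N * (\<integral>\<^sup>+y. h y \<partial>\<mu>)" by (rule nn_integral_cmult) measurable
 finally show ?thesis .
qed

lemma null_image:
 assumes N: "N \<in> sets borel" "emeasure \<mu> N = 0"
 shows "f ` N \<in> sets borel" "emeasure \<mu> (f ` N) = 0"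
proof -
 have eq: "f ` N = (\<Union>k. f ` (N \<inter> U k)) \<union> f ` (N \<inter> crit)" using U(6) by blast
 have m: "f ` (N \<inter> U k) \<in> sets borel" for k by (rule image_AU[OF N(1)])
 have c: "f ` (N \<inter> crit) \<in> sets borel" using finite_crit' by (intro borel_closed finite_imp_closed) auto
 show "f ` N \<in> sets borel" unfolding eq using m c by auto
 have "emeasure \<mu> (f ` (N \<inter> U k)) = 0" for k
 proof -
  have "emeasure \<mu> (f ` (N \<inter> U k)) = (\<integral>\<^sup>+x\<in>N \<inter> U k. ennreal (D x powr \<alpha>) \<partial>\<mu>)"
   by (rule conf_eq) (use N U(1) U_inj inj_on_subset in \<open>auto intro: inj_on_subset\<close>)
  also have "... = 0"
  proof -
   have "AE x in \<mu>. x \<notin> N" by (rule AE_not_in[OF null_setsI]) (use N in auto)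
   then have "AE x in \<mu>. ennreal (D x powr \<alpha>) * indicator (N \<inter> U k) x = 0" by eventually_elim auto
   then show ?thesis by (subst nn_integral_cong_AE) auto
  qed
  finally show ?thesis .
 qed
 then have "emeasure \<mu> (\<Union>k. f ` (N \<inter> U k)) = 0" using m by (intro emeasure_UN_eq_0) auto
 moreover have "emeasure \<mu> (f ` (N \<inter> crit)) = 0" by (rule fcrit_null) simp
 ultimately show "emeasure \<mu> (f ` N) = 0" unfolding eq using m c by (subst emeasure_Un_null_set) (auto simp: null_sets_def)
qed

text \<open>Peeling off the last iterate reduces this to \<open>image_bound\<close>. Several points
  of \<open>A\<close> may share an image, which the left side counts only once.\<close>

lemma image_bound_pow:
 assumes A: "open A" and h [measurable]: "h \<in> borel_measurable borel"
 shows "(\<integral>\<^sup>+y\<in>fn n ` A. h y \<partial>\<mu>) \<le> (\<integral>\<^sup>+x\<in>A. h (fn n x) * ennreal (Dn n x powr \<alpha>) \<partial>\<mu>)"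
 using h
proof (induction n arbitrary: h)
 case 0 then show ?case by (simp add: Dn_def id_def)
next
 case (Suc n)
 note [measurable] = Suc.prems
 have op: "open (fn n ` A)" by (rule open_map_pow[OF A])
 have "(\<integral>\<^sup>+y\<in>(f ^^ Suc n) ` A. h y \<partial>\<mu>) = (\<integral>\<^sup>+y\<in>f ` (fn n ` A). h y \<partial>\<mu>)" by (simp add: image_comp)
 also have "... \<le> (\<integral>\<^sup>+x\<in>fn n ` A. h (f x) * ennreal (D x powr \<alpha>) \<partial>\<mu>)"
  by (rule image_bound) (use op open_map in auto)
 also have "... \<le> (\<integral>\<^sup>+x\<in>A. (h (f (fn n x)) * ennreal (D (fn n x) powr \<alpha>)) * ennreal (Dn n x powr \<alpha>) \<partial>\<mu>)"
  by (rule Suc.IH) measurable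
 also have "... = (\<integral>\<^sup>+x\<in>A. h ((f ^^ Suc n) x) * ennreal (Dn (Suc n) x powr \<alpha>) \<partial>\<mu>)"
  by (rule nn_integral_cong) (simp add: Dn_Suc powr_mult D_nonneg Dn_nonneg ennreal_mult mult_ac)
 finally show ?case .
qed

lemma change_of_variables_pow:
 assumes W: "open W" "inj_on (fn n) W" and A: "A \<in> sets borel" "A \<subseteq> W" and h: "h \<in> borel_measurable borel"
 shows "fn n ` A \<in> sets borel"
  "(\<integral>\<^sup>+x\<in>A. h (fn n x) * ennreal (Dn n x powr \<alpha>) \<partial>\<mu>) = (\<integral>\<^sup>+y\<in>fn n ` A. h y \<partial>\<mu>)"
proof -
 have "fn n ` A \<in> sets borel \<and> (\<integral>\<^sup>+x\<in>A. h (fn n x) * ennreal (Dn n x powr \<alpha>) \<partial>\<mu>) = (\<integral>\<^sup>+y\<in>fn n ` A. h y \<partial>\<mu>)"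
  using W(2) h
 proof (induction n arbitrary: h)
  case 0 then show ?case using A(1) by (simp add: Dn_def id_def)
 next
  case (Suc n)
  note [measurable] = Suc.prems(2)
  have inj: "inj_on (fn n) W" "inj_on f (fn n ` W)"
   using Suc.prems(1) by (auto simp: inj_on_def)
  have op: "open (fn n ` W)" by (rule open_map_pow[OF W(1)])
  have fA: "fn n ` A \<in> sets borel" using Suc.IH[OF inj(1), of "\<lambda>_. 0"] by simp
  have sub: "fn n ` A \<subseteq> fn n ` W" using A(2) by auto
  have eq: "(f ^^ Suc n) ` A = f ` (fn n ` A)" by (simp add: image_comp)
  have 1: "(f ^^ Suc n) ` A \<in> sets borel"
   unfolding eq using image_borel[OF op inj(2) fA] sub by (simp add: Int_absorb2)
  have "(\<integral>\<^sup>+x\<in>A. h ((f ^^ Suc n) x) * ennreal (Dn (Suc n) x powr \<alpha>) \<partial>\<mu>) =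
    (\<integral>\<^sup>+x\<in>A. (h (f (fn n x)) * ennreal (D (fn n x) powr \<alpha>)) * ennreal (Dn n x powr \<alpha>) \<partial>\<mu>)"
   by (rule nn_integral_cong) (simp add: Dn_Suc powr_mult D_nonneg Dn_nonneg ennreal_mult mult_ac)
  also have "... = (\<integral>\<^sup>+x\<in>fn n ` A. h (f x) * ennreal (D x powr \<alpha>) \<partial>\<mu>)"
   using Suc.IH[OF inj(1), of "\<lambda>x. h (f x) * ennreal (D x powr \<alpha>)"] by simp
  also have "... = (\<integral>\<^sup>+y\<in>(f ^^ Suc n) ` A. h y \<partial>\<mu>)"
   unfolding eq by (rule change_of_variables_inj[OF op inj(2) fA sub]) measurable
  finally show ?case using 1 by simp
 qed
 then show "fn n ` A \<in> sets borel"
  "(\<integral>\<^sup>+x\<in>A. h (fn n x) * ennreal (Dn n x powr \<alpha>) \<partial>\<mu>) = (\<integral>\<^sup>+y\<in>fn n ` A. h y \<partial>\<mu>)" by auto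
qed

end

section \<open>The absolutely continuous measure has large entropy\<close>

locale conformal_invariant = conformal f d \<mu> \<alpha> + inv_measure f \<nu> for f d \<mu> \<alpha> \<nu> +
 assumes ac: "absolutely_continuous \<mu> \<nu>"

locale ac_measure = conformal_invariant f d \<mu> \<alpha> \<nu> + julia_measure f d \<nu> for f d \<mu> \<alpha> \<nu>
begin

text \<open>Compactness gives finitely many cells of injectivity outside a small neighbourhood of
  the critical points; that neighbourhood is the only cell on which branches can merge.\<close>

lemma injective_partition:
 assumes \<kappa>: "0 < \<kappa>"
 obtains P where "part P" "{x. D x < \<kappa>} \<in> P" "\<And>A. A \<in> P \<Longrightarrow> A \<noteq> {x. D x < \<kappa>} \<Longrightarrow> inj_on f A"
proof -
 define Z where "Z = {x. D x < \<kappa>}"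
 have Zb: "Z \<in> sets borel" unfolding Z_def by measurable
 have "- Z = D -` {\<kappa>..}" by (auto simp: Z_def)
 then have "closed (- Z)" using closed_vimage[OF closed_atLeast D_cont] by metis
 then have cpt: "compact (- Z)" by (rule rsphere_compact)
 have cv: "- Z \<subseteq> (\<Union>x\<in>- Z. ball x (\<kappa> / (2 * M)))"
 using \<kappa> M(1) by auto
 obtain F where F: "F \<subseteq> - Z" "finite F" "- Z \<subseteq> (\<Union>x\<in>F. ball x (\<kappa> / (2 * M)))"
  by (rule compactE_image[OF cpt _ cv]) auto
 obtain xs where xs: "set xs = F" using finite_list[OF F(2)] by blast
 define B where "B i = (if i < length xs then ball (xs ! i) (\<kappa> / (2 * M)) else {})" for i
 have Bb: "B i \<in> sets borel" for i by (simp add: B_def)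
 have Binj: "inj_on f (B i)" for i
 proof (cases "i < length xs")
  case True
  then have "xs ! i \<in> - Z" using xs F(1) nth_mem by blast
  then have "\<kappa> / (2 * M) \<le> D (xs ! i) / (2 * M)" using M(1) by (intro divide_right_mono) (auto simp: Z_def)
  then show ?thesis using inj_ball True by (simp add: B_def)
 qed (simp add: B_def)
 have cov: "- Z \<subseteq> (\<Union>i. B i)"
 proof
  fix x assume "x \<in> - Z"
  then obtain y where "y \<in> set xs" "x \<in> ball y (\<kappa> / (2 * M))" using F(3) xs by blast
  then obtain i where "i < length xs" "x \<in> ball (xs ! i) (\<kappa> / (2 * M))" by (metis in_set_conv_nth)
  then show "x \<in> (\<Union>i. B i)" by (auto simp: B_def)
 qed
 define P where "P = insert Z ((\<lambda>i. disjointed B i - Z) ` {..<length xs})"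
 have dj: "disjointed B i \<in> sets borel" for i
  using sets.range_disjointed_sets[of B] Bb by blast
 show ?thesis
 proof (rule that[of P, folded Z_def])
  show "part P" unfolding part_def
  proof (intro conjI)
   show "finite P" by (simp add: P_def)
   show "P \<subseteq> sets borel" using Zb dj by (auto simp: P_def)
   show "disjoint P"
   proof (rule disjointI)
    fix X Y assume XY: "X \<in> P" "Y \<in> P" "X \<noteq> Y"
    have dd: "disjointed B i \<inter> disjointed B j = {}" if "i \<noteq> j" for i j
     using disjoint_family_disjointed[of B] that by (auto simp: disjoint_family_on_def)
    have ex: "\<exists>i. W = disjointed B i - Z" if "W \<in> P" "W \<noteq> Z" for W
     using that unfolding P_def by blast
    show "X \<inter> Y = {}"
    proof (cases "X = Z \<or> Y = Z")
     case True
     then show ?thesis using ex[OF XY(1)] ex[OF XY(2)] XY(3) by blast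
    next
     case False
     then obtain i j where ij: "X = disjointed B i - Z" "Y = disjointed B j - Z" using ex XY(1,2) by meson
     then show ?thesis using dd[of i j] XY(3) by blast
    qed
   qed
   have "x \<in> \<Union>P" for x
   proof (cases "x \<in> Z")
    case False
    then have "x \<in> (\<Union>i. disjointed B i)" using cov UN_disjointed_eq[of B] by blast
    then obtain i where i: "x \<in> disjointed B i" by blast
    then have "i < length xs" using disjointed_subset[of B i] by (auto simp: B_def split: if_splits)
    then show ?thesis using i False by (auto simp: P_def)
   qed (simp add: P_def)
   then show "\<Union>P = UNIV" by blast
  qed
  show "Z \<in> P" by (simp add: P_def)
  fix A assume "A \<in> P" "A \<noteq> Z"
  then obtain i where "A \<subseteq> B i" using disjointed_subset[of B] by (auto simp: P_def)
  then show "inj_on f A" using Binj inj_on_subset by blast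
 qed
qed

text \<open>Iterating the change of variables over one cell after another, each step loses a factor
  \<open>Suc d\<close> only if the letter is the exceptional cell \<open>Z\<close>. The free
  function \<open>h\<close> carries the induction.\<close>

lemma word_bound:
 assumes P: "part P" and a: "\<And>i. i < n \<Longrightarrow> a i \<in> P" and inj: "\<And>A. A \<in> P \<Longrightarrow> A \<noteq> Z \<Longrightarrow> inj_on f A"
  and h: "h \<in> borel_measurable borel"
 shows "(\<integral>\<^sup>+x\<in>atom n a. h (fn n x) * ennreal (Dn n x powr \<alpha>) \<partial>\<mu>) \<le>
  of_nat (Suc d ^ card {i\<in>{..<n}. a i = Z}) * (\<integral>\<^sup>+y. h y \<partial>\<mu>)"
 using a h
proof (induction n arbitrary: h)
 case 0 then show ?case by (simp add: atom_def Dn_def id_def)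
next
 case (Suc n)
 note [measurable] = Suc.prems(2)
 have an [measurable]: "a n \<in> sets borel" using Suc.prems(1)[of n] P by (auto simp: part_def)
 have IH: "\<And>h. h \<in> borel_measurable borel \<Longrightarrow> (\<integral>\<^sup>+x\<in>atom n a. h (fn n x) * ennreal (Dn n x powr \<alpha>) \<partial>\<mu>) \<le>
  of_nat (Suc d ^ card {i\<in>{..<n}. a i = Z}) * (\<integral>\<^sup>+y. h y \<partial>\<mu>)" using Suc by simp
 define N where "N = (if a n = Z then Suc d else 1)"
 have "(\<integral>\<^sup>+x\<in>atom (Suc n) a. h ((f ^^ Suc n) x) * ennreal (Dn (Suc n) x powr \<alpha>) \<partial>\<mu>) =
   (\<integral>\<^sup>+x\<in>atom n a. (h (f (fn n x)) * ennreal (D (fn n x) powr \<alpha>) * indicator (a n) (fn n x)) * ennreal (Dn n x powr \<alpha>) \<partial>\<mu>)"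
  by (rule nn_integral_cong)
    (auto simp: Dn_Suc powr_mult D_nonneg Dn_nonneg ennreal_mult mult_ac atom_def less_Suc_eq indicator_def)
 also have "... \<le> of_nat (Suc d ^ card {i\<in>{..<n}. a i = Z}) * (\<integral>\<^sup>+x\<in>a n. h (f x) * ennreal (D x powr \<alpha>) \<partial>\<mu>)"
  by (rule IH) measurable
 also have "... \<le> of_nat (Suc d ^ card {i\<in>{..<n}. a i = Z}) * (of_nat N * (\<integral>\<^sup>+y. h y \<partial>\<mu>))"
  by (intro mult_left_mono multiplicity_bound) (use inj[of "a n"] Suc.prems(1)[of n] in \<open>auto simp: N_def\<close>)
 also have "... = of_nat (Suc d ^ card {i\<in>{..<Suc n}. a i = Z}) * (\<integral>\<^sup>+y. h y \<partial>\<mu>)"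
 proof -
  have "{i\<in>{..<Suc n}. a i = Z} = (if a n = Z then insert n {i\<in>{..<n}. a i = Z} else {i\<in>{..<n}. a i = Z})"
   by (auto simp: less_Suc_eq)
  then show ?thesis by (simp add: N_def mult_ac)
 qed
 finally show ?case .
qed

definition h0 where "h0 = RN_deriv \<mu> \<nu>"

lemma h0_meas [measurable]: "h0 \<in> borel_measurable borel"
 using borel_measurable_RN_deriv[of \<mu> \<nu>] by (simp add: h0_def)

lemma density_h0: "density \<mu> h0 = \<nu>"
 unfolding h0_def by (rule P.density_RN_deriv[OF ac]) simp

lemma h0_finite: "AE x in \<nu>. h0 x \<noteq> \<infinity>"
proof -
 have fin: "AE x in \<mu>. h0 x \<noteq> \<infinity>"
  unfolding h0_def by (rule P.RN_deriv_finite[OF _ ac]) (auto intro: sigma_finite_measure_axioms)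
 show ?thesis by (rule absolutely_continuous_AE[OF _ ac fin]) simp
qed

lemma small_crit_mass:
 assumes "0 < e" obtains \<kappa> where "0 < \<kappa>" "prob {x. D x < \<kappa>} < e"
proof -
 have "(\<lambda>n. prob {x. D x < seq n}) \<longlonglongrightarrow> prob (\<Inter>n. {x. D x < seq n})"
  by (rule finite_Lim_measure_decseq) (use seq(4) in \<open>auto simp: decseq_def intro: less_le_trans\<close>)
 moreover have "prob (\<Inter>n. {x. D x < seq n}) = 0"
 proof -
  have sub: "(\<Inter>n. {x. D x < seq n}) \<subseteq> {x. \<not> 0 < D x}"
  proof safe
   fix x assume x: "x \<in> (\<Inter>n. {x. D x < seq n})" "0 < D x"
   then obtain n where "seq n < D x" using order_tendstoD(2)[OF seq(3), of "D x"] by (auto simp: eventually_sequentially)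
   then show False using x by (auto dest: spec[of _ n])
  qed
  have "AE x in \<nu>. x \<notin> (\<Inter>n. {x. D x < seq n})"
   using AE_D_pos by eventually_elim (use sub in blast)
  moreover have "(\<Inter>n. {x. D x < seq n}) \<in> sets \<nu>" by simp
  ultimately show ?thesis using AE_iff_null_sets measure_eq_0_null_sets by blast
 qed
 ultimately have "eventually (\<lambda>n. prob {x. D x < seq n} < e) sequentially" using assms order_tendstoD(2) by metis
 then obtain n where "prob {x. D x < seq n} < e" by (auto simp: eventually_sequentially)
 then show ?thesis using that seq(1) by blast
qed

lemma large_density_mass:
 assumes "0 < e" obtains K :: real where "1 \<le> K" "prob {x. \<not> h0 x \<le> ennreal K} < e"
proof -
 have "(\<lambda>n::nat. prob {x. \<not> h0 x \<le> of_nat n}) \<longlonglongrightarrow> prob (\<Inter>n::nat. {x. \<not> h0 x \<le> of_nat n})"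
  by (rule finite_Lim_measure_decseq)
    (auto simp: decseq_def intro: order_trans[OF _ of_nat_mono])
 moreover have "prob (\<Inter>n::nat. {x. \<not> h0 x \<le> of_nat n}) = 0"
 proof -
  have sub: "(\<Inter>n::nat. {x. \<not> h0 x \<le> of_nat n}) \<subseteq> {x. h0 x = \<infinity>}"
  proof safe
   fix x assume x: "x \<in> (\<Inter>n::nat. {x. \<not> h0 x \<le> of_nat n})"
   show "h0 x = \<infinity>"
   proof (rule ccontr)
    assume "h0 x \<noteq> \<infinity>"
    then obtain n :: nat where "h0 x < of_nat n" using ennreal_Ex_less_of_nat[of "h0 x"] by (auto simp: less_top)
    then show False using x by (auto dest: spec[of _ n])
   qed
  qed
  have "AE x in \<nu>. x \<notin> (\<Inter>n::nat. {x. \<not> h0 x \<le> of_nat n})"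
   using h0_finite by eventually_elim (use sub in blast)
  moreover have "(\<Inter>n::nat. {x. \<not> h0 x \<le> of_nat n}) \<in> sets \<nu>" by simp
  ultimately show ?thesis using AE_iff_null_sets measure_eq_0_null_sets by blast
 qed
 ultimately have "eventually (\<lambda>n::nat. prob {x. \<not> h0 x \<le> of_nat n} < e) sequentially" using assms order_tendstoD(2) by metis
 then obtain n0 :: nat where "\<And>n. n \<ge> n0 \<Longrightarrow> prob {x. \<not> h0 x \<le> of_nat n} < e" by (auto simp: eventually_sequentially)
 from this[of "Suc n0"] show ?thesis using that[of "real (Suc n0)"] by (simp add: ennreal_of_nat_eq_real_of_nat del: of_nat_Suc)
qed

text \<open>A Rokhlin-type inequality. A function \<open>F\<close> built from the Jacobian of the
  iterate and the probability of the atom has integral at most 1. Integrating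
  \<open>ln F \<le> F - 1\<close> bounds \<open>\<alpha>\<close> times the sum of
  \<open>ln D\<close> by the information of the join, up to small errors per step.\<close>

lemma entropy_ge: "ereal (\<alpha> * chi) \<le> metric_entropy \<nu> f"
proof -
 have main: "ereal (\<alpha> * chi - 2 * e) \<le> metric_entropy \<nu> f" if e: "0 < e" for e
 proof -
  have ld: "0 < ln (real (Suc d))" using deg by simp
  \<comment> \<open>Each visit to the exceptional cell costs \<open>ln (real (Suc d))\<close>; its
    mass is chosen so that this is at most \<open>e\<close> per step on average.\<close>
  obtain \<kappa> where \<kappa>: "0 < \<kappa>" "prob {x. D x < \<kappa>} < e / ln (real (Suc d))"
   by (rule small_crit_mass[of "e / ln (real (Suc d))"]) (use e ld in auto)
  \<comment> \<open>The trivial bound per step for \<open>\<alpha> * ln D\<close>. It is used where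
    the density exceeds \<open>K\<close>, a set so small that the total cost is at most
    \<open>e\<close> per step.\<close>
  define b where "b = \<alpha> * ln L"
  have b0: "0 \<le> b" using \<alpha> L(1) by (simp add: b_def)
  obtain K :: real where K: "1 \<le> K" "prob {x. \<not> h0 x \<le> ennreal K} < e / (b + 1)"
   by (rule large_density_mass[of "e / (b + 1)"]) (use e b0 in auto)
  define G where "G = {x. h0 x \<le> ennreal K}"
  have Gm [measurable]: "G \<in> sets borel" unfolding G_def by measurable
  define Z where "Z = {x. D x < \<kappa>}"
  have Zm [measurable]: "Z \<in> sets borel" unfolding Z_def by measurable
  obtain P where P: "part P" "Z \<in> P" "\<And>A. A \<in> P \<Longrightarrow> A \<noteq> Z \<Longrightarrow> inj_on f A"
   unfolding Z_def by (rule injective_partition[OF \<kappa>(1)]) blast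
  show ?thesis
  proof (rule metric_entropy_ge[OF P(1), of _ "1 + ln K"])
   fix n
   define Q where "Q = join P n"
   have Q: "part Q" unfolding Q_def by (rule part_join[OF P(1)])
   define c where "c A = card {i\<in>{..<n}. word P n (SOME x. x \<in> A) i = Z}" for A
   have cA: "c (cell Q x) = card {i\<in>{..<n}. (fn i) x \<in> Z}" for x
   proof -
    have "word P n (SOME y. y \<in> cell Q x) = word P n x"
    using cell(2) Q someI in_atom_eq P(1) word_PiE cell_join unfolding Q_def by metis
    moreover have "word P n x i = Z \<longleftrightarrow> fn i x \<in> Z" if "i < n" for i
     using that cell(1,2)[OF P(1), of "fn i x"] cell(3)[OF P(1,2)] by (auto simp: word_def)
    ultimately show ?thesis by (auto simp: c_def intro!: arg_cong[of _ _ card])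
   qed
   define t where "t x = Dn n x powr \<alpha>" for x
   have tm [measurable]: "t \<in> borel_measurable borel" unfolding t_def by measurable
   have t0: "0 \<le> t x" for x by (simp add: t_def)
   have DnL: "Dn n x \<le> L ^ n" for x
   proof -
    have "Dn n x \<le> (\<Prod>j<n. L)" unfolding Dn_def by (intro prod_mono) (use D_nonneg L(2) in auto)
    then show ?thesis by simp
   qed
   have tL: "t x \<le> (L ^ n) powr \<alpha>" for x unfolding t_def using DnL Dn_nonneg \<alpha> by (intro powr_mono2) auto
   have intt: "integrable \<nu> (\<lambda>x. indicator A x * (indicator G x * t x * g))" if [measurable]: "A \<in> sets borel" for A and g :: real
    by (rule integrable_const_bound[of _ "(L ^ n) powr \<alpha> * \<bar>g\<bar>"], intro AE_I2)
      (use t0 tL in \<open>auto simp: indicator_def abs_mult intro!: mult_right_mono\<close>)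
   have atom_int: "(\<integral>x. indicator A x * (indicator G x * t x) \<partial>\<nu>) \<le> K * real (Suc d) ^ c A" if A: "A \<in> Q" "A \<noteq> {}" for A
   proof -
    have [measurable]: "A \<in> sets borel" using A Q by (auto simp: part_def)
    obtain x where x: "x \<in> A" using A by auto
    then have Ax: "A = cell Q x" using cell(3)[OF Q A(1)] by simp
    define a where "a = word P n (SOME y. y \<in> A)"
    have ca: "c A = card {i\<in>{..<n}. a i = Z}" by (simp add: c_def a_def)
    have y: "(SOME y. y \<in> A) \<in> A" using x by (rule someI)
    have "cell Q (SOME y. y \<in> A) = A" by (rule cell(3)[OF Q A(1) y])
    then have Aa: "A = atom n a" by (simp add: Q_def cell_join[OF P(1)] a_def)
    have aP: "a i \<in> P" if "i < n" for i using that cell(1)[OF P(1)] by (simp add: a_def word_def)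
    have "ennreal (\<integral>x. indicator A x * (indicator G x * t x) \<partial>\<nu>) = (\<integral>\<^sup>+x. ennreal (indicator A x * (indicator G x * t x)) \<partial>\<nu>)"
     using intt[of A 1] t0 by (intro nn_integral_eq_integral[symmetric]) auto
    also have "... = (\<integral>\<^sup>+x. h0 x * ennreal (indicator A x * (indicator G x * t x)) \<partial>\<mu>)"
     by (subst density_h0[symmetric]) (rule nn_integral_density, measurable)
    also have "... \<le> (\<integral>\<^sup>+x. ennreal K * (ennreal (t x) * indicator A x) \<partial>\<mu>)"
     by (rule nn_integral_mono) (auto simp: indicator_def G_def intro!: mult_right_mono)
    also have "... = ennreal K * (\<integral>\<^sup>+x\<in>A. ennreal (t x) \<partial>\<mu>)" by (rule nn_integral_cmult) measurable
    also have "... \<le> ennreal K * (of_nat (Suc d ^ c A) * (\<integral>\<^sup>+y. 1 \<partial>\<mu>))"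
     using word_bound[of P n a Z "\<lambda>_. 1", OF P(1) aP P(3)] unfolding Aa[symmetric] ca[symmetric] t_def
     by (intro mult_left_mono) auto
    also have "(\<integral>\<^sup>+y. 1 \<partial>\<mu>) = 1" using P.emeasure_space_1 by simp
    also have "ennreal K * (of_nat (Suc d ^ c A) * 1) = ennreal (K * real (Suc d) ^ c A)"
    using ennreal_of_nat_eq_real_of_nat K(1) ennreal_mult by simp
    finally show ?thesis using K(1) by (subst (asm) ennreal_le_iff) auto
   qed
   \<comment> \<open>The denominator is the bound \<open>atom_int\<close> for the Jacobian integral
     over \<open>A\<close>, so the integrals of \<open>F\<close> over the atoms sum to at most the
     total probability.\<close>
   define q where "q A = prob A / (K * real (Suc d) ^ c A)" for A
   have Kc: "0 < K * real (Suc d) ^ c A" for A using K(1) by simp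
   define F where "F x = indicator G x * t x * q (cell Q x)" for x
   have Feq: "indicator A x * F x = indicator A x * (indicator G x * t x * q A)" if "A \<in> Q" for A x
    using cell(3)[OF Q that] by (auto simp: F_def indicator_def)
   have Fsum: "F x = (\<Sum>A\<in>Q. indicator A x * (indicator G x * t x * q A))" for x
   proof -
    have "(\<Sum>A\<in>Q. indicator A x * (indicator G x * t x * q A)) = (\<Sum>A\<in>{cell Q x}. indicator A x * (indicator G x * t x * q A))"
     using Q cell[OF Q] by (intro sum.mono_neutral_right) (auto simp: part_def indicator_def)
    then show ?thesis using cell(2)[OF Q] by (simp add: F_def)
   qed
   have QB: "A \<in> sets borel" if "A \<in> Q" for A using that Q by (auto simp: part_def)
   have Fint: "integrable \<nu> F" unfolding Fsum using QB by (intro Bochner_Integration.integrable_sum intt)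
   have F1: "(\<integral>x. F x \<partial>\<nu>) \<le> 1"
   proof -
    have "(\<integral>x. F x \<partial>\<nu>) = (\<Sum>A\<in>Q. \<integral>x. indicator A x * (indicator G x * t x * q A) \<partial>\<nu>)"
     unfolding Fsum using QB by (intro Bochner_Integration.integral_sum intt)
    also have "... \<le> (\<Sum>A\<in>Q. prob A)"
    proof (rule sum_mono)
     fix A assume A: "A \<in> Q"
     show "(\<integral>x. indicator A x * (indicator G x * t x * q A) \<partial>\<nu>) \<le> prob A"
     proof (cases "A = {}")
      case False
      have "(\<integral>x. indicator A x * (indicator G x * t x * q A) \<partial>\<nu>) = (\<integral>x. indicator A x * (indicator G x * t x) \<partial>\<nu>) * q A"
       by (simp add: mult.assoc[symmetric])
      also have "... \<le> (K * real (Suc d) ^ c A) * q A"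
       using atom_int[OF A False] Kc[of A] by (intro mult_right_mono) (auto simp: q_def)
      also have "... = prob A" using Kc[of A] unfolding q_def
       by (metis less_irrefl nonzero_mult_div_cancel_left times_divide_eq_right)
      finally show ?thesis .
     qed simp
    qed
    also have "... = 1"
    proof -
     have "(\<Sum>A\<in>Q. prob A) = prob (\<Union>A\<in>Q. A)"
      by (rule finite_measure_finite_Union[symmetric]) (use Q in \<open>auto simp: part_def disjoint_def disjoint_family_on_def\<close>)
     then show ?thesis using Q by (simp add: part_def)
    qed
    finally show ?thesis .
   qed
   define R where "R x = F x + ln K + ln (real (Suc d)) * (\<Sum>i<n. indicator Z (fn i x)) + (- ln (prob (cell Q x))) + real n * b * indicator (- G) x" for x
   have intZ: "integrable \<nu> (\<lambda>x. indicator Z (fn j x) :: real)" for j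
    by (rule integrable_pow) (auto simp: less_top[symmetric])
   have intG: "integrable \<nu> (\<lambda>x. real n * b * indicator (- G) x)"
    by (intro integrable_mult_right) (auto simp: less_top[symmetric])
   have Rint: "integrable \<nu> R" unfolding R_def
    by (intro Bochner_Integration.integrable_add Fint entropy_info(1)[OF Q] intG integrable_mult_right Bochner_Integration.integrable_sum intZ) auto
   have lnDn: "integrable \<nu> (\<lambda>x. ln (D (fn i x)))" for i by (rule integrable_pow[OF ln_D])
   have "AE x in \<nu>. \<forall>i\<in>{..<n}. 0 < D (fn i x)" by (rule AE_finite_allI) (use AE_pow[OF AE_D_pos] in auto)
   then have "AE x in \<nu>. \<alpha> * (\<Sum>i<n. ln (D (fn i x))) \<le> R x"
    using entropy_info(3)[OF Q]
   proof eventually_elim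
    case (elim x)
    have Dn0: "0 < Dn n x" unfolding Dn_def using elim by (intro prod_pos) auto
    have lD: "ln (Dn n x) = (\<Sum>i<n. ln (D (fn i x)))" unfolding Dn_def by (rule ln_prod) (use elim in force)+
    have sZ: "(\<Sum>i<n. indicator Z (fn i x)) = real (c (cell Q x))"
    proof -
     have "{..<n} \<inter> {i. (fn i) x \<in> Z} = {i\<in>{..<n}. (fn i) x \<in> Z}" by auto
     then show ?thesis unfolding cA by (simp add: indicator_def sum_of_bool_eq)
    qed
    have cell1: "0 \<le> - ln (prob (cell Q x))" using elim prob_le_1 by simp
    have cost0: "0 \<le> ln (real (Suc d)) * real (c (cell Q x))" using ld by simp
    show ?case
    proof (cases "x \<in> G")
     case True
     define y where "y = F x"
     have y: "y = t x * prob (cell Q x) / (K * real (Suc d) ^ c (cell Q x))" using True by (simp add: y_def F_def q_def)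
     have tx: "0 < t x" using Dn0 by (simp add: t_def)
     then have y0: "0 < y" using elim K(1) by (simp add: y)
     have "ln y = \<alpha> * ln (Dn n x) + ln (prob (cell Q x)) - (ln K + real (c (cell Q x)) * ln (real (Suc d)))"
      unfolding y using tx elim K(1) Dn0 by (simp add: ln_div ln_mult ln_realpow t_def ln_powr del: of_nat_Suc)
     moreover have "ln y \<le> y - 1" by (rule ln_le_minus_one[OF y0])
     ultimately show ?thesis using True lD sZ by (simp add: R_def y_def[symmetric] algebra_simps)
    next
     case False
     have "ln (Dn n x) \<le> ln (L ^ n)" using DnL Dn0 by (intro ln_mono) auto
     also have "... = real n * ln L" using L(1) by (simp add: ln_realpow)
     finally have "\<alpha> * ln (Dn n x) \<le> real n * b" using \<alpha> mult_left_mono[of "ln (Dn n x)" "real n * ln L" \<alpha>] by (simp add: b_def mult_ac)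
     moreover have "0 \<le> F x" unfolding F_def q_def using t0[of x] K(1) by (intro mult_nonneg_nonneg divide_nonneg_nonneg) auto
     moreover have "0 \<le> ln K" using K(1) by simp
     moreover have "indicator (- G) x = (1 :: real)" using False by simp
     then have "R x = F x + ln K + ln (real (Suc d)) * real (c (cell Q x)) + (- ln (prob (cell Q x))) + real n * b"
      unfolding R_def sZ by simp
     ultimately show ?thesis using cell1 cost0 unfolding lD[symmetric] by linarith
    qed
   qed
   then have "(\<integral>x. \<alpha> * (\<Sum>i<n. ln (D (fn i x))) \<partial>\<nu>) \<le> (\<integral>x. R x \<partial>\<nu>)"
    by (intro integral_mono_AE Rint integrable_mult_right Bochner_Integration.integrable_sum lnDn)
   moreover have "(\<integral>x. \<alpha> * (\<Sum>i<n. ln (D (fn i x))) \<partial>\<nu>) = \<alpha> * (real n * chi)"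
   proof -
    have "(\<integral>x. ln (D (fn i x)) \<partial>\<nu>) = chi" for i unfolding chi_def by (rule integral_pow) measurable
    then show ?thesis using lnDn by (simp add: Bochner_Integration.integral_sum)
   qed
   moreover have "(\<integral>x. R x \<partial>\<nu>) = (\<integral>x. F x \<partial>\<nu>) + ln K + ln (real (Suc d)) * (real n * prob Z) + partition_entropy \<nu> Q + real n * b * prob (- G)"
   using integral_pow entropy_info(2) Q Fint entropy_info(1) intG intZ by (simp add: R_def)
   moreover have "ln (real (Suc d)) * (real n * prob Z) \<le> real n * e"
   proof -
    have "ln (real (Suc d)) * prob Z \<le> e" using \<kappa>(2) ld by (simp add: Z_def field_simps)
    then have "real n * (ln (real (Suc d)) * prob Z) \<le> real n * e" by (intro mult_left_mono) auto
    then show ?thesis by (simp add: mult_ac)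
   qed
   moreover have "real n * b * prob (- G) \<le> real n * e"
   proof -
    have "- G = {x. \<not> h0 x \<le> ennreal K}" by (auto simp: G_def)
    then have "prob (- G) \<le> e / (b + 1)" using K(2) by simp
    then have "b * prob (- G) \<le> b * (e / (b + 1))" using b0 by (intro mult_left_mono) auto
    also have "... \<le> e" using b0 e by (simp add: field_simps)
    finally have "real n * (b * prob (- G)) \<le> real n * e" by (intro mult_left_mono) auto
    then show ?thesis by (simp add: mult_ac)
   qed
   ultimately have "\<alpha> * (real n * chi) \<le> 1 + ln K + real n * e + partition_entropy \<nu> Q + real n * e" using F1 by linarith
   then show "real n * (\<alpha> * chi - 2 * e) - (1 + ln K) \<le> partition_entropy \<nu> (join P n)"
    by (simp add: Q_def algebra_simps)
  qed
 qed
 show ?thesis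
 proof (rule ereal_le_epsilon2)
  fix e :: real assume "0 < e"
  have "ereal (\<alpha> * chi - e) \<le> metric_entropy \<nu> f" using main[of "e / 2"] \<open>0 < e\<close> by simp
  then have "ereal (\<alpha> * chi - e) + ereal e \<le> metric_entropy \<nu> f + ereal e" by (rule add_right_mono)
  then show "ereal (\<alpha> * chi) \<le> metric_entropy \<nu> f + ereal e" by simp
 qed
qed

end

section \<open>Full support\<close>

context tce_map
begin

lemma summable_tail: "summable tail"
proof -
 have "summable (\<lambda>k. 4 * M * (1 / lam) ^ k)" by (intro summable_mult summable_geometric) (use lam in simp)
 then show ?thesis by (simp add: tail_def[abs_def] power_divide)
qed

text \<open>Along a periodic orbit with nonzero multiplier \<open>D\<close> is bounded below by some
  \<open>m0\<close>, so the tail corrections change the sum of logarithms by at most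
  \<open>tail / m0\<close> per step, which is summable. Multiplier 1 would keep the sum bounded,
  against its growth at rate \<open>ln lam\<close>.\<close>

lemma periodic_not_neutral:
 assumes q: "q \<in> J" and s: "0 < s" "fn s q = q" shows "Dn s q \<noteq> 1"
proof
 assume one: "Dn s q = 1"
 have per: "fn (m * s) q = q" for m
  by (induction m) (simp_all add: funpow_add s(2))
 have mods: "fn i q = fn (i mod s) q" for i
 proof -
  have "fn i q = fn (i mod s + i div s * s) q" by simp
  also have "... = fn (i mod s) q" using per by (simp only: funpow_add comp_apply)
  finally show ?thesis .
 qed
 have pos0: "0 < D (fn i q)" if "i < s" for i
 proof -
  have "D (fn i q) \<noteq> 0"
  proof
   assume "D (fn i q) = 0"
   then have "Dn s q = 0" unfolding Dn_def using that by (auto simp: prod_zero_iff)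
   then show False using one by simp
  qed
  then show ?thesis using D_nonneg[of "fn i q"] by linarith
 qed
 have pos: "0 < D (fn i q)" for i using pos0[of "i mod s"] mods[of i] s(1) by simp
 define m0 where "m0 = Min ((\<lambda>i. D (fn i q)) ` {..<s})"
 have m0: "0 < m0" unfolding m0_def using s(1) pos by (subst Min_gr_iff) auto
 have m0le: "m0 \<le> D (fn i q)" for i
  unfolding m0_def mods[of i] using s(1) by (intro Min_le) auto
 have lnD: "(\<Sum>i<m * s. ln (D (fn i q))) = 0" for m
 proof (induction m)
  case (Suc m)
  have "(\<Sum>i<s. ln (D (fn (m * s + i) q))) = (\<Sum>i<s. ln (D (fn i q)))"
   by (intro sum.cong refl) (simp add: mods[of "m * s + _"] )
  also have "... = ln (Dn s q)" unfolding Dn_def by (rule ln_prod[symmetric]) (use pos in \<open>auto simp: less_le\<close>)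
  finally have "(\<Sum>i<s. ln (D (fn (m * s + i) q))) = 0" using one by simp
  then show ?case using Suc sum_lessThan_concat[of "\<lambda>i. ln (D (fn i q))" "m * s" s] by (simp add: add.commute)
 qed simp
 define C where "C = (\<Sum>k. tail k) / m0"
 have "real m * (real s * ln lam) \<le> real m * 0 + (C - ln (r0 / 8))" for m
 proof -
  define n where "n = m * s"
  have "real n * ln lam + ln (r0 / 8) \<le> (\<Sum>i<n. ln (D (fn i q) + tail (n - i)))" by (rule sum_tail_lower[OF q])
  also have "... \<le> (\<Sum>i<n. ln (D (fn i q)) + tail (n - i) / m0)"
  proof (rule sum_mono)
   fix i
   define x where "x = D (fn i q)"
   define t where "t = tail (n - i)"
   have x: "0 < x" "m0 \<le> x" "0 < t" using pos m0le tail(1) by (auto simp: x_def t_def)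
   have "x + t = x * (1 + t / x)" using x by (simp add: field_simps)
   moreover have "0 < 1 + t / x" using x by (intro add_pos_pos) auto
   ultimately have "ln (x + t) = ln x + ln (1 + t / x)" using x by (simp add: ln_mult)
   also have "ln (1 + t / x) \<le> t / x" using x by (intro ln_add_one_self_le_self) auto
   also have "t / x \<le> t / m0" using x m0 by (intro divide_left_mono) auto
   finally show "ln (D (fn i q) + tail (n - i)) \<le> ln (D (fn i q)) + tail (n - i) / m0" by (simp add: x_def t_def)
  qed
  also have "... = (\<Sum>i<n. tail (n - i)) / m0" using lnD[of m] by (simp add: sum.distrib n_def sum_divide_distrib)
  also have "(\<Sum>i<n. tail (n - i)) = (\<Sum>k\<in>{1..n}. tail k)"
   by (rule sum.reindex_bij_witness[of _ "\<lambda>k. n - k" "\<lambda>i. n - i"]) auto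
  also have "(\<Sum>k\<in>{1..n}. tail k) / m0 \<le> C"
   unfolding C_def using m0 tail(1) by (intro divide_right_mono sum_le_suminf summable_tail) (auto intro: less_imp_le)
  finally show ?thesis by (simp add: n_def)
 qed
 then have "real s * ln lam \<le> 0" by (rule le_of_linear_le)
 then show False using s(1) lam by (simp add: mult_le_0_iff)
qed

end

section \<open>Atoms of invariant and conformal measures\<close>

lemma (in conformal) atom_image_pow: "emeasure \<mu> {fn n x} = ennreal (Dn n x powr \<alpha>) * emeasure \<mu> {x}"
proof (induction n)
 case (Suc n)
 have "emeasure \<mu> {(f ^^ Suc n) x} = ennreal (D (fn n x) powr \<alpha>) * emeasure \<mu> {fn n x}" using atom_image by simp
 then show ?case using Suc by (simp add: Dn_Suc powr_mult D_nonneg Dn_nonneg ennreal_mult mult_ac)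
qed (simp add: Dn_def)

lemma (in inv_measure) atom_mono: "prob {x} \<le> prob {(f ^^ n) x}"
proof -
 have "prob {x} \<le> prob ((f ^^ n) -` {(f ^^ n) x})"
  by (rule finite_measure_mono) (auto intro!: measurable_sets_borel[OF meas_pow])
 then show ?thesis by (simp add: measure_pow)
qed

text \<open>Point masses do not decrease along an orbit, so an orbit without repetitions starting at
  an atom would have infinite mass.\<close>

lemma (in inv_measure) atom_preperiodic:
 assumes "0 < prob {x}" obtains i s where "0 < s" "(f ^^ s) ((f ^^ i) x) = (f ^^ i) x"
proof -
 define c where "c = prob {x}"
 have "\<not> inj (\<lambda>n. (f ^^ n) x)"
 proof
  assume inj: "inj (\<lambda>n. (f ^^ n) x)"
  obtain N :: nat where N: "1 / c < real N" using reals_Archimedean2 by blast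
  have "real N * c \<le> (\<Sum>n<N. prob {(f ^^ n) x})"
   using sum_mono[of "{..<N}" "\<lambda>_. c" "\<lambda>n. prob {(f ^^ n) x}"] atom_mono by (simp add: c_def)
  also have "... = prob (\<Union>n<N. {(f ^^ n) x})"
   by (rule finite_measure_finite_Union[symmetric]) (use inj in \<open>auto simp: disjoint_family_on_def inj_def\<close>)
  also have "... \<le> 1" by simp
  finally show False using N assms by (simp add: c_def field_simps)
 qed
 then obtain i j where "i < j" "(f ^^ i) x = (f ^^ j) x" by (auto simp: inj_def) (metis linorder_neqE_nat)
 then show ?thesis using that[of "j - i" i] by (metis add_diff_inverse_nat add.commute comp_apply funpow_add not_less_iff_gr_or_eq zero_less_diff)
qed

text \<open>Absolute continuity makes \<open>q\<close> an atom of \<mu> too, and conformality around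
  the loop multiplies its positive mass by \<open>Dn n q powr \<alpha>\<close>.\<close>

lemma (in conformal_invariant) atom_neutral:
 assumes "0 < measure \<nu> {q}" "(f ^^ n) q = q" shows "Dn n q = 1"
proof -
 have "emeasure \<mu> {q} \<noteq> 0"
 proof
  assume "emeasure \<mu> {q} = 0"
  then have "{q} \<in> null_sets \<mu>" by (simp add: null_sets_def)
  then have "{q} \<in> null_sets \<nu>" using ac unfolding absolutely_continuous_def by blast
  then show False using assms(1) by (simp add: measure_eq_0_null_sets)
 qed
 moreover have "emeasure \<mu> {q} = ennreal (Dn n q powr \<alpha>) * emeasure \<mu> {q}" using atom_image_pow[of n q] assms(2) by simp
 ultimately have "ennreal (Dn n q powr \<alpha>) = 1"
  by (simp add: P.emeasure_eq_measure ennreal_mult[symmetric] ennreal_1[symmetric] del: ennreal_1)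
 then have "Dn n q powr \<alpha> = 1" by simp
 then show ?thesis using \<alpha> Dn_nonneg[of n q] by (metis powr_eq_one_iff_gen powr_0 zero_neq_one less_irrefl less_le powr_one_eq_one powr_inj)
qed

context ac_measure
begin

text \<open>An atom leads along its orbit to a periodic atom in \<open>J\<close>. Conformality
  forces its multiplier to be 1, which exponential shrinking forbids.\<close>

lemma no_atoms: "prob {x} = 0"
proof (rule ccontr)
 assume "prob {x} \<noteq> 0"
 then have c: "0 < prob {x}" using measure_nonneg[of \<nu> "{x}"] by linarith
 obtain i s where per: "0 < s" "fn s (fn i x) = fn i x" by (rule atom_preperiodic[OF c])
 define q where "q = fn i x"
 have cq: "0 < prob {q}" using atom_mono[of x i] c by (simp add: q_def)
 have "q \<in> J"
 proof (rule ccontr)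
  assume "q \<notin> J"
  then have "AE y in \<nu>. y \<notin> {q}" using AE_J by auto
  then have "prob {q} = 0" using AE_iff_null_sets[of "{q}" \<nu>] measure_eq_0_null_sets by auto
  then show False using cq by simp
 qed
 have "Dn s q = 1" by (rule atom_neutral[OF cq]) (simp add: q_def per(2))
 then show False using periodic_not_neutral[OF \<open>q \<in> J\<close> per(1)] per(2) by (simp add: q_def)
qed

lemma countable_null: assumes "countable S" shows "S \<in> null_sets \<nu>"
proof -
 have "(\<Union>x\<in>S. {x}) \<in> null_sets \<nu>"
  by (rule null_sets_UN'[OF assms]) (use no_atoms in \<open>auto simp: null_sets_def emeasure_eq_measure\<close>)
 then show ?thesis by simp
qed

lemma null_image_pow:
 assumes "N \<in> sets borel" "emeasure \<mu> N = 0"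
 shows "fn n ` N \<in> sets borel \<and> emeasure \<mu> (fn n ` N) = 0"
proof (induction n)
 case (Suc n)
 have "(f ^^ Suc n) ` N = f ` (fn n ` N)" by (simp add: image_comp)
 then show ?case using null_image Suc by metis
qed (use assms in simp)

text \<open>If \<open>V\<close> were \<mu>-null, so would be all its forward images, and hence they
  would be \<nu>-null. They omit only countably many points, which \<nu> cannot charge because it
  has no atoms.\<close>

lemma full_support:
 assumes V: "open V" "x \<in> V" "x \<in> J" shows "0 < P.prob V"
proof (rule ccontr)
 assume "\<not> 0 < P.prob V"
 then have "P.prob V = 0" using measure_nonneg[of \<mu> V] by linarith
 then have e0: "emeasure \<mu> V = 0" by (simp add: P.emeasure_eq_measure)
 have "(\<Union>n. (fn n) ` V) \<in> null_sets \<mu>"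
  using null_image_pow[OF borel_open[OF V(1)] e0] by (intro null_sets_UN) (auto simp: null_sets_def)
 then have 1: "(\<Union>n. (fn n) ` V) \<in> null_sets \<nu>" using ac by (auto simp: absolutely_continuous_def)
 have 2: "- (\<Union>n. (fn n) ` V) \<in> null_sets \<nu>" by (rule countable_null[OF forward_images_cocountable[OF V]])
 have "UNIV = (\<Union>n. (fn n) ` V) \<union> - (\<Union>n. (fn n) ` V)" by auto
 then have "UNIV \<in> null_sets \<nu>" using null_sets.Un[OF 1 2] by simp
 then show False using prob_UNIV measure_eq_0_null_sets by fastforce
qed

lemma ball_mass:
 assumes "0 < \<eta>" obtains c where "0 < c" "\<And>y. y \<in> J \<Longrightarrow> c \<le> P.prob (ball y \<eta>)"
proof -
 have cov: "J \<subseteq> (\<Union>x\<in>J. ball x (\<eta> / 2))"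
 proof
  fix x assume "x \<in> J"
  moreover have "x \<in> ball x (\<eta> / 2)" using assms by simp
  ultimately show "x \<in> (\<Union>x\<in>J. ball x (\<eta> / 2))" by blast
 qed
 obtain F where F: "F \<subseteq> J" "finite F" "J \<subseteq> (\<Union>x\<in>F. ball x (\<eta> / 2))"
  by (rule compactE_image[OF compact_J _ cov]) auto
 define c where "c = Min (insert 1 ((\<lambda>x. P.prob (ball x (\<eta> / 2))) ` F))"
 show ?thesis
 proof (rule that[of c])
  have "0 < P.prob (ball x (\<eta> / 2))" if "x \<in> F" for x
   by (rule full_support[of _ x]) (use that F(1) assms in auto)
  then show "0 < c" unfolding c_def using F(2) by (subst Min_gr_iff) auto
  fix y assume "y \<in> J"
  then obtain x where x: "x \<in> F" "y \<in> ball x (\<eta> / 2)" using F(3) by blast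
  have "c \<le> P.prob (ball x (\<eta> / 2))" unfolding c_def using F(2) x(1) by (intro Min_le) auto
  also have "... \<le> P.prob (ball y \<eta>)"
  proof (rule P.finite_measure_mono)
   show "ball x (\<eta> / 2) \<subseteq> ball y \<eta>"
   proof
    fix z assume "z \<in> ball x (\<eta> / 2)"
    then show "z \<in> ball y \<eta>" using x(2) dist_triangle[of y z x] by (simp add: dist_commute)
   qed
  qed simp
  finally show "c \<le> P.prob (ball y \<eta>)" .
 qed
qed

end

section \<open>Upper bound for the dimension of the Julia set\<close>

text \<open>A normal family argument. Without a uniform \<rho> there are functions taking values
  close to 0 on every circle; a limit has a zero on every circle around 0, so it vanishes
  identically, against the value of modulus at least \<eta>.\<close>

lemma lower_bound_on_circle:
 fixes \<eta> :: real assumes \<eta>: "0 < \<eta>"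
 obtains \<rho> where "0 < \<rho>" "\<And>g. \<lbrakk>g holomorphic_on ball 0 1; \<And>z. z \<in> ball 0 1 \<Longrightarrow> norm (g z) \<le> 1; g 0 = 0;
   \<exists>z. norm z \<le> 1 / 2 \<and> \<eta> \<le> norm (g z)\<rbrakk> \<Longrightarrow> \<exists>s. 0 < s \<and> s < 1 \<and> (\<forall>z. norm z = s \<longrightarrow> \<rho> < norm (g z))"
proof (rule ccontr)
 assume no: "\<not> thesis"
 have "\<exists>g. g holomorphic_on ball 0 1 \<and> (\<forall>z\<in>ball 0 1. norm (g z) \<le> 1) \<and> g 0 = 0 \<and> (\<exists>z. norm z \<le> 1 / 2 \<and> \<eta> \<le> norm (g z))
   \<and> (\<forall>s. 0 < s \<and> s < 1 \<longrightarrow> (\<exists>z. norm z = s \<and> norm (g z) \<le> 1 / real (Suc n)))" for n :: nat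
 proof (rule ccontr)
  assume H: "\<not> (\<exists>g. g holomorphic_on ball 0 1 \<and> (\<forall>z\<in>ball 0 1. norm (g z) \<le> 1) \<and> g 0 = 0 \<and> (\<exists>z. norm z \<le> 1 / 2 \<and> \<eta> \<le> norm (g z))
   \<and> (\<forall>s. 0 < s \<and> s < 1 \<longrightarrow> (\<exists>z. norm z = s \<and> norm (g z) \<le> 1 / real (Suc n))))"
  show False
  proof (rule no[THEN notE], rule that[of "1 / real (Suc n)"])
   fix g assume g: "g holomorphic_on ball 0 1" "\<And>z. z \<in> ball 0 1 \<Longrightarrow> norm (g z) \<le> 1" "g 0 = 0"
    "\<exists>z. norm z \<le> 1 / 2 \<and> \<eta> \<le> norm (g z)"
   then show "\<exists>s. 0 < s \<and> s < 1 \<and> (\<forall>z. norm z = s \<longrightarrow> 1 / real (Suc n) < norm (g z))"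
    using H by (meson not_le)
  qed simp
 qed
 then obtain G where G: "\<And>n. G n holomorphic_on ball 0 1" "\<And>n z. z \<in> ball 0 1 \<Longrightarrow> norm (G n z) \<le> 1" "\<And>n. G n 0 = 0"
  "\<And>n. \<exists>z. norm z \<le> 1 / 2 \<and> \<eta> \<le> norm (G n z)"
  "\<And>n s. 0 < s \<Longrightarrow> s < 1 \<Longrightarrow> \<exists>z. norm z = s \<and> norm (G n z) \<le> 1 / real (Suc n)" by metis
 obtain g r where g: "g holomorphic_on ball 0 1" "strict_mono (r :: nat \<Rightarrow> nat)"
  "\<And>x. x \<in> ball 0 1 \<Longrightarrow> (\<lambda>n. G (r n) x) \<longlonglongrightarrow> g x"
  "\<And>K. compact K \<Longrightarrow> K \<subseteq> ball 0 1 \<Longrightarrow> uniform_limit K (G \<circ> r) g sequentially"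
 proof (rule Montel[of "ball 0 1" "range G" G])
  show "\<And>h. h \<in> range G \<Longrightarrow> h holomorphic_on ball 0 1" using G(1) by auto
  show "\<exists>B. \<forall>h\<in>range G. \<forall>z\<in>K. norm (h z) \<le> B" if "compact K" "K \<subseteq> ball 0 1" for K
   using G(2) that(2) by (intro exI[of _ 1]) blast
 qed auto
 have zero: "\<exists>z. norm z = s \<and> g z = 0" if s: "0 < s" "s < 1" for s
 proof (rule ccontr)
  assume nz: "\<not> (\<exists>z. norm z = s \<and> g z = 0)"
  have sub: "sphere 0 s \<subseteq> ball (0::complex) 1" using s by auto
  have "continuous_on (sphere 0 s) (\<lambda>z. norm (g z))"
   using g(1) sub by (intro continuous_on_norm holomorphic_on_imp_continuous_on holomorphic_on_subset[OF g(1)])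
  moreover have "sphere (0::complex) s \<noteq> {}" using s by (simp add: less_imp_le)
  ultimately obtain z0 where z0: "z0 \<in> sphere 0 s" "\<And>z. z \<in> sphere 0 s \<Longrightarrow> norm (g z0) \<le> norm (g z)"
   using continuous_attains_inf[OF compact_sphere] by blast
  define m where "m = norm (g z0)"
  have m: "0 < m" using nz z0(1) by (auto simp: m_def)
  have "uniform_limit (sphere 0 s) (G \<circ> r) g sequentially" by (rule g(4)[OF compact_sphere sub])
  from uniform_limitD[OF this, of "m / 2"] m
  have "eventually (\<lambda>n. \<forall>z\<in>sphere 0 s. dist (G (r n) z) (g z) < m / 2) sequentially" by simp
  moreover have "eventually (\<lambda>n. 1 / real (Suc n) < m / 2) sequentially"
   using order_tendstoD(2)[OF LIMSEQ_Suc[OF lim_1_over_n], of "m / 2"] m by simp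
  ultimately have "eventually (\<lambda>n. False) sequentially"
  proof eventually_elim
   case (elim n)
   obtain z where z: "norm z = s" "norm (G (r n) z) \<le> 1 / real (Suc (r n))" using G(5)[OF s] by blast
   have "1 / real (Suc (r n)) \<le> 1 / real (Suc n)"
    using seq_suble[OF g(2), of n] by (intro divide_left_mono) auto
   moreover have "dist (G (r n) z) (g z) < m / 2" using elim(1) z(1) by auto
   moreover have "m \<le> norm (g z)" using z0(2)[of z] z(1) by (simp add: m_def)
   moreover have "norm (g z) \<le> norm (G (r n) z) + dist (G (r n) z) (g z)"
    using norm_triangle_sub[of "g z" "G (r n) z"] by (simp add: dist_norm norm_minus_commute)
   ultimately show False using z(2) elim(2) by linarith
  qed
  then show False by simp
 qed
 define Z where "Z = {z \<in> ball 0 1. g z = 0}"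
 have islim: "(0::complex) islimpt Z"
 proof (subst islimpt_approachable, safe)
  fix e :: real assume e: "0 < e"
  define s where "s = min (e / 2) (1 / 2)"
  have s: "0 < s" "s < 1" "s < e" using e by (auto simp: s_def)
  obtain z where z: "norm z = s" "g z = 0" using zero[OF s(1,2)] by blast
  then show "\<exists>x'\<in>Z. x' \<noteq> 0 \<and> dist x' 0 < e" using s by (intro bexI[of _ z]) (auto simp: Z_def)
 qed
 have g0: "g z = 0" if "z \<in> ball 0 1" for z
  by (rule analytic_continuation[OF g(1) open_ball connected_ball, of Z 0]) (use islim that in \<open>auto simp: Z_def\<close>)
 have sub2: "cball 0 (1 / 2) \<subseteq> ball (0::complex) 1" by auto
 have "uniform_limit (cball 0 (1 / 2)) (G \<circ> r) g sequentially" by (rule g(4)[OF compact_cball sub2])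
 from uniform_limitD[OF this \<eta>]
 have "eventually (\<lambda>n. \<forall>z\<in>cball 0 (1/2). dist (G (r n) z) (g z) < \<eta>) sequentially" by simp
 then obtain n where n: "\<And>z. z \<in> cball 0 (1 / 2) \<Longrightarrow> dist (G (r n) z) (g z) < \<eta>"
  using eventually_happens'[OF sequentially_bot] by blast
 obtain z where z: "norm z \<le> 1 / 2" "\<eta> \<le> norm (G (r n) z)" using G(4) by blast
 have "g z = 0" by (rule g0) (use z in simp)
 then show False using n[of z] z by (simp add: dist_norm)
qed

text \<open>\<open>C\<close> avoids the image of the boundary \<open>S\<close>, so it is separated
  by the open image of \<open>W\<close> and the open complement of a compact image. Connectedness
  leaves only the first.\<close>

lemma image_covers_connected:
 fixes F :: "'a::topological_space \<Rightarrow> 'b::t2_space"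
 assumes cont: "continuous_on UNIV F" and W: "open (F ` W)" "compact (W \<union> S)" "F ` S \<inter> C = {}"
  and C: "connected C" "F ` W \<inter> C \<noteq> {}"
 shows "C \<subseteq> F ` W"
proof (rule ccontr)
 assume ne: "\<not> C \<subseteq> F ` W"
 have "closed (F ` (W \<union> S))"
  by (intro compact_imp_closed compact_continuous_image W(2) continuous_on_subset[OF cont]) simp
 then have op: "open (- (F ` (W \<union> S)))" by (rule open_Compl)
 have "C \<subseteq> F ` W \<union> - (F ` (W \<union> S))" using W(3) by blast
 moreover have "- (F ` (W \<union> S)) \<inter> C \<noteq> {}" using W(3) ne by blast
 moreover have "F ` W \<inter> - (F ` (W \<union> S)) = {}" by blast
 ultimately have "\<not> connected C"
  unfolding connected_def not_not
  by (intro exI[of _ "F ` W"] exI[of _ "- (F ` (W \<union> S))"]) (use op W(1) C(2) in simp)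
 then show False using C by simp
qed

context rational
begin

text \<open>A substitute for the Koebe quarter theorem that allows critical points. On a suitable
  circle the iterate stays away from its central value, so the image of the enclosed disc covers a
  ball of fixed size.\<close>

lemma large_image_contains_ball:
 assumes s0: "0 < s0" "s0 \<le> 1 / 2" and \<eta>: "0 < \<eta>"
 obtains \<rho> where "0 < \<rho>" "\<And>m x r. \<lbrakk>0 < r; r \<le> 1 / 2; fn m ` ball x r \<subseteq> ball (fn m x) s0;
   \<exists>u. dist x u \<le> r / 20 \<and> \<eta> \<le> dist (fn m x) (fn m u)\<rbrakk> \<Longrightarrow> ball (fn m x) \<rho> \<subseteq> fn m ` ball x r"
proof -
 \<comment> \<open>Values are rescaled by \<open>5 / 2 * s0\<close>, and spherical distances are at
   most 4 times Euclidean ones, whence \<open>10 * s0\<close>. Distance \<open>r / 20\<close> in the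
   source becomes at most \<open>r / 8\<close>, half the chart radius.\<close>
 obtain \<rho>1 where \<rho>1: "0 < \<rho>1" "\<And>g. \<lbrakk>g holomorphic_on ball 0 1; \<And>z. z \<in> ball 0 1 \<Longrightarrow> norm (g z) \<le> 1; g 0 = 0;
   \<exists>z. norm z \<le> 1 / 2 \<and> \<eta> / (10 * s0) \<le> norm (g z)\<rbrakk> \<Longrightarrow> \<exists>s. 0 < s \<and> s < 1 \<and> (\<forall>z. norm z = s \<longrightarrow> \<rho>1 < norm (g z))"
  by (rule lower_bound_on_circle[of "\<eta> / (10 * s0)"]) (use \<eta> s0 in simp, blast)
 define \<rho> where "\<rho> = min (1 / 2) (\<rho>1 * s0)"
 show ?thesis
 proof (rule that[of \<rho>])
  show "0 < \<rho>" using \<rho>1 s0 by (simp add: \<rho>_def)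
  fix m x r assume r: "0 < r" "r \<le> 1 / 2" and sub: "fn m ` ball x r \<subseteq> ball (fn m x) s0"
   and ex: "\<exists>u. dist x u \<le> r / 20 \<and> \<eta> \<le> dist (fn m x) (fn m u)"
  define F where "F = f ^^ m"
  obtain A B a b where L: "A \<in> charts" "B \<in> charts" "norm a \<le> 1" "norm b \<le> 1" "x = B (Fin a)" "F x = A (Fin b)"
   "cr A F B holomorphic_on ball a (r / 4)" "cr A F B a = b"
   "\<And>z. z \<in> ball a (r / 4) \<Longrightarrow> F (B (Fin z)) = A (Fin (cr A F B z))"
   "\<And>z. z \<in> ball a (r / 4) \<Longrightarrow> cr A F B z \<in> ball b (5 / 2 * s0) \<inter> ball 0 2"
   "\<And>y. y \<in> ball x r \<Longrightarrow> \<exists>z. y = B (Fin z) \<and> norm (z - a) \<le> 5 / 2 * dist y x"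
   "\<And>z. z \<in> ball a (r / 4) \<Longrightarrow> B (Fin z) \<in> ball x r"
   by (rule sph_hol_local[OF hol_pow r s0(2) sub, folded F_def]) blast
  define c where "c = 5 / 2 * s0"
  have c: "0 < c" using s0 by (simp add: c_def)
  define p where "p z = a + of_real (r / 4) * z" for z :: complex
  have p: "p z \<in> ball a (r / 4)" if "norm z < 1" for z
  proof -
   have "norm (of_real (r / 4) * z) = r / 4 * norm z" using r by (simp add: norm_mult)
   also have "... < r / 4" using that r by simp
   finally show ?thesis by (simp add: p_def dist_norm)
  qed
  define g where "g z = (cr A F B (p z) - b) / of_real c" for z
  have "\<exists>s. 0 < s \<and> s < 1 \<and> (\<forall>z. norm z = s \<longrightarrow> \<rho>1 < norm (g z))"
  proof (rule \<rho>1(2))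
   have "(cr A F B \<circ> p) holomorphic_on ball 0 1"
    by (rule holomorphic_on_compose_gen[OF _ L(7)]) (use p in \<open>auto simp: p_def[abs_def] intro!: holomorphic_intros\<close>)
   then show "g holomorphic_on ball 0 1" unfolding g_def[abs_def] using c
    by (intro holomorphic_intros) (auto simp: o_def)
   show "g 0 = 0" by (simp add: g_def p_def L(8))
   show "norm (g z) \<le> 1" if "z \<in> ball 0 1" for z
   proof -
    have "norm (b - cr A F B (p z)) < c" using L(10)[OF p, of z] that by (simp add: dist_norm c_def)
    then have "norm (cr A F B (p z) - b) \<le> c" by (simp add: norm_minus_commute)
    then show ?thesis using c by (simp add: g_def norm_divide)
   qed
   obtain u where u: "dist x u \<le> r / 20" "\<eta> \<le> dist (F x) (F u)" using ex by (auto simp: F_def)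
   have "u \<in> ball x r" using u(1) r by simp
   then obtain z where z: "u = B (Fin z)" "norm (z - a) \<le> 5 / 2 * dist u x" using L(11) by blast
   define y where "y = (z - a) / of_real (r / 4)"
   have py: "p y = z" using r by (simp add: p_def y_def)
   have "norm (z - a) \<le> r / 8" using z(2) u(1) by (simp add: dist_commute)
   moreover have "norm y = norm (z - a) / (r / 4)" using r unfolding y_def norm_divide by simp
   ultimately have ny: "norm y \<le> 1 / 2" using r by (simp add: divide_le_eq)
   have zb: "z \<in> ball a (r / 4)" using p[of y] py ny by simp
   have "\<eta> \<le> dist (Fin b) (Fin (cr A F B z))"
    using u(2) L(6) L(9)[OF zb] z(1) charts_dist[OF L(1)] by simp
   also have "... \<le> 4 * norm (b - cr A F B z)" by (rule dist_Fin_le)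
   finally have "\<eta> \<le> 4 * norm (b - cr A F B z)" .
   moreover have "norm (g y) = norm (b - cr A F B z) / c" using c unfolding g_def py norm_divide by (simp add: norm_minus_commute)
   ultimately have "\<eta> / (10 * s0) \<le> norm (g y)"
    using s0 by (simp only: c_def) (simp add: divide_le_eq le_divide_eq)
   then show "\<exists>z. norm z \<le> 1 / 2 \<and> \<eta> / (10 * s0) \<le> norm (g z)" using ny by blast
  qed
  then obtain s where s: "0 < s" "s < 1" "\<And>z. norm z = s \<Longrightarrow> \<rho>1 < norm (g z)" by blast
  define W where "W = B ` Fin ` ball a (s * (r / 4))"
  define S where "S = B ` Fin ` sphere a (s * (r / 4))"
  have le: "s * (r / 4) < r / 4" using s r by simp
  have "W \<subseteq> ball x r" unfolding W_def using L(12) le by force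
  have "ball (F x) \<rho> \<subseteq> F ` W"
  proof (rule image_covers_connected)
   show "continuous_on UNIV F" unfolding F_def by (rule cont_pow)
   show "open (F ` W)" unfolding F_def W_def by (intro open_map_pow open_charts L(2) open_image_Fin open_ball)
   have "W \<union> S = B ` Fin ` cball a (s * (r / 4))" unfolding W_def S_def image_Un[symmetric] by (intro arg_cong[of _ _ "(`) B"] arg_cong[of _ _ "(`) Fin"]) auto
   then show "compact (W \<union> S)"
    by (simp only:) (intro compact_continuous_image charts_cont[OF L(2)] continuous_on_Fin compact_cball)
   show "connected (ball (F x) \<rho>)" by (rule connected_ball_rsphere) (simp add: \<rho>_def)
   have "F x \<in> F ` W \<inter> ball (F x) \<rho>" using L(5) s r \<open>0 < \<rho>\<close> by (auto simp: W_def)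
   then show "F ` W \<inter> ball (F x) \<rho> \<noteq> {}" by blast
   have "y \<notin> ball (F x) \<rho>" if "y \<in> F ` S" for y
   proof -
    obtain z where z: "norm (z - a) = s * (r / 4)" "y = F (B (Fin z))"
     using \<open>y \<in> F ` S\<close> by (force simp: S_def dist_norm norm_minus_commute)
    define v where "v = (z - a) / of_real (r / 4)"
    have "norm v = norm (z - a) / (r / 4)" using r unfolding v_def norm_divide by simp
    then have v: "p v = z" "norm v = s" using r z(1) by (auto simp: p_def v_def)
    have zb: "z \<in> ball a (r / 4)" using p[of v] v s by simp
    have "\<rho>1 * c < norm (cr A F B z - b)" using s(3)[OF v(2)] c by (simp add: g_def v(1) norm_divide field_simps)
    also have "... \<le> 5 / 2 * dist (Fin (cr A F B z)) (Fin b)"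
     by (rule norm_le_dist_Fin) (use L(10)[OF zb] L(4) in auto)
    also have "dist (Fin (cr A F B z)) (Fin b) = dist y (F x)"
     using L(9)[OF zb] L(6) z(2) charts_dist[OF L(1)] by simp
    finally have "\<rho>1 * s0 < dist y (F x)" by (simp add: c_def)
    then show ?thesis by (simp add: \<rho>_def dist_commute)
   qed
   then show "F ` S \<inter> ball (F x) \<rho> = {}" by blast
  qed
  then show "ball (fn m x) \<rho> \<subseteq> fn m ` ball x r" using \<open>W \<subseteq> ball x r\<close> unfolding F_def by blast
 qed
qed

end

text \<open>Select a ball of maximal radius and discard those meeting it: they lie in its triple.
  Repeat with the rest.\<close>

lemma finite_Vitali:
 fixes c :: "'i \<Rightarrow> 'a::metric_space" and r :: "'i \<Rightarrow> real"
 assumes "finite F"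
 shows "\<exists>G\<subseteq>F. (\<forall>i\<in>G. \<forall>j\<in>G. i \<noteq> j \<longrightarrow> ball (c i) (r i) \<inter> ball (c j) (r j) = {}) \<and>
  (\<Union>i\<in>F. ball (c i) (r i)) \<subseteq> (\<Union>i\<in>G. ball (c i) (3 * r i))"
 using assms
proof (induction F rule: finite_psubset_induct)
 case (psubset F)
 show ?case
 proof (cases "F = {}")
  case False
  have "Max (r ` F) \<in> r ` F" using psubset(1) False by (intro Max_in) auto
  then obtain i where "i \<in> F" "r i = Max (r ` F)" by auto
  with psubset(1) have i: "i \<in> F" "\<And>j. j \<in> F \<Longrightarrow> r j \<le> r i" by auto
  define F' where "F' = {j \<in> F. ball (c j) (r j) \<inter> ball (c i) (r i) = {} \<and> j \<noteq> i}"
  have "F' \<subset> F" using i(1) by (auto simp: F'_def)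
  from psubset.IH[OF this] obtain G where G: "G \<subseteq> F'"
   "\<forall>i\<in>G. \<forall>j\<in>G. i \<noteq> j \<longrightarrow> ball (c i) (r i) \<inter> ball (c j) (r j) = {}"
   "(\<Union>i\<in>F'. ball (c i) (r i)) \<subseteq> (\<Union>i\<in>G. ball (c i) (3 * r i))" by (elim exE conjE) (rule that)
  have dis: "ball (c j) (r j) \<inter> ball (c i) (r i) = {}" if "j \<in> G" for j using that G(1) by (auto simp: F'_def)
  have cov: "ball (c j) (r j) \<subseteq> (\<Union>k\<in>insert i G. ball (c k) (3 * r k))" if j: "j \<in> F" for j
  proof (cases "j \<in> F'")
   case True
   then have "ball (c j) (r j) \<subseteq> (\<Union>i\<in>F'. ball (c i) (r i))" by blast
   then show ?thesis using G(3) by (simp add: subset_iff)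
  next
   case False
   show ?thesis
   proof
    fix x assume x: "x \<in> ball (c j) (r j)"
    have "x \<in> ball (c i) (3 * r i)"
    proof (cases "j = i")
     case True
     then have "0 < r i" using x by (metis mem_ball order.strict_trans1 zero_le_dist)
     then show ?thesis using x True by simp
    next
     case ne: False
     then obtain y where y: "y \<in> ball (c j) (r j)" "y \<in> ball (c i) (r i)" using False j by (auto simp: F'_def)
     have "dist (c i) x \<le> dist (c i) y + (dist y (c j) + dist (c j) x)"
      using dist_triangle[of "c i" x y] dist_triangle[of y x "c j"] by linarith
     then show ?thesis using x y i(2)[OF j] by (simp add: dist_commute)
    qed
    then show "x \<in> (\<Union>k\<in>insert i G. ball (c k) (3 * r k))" by blast
   qed
  qed
  show ?thesis
  proof (intro exI[of _ "insert i G"] conjI ballI impI)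
   show "insert i G \<subseteq> F" using i(1) G(1) by (auto simp: F'_def)
   show "(\<Union>i\<in>F. ball (c i) (r i)) \<subseteq> (\<Union>i\<in>insert i G. ball (c i) (3 * r i))" using cov by blast
   fix j k assume jk: "j \<in> insert i G" "k \<in> insert i G" "j \<noteq> k"
   show "ball (c j) (r j) \<inter> ball (c k) (r k) = {}"
    using jk dis[of j] dis[of k] G(2) by (cases "j = i"; cases "k = i") (auto simp: Int_commute)
  qed
 qed simp
qed

context ac_measure
begin

text \<open>Along the scales \<open>r k\<close> the first escape time grows at most linearly, so
  infinitely often two consecutive scales escape within a bounded time. Just before the larger ball
  escapes, the image of the smaller one is already of definite size. Hence a ball of fixed size is
  covered by a map with derivative of order \<open>1 / r k\<close>, and conformality gives the mass
  bound.\<close>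

lemma fat_scales:
 obtains c where "0 < c" "\<And>x \<theta>. \<lbrakk>x \<in> J; 0 < \<theta>\<rbrakk> \<Longrightarrow> \<exists>r. 0 < r \<and> r < \<theta> \<and> c * r powr \<alpha> \<le> P.prob (ball x r)"
proof -
 define s0 where "s0 = r0 / 2"
 have s0: "0 < s0" "s0 \<le> 1 / 8" "s0 < r0" using r0 by (auto simp: s0_def)
 \<comment> \<open>In \<open>a\<close> iterates sizes shrink at least by the ratio 40 of consecutive
   scales, so a ball of radius \<open>r k\<close> escapes by time \<open>a * k + b\<close>. The
   ratio 40 is twice the 20 of \<open>large_image_contains_ball\<close>, which is applied to the
   ball of half the radius.\<close>
 obtain a :: nat where a: "40 \<le> lam ^ a" using real_arch_pow[OF lam, of 40] less_imp_le by blast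
 obtain b :: nat where b: "4 / s0 < lam ^ b" using real_arch_pow[OF lam] by blast
 \<comment> \<open>The smaller ball reaches size \<open>s0\<close> at most \<open>2 * a + 1\<close>
   steps later, and each step stretches by at most \<open>L\<close>.\<close>
 define \<eta> where "\<eta> = s0 / L ^ (2 * a + 1)"
 have \<eta>: "0 < \<eta>" using s0 L(1) by (simp add: \<eta>_def)
 obtain \<rho> where \<rho>: "0 < \<rho>" "\<And>m x r. \<lbrakk>0 < r; r \<le> 1 / 2; fn m ` ball x r \<subseteq> ball (fn m x) s0;
   \<exists>u. dist x u \<le> r / 20 \<and> \<eta> \<le> dist (fn m x) (fn m u)\<rbrakk> \<Longrightarrow> ball (fn m x) \<rho> \<subseteq> fn m ` ball x r"
  by (rule large_image_contains_ball[of s0 \<eta>]) (use s0 \<eta> in auto)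
 obtain c where c: "0 < c" "\<And>y. y \<in> J \<Longrightarrow> c \<le> P.prob (ball y \<rho>)" by (rule ball_mass[OF \<rho>(1)]) blast
 define r where "r k = s0 / 40 ^ k" for k :: nat
 have r: "0 < r k" "r k \<le> s0" "r (Suc k) = r k / 40" for k
  using s0 by (auto simp: r_def divide_le_eq mult_le_cancel_left1)
 have main: "\<exists>k\<ge>K. c / (160 * s0) powr \<alpha> * r k powr \<alpha> \<le> P.prob (ball x (r k))" if x: "x \<in> J" for x K
 proof -
  define esc where "esc k n \<longleftrightarrow> \<not> fn n ` ball x (r k) \<subseteq> ball (fn n x) s0" for k n
  have ex: "esc k (a * k + b)" for k
  proof -
   have "(40::real) ^ k \<le> lam ^ (a * k)" using power_mono[OF a, of k] by (simp add: power_mult)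
   then have "4 / s0 * 40 ^ k < lam ^ b * lam ^ (a * k)" using b lam s0 by (intro mult_less_le_imp_less) auto
   then have "4 / lam ^ (a * k + b) < r k" using s0 lam by (simp add: r_def power_add field_simps)
   from expand[OF x this] have sub: "ball (fn (a * k + b) x) r0 \<subseteq> fn (a * k + b) ` ball x (r k)" .
   obtain y where y: "y \<in> ball (fn (a * k + b) x) r0" "s0 \<le> dist (fn (a * k + b) x) y"
    by (rule rsphere_point_at[OF s0(3), of "fn (a * k + b) x"]) (use r0 in auto)
   have "y \<in> fn (a * k + b) ` ball x (r k)" "y \<notin> ball (fn (a * k + b) x) s0" using subsetD[OF sub y(1)] y(2) by auto
   then show ?thesis unfolding esc_def using subsetD by blast
  qed
  define n where "n k = (LEAST n. esc k n)" for k
  have n1: "esc k (n k)" for k unfolding n_def by (rule LeastI[of "esc k", OF ex])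
  have n2: "\<not> esc k m" if "m < n k" for m k using not_less_Least[OF that[unfolded n_def]] .
  have n3: "n k \<le> a * k + b" for k unfolding n_def by (rule Least_le[of "esc k", OF ex])
  \<comment> \<open>Otherwise the escape times would grow with slope \<open>2 * a + 1\<close> from
    \<open>K\<close> on, against the bound of slope \<open>a\<close>.\<close>
  have "\<exists>k\<ge>K. n (Suc k) \<le> n k + 2 * a"
  proof (rule ccontr)
   assume H: "\<not> (\<exists>k\<ge>K. n (Suc k) \<le> n k + 2 * a)"
   have "(2 * a + 1) * i \<le> n (K + i)" for i
   proof (induction i)
    case (Suc i)
    have "n (K + i) + 2 * a < n (Suc (K + i))" using H by (meson le_add1 not_le)
    then show ?case using Suc by simp
   qed simp
   from this[of "a * K + b + 1"] n3[of "K + (a * K + b + 1)"] show False by (simp add: algebra_simps)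
  qed
  then obtain k where k: "K \<le> k" "n (Suc k) \<le> n k + 2 * a" by blast
  have "\<not> esc k 0" using r[of k] by (auto simp: esc_def)
  then have nk: "n k \<noteq> 0" using n1[of k] by metis
  \<comment> \<open>The last time before escape, when the image of the larger ball is still
    contained in a ball of radius \<open>s0\<close>.\<close>
  define m where "m = n k - 1"
  have mn: "m < n k" "n k = Suc m" using nk by (auto simp: m_def)
  have sub: "fn m ` ball x (r k) \<subseteq> ball (fn m x) s0" using n2[OF mn(1)] by (simp add: esc_def)
  obtain u where u: "u \<in> ball x (r (Suc k))" "s0 \<le> dist ((f ^^ n (Suc k)) x) ((f ^^ n (Suc k)) u)"
   using n1[of "Suc k"] by (auto simp: esc_def image_subset_iff not_less)
  define B where "B = ball x (r k / 2)"
  have "ball (fn m x) \<rho> \<subseteq> fn m ` B" unfolding B_def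
  proof (rule \<rho>(2))
   show "0 < r k / 2" "r k / 2 \<le> 1 / 2" using r[of k] s0 by auto
   show "fn m ` ball x (r k / 2) \<subseteq> ball (fn m x) s0" using sub r(1)[of k] by (auto simp: image_subset_iff)
   have "m \<le> n (Suc k)"
   proof (rule ccontr)
    assume "\<not> m \<le> n (Suc k)"
    then have "\<not> esc k (n (Suc k))" using n2 mn by auto
    moreover have "ball x (r (Suc k)) \<subseteq> ball x (r k)" using r[of k] by (intro subset_ball) simp
    ultimately show False using n1[of "Suc k"] by (auto simp: esc_def)
   qed
   then obtain j where j: "n (Suc k) = j + m" "j \<le> 2 * a + 1"
    using k(2) mn(2) by (intro that[of "n (Suc k) - m"]) auto
   have "s0 \<le> dist (fn j (fn m x)) (fn j (fn m u))" using u(2) by (simp add: j(1) funpow_add)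
   also have "... \<le> L ^ j * dist (fn m x) (fn m u)" by (rule dist_pow_le)
   also have "... \<le> L ^ (2 * a + 1) * dist (fn m x) (fn m u)"
    using j(2) L(1) by (intro mult_right_mono power_increasing) auto
   finally have "\<eta> \<le> dist (fn m x) (fn m u)" using L(1) by (simp add: \<eta>_def field_simps)
   moreover have "dist x u \<le> r k / 2 / 20" using u(1) r(3)[of k] by simp
   ultimately show "\<exists>u. dist x u \<le> r k / 2 / 20 \<and> \<eta> \<le> dist (fn m x) (fn m u)" by blast
  qed
  \<comment> \<open>\<open>Cauchy_sphere\<close> with radius \<open>r k / 2\<close> and target
    radius \<open>2 * s0\<close>.\<close>
  define q where "q = 160 * s0 / r k"
  have Dq: "Dn m y \<le> q" if y: "y \<in> B" for y
  proof -
   have "sph_deriv (fn m) y \<le> 40 * (2 * s0) / (r k / 2)"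
   proof (rule Cauchy_sphere[OF hol_pow])
    show "0 < r k / 2" "r k / 2 \<le> 1 / 2" "2 * s0 \<le> 1 / 2" using r[of k] s0 by auto
    show "fn m ` ball y (r k / 2) \<subseteq> ball (fn m y) (2 * s0)"
    proof safe
     fix z assume z: "z \<in> ball y (r k / 2)"
     have "dist x z < r k" using z y dist_triangle[of x z y] by (simp add: B_def)
     then have "dist (fn m x) (fn m z) < s0" using sub by (simp add: image_subset_iff)
     moreover have "dist (fn m x) (fn m y) < s0" using sub y r(1)[of k] by (auto simp: B_def image_subset_iff)
     ultimately show "fn m z \<in> ball (fn m y) (2 * s0)"
      using dist_triangle[of "fn m y" "fn m z" "fn m x"] by (simp add: dist_commute)
    qed
   qed
   then show ?thesis by (simp add: Dn_eq q_def)
  qed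
  have opB: "open B" by (simp add: B_def)
  have "ennreal c \<le> emeasure \<mu> (ball (fn m x) \<rho>)"
   using c(2)[OF J_pow[OF x]] by (simp add: P.emeasure_eq_measure ennreal_leI)
  also have "... \<le> emeasure \<mu> (fn m ` B)"
   using \<open>ball (fn m x) \<rho> \<subseteq> fn m ` B\<close> open_map_pow[OF opB] by (intro emeasure_mono) auto
  also have "... = (\<integral>\<^sup>+y\<in>fn m ` B. 1 \<partial>\<mu>)" using open_map_pow[OF opB] by simp
  also have "... \<le> (\<integral>\<^sup>+y\<in>B. 1 * ennreal (Dn m y powr \<alpha>) \<partial>\<mu>)" by (rule image_bound_pow[OF opB]) simp
  also have "... \<le> (\<integral>\<^sup>+y. ennreal (q powr \<alpha>) * indicator B y \<partial>\<mu>)"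
   by (rule nn_integral_mono) (use Dq \<alpha> Dn_nonneg in \<open>auto simp: indicator_def intro!: ennreal_leI powr_mono2\<close>)
  also have "... = ennreal (q powr \<alpha>) * emeasure \<mu> B" using opB by (intro nn_integral_cmult_indicator) simp
  also have "... = ennreal (q powr \<alpha> * P.prob B)" by (simp add: P.emeasure_eq_measure ennreal_mult)
  finally have "ennreal c \<le> ennreal (q powr \<alpha> * P.prob B)" .
  then have "c \<le> q powr \<alpha> * P.prob B" by (subst (asm) ennreal_le_iff) auto
  also have "q powr \<alpha> * P.prob B \<le> q powr \<alpha> * P.prob (ball x (r k))"
   unfolding B_def using r(1)[of k] by (intro mult_left_mono P.finite_measure_mono subset_ball) auto
  finally have "c \<le> q powr \<alpha> * P.prob (ball x (r k))" .
  moreover have "q powr \<alpha> = (160 * s0) powr \<alpha> / r k powr \<alpha>" unfolding q_def using s0 r[of k] by (simp add: powr_divide)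
  ultimately have "c * r k powr \<alpha> \<le> (160 * s0) powr \<alpha> * P.prob (ball x (r k))"
   using r(1)[of k] by (simp add: divide_le_eq le_divide_eq mult_ac)
  then have "c / (160 * s0) powr \<alpha> * r k powr \<alpha> \<le> P.prob (ball x (r k))" using s0 by (simp add: field_simps)
  with k(1) show ?thesis by blast
 qed
 show ?thesis
 proof (rule that[of "c / (160 * s0) powr \<alpha>"])
  show "0 < c / (160 * s0) powr \<alpha>" using c s0 by simp
  fix x \<theta> assume x: "x \<in> J" and \<theta>: "0 < (\<theta>::real)"
  have "r \<longlonglongrightarrow> 0" unfolding r_def by (rule LIMSEQ_divide_realpow_zero) simp
  then obtain K where K: "\<And>k. k \<ge> K \<Longrightarrow> r k < \<theta>" using order_tendstoD(2)[of r 0 sequentially \<theta>] \<theta> by (auto simp: eventually_sequentially)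
  obtain k where "k \<ge> K" "c / (160 * s0) powr \<alpha> * r k powr \<alpha> \<le> P.prob (ball x (r k))" using main[OF x] by blast
  then show "\<exists>r. 0 < r \<and> r < \<theta> \<and> c / (160 * s0) powr \<alpha> * r powr \<alpha> \<le> P.prob (ball x r)"
   using K r(1) by blast
 qed
qed

text \<open>Take fat balls of radius below \<theta> and select disjoint ones by Vitali. Their
  triples have diameter at most \<open>6 * r\<close>, and each power \<open>r powr s\<close> is at
  most \<open>\<theta> powr (s - \<alpha>)\<close> times a multiple of the mass of the ball. The
  masses sum to at most 1.\<close>

lemma hausdorff_null: assumes s: "\<alpha> < s" shows "hausdorff_measure s J = 0"
proof -
 obtain c where c: "0 < c" "\<And>x \<theta>. \<lbrakk>x \<in> J; 0 < \<theta>\<rbrakk> \<Longrightarrow> \<exists>r. 0 < r \<and> r < \<theta> \<and> c * r powr \<alpha> \<le> P.prob (ball x r)"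
  by (rule fat_scales) blast
 have content: "hausdorff_content s \<delta> J \<le> ennreal (6 powr s * \<theta> powr (s - \<alpha>) / c)" if \<delta>: "0 < \<delta>" and \<theta>: "0 < \<theta>" "6 * \<theta> \<le> \<delta>" for \<delta> \<theta>
 proof -
  obtain r where r: "\<And>x. x \<in> J \<Longrightarrow> 0 < r x" "\<And>x. x \<in> J \<Longrightarrow> r x < \<theta>" "\<And>x. x \<in> J \<Longrightarrow> c * r x powr \<alpha> \<le> P.prob (ball x (r x))"
   using c(2)[OF _ \<theta>(1)] by metis
  have cv: "J \<subseteq> (\<Union>x\<in>J. ball x (r x))"
  using r(1) by auto
  obtain F where F: "F \<subseteq> J" "finite F" "J \<subseteq> (\<Union>x\<in>F. ball x (r x))" by (rule compactE_image[OF compact_J _ cv]) auto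
  obtain G where G: "G \<subseteq> F" "\<And>i j. i \<in> G \<Longrightarrow> j \<in> G \<Longrightarrow> i \<noteq> j \<Longrightarrow> ball i (r i) \<inter> ball j (r j) = {}"
   "(\<Union>i\<in>F. ball i (r i)) \<subseteq> (\<Union>i\<in>G. ball i (3 * r i))" using finite_Vitali[OF F(2), of "\<lambda>x. x" r] by blast
  have finG: "finite G" using G(1) F(2) finite_subset by blast
  obtain xs where xs: "set xs = G" "distinct xs" using finite_distinct_list[OF finG] by blast
  define C where "C i = (if i < length xs then ball (xs ! i) (3 * r (xs ! i)) else {})" for i
  have nthJ: "xs ! i \<in> J" if "i < length xs" for i using that xs(1) G(1) F(1) nth_mem by blast
  have dia: "diameter (C i) \<le> 6 * r (xs ! i)" if "i < length xs" for i
  proof -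
   have "dist u v \<le> 6 * r (xs ! i)" if "u \<in> C i" "v \<in> C i" for u v
    using that \<open>i < length xs\<close> dist_triangle[of u v "xs ! i"] by (simp add: C_def dist_commute)
   then show ?thesis
    unfolding diameter_def using r(1)[OF nthJ[OF that]] by (auto intro!: cSUP_least simp: less_imp_le)
  qed
  have "hausdorff_content s \<delta> J \<le> (\<Sum>i. ennreal (diameter (C i) powr s))"
   unfolding hausdorff_content_def
  proof (rule INF_lower, safe)
   fix x assume "x \<in> J"
   then obtain y where "y \<in> G" "x \<in> ball y (3 * r y)" using F(3) G(3) by blast
   then obtain i where "i < length xs" "x \<in> ball (xs ! i) (3 * r (xs ! i))" using xs(1) by (metis in_set_conv_nth)
   then show "x \<in> (\<Union>i. C i)" by (auto simp: C_def)
  next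
   fix i show "bounded (C i)" by simp
   show "diameter (C i) \<le> \<delta>"
   proof (cases "i < length xs")
    case True
    then show ?thesis using dia[OF True] r(2)[OF nthJ[OF True]] \<theta>(2) by linarith
   qed (use \<delta> in \<open>simp add: C_def\<close>)
  qed
  also have "... = (\<Sum>i<length xs. ennreal (diameter (C i) powr s))"
   by (rule suminf_finite) (auto simp: C_def)
  also have "... = ennreal (\<Sum>i<length xs. diameter (C i) powr s)" by simp
  also have "(\<Sum>i<length xs. diameter (C i) powr s) \<le> (\<Sum>i<length xs. 6 powr s * \<theta> powr (s - \<alpha>) / c * P.prob (ball (xs ! i) (r (xs ! i))))"
  proof (rule sum_mono)
   fix i assume "i \<in> {..<length xs}"
   then have i: "i < length xs" by simp
   define t where "t = r (xs ! i)"
   have t: "0 < t" "t < \<theta>" "c * t powr \<alpha> \<le> P.prob (ball (xs ! i) t)" using r nthJ[OF i] by (auto simp: t_def)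
   have "diameter (C i) powr s \<le> (6 * t) powr s"
    using dia[OF i] s \<alpha> by (intro powr_mono2 diameter_ge_0) (auto simp: t_def)
   also have "... = 6 powr s * (t powr (s - \<alpha>) * t powr \<alpha>)" using t(1) by (simp add: powr_mult powr_add[symmetric])
   also have "... \<le> 6 powr s * (\<theta> powr (s - \<alpha>) * (P.prob (ball (xs ! i) t) / c))"
    using t s c(1) by (intro mult_left_mono mult_mono powr_mono2) (auto simp: field_simps)
   finally show "diameter (C i) powr s \<le> 6 powr s * \<theta> powr (s - \<alpha>) / c * P.prob (ball (xs ! i) (r (xs ! i)))" by (simp add: t_def)
  qed
  also have "... = 6 powr s * \<theta> powr (s - \<alpha>) / c * (\<Sum>x\<in>G. P.prob (ball x (r x)))"
  proof -
   have "bij_betw ((!) xs) {..<length xs} G" using bij_betw_nth[OF xs(2)] xs(1) by simp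
   from sum.reindex_bij_betw[OF this, of "\<lambda>x. P.prob (ball x (r x))"]
   show ?thesis by (simp only: sum_distrib_left[symmetric])
  qed
  also have "(\<Sum>x\<in>G. P.prob (ball x (r x))) = P.prob (\<Union>x\<in>G. ball x (r x))"
   by (rule P.finite_measure_finite_Union[symmetric, OF finG]) (use G(2) in \<open>auto simp: disjoint_family_on_def\<close>)
  also have "6 powr s * \<theta> powr (s - \<alpha>) / c * P.prob (\<Union>x\<in>G. ball x (r x)) \<le> 6 powr s * \<theta> powr (s - \<alpha>) / c * 1"
   using c(1) by (intro mult_left_mono) auto
  finally show ?thesis by (simp add: ennreal_leI)
 qed
 have "hausdorff_content s \<delta> J \<le> 0" if \<delta>: "0 < \<delta>" for \<delta>
 proof -
  have lim: "(\<lambda>n. ennreal (6 powr s * seq n powr (s - \<alpha>) / c)) \<longlonglongrightarrow> ennreal (6 powr s * 0 powr (s - \<alpha>) / c)"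
   using s c(1) seq by (intro tendsto_ennrealI tendsto_intros tendsto_powr') (auto simp: less_imp_le)
  have "eventually (\<lambda>n. seq n < \<delta> / 6) sequentially" using order_tendstoD(2)[OF seq(3), of "\<delta> / 6"] \<delta> by simp
  then have "eventually (\<lambda>n. hausdorff_content s \<delta> J \<le> ennreal (6 powr s * seq n powr (s - \<alpha>) / c)) sequentially"
   by eventually_elim (use content[OF \<delta> seq(1)] in auto)
  from tendsto_le[OF sequentially_bot lim tendsto_const this] show ?thesis using s by simp
 qed
 then have "hausdorff_measure s J \<le> 0" unfolding hausdorff_measure_def by (intro SUP_least) auto
 then show ?thesis by simp
qed

end

section \<open>Times of bounded distortion\<close>

context tce_map
begin

definition sl where "sl = sqrt lam"

lemma sl: "1 < sl" "sl * sl = lam" using lam by (auto simp: sl_def)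

text \<open>At such a time the orbit has not come too close to the critical points recently; the rate
 \<open>sl\<close> lies strictly between \<open>1\<close> and the contraction rate \<open>lam\<close> of the components.\<close>

definition good :: "real \<Rightarrow> nat \<Rightarrow> rsphere \<Rightarrow> bool" where
 "good \<kappa> n x \<longleftrightarrow> (\<forall>j<n. \<kappa> / sl ^ (n - j) \<le> D (fn j x))"

lemma good_borel [measurable]: "{x. good \<kappa> n x} \<in> sets borel"
proof -
 have "{x \<in> space borel. \<forall>j\<in>{..<n}. \<kappa> / sl ^ (n - j) \<le> D (fn j x)} \<in> sets borel"
  by (intro sets.sets_Collect_finite_All) auto
 then show ?thesis by (simp add: good_def Ball_def)
qed

lemma geometric_sum: "(\<Sum>j<n. 1 / sl ^ (n - j)) \<le> 1 / (sl - 1)"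
proof (induction n)
 case (Suc n)
 have "(\<Sum>j<Suc n. 1 / sl ^ (Suc n - j)) = (\<Sum>j<n. 1 / sl ^ (n - j) / sl) + 1 / sl"
  by (simp add: Suc_diff_le mult.commute)
 also have "... = ((\<Sum>j<n. 1 / sl ^ (n - j)) + 1) / sl"
  by (simp only: sum_divide_distrib[symmetric] add_divide_distrib)
 also have "... \<le> (1 / (sl - 1) + 1) / sl" using Suc sl by (intro divide_right_mono) auto
 also have "... = 1 / (sl - 1)" using sl(1) by (simp add: field_simps)
 finally show ?case .
qed (use sl in simp)

lemma finite_fiber_pow: "finite (fn n -` {y})"
proof (induction n)
 case (Suc n)
 have "(f ^^ Suc n) -` {y} = (\<Union>z\<in>fn n -` {y}. f -` {z})" by (auto simp: funpow_swap1)
 then show ?case using Suc fiber(1) by (simp only:) auto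
qed (simp add: vimage_def)

definition comps :: "nat \<Rightarrow> rsphere \<Rightarrow> rsphere set set" where
 "comps n y = pcomp n (ball y r0) ` (fn n -` ball y r0)"

lemma connected_ball_r0: "connected (ball (y::rsphere) r0)" using r0 by (intro connected_ball_rsphere) auto

lemma comps:
 assumes "W \<in> comps n y"
 shows "open W" "connected W" "fn n ` W = ball y r0" "W \<noteq> {}"
  "x \<in> W \<Longrightarrow> W = pcomp n (ball y r0) x"
proof -
 obtain z where z: "W = pcomp n (ball y r0) z" "fn n z \<in> ball y r0" using assms by (auto simp: comps_def)
 show "open W" "connected W" using z pcomp_open pcomp_connected by auto
 show "fn n ` W = ball y r0" unfolding z(1) by (rule pcomp_onto[OF open_ball connected_ball_r0 z(2)])
 show "W \<noteq> {}" using z pcomp_self by blast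
 show "x \<in> W \<Longrightarrow> W = pcomp n (ball y r0) x" using z pcomp_eq by simp
qed

text \<open>Each component is mapped onto the ball, so it contains one of the finitely many
  preimages of the centre.\<close>

lemma finite_comps: "finite (comps n y)"
proof (rule finite_subset)
 show "comps n y \<subseteq> pcomp n (ball y r0) ` (fn n -` {y})"
 proof
  fix W assume W: "W \<in> comps n y"
  have "y \<in> fn n ` W" using comps(3)[OF W] r0 by simp
  then obtain p where "p \<in> W" "fn n p = y" by auto
  then show "W \<in> pcomp n (ball y r0) ` (fn n -` {y})" using comps(5)[OF W] by auto
 qed
qed (use finite_fiber_pow in simp)

lemma comps_disjoint: "disjoint (comps n y)"
proof (rule pairwiseI)
 fix V W assume VW: "V \<in> comps n y" "W \<in> comps n y" "V \<noteq> W"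
 show "disjnt V W"
 proof (rule ccontr)
  assume "\<not> disjnt V W"
  then obtain x where "x \<in> V" "x \<in> W" by (auto simp: disjnt_def)
  then show False using comps(5)[OF VW(1)] comps(5)[OF VW(2)] VW(3) by metis
 qed
qed

lemma comps_small:
 assumes "W \<in> comps n y" "y \<in> J" "u \<in> W" "v \<in> W" "j \<le> n"
 shows "dist (fn j u) (fn j v) \<le> 4 / lam ^ (n - j)"
 by (rule shrink_mid[OF assms(2) comps(2)[OF assms(1)]]) (use comps(3)[OF assms(1)] assms in auto)

text \<open>Univalence together with bounded distortion: \<open>c\<close> is a reference value for
  the derivative on the whole of \<open>W\<close>.\<close>

definition tame :: "nat \<Rightarrow> rsphere set \<Rightarrow> real \<Rightarrow> bool" where
 "tame n W c \<longleftrightarrow> inj_on (fn n) W \<and> 0 < c \<and> (\<forall>u\<in>W. Dn n u \<le> 3 * c \<and> c \<le> 3 * Dn n u)"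

text \<open>Pulling back \<open>q\<close> further steps makes the variation of \<open>D\<close> at
  step \<open>j\<close> at most \<open>tail q / lam ^ (n - j)\<close>. At a good time
  \<open>D\<close> is at least \<open>\<kappa> / sl ^ (n - j)\<close>, and
  \<open>lam = sl * sl\<close>, so the relative variation is geometrically small. For large
  \<open>q\<close> these errors sum to at most 1/4.\<close>

lemma good_distortion:
 assumes \<kappa>: "0 < \<kappa>"
 obtains q where "\<And>n x y W. \<lbrakk>good \<kappa> n x; x \<in> W; W \<in> comps (n + q) y; y \<in> J\<rbrakk> \<Longrightarrow> tame n W (Dn n x)"
proof -
 define e where "e = (sl - 1) / 4 * \<kappa>"
 have "0 < e" using \<kappa> sl by (simp add: e_def)
 then obtain q where q: "tail q < e" using tail_small by blast
 define \<theta> where "\<theta> = tail q / \<kappa>"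
 have \<theta>: "0 < \<theta>" "\<theta> * (1 / (sl - 1)) \<le> 1 / 4"
  using q tail(1)[of q] \<kappa> sl by (auto simp: \<theta>_def e_def field_simps)
 show ?thesis
 proof (rule that[of q])
  fix n x y W assume g: "good \<kappa> n x" and x: "x \<in> W" and W: "W \<in> comps (n + q) y" and y: "y \<in> J"
  define \<delta> where "\<delta> j = \<theta> * (1 / sl ^ (n - j))" for j
  have d0: "0 \<le> \<delta> j" for j using \<theta> sl by (simp add: \<delta>_def)
  have dsum: "(\<Sum>j<n. \<delta> j) \<le> 1 / 4"
  proof -
   have "(\<Sum>j<n. \<delta> j) = \<theta> * (\<Sum>j<n. 1 / sl ^ (n - j))" by (simp add: \<delta>_def sum_distrib_left)
   also have "... \<le> \<theta> * (1 / (sl - 1))" using geometric_sum \<theta> by (intro mult_left_mono) auto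
   finally show ?thesis using \<theta> by linarith
  qed
  have d1: "\<delta> j \<le> 1 / 4" if "j < n" for j
   using member_le_sum[of j "{..<n}" \<delta>] that d0 dsum by force
  have Dpos: "0 < D (fn j x)" if "j < n" for j
   using g that \<kappa> sl by (force simp: good_def intro: less_le_trans[of 0 "\<kappa> / sl ^ (n - j)"])
  have small: "M * (4 / lam ^ (n + q - j)) \<le> \<delta> j * D (fn j x)" if j: "j < n" for j
  proof -
   have "M * (4 / lam ^ (n + q - j)) = tail q / (lam ^ (n - j))"
    using j by (simp add: tail_def power_add[symmetric] ac_simps)
   also have "lam ^ (n - j) = sl ^ (n - j) * sl ^ (n - j)" by (simp add: sl(2)[symmetric] power_mult_distrib)
   also have "tail q / (sl ^ (n - j) * sl ^ (n - j)) = \<delta> j * (\<kappa> / sl ^ (n - j))"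
    using \<kappa> by (simp add: \<delta>_def \<theta>_def)
   also have "... \<le> \<delta> j * D (fn j x)" using g j d0 by (intro mult_left_mono) (auto simp: good_def)
   finally show ?thesis .
  qed
  have close: "dist (fn j u) (fn j v) \<le> 4 / lam ^ (n + q - j)" if "j \<le> n" "u \<in> W" "v \<in> W" for j u v
   by (rule comps_small[OF W y]) (use that in auto)
  have "inj_on (fn j) W" if "j \<le> n" for j
   using that
  proof (induction j)
   case (Suc j)
   show ?case
   proof (rule inj_onI)
    fix u v assume uv: "u \<in> W" "v \<in> W" "(f ^^ Suc j) u = (f ^^ Suc j) v"
    let ?u = "fn j u" and ?v = "fn j v" and ?x = "fn j x"
    have "(D ?x - M * (4 / lam ^ (n + q - j))) * dist ?u ?v \<le> dist (f ?u) (f ?v)"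
     by (rule dist_f_lower) (use close Suc.prems uv x in auto)
    moreover have "\<delta> j * D ?x \<le> 1 / 4 * D ?x" using d1[of j] Suc.prems Dpos[of j] by (intro mult_right_mono) auto
    then have "0 < D ?x - M * (4 / lam ^ (n + q - j))" using small[of j] Dpos[of j] Suc.prems by linarith
    ultimately have "dist ?u ?v \<le> 0" using uv(3) by (auto simp: mult_le_0_iff)
    then show "u = v" using Suc uv by (auto dest: inj_onD)
   qed
  qed simp
  then have "inj_on (fn n) W" by simp
  moreover have "0 < Dn n x" unfolding Dn_def using Dpos by (intro prod_pos) auto
  moreover have "Dn n u \<le> 3 * Dn n x \<and> Dn n x \<le> 3 * Dn n u" if u: "u \<in> W" for u
  proof -
   have near: "\<bar>D (fn j u) - D (fn j x)\<bar> \<le> \<delta> j * D (fn j x)" if j: "j < n" for j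
   proof -
    have "M * dist (fn j u) (fn j x) \<le> M * (4 / lam ^ (n + q - j))"
     using close[of j u x] j u x M(1) by (intro mult_left_mono) auto
    then show ?thesis using D_lipschitz[of "fn j u" "fn j x"] small[OF j] by linarith
   qed
   have up: "D (fn j u) \<le> exp (\<delta> j) * D (fn j x)" if j: "j < n" for j
   proof -
    have "D (fn j u) \<le> (1 + \<delta> j) * D (fn j x)" using near[OF j] by (simp add: algebra_simps)
    also have "... \<le> exp (\<delta> j) * D (fn j x)" by (intro mult_right_mono exp_ge_add_one_self D_nonneg)
    finally show ?thesis .
   qed
   have low: "D (fn j x) \<le> exp (2 * \<delta> j) * D (fn j u)" if j: "j < n" for j
   proof -
    have "\<delta> j * \<delta> j \<le> \<delta> j * (1 / 4)" using d0 d1[OF j] by (intro mult_left_mono) auto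
    then have "1 \<le> (1 + 2 * \<delta> j) * (1 - \<delta> j)" using d0[of j] by (simp add: algebra_simps)
    then have "1 * D (fn j x) \<le> ((1 + 2 * \<delta> j) * (1 - \<delta> j)) * D (fn j x)" by (intro mult_right_mono D_nonneg)
    also have "... = (1 + 2 * \<delta> j) * ((1 - \<delta> j) * D (fn j x))" by simp
    also have "... \<le> exp (2 * \<delta> j) * D (fn j u)"
    proof (rule mult_mono)
     show "(1 - \<delta> j) * D (fn j x) \<le> D (fn j u)" using near[OF j] by (simp add: algebra_simps)
     show "0 \<le> (1 - \<delta> j) * D (fn j x)" using d1[OF j] by (intro mult_nonneg_nonneg D_nonneg) simp
    qed (use exp_ge_add_one_self[of "2 * \<delta> j"] in auto)
    finally show ?thesis by simp
   qed
   have e3: "exp t \<le> (3::real)" if "t \<le> 1" for t using that exp_le by (meson exp_le_cancel_iff order_trans)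
   have "Dn n u \<le> (\<Prod>j<n. exp (\<delta> j) * D (fn j x))"
    unfolding Dn_def by (intro prod_mono) (use up D_nonneg in auto)
   also have "... = exp (\<Sum>j<n. \<delta> j) * Dn n x" by (simp add: Dn_def prod.distrib exp_sum)
   also have "... \<le> 3 * Dn n x" using dsum by (intro mult_right_mono e3 Dn_nonneg) simp
   finally have "Dn n u \<le> 3 * Dn n x" .
   moreover have "Dn n x \<le> (\<Prod>j<n. exp (2 * \<delta> j) * D (fn j u))"
    unfolding Dn_def by (intro prod_mono) (use low D_nonneg in auto)
   then have "Dn n x \<le> exp (\<Sum>j<n. 2 * \<delta> j) * Dn n u" by (simp add: Dn_def prod.distrib exp_sum)
   moreover have "exp (\<Sum>j<n. 2 * \<delta> j) * Dn n u \<le> 3 * Dn n u"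
    using dsum by (intro mult_right_mono e3 Dn_nonneg) (simp add: sum_distrib_left[symmetric])
   ultimately show ?thesis by linarith
  qed
  ultimately show "tame n W (Dn n x)" unfolding tame_def by blast
 qed
qed

definition net :: "rsphere set" where
 "net = (SOME Y. finite Y \<and> Y \<subseteq> J \<and> J \<subseteq> (\<Union>y\<in>Y. ball y (r0 / 2)))"

lemma net: "finite net" "net \<subseteq> J" "J \<subseteq> (\<Union>y\<in>net. ball y (r0 / 2))"
proof -
 have "J \<subseteq> (\<Union>y\<in>J. ball y (r0 / 2))" using r0 by force
 then obtain Y where "Y \<subseteq> J" "finite Y" "J \<subseteq> (\<Union>y\<in>Y. ball y (r0 / 2))"
  by (rule compactE_image[OF compact_J, rotated]) auto
 then have "finite net \<and> net \<subseteq> J \<and> J \<subseteq> (\<Union>y\<in>net. ball y (r0 / 2))"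
  unfolding net_def by (rule_tac someI[of _ Y]) blast
 then show "finite net" "net \<subseteq> J" "J \<subseteq> (\<Union>y\<in>net. ball y (r0 / 2))" by auto
qed

text \<open>The image of \<open>x\<close> lies in the half-size ball. This margin is what allows
  later components to be nested in \<open>comps_nested\<close>.\<close>

lemma comps_ex:
 assumes "x \<in> J" obtains y W where "y \<in> net" "W \<in> comps n y" "x \<in> W" "fn n x \<in> ball y (r0 / 2)"
proof -
 obtain y where y: "y \<in> net" "fn n x \<in> ball y (r0 / 2)" using net(3) J_pow[OF assms] by blast
 then have b: "fn n x \<in> ball y r0" using r0 by simp
 then show ?thesis using that[OF y(1) _ _ y(2), of "pcomp n (ball y r0) x"] pcomp_self[OF b] by (auto simp: comps_def)
qed

end

context julia_measure
begin

text \<open>By the union bound and invariance the exceptional probability is at most the sum over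
  \<open>k\<close> of the mass where \<open>D < \<kappa> / sl ^ k\<close>. That sum counts the
  integers below \<open>(ln \<kappa> - ln D) / ln sl\<close>, so it is bounded by the integral of
  \<open>Y\<close>, which tends to 0 with \<kappa> by dominated convergence.\<close>

lemma good_mass:
 assumes e: "0 < e"
 obtains \<kappa> where "0 < \<kappa>" "\<And>n. prob {x. \<not> good \<kappa> n x} \<le> e"
proof -
 define Y where "Y i x = max 0 (ln (seq i) - ln (D x)) / ln sl" for i x
 have lsl: "0 < ln sl" using sl by simp
 have Yint: "integrable \<nu> (Y i)" for i unfolding Y_def[abs_def]
  by (intro integrable_divide_zero integrable_max Bochner_Integration.integrable_diff ln_D integrable_const)
 have "(\<lambda>i. \<integral>x. Y i x \<partial>\<nu>) \<longlonglongrightarrow> (\<integral>x. 0 \<partial>\<nu>)"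
 proof (rule integral_dominated_convergence[where w = "\<lambda>x. \<bar>ln (D x)\<bar> / ln sl"])
  show "integrable \<nu> (\<lambda>x. \<bar>ln (D x)\<bar> / ln sl)" using ln_D by auto
  show "AE x in \<nu>. norm (Y i x) \<le> \<bar>ln (D x)\<bar> / ln sl" for i
  proof (rule AE_I2)
   fix x
   have "ln (seq i) \<le> 0" using seq(1,2)[of i] by simp
   then show "norm (Y i x) \<le> \<bar>ln (D x)\<bar> / ln sl" unfolding Y_def using lsl by (auto simp: divide_right_mono)
  qed
  show "AE x in \<nu>. (\<lambda>i. Y i x) \<longlonglongrightarrow> 0"
  proof (rule AE_I2)
   fix x
   have "seq n \<noteq> 0" for n using seq(1)[of n] by simp
   then have "filterlim seq (at_right 0) sequentially" using seq(1,3) by (auto simp: filterlim_at)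
   from filterlim_compose[OF ln_at_0 this] have "eventually (\<lambda>i. ln (seq i) \<le> ln (D x)) sequentially"
    by (auto simp: filterlim_at_bot)
   then have "eventually (\<lambda>i. 0 = Y i x) sequentially" by eventually_elim (simp add: Y_def)
   then show "(\<lambda>i. Y i x) \<longlonglongrightarrow> 0" by (rule Lim_transform_eventually[OF tendsto_const])
  qed
 qed (use Yint in auto)
 then have "eventually (\<lambda>i. (\<integral>x. Y i x \<partial>\<nu>) < e) sequentially" using order_tendstoD(2)[of _ 0] e by simp
 then obtain i where i: "(\<integral>x. Y i x \<partial>\<nu>) < e" using eventually_happens'[OF sequentially_bot] by blast
 define \<kappa> where "\<kappa> = seq i"
 have \<kappa>: "0 < \<kappa>" using seq(1) by (simp add: \<kappa>_def)
 define S where "S k = {x. D x < \<kappa> / sl ^ k}" for k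
 have S [measurable]: "S k \<in> sets borel" for k unfolding S_def by measurable
 have "prob {x. \<not> good \<kappa> n x} \<le> e" for n
 proof -
  have "{x. \<not> good \<kappa> n x} = (\<Union>j<n. (fn j) -` S (n - j))"
   by (auto simp: good_def S_def not_le)
  then have "prob {x. \<not> good \<kappa> n x} \<le> (\<Sum>j<n. prob (fn j -` S (n - j)))"
   using measurable_sets_borel[OF meas_pow S] by (simp, intro finite_measure_subadditive_finite) auto
  also have "... = (\<Sum>j<n. prob (S (n - j)))" by (intro sum.cong refl measure_pow S)
  also have "... = (\<Sum>k<n. prob (S (Suc k)))"
   by (subst sum.nat_diff_reindex[symmetric]) (intro sum.cong refl, auto simp: Suc_diff_Suc)
  also have "... = (\<Sum>k<n. \<integral>x. indicator (S (Suc k)) x \<partial>\<nu>)" by simp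
  also have "... = (\<integral>x. (\<Sum>k<n. indicator (S (Suc k)) x) \<partial>\<nu>)"
   by (rule Bochner_Integration.integral_sum[symmetric]) (simp add: emeasure_eq_measure)
  also have "... \<le> (\<integral>x. Y i x \<partial>\<nu>)"
  proof (rule integral_mono_AE)
   show "AE x in \<nu>. (\<Sum>k<n. indicator (S (Suc k)) x) \<le> Y i x"
    using AE_D_pos
   proof eventually_elim
    case (elim x)
    define y where "y = (ln \<kappa> - ln (D x)) / ln sl"
    have "x \<in> S (Suc k) \<Longrightarrow> real (Suc k) < y" for k
    proof -
     assume "x \<in> S (Suc k)"
     then have "ln (D x) < ln (\<kappa> / sl ^ Suc k)" using elim by (simp add: S_def del: power_Suc)
     also have "... = ln \<kappa> - real (Suc k) * ln sl" using \<kappa> sl by (simp add: ln_div ln_realpow del: power_Suc)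
     finally show "real (Suc k) < y" using lsl by (simp add: y_def field_simps)
    qed
    then have "(\<Sum>k<n. indicator (S (Suc k)) x) \<le> (\<Sum>k<n. if real (Suc k) < y then 1 else 0 :: real)"
     by (intro sum_mono) (auto simp: indicator_def)
    also have "... \<le> max 0 y"
    proof (induction n)
     case (Suc n)
     show ?case
     proof (cases "real (Suc n) < y")
      case True
      have "(\<Sum>k<Suc n. if real (Suc k) < y then 1 else 0 :: real) \<le> (\<Sum>k<Suc n. 1)" by (intro sum_mono) auto
      then show ?thesis using True by simp
     qed (use Suc in simp)
    qed simp
    also have "... = Y i x" using lsl by (auto simp: Y_def y_def \<kappa>_def max_def divide_le_0_iff zero_le_divide_iff)
    finally show ?case .
   qed
  qed (use Yint in \<open>auto simp: emeasure_eq_measure\<close>)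
  finally show ?thesis using i by simp
 qed
 with \<kappa> show ?thesis by (rule that)
qed

end

context conformal
begin

section \<open>Conformal mass under iterates\<close>

lemma distortion_image:
 assumes W: "open W" and tame: "tame n W c" and A: "A \<in> sets borel"
 shows "(c / 3) powr \<alpha> * P.prob (W \<inter> fn n -` A) \<le> P.prob (fn n ` W \<inter> A)"
  "P.prob (fn n ` W \<inter> A) \<le> (3 * c) powr \<alpha> * P.prob (W \<inter> fn n -` A)"
proof -
 have inj: "inj_on (fn n) W" and c: "0 < c" "\<And>u. u \<in> W \<Longrightarrow> Dn n u \<le> 3 * c \<and> c \<le> 3 * Dn n u"
  using tame by (auto simp: tame_def)
 define X where "X = W \<inter> fn n -` A"
 have X [measurable]: "X \<in> sets borel" using W A measurable_sets_borel[OF meas_pow' A] by (auto simp: X_def)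
 have XW: "X \<subseteq> W" by (auto simp: X_def)
 have cX: "c / 3 \<le> Dn n u \<and> Dn n u \<le> 3 * c" if "u \<in> X" for u using c(2)[of u] XW that by auto
 have im: "fn n ` X = fn n ` W \<inter> A" by (auto simp: X_def)
 have "emeasure \<mu> (fn n ` X) = (\<integral>\<^sup>+y\<in>fn n ` X. 1 \<partial>\<mu>)"
  using change_of_variables_pow(1)[OF W inj X XW borel_measurable_const[of 1]] by simp
 also have "... = (\<integral>\<^sup>+x\<in>X. 1 * ennreal (Dn n x powr \<alpha>) \<partial>\<mu>)"
  by (rule change_of_variables_pow(2)[OF W inj X XW, symmetric]) simp
 finally have eq: "emeasure \<mu> (fn n ` X) = (\<integral>\<^sup>+x. ennreal (Dn n x powr \<alpha>) * indicator X x \<partial>\<mu>)" by simp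
 have "(\<integral>\<^sup>+x. ennreal ((c / 3) powr \<alpha>) * indicator X x \<partial>\<mu>) \<le> emeasure \<mu> (fn n ` X)"
  unfolding eq by (rule nn_integral_mono) (use c(1) cX \<alpha> in \<open>auto simp: indicator_def intro!: ennreal_leI powr_mono2\<close>)
 then have "ennreal ((c / 3) powr \<alpha>) * emeasure \<mu> X \<le> emeasure \<mu> (fn n ` X)"
  by (simp add: nn_integral_cmult_indicator)
 then have "ennreal ((c / 3) powr \<alpha> * P.prob X) \<le> ennreal (P.prob (fn n ` X))"
  by (simp add: P.emeasure_eq_measure ennreal_mult)
 then show "(c / 3) powr \<alpha> * P.prob (W \<inter> fn n -` A) \<le> P.prob (fn n ` W \<inter> A)"
  by (simp add: im[symmetric] X_def)
 have "emeasure \<mu> (fn n ` X) \<le> (\<integral>\<^sup>+x. ennreal ((3 * c) powr \<alpha>) * indicator X x \<partial>\<mu>)"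
  unfolding eq by (rule nn_integral_mono) (use c(1) cX \<alpha> Dn_nonneg in \<open>auto simp: indicator_def intro!: ennreal_leI powr_mono2\<close>)
 then have "emeasure \<mu> (fn n ` X) \<le> ennreal ((3 * c) powr \<alpha>) * emeasure \<mu> X"
  by (simp add: nn_integral_cmult_indicator)
 then have "ennreal (P.prob (fn n ` X)) \<le> ennreal ((3 * c) powr \<alpha> * P.prob X)"
  by (simp add: P.emeasure_eq_measure ennreal_mult)
 then show "P.prob (fn n ` W \<inter> A) \<le> (3 * c) powr \<alpha> * P.prob (W \<inter> fn n -` A)"
  by (simp add: im[symmetric] X_def)
qed

lemma open_image_measure:
 assumes V: "open V" and A: "A \<in> sets borel" and c: "\<And>u. u \<in> V \<Longrightarrow> Dn n u \<le> c"
 shows "P.prob (fn n ` V \<inter> A) \<le> c powr \<alpha> * P.prob (V \<inter> fn n -` A)"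
proof -
 have X [measurable]: "V \<inter> fn n -` A \<in> sets borel" using V measurable_sets_borel[OF meas_pow' A] by auto
 have [measurable]: "fn n ` V \<in> sets borel" using open_map_pow[OF V] by simp
 have "emeasure \<mu> (fn n ` V \<inter> A) = (\<integral>\<^sup>+y\<in>fn n ` V. indicator A y \<partial>\<mu>)"
  using A by (simp add: indicator_inter_arith[symmetric] Int_commute)
 also have "... \<le> (\<integral>\<^sup>+x\<in>V. indicator A (fn n x) * ennreal (Dn n x powr \<alpha>) \<partial>\<mu>)"
  using A by (intro image_bound_pow[OF V]) simp
 also have "... \<le> (\<integral>\<^sup>+x. ennreal (c powr \<alpha>) * indicator (V \<inter> fn n -` A) x \<partial>\<mu>)"
  by (rule nn_integral_mono) (use c \<alpha> Dn_nonneg in \<open>auto simp: indicator_def intro!: ennreal_leI powr_mono2\<close>)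
 also have "... = ennreal (c powr \<alpha>) * emeasure \<mu> (V \<inter> fn n -` A)" by (intro nn_integral_cmult_indicator) simp
 finally have "ennreal (P.prob (fn n ` V \<inter> A)) \<le> ennreal (c powr \<alpha> * P.prob (V \<inter> fn n -` A))"
  by (simp add: P.emeasure_eq_measure ennreal_mult)
 then show ?thesis by simp
qed

lemma Dn_le_L: "Dn n x \<le> L ^ n"
 unfolding Dn_def using prod_mono[of "{..<n}" "\<lambda>j. D (fn j x)" "\<lambda>_. L"] L(2) D_nonneg by simp

text \<open>The derivative on the whole component is bounded by the corrected product along one of
  its orbits. This is where the weight \<mu> of a component acquires its cost, \<alpha> times the
  sum of regularized logarithms.\<close>

lemma comps_measure:
 assumes W: "W \<in> comps n y" and y: "y \<in> J" and x: "x \<in> W"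
 shows "P.prob (ball y r0) \<le> (\<Prod>i<n. D (fn i x) + tail (n - i)) powr \<alpha> * P.prob W"
proof -
 have "Dn n u \<le> (\<Prod>i<n. D (fn i x) + tail (n - i))" if u: "u \<in> W" for u
  unfolding Dn_def
 proof (intro prod_mono conjI D_nonneg)
  fix i assume i: "i \<in> {..<n}"
  have "M * dist (fn i u) (fn i x) \<le> M * (4 / lam ^ (n - i))"
   using comps_small[OF W y u x, of i] i M(1) by (intro mult_left_mono) auto
  then show "D (fn i u) \<le> D (fn i x) + tail (n - i)"
   using D_lipschitz[of "fn i u" "fn i x"] by (simp add: tail_def mult.commute)
 qed
 from open_image_measure[OF comps(1)[OF W] _ this, of UNIV] comps(3)[OF W] show ?thesis by simp
qed

end

section \<open>Uniqueness of the absolutely continuous invariant measure\<close>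

lemma (in finite_measure) sum_measure_le:
 assumes "finite I" "disjoint_family_on A I" "A ` I \<subseteq> sets M" "(\<Union>i\<in>I. A i) \<subseteq> G" "G \<in> sets M"
 shows "(\<Sum>i\<in>I. measure M (A i)) \<le> measure M G"
 using finite_measure_finite_Union[OF assms(1,3,2)] finite_measure_mono[OF assms(4,5)] by simp

lemma compact_neighbourhood_measure:
 fixes F :: "'a::metric_space set"
 assumes fin: "finite_measure M" and sets: "sets M = sets borel" and F: "compact F" and e: "0 < e"
 obtains \<rho> where "0 < \<rho>" "measure M (\<Union>y\<in>F. ball y \<rho>) < measure M F + e"
proof -
 interpret finite_measure M by (rule fin)
 define G where "G n = (\<Union>y\<in>F. ball y (1 / real (Suc n)))" for n
 have op: "open (G n)" for n by (auto simp: G_def)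
 have dec: "decseq G" unfolding decseq_def G_def
  by (intro allI impI UN_mono subset_ball frac_le) auto
 have Int: "(\<Inter>n. G n) = F"
 proof (rule set_eqI)
  fix x
  have "x \<in> F" if x: "x \<in> (\<Inter>n. G n)"
  proof -
   have "x \<in> closure F" unfolding closure_approachable
   proof (intro allI impI)
    fix \<epsilon> :: real assume "0 < \<epsilon>"
    then obtain n where "1 / real (Suc n) < \<epsilon>" using reals_Archimedean[of \<epsilon>] by (auto simp: inverse_eq_divide)
    moreover obtain y where "y \<in> F" "dist y x < 1 / real (Suc n)" using x by (auto simp: G_def)
    ultimately show "\<exists>y\<in>F. dist y x < \<epsilon>" by (intro bexI[of _ y]) auto
   qed
   then show ?thesis using compact_imp_closed[OF F] by simp
  qed
  moreover have "x \<in> (\<Inter>n. G n)" if "x \<in> F" using that by (auto simp: G_def intro!: bexI[of _ x])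
  ultimately show "x \<in> (\<Inter>n. G n) \<longleftrightarrow> x \<in> F" by blast
 qed
 have "(\<lambda>n. measure M (G n)) \<longlonglongrightarrow> measure M F"
 proof -
  have "range G \<subseteq> Sigma_Algebra.sets M" using op sets by auto
  from finite_Lim_measure_decseq[OF this dec] show ?thesis unfolding Int .
 qed
 then have "eventually (\<lambda>n. measure M (G n) < measure M F + e) sequentially" using order_tendstoD(2) e by fastforce
 then obtain n where "measure M (G n) < measure M F + e" using eventually_happens'[OF sequentially_bot] by blast
 then show ?thesis using that[of "1 / real (Suc n)"] by (simp add: G_def)
qed

lemma countable_in_borel: "countable C \<Longrightarrow> (C :: 'a::t1_space set) \<in> sets borel"
 by (rule sets.countable) auto

context conformal
begin

text \<open>Relative masses are preserved up to the factor \<open>9 powr \<alpha>\<close>: upper and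
  lower bounds differ by \<open>3 * 3\<close>, and the reference derivative \<open>c\<close>
  cancels. The products avoid division by a mass that could be 0.\<close>

lemma distortion_ratio:
 assumes W: "open W" and tame: "tame n W c" and A: "A \<in> sets borel"
 shows "P.prob (W \<inter> fn n -` A) * P.prob (fn n ` W) \<le> 9 powr \<alpha> * P.prob W * P.prob (fn n ` W \<inter> A)"
  "P.prob W * P.prob (fn n ` W \<inter> A) \<le> 9 powr \<alpha> * P.prob (W \<inter> fn n -` A) * P.prob (fn n ` W)"
proof -
 define b where "b = (c / 3) powr \<alpha>"
 have b: "0 < b" "(3 * c) powr \<alpha> = 9 powr \<alpha> * b"
  using tame powr_mult[of 9 "c / 3" \<alpha>] by (auto simp: b_def tame_def)
 note 1 = distortion_image[OF W tame A, folded b_def, unfolded b(2)]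
 note 2 = distortion_image[OF W tame, of UNIV, folded b_def, unfolded b(2), simplified]
 have "b * (P.prob (W \<inter> fn n -` A) * P.prob (fn n ` W)) =
   (b * P.prob (W \<inter> fn n -` A)) * P.prob (fn n ` W)" by simp
 also have "... \<le> P.prob (fn n ` W \<inter> A) * (9 powr \<alpha> * b * P.prob W)" by (intro mult_mono 1 2) auto
 finally have "b * (P.prob (W \<inter> fn n -` A) * P.prob (fn n ` W)) \<le>
   b * (9 powr \<alpha> * P.prob W * P.prob (fn n ` W \<inter> A))" by (simp add: mult_ac)
 then show "P.prob (W \<inter> fn n -` A) * P.prob (fn n ` W) \<le> 9 powr \<alpha> * P.prob W * P.prob (fn n ` W \<inter> A)"
  using b(1) by simp
 have "b * (P.prob W * P.prob (fn n ` W \<inter> A)) = (b * P.prob W) * P.prob (fn n ` W \<inter> A)" by simp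
 also have "... \<le> P.prob (fn n ` W) * (9 powr \<alpha> * b * P.prob (W \<inter> fn n -` A))" by (intro mult_mono 1 2) auto
 finally have "b * (P.prob W * P.prob (fn n ` W \<inter> A)) \<le>
   b * (9 powr \<alpha> * P.prob (W \<inter> fn n -` A) * P.prob (fn n ` W))" by (simp add: mult_ac)
 then show "P.prob W * P.prob (fn n ` W \<inter> A) \<le> 9 powr \<alpha> * P.prob (W \<inter> fn n -` A) * P.prob (fn n ` W)"
  using b(1) by simp
qed

text \<open>Bounded distortion holds up to time \<open>n\<close>; the remaining \<open>q\<close>
  steps, which complete the ball, lose at most a fixed power of \<open>L\<close>.\<close>

lemma image_of_comps_measure:
 assumes W: "W \<in> comps (n + q) y" and A: "A \<in> sets borel"
 shows "P.prob (ball y r0 \<inter> A) \<le> (L ^ q) powr \<alpha> * P.prob (fn n ` W \<inter> fn q -` A)"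
proof -
 have "fn q ` fn n ` W = ball y r0" using comps(3)[OF W] by (simp add: image_comp funpow_add[symmetric] add.commute)
 then show ?thesis
  using open_image_measure[OF open_map_pow[OF comps(1)[OF W], of n] A, of q "L ^ q"] Dn_le_L by simp
qed

end

context ac_measure
begin

text \<open>Where the density is at most \<open>K\<close>, \<nu> is at most \<open>K\<close> times
  \<mu>; the remaining points have small \<nu>-mass.\<close>

lemma ac_bound:
 assumes e: "0 < e"
 obtains K where "0 < K" "\<And>A. A \<in> sets borel \<Longrightarrow> prob A \<le> e + K * P.prob A"
proof -
 obtain K :: real where K: "1 \<le> K" "prob {x. \<not> h0 x \<le> ennreal K} < e" by (rule large_density_mass[OF e])
 show ?thesis
 proof (rule that[of K])
  fix A :: "rsphere set" assume A [measurable]: "A \<in> sets borel"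
  define H where "H = {x. h0 x \<le> ennreal K}"
  have H [measurable]: "H \<in> sets borel" unfolding H_def by measurable
  have H': "- H = {x. \<not> h0 x \<le> ennreal K}" by (auto simp: H_def)
  have "emeasure \<nu> (A \<inter> H) = (\<integral>\<^sup>+x. h0 x * indicator (A \<inter> H) x \<partial>\<mu>)"
   by (subst density_h0[symmetric], subst emeasure_density) auto
  also have "... \<le> (\<integral>\<^sup>+x. ennreal K * indicator (A \<inter> H) x \<partial>\<mu>)"
   by (rule nn_integral_mono) (auto simp: H_def indicator_def)
  also have "... = ennreal K * emeasure \<mu> (A \<inter> H)" by (rule nn_integral_cmult_indicator) simp
  also have "... \<le> ennreal K * emeasure \<mu> A" by (intro mult_left_mono emeasure_mono) auto
  finally have "ennreal (prob (A \<inter> H)) \<le> ennreal (K * P.prob A)"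
   using K(1) by (simp add: P.emeasure_eq_measure emeasure_eq_measure ennreal_mult)
  then have "prob (A \<inter> H) \<le> K * P.prob A" using K(1) by simp
  moreover have "prob A \<le> prob (A \<inter> H) + prob (- H)"
   by (rule order_trans[OF finite_measure_mono measure_Un_le]) auto
  ultimately show "prob A \<le> e + K * P.prob A" using K(2) H' by simp
 qed (use K in simp)
qed

lemma invariant_pow: "f -` T = T \<Longrightarrow> fn n -` T = T"
proof (induction n)
 case (Suc n)
 have "(f ^^ Suc n) -` T = fn n -` (f -` T)" by (simp add: vimage_comp funpow_swap1 o_def)
 then show ?case using Suc by (simp only:)
qed simp

text \<open>A density argument with components at good times in place of balls. If the complement of
  \<open>T\<close> charged every ball of the net, it would fill a fixed fraction of every such
  component. But small components around a compact part of \<open>T\<close> lie in a neighbourhood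
  where the complement of \<open>T\<close> has tiny mass.\<close>

lemma invariant_ball:
 assumes T [measurable]: "T \<in> sets borel" and inv: "f -` T = T" and pos: "0 < prob T"
 obtains y where "y \<in> net" "P.prob (ball y r0 - T) = 0"
proof (rule ccontr)
 note found = that
 assume none: "\<not> thesis"
 have npos: "0 < P.prob (ball y r0 - T)" if "y \<in> net" for y
  using found[OF that] none by (auto simp: zero_less_measure_iff)
 have invn: "fn n -` T = T" for n by (rule invariant_pow[OF inv])
 define a where "a = prob T"
 define c where "c = Min (insert 1 ((\<lambda>y. P.prob (ball y r0 - T)) ` net))"
 have c: "0 < c" "y \<in> net \<Longrightarrow> c \<le> P.prob (ball y r0 - T)" for y
  using net(1) npos by (auto simp: c_def Min_gr_iff)
 have a: "0 < a / 4" using pos by (simp add: a_def)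
 obtain \<kappa> where \<kappa>: "0 < \<kappa>" "\<And>n. prob {x. \<not> good \<kappa> n x} \<le> a / 4" by (rule good_mass[OF a]) blast
 obtain q where q: "\<And>n x y W. \<lbrakk>good \<kappa> n x; x \<in> W; W \<in> comps (n + q) y; y \<in> J\<rbrakk> \<Longrightarrow> tame n W (Dn n x)"
  by (rule good_distortion[OF \<kappa>(1)]) blast
 \<comment> \<open>The fraction of a component that must lie outside \<open>T\<close>: the mass
   \<open>c\<close> near the net, reduced by the last \<open>q\<close> steps and by
   distortion.\<close>
 define c' where "c' = c / ((L ^ q) powr \<alpha> * 9 powr \<alpha>)"
 have L0: "0 < L ^ q" using L(1) by simp
 have Lp: "0 < (L ^ q) powr \<alpha> * 9 powr \<alpha>" using L0 L(1) by simp
 then have c': "0 < c'" using c(1) by (simp add: c'_def)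
 have ratio: "c' * P.prob W \<le> P.prob (W - T)"
  if W: "W \<in> comps (n + q) y" "y \<in> net" "x \<in> W" "good \<kappa> n x" for W n y x
 proof -
  have y: "y \<in> J" using W net by blast
  have tame: "tame n W (Dn n x)" by (rule q[OF W(4,3,1) y])
  have vc: "fn m -` (- T) = - T" for m using invn[of m] by auto
  have nE: "- T \<in> sets borel" by simp
  have "P.prob W * P.prob (fn n ` W \<inter> - T) \<le> 9 powr \<alpha> * P.prob (W \<inter> - T) * P.prob (fn n ` W)"
   using distortion_ratio(2)[OF comps(1)[OF W(1)] tame nE] by (simp add: vc)
  also have "... \<le> 9 powr \<alpha> * P.prob (W \<inter> - T) * 1" by (intro mult_left_mono) auto
  finally have 1: "P.prob W * P.prob (fn n ` W \<inter> - T) \<le> 9 powr \<alpha> * P.prob (W - T)"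
   by (simp add: Diff_eq)
  have "c \<le> (L ^ q) powr \<alpha> * P.prob (fn n ` W \<inter> - T)"
   using image_of_comps_measure[OF W(1) nE] c(2)[OF W(2)] by (simp add: vc Diff_eq)
  then have "c * P.prob W \<le> (L ^ q) powr \<alpha> * P.prob (fn n ` W \<inter> - T) * P.prob W" by (rule mult_right_mono) simp
  also have "... = (L ^ q) powr \<alpha> * (P.prob W * P.prob (fn n ` W \<inter> - T))" by simp
  also have "... \<le> (L ^ q) powr \<alpha> * (9 powr \<alpha> * P.prob (W - T))" by (intro mult_left_mono 1) simp
  finally show ?thesis using Lp by (simp add: c'_def divide_le_eq mult_ac)
 qed
 obtain K where K: "0 < K" "\<And>A. A \<in> sets borel \<Longrightarrow> prob A \<le> a / 4 + K * P.prob A" by (rule ac_bound[OF a]) blast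
 obtain F where F: "F \<subseteq> T \<inter> J" "compact F" "prob (T \<inter> J) - a / 4 < prob F"
  by (rule compact_approx[OF _ a, of "T \<inter> J"]) (use closed_J in auto)
 define N where "N = real (card net) + 1"
 have N: "0 < N" by (simp add: N_def)
 \<comment> \<open>Chosen so that the components cover mass at most \<open>a / (8 * K)\<close>.
   Their \<nu>-mass is then at most \<open>a / 4 + a / 8\<close>, too little for the good points of
   \<open>F\<close>.\<close>
 define \<eta> where "\<eta> = a * c' / (8 * K * N)"
 have \<eta>: "0 < \<eta>" using a c' K(1) N by (simp add: \<eta>_def)
 obtain \<rho> where \<rho>: "0 < \<rho>" "P.prob (\<Union>y\<in>F. ball y \<rho>) < P.prob F + \<eta>"
  by (rule compact_neighbourhood_measure[OF P.finite_measure_axioms sets_mu F(2) \<eta>]) blast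
 define G where "G = (\<Union>y\<in>F. ball y \<rho>)"
 have G: "open G" "F \<subseteq> G" using \<rho>(1) by (auto simp: G_def)
 have "P.prob (G - T) \<le> P.prob (G - F)" using G F compact_imp_closed[OF F(2)] by (intro P.finite_measure_mono) auto
 also have "... = P.prob G - P.prob F" using G compact_imp_closed[OF F(2)] by (intro P.finite_measure_Diff) auto
 finally have GE: "P.prob (G - T) \<le> \<eta>" using \<rho>(2) by (simp add: G_def)
 obtain n where n: "4 / lam ^ n < \<rho>" using lam_small[OF \<rho>(1)] by blast
 define X where "X = F \<inter> {x. good \<kappa> n x}"
 have X [measurable]: "X \<in> sets borel" using compact_imp_closed[OF F(2)] by (simp add: X_def)
 define \<W> where "\<W> y = {W \<in> comps (n + q) y. W \<inter> X \<noteq> {}}" for y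
 have finW: "finite (\<W> y)" for y using finite_comps by (simp add: \<W>_def)
 have small: "(\<Sum>W\<in>\<W> y. P.prob W) \<le> \<eta> / c'" if y: "y \<in> net" for y
 proof -
  have "(\<Sum>W\<in>\<W> y. P.prob W) \<le> (\<Sum>W\<in>\<W> y. P.prob (W - T) / c')"
  proof (rule sum_mono)
   fix W assume "W \<in> \<W> y"
   then obtain x where "W \<in> comps (n + q) y" "x \<in> W" "good \<kappa> n x" by (auto simp: \<W>_def X_def)
   then have "c' * P.prob W \<le> P.prob (W - T)" using y by (intro ratio) auto
   then show "P.prob W \<le> P.prob (W - T) / c'" using c' by (simp add: field_simps)
  qed
  also have "... = (\<Sum>W\<in>\<W> y. P.prob (W - T)) / c'" by (rule sum_divide_distrib[symmetric])
  also have "(\<Sum>W\<in>\<W> y. P.prob (W - T)) \<le> P.prob (G - T)"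
  proof (rule P.sum_measure_le[OF finW])
   show "disjoint_family_on (\<lambda>W. W - T) (\<W> y)"
    using comps_disjoint[of "n + q" y] by (fastforce simp: disjoint_family_on_def pairwise_def disjnt_def \<W>_def)
   show "(\<lambda>W. W - T) ` \<W> y \<subseteq> sets \<mu>" using comps(1) by (auto simp: \<W>_def)
   have "W \<subseteq> G" if WW: "W \<in> \<W> y" for W
   proof
    fix v assume v: "v \<in> W"
    obtain x where x: "W \<in> comps (n + q) y" "x \<in> W" "x \<in> F" using WW by (auto simp: \<W>_def X_def)
    have "dist x v \<le> 4 / lam ^ (n + q)" using comps_small[OF x(1) _ x(2) v, of 0] y net by auto
    also have "... \<le> 4 / lam ^ n" using lam by (intro divide_left_mono power_increasing) auto
    finally show "v \<in> G" using n x(3) by (auto simp: G_def intro!: bexI[of _ x])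
   qed
   then show "(\<Union>W\<in>\<W> y. W - T) \<subseteq> G - T" by blast
   show "G - T \<in> sets \<mu>" using G by simp
  qed
  also note GE
  finally show ?thesis using c' by (simp add: divide_right_mono)
 qed
 have "X \<subseteq> (\<Union>y\<in>net. \<Union>(\<W> y))"
 proof
  fix x assume x: "x \<in> X"
  then have "x \<in> J" using F by (auto simp: X_def)
  then obtain y W where "y \<in> net" "W \<in> comps (n + q) y" "x \<in> W" by (rule comps_ex)
  then show "x \<in> (\<Union>y\<in>net. \<Union>(\<W> y))" using x by (auto simp: \<W>_def)
 qed
 moreover have op: "open (\<Union>(\<W> y))" for y using comps(1) by (auto simp: \<W>_def)
 ultimately have "P.prob X \<le> P.prob (\<Union>y\<in>net. \<Union>(\<W> y))"
  by (intro P.finite_measure_mono) (simp_all only: sets_mu, intro borel_open open_UN ballI)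
 also have "... \<le> (\<Sum>y\<in>net. P.prob (\<Union>(\<W> y)))" using op net by (intro P.finite_measure_subadditive_finite) auto
 also have "... \<le> (\<Sum>y\<in>net. \<eta> / c')"
 proof (rule sum_mono)
  fix y assume "y \<in> net"
  have "P.prob (\<Union>(\<W> y)) \<le> (\<Sum>W\<in>\<W> y. P.prob W)"
  proof -
   have "(\<lambda>W. W) ` \<W> y \<subseteq> sets \<mu>" using comps(1) by (auto simp: \<W>_def)
   from P.finite_measure_subadditive_finite[OF finW this] show ?thesis by simp
  qed
  then show "P.prob (\<Union>(\<W> y)) \<le> \<eta> / c'" using small[OF \<open>y \<in> net\<close>] by linarith
 qed
 also have "... \<le> N * (\<eta> / c')" using \<eta> c' by (simp add: N_def field_simps)
 also have "... = a / (8 * K)" using N c' by (simp add: \<eta>_def)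
 finally have "K * P.prob X \<le> a / 8" using K(1) by (simp add: field_simps)
 then have "prob X \<le> a / 4 + a / 8" using K(2)[OF X] by linarith
 moreover have "prob F \<le> prob X + prob {x. \<not> good \<kappa> n x}"
 proof (rule order_trans[OF finite_measure_mono measure_Un_le])
  show "F \<subseteq> X \<union> {x. \<not> good \<kappa> n x}" by (auto simp: X_def)
  have "- {x. good \<kappa> n x} \<in> sets borel" by (intro borel_comp good_borel)
  then show "{x. \<not> good \<kappa> n x} \<in> sets \<nu>" "X \<union> {x. \<not> good \<kappa> n x} \<in> sets \<nu>" by (auto simp: Collect_neg_eq)
 qed simp
 moreover have "prob (T \<inter> J) = a" unfolding a_def
  by (rule finite_measure_eq_AE) (use AE_J closed_J in auto)
 ultimately show False using F(3) \<kappa>(2)[of n] a by linarith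
qed

text \<open>The null part of the ball outside \<open>T\<close> has null forward images, and by
  invariance these contain every point outside \<open>T\<close> that the images of the ball
  reach.\<close>

lemma invariant_conull:
 assumes T [measurable]: "T \<in> sets borel" and inv: "f -` T = T" and pos: "0 < prob T"
 obtains C where "countable C" "emeasure \<mu> (- T - C) = 0"
proof -
 have invn: "fn n -` T = T" for n by (rule invariant_pow[OF inv])
 obtain y where y: "y \<in> net" "P.prob (ball y r0 - T) = 0" by (rule invariant_ball[OF assms])
 define B where "B = ball y r0"
 define C where "C = - (\<Union>n. (fn n) ` B)"
 have cC: "countable C" unfolding C_def by (rule forward_images_cocountable[of B y]) (use y net r0 in \<open>auto simp: B_def\<close>)
 have N: "B - T \<in> sets borel" "emeasure \<mu> (B - T) = 0" using y(2) by (auto simp: B_def P.emeasure_eq_measure)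
 have null: "fn n ` (B - T) \<in> null_sets \<mu>" for n using null_image_pow[OF N, of n] by (auto simp: null_sets_def)
 have "- T - C \<subseteq> (\<Union>n. (fn n) ` (B - T))"
 proof
  fix z assume z: "z \<in> - T - C"
  then obtain n x where x: "x \<in> B" "z = fn n x" by (auto simp: C_def)
  have "x \<notin> T" using invn[of n] z x(2) by auto
  then show "z \<in> (\<Union>n. (fn n) ` (B - T))" using x by auto
 qed
 moreover have "(\<Union>n. (fn n) ` (B - T)) \<in> null_sets \<mu>" using null by (intro null_sets_UN) auto
 moreover have "- T - C \<in> sets \<mu>" using countable_in_borel[OF cC] by simp
 ultimately have "- T - C \<in> null_sets \<mu>" by (rule null_sets_subset[rotated, rotated])
 then show ?thesis using that[OF cC] by auto
qed

end

text \<open>A Hahn set \<open>P\<close> maximizes the difference \<open>sg\<close> of the two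
  measures. Maximizers are stable under preimages, unions and monotone limits, so the limes superior
  of the preimages of \<open>P\<close> is an exactly invariant maximizer. If the maximum were
  positive, this set would have \<nu>'-measure 1 by \<open>invariant_conull\<close>, a
  contradiction.\<close>

lemma ac_measure_unique:
 assumes A: "ac_measure f d \<mu> \<alpha> \<nu>" and B: "ac_measure f d \<mu> \<alpha> \<nu>'"
 shows "\<nu> = \<nu>'"
proof -
 interpret A: ac_measure f d \<mu> \<alpha> \<nu> by (rule A)
 interpret B: ac_measure f d \<mu> \<alpha> \<nu>' by (rule B)
 obtain P where P: "P \<in> sets borel" "\<And>X. \<lbrakk>X \<in> sets borel; X \<subseteq> P\<rbrakk> \<Longrightarrow> measure \<nu>' X \<le> measure \<nu> X"
  "\<And>X. \<lbrakk>X \<in> sets borel; X \<inter> P = {}\<rbrakk> \<Longrightarrow> measure \<nu> X \<le> measure \<nu>' X"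
  using finite_unsigned_Hahn_decomposition[OF A.finite_measure_axioms B.finite_measure_axioms]
  by (auto simp: A.emeasure_eq_measure B.emeasure_eq_measure)
 define sg where "sg X = measure \<nu> X - measure \<nu>' X" for X
 have sg_Un: "sg (X \<union> Y) + sg (X \<inter> Y) = sg X + sg Y" if [measurable]: "X \<in> sets borel" "Y \<in> sets borel" for X Y
  using A.finite_measure_Union'[of X Y] A.finite_measure_Diff'[of Y X] B.finite_measure_Union'[of X Y] B.finite_measure_Diff'[of Y X]
  by (simp add: sg_def Int_commute)
 have max: "sg X \<le> sg P" if X [measurable]: "X \<in> sets borel" for X
 proof -
  have [measurable]: "P \<in> sets borel" by (rule P)
  have "sg X = sg (X \<inter> P) + sg (X - P)" "sg P = sg (X \<inter> P) + sg (P - X)"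
  proof -
   have "X \<inter> P \<union> (X - P) = X" "X \<inter> P \<union> (P - X) = P" "(X \<inter> P) \<inter> (X - P) = {}" "(X \<inter> P) \<inter> (P - X) = {}" by auto
   then show "sg X = sg (X \<inter> P) + sg (X - P)" "sg P = sg (X \<inter> P) + sg (P - X)"
    using sg_Un[of "X \<inter> P" "X - P"] sg_Un[of "X \<inter> P" "P - X"] by (simp_all add: sg_def)
  qed
  moreover have "sg (X - P) \<le> 0" "0 \<le> sg (P - X)" using P(2)[of "P - X"] P(3)[of "X - P"] by (auto simp: sg_def)
  ultimately show ?thesis by linarith
 qed
 \<comment> \<open>Their intersection consists of the points that visit \<open>P\<close> infinitely
   often; one preimage only shifts the index.\<close>
 define U where "U n = (\<Union>k\<in>{n..}. (f ^^ k) -` P)" for n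
 have pre [measurable]: "(f ^^ k) -` P \<in> sets borel" for k using measurable_sets_borel[OF A.meas_pow P(1)] by simp
 have fin: "(\<Union>k\<in>{n..n + m}. (f ^^ k) -` P) \<in> sets borel \<and> sg (\<Union>k\<in>{n..n + m}. (f ^^ k) -` P) = sg P" for n m
 proof (induction m)
  case 0
  show ?case using pre P(1) by (simp add: sg_def A.measure_pow B.measure_pow)
 next
  case (Suc m)
  define V where "V = (\<Union>k\<in>{n..n + m}. (f ^^ k) -` P)"
  have V: "V \<in> sets borel" "sg V = sg P" using Suc by (auto simp: V_def)
  have eq: "(\<Union>k\<in>{n..n + Suc m}. (f ^^ k) -` P) = V \<union> (f ^^ (n + Suc m)) -` P"
   by (simp add: V_def atLeastAtMostSuc_conv Un_commute)
  have "sg ((f ^^ (n + Suc m)) -` P) = sg P" unfolding sg_def using P(1) by (simp only: A.measure_pow B.measure_pow)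
  \<comment> \<open>By modularity the values on union and intersection add up to twice the maximum,
    and neither can exceed it.\<close>
  then have "sg (V \<union> (f ^^ (n + Suc m)) -` P) = sg P"
   using sg_Un[OF V(1) pre[of "n + Suc m"]] V(2) max[of "V \<union> (f ^^ (n + Suc m)) -` P"] max[of "V \<inter> (f ^^ (n + Suc m)) -` P"] V(1) pre[of "n + Suc m"]
   by simp
  then show ?case unfolding eq using V(1) pre by blast
 qed
 have U: "U n \<in> sets borel" "sg (U n) = sg P" for n
 proof -
  show "U n \<in> sets borel" unfolding U_def by (intro sets.countable_UN'') auto
  have Un: "(\<Union>m. \<Union>k\<in>{n..n + m}. (f ^^ k) -` P) = U n"
  proof safe
   fix x assume "x \<in> U n"
   then obtain k where "n \<le> k" "(f ^^ k) x \<in> P" by (auto simp: U_def)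
   then show "x \<in> (\<Union>m. \<Union>k\<in>{n..n + m}. (f ^^ k) -` P)" by (auto intro!: exI[of _ "k - n"] bexI[of _ k])
  qed (auto simp: U_def)
  have inc: "incseq (\<lambda>m. \<Union>k\<in>{n..n + m}. (f ^^ k) -` P)" by (rule monoI) (intro UN_mono, auto)
  have "(\<lambda>m. sg (\<Union>k\<in>{n..n + m}. (f ^^ k) -` P)) \<longlonglongrightarrow> sg (U n)"
   unfolding sg_def Un[symmetric]
   by (intro tendsto_diff A.finite_Lim_measure_incseq B.finite_Lim_measure_incseq inc) (use fin in auto)
  then show "sg (U n) = sg P" using fin by (simp add: LIMSEQ_const_iff)
 qed
 define E where "E = (\<Inter>n. U n)"
 have E [measurable]: "E \<in> sets borel" unfolding E_def using U(1) by auto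
 have dec: "decseq U" unfolding decseq_def U_def by (intro allI impI UN_mono) auto
 have "(\<lambda>n. sg (U n)) \<longlonglongrightarrow> sg E"
  unfolding sg_def E_def
  by (intro tendsto_diff A.finite_Lim_measure_decseq B.finite_Lim_measure_decseq dec) (use U in auto)
 then have sgE: "sg E = sg P" using U(2) by (simp add: LIMSEQ_const_iff)
 have "f -` U n = U (Suc n)" for n
 proof -
  have "f -` (f ^^ k) -` P = (f ^^ Suc k) -` P" for k by (auto simp: funpow_swap1)
  then have "f -` U n = (\<Union>k\<in>{n..}. (f ^^ Suc k) -` P)" by (simp only: U_def vimage_UN)
  also have "... = (\<Union>k\<in>Suc ` {n..}. (f ^^ k) -` P)" by blast
  also have "Suc ` {n..} = {Suc n..}" by (auto simp: image_iff Suc_le_eq less_iff_Suc_add intro: exI)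
  finally have "f -` U n = (\<Union>k\<in>{Suc n..}. (f ^^ k) -` P)" .
  also have "... = U (Suc n)" by (simp only: U_def)
  finally show ?thesis .
 qed
 then have "f -` E = (\<Inter>n. U (Suc n))" by (simp only: E_def vimage_INT)
 also have "... = E" using dec by (fastforce simp: E_def decseq_Suc_iff)
 finally have inv: "f -` E = E" .
 have le0: "sg P \<le> 0"
 proof (rule ccontr)
  assume "\<not> sg P \<le> 0"
  then have gt: "measure \<nu>' E < measure \<nu> E" using sgE by (simp add: sg_def)
  then have "0 < measure \<nu> E" using measure_nonneg[of \<nu>' E] by linarith
  then obtain C where C: "countable C" "emeasure \<mu> (- E - C) = 0" by (rule A.invariant_conull[OF E inv])
  have "- E - C \<in> null_sets \<mu>" using C countable_in_borel[OF C(1)] by (auto simp: null_sets_def)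
  then have "- E - C \<in> null_sets \<nu>'" using B.ac by (auto simp: absolutely_continuous_def)
  then have "(- E - C) \<union> C \<in> null_sets \<nu>'" using B.countable_null[OF C(1)] by (rule null_sets.Un)
  then have "- E \<in> null_sets \<nu>'" by (rule null_sets_subset) auto
  then have "measure \<nu>' (- E) = 0" by (auto simp: null_sets_def measure_def)
  then have "measure \<nu>' E = 1" using B.prob_compl[of E] by (simp add: Compl_eq_Diff_UNIV)
  then show False using gt A.prob_le_1[of E] by linarith
 qed
 show ?thesis
 proof (rule measure_eqI)
  fix X assume "X \<in> sets \<nu>"
  then have X: "X \<in> sets borel" "- X \<in> sets borel" by auto
  have "measure \<nu> X \<le> measure \<nu>' X" "measure \<nu> (- X) \<le> measure \<nu>' (- X)"
   using max[OF X(1)] max[OF X(2)] le0 by (auto simp: sg_def)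
  moreover have "measure \<nu> (- X) = 1 - measure \<nu> X" "measure \<nu>' (- X) = 1 - measure \<nu>' X"
   using A.prob_compl[of X] B.prob_compl[of X] X by (auto simp: Compl_eq_Diff_UNIV)
  ultimately show "emeasure \<nu> X = emeasure \<nu>' X" by (simp add: A.emeasure_eq_measure B.emeasure_eq_measure)
 qed simp
qed

section \<open>Strict inequality for measures that are not absolutely continuous\<close>

text \<open>At time \<open>t\<close> the later component is smaller than the margin
  \<open>r0 / 2\<close>, so it is mapped into the larger ball and by connectedness lies in the
  component of \<open>x\<close>.\<close>

lemma (in tce_map) comps_nested:
 assumes V: "V \<in> comps s y'" "y' \<in> J" "x \<in> V" and W: "W \<in> comps t y" "x \<in> W" "fn t x \<in> ball y (r0 / 2)"
  and t: "t \<le> s" "4 / lam ^ (s - t) < r0 / 2"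
 shows "V \<subseteq> W"
proof -
 have "fn t ` V \<subseteq> ball y r0"
 proof safe
  fix v assume "v \<in> V"
  then have "dist (fn t x) (fn t v) < r0 / 2" using comps_small[OF V(1,2,3), of v t] t by simp
  then show "fn t v \<in> ball y r0" using W(3) dist_triangle[of y "fn t v" "fn t x"] by simp
 qed
 from pcomp_maximal[OF comps(2)[OF V(1)] V(3) this] show ?thesis using comps(5)[OF W(1,2)] by simp
qed

text \<open>A small set \<open>A\<close> of positive \<open>\<nu>\<close>-measure is hit with positive frequency at times of bounded
 distortion, yet each visit shrinks the \<open>\<mu>\<close>-measure of the set of possible orbits by a small
 factor; \<open>g\<close> is the gap between the times that are taken into account.\<close>

locale sparse_returns = conformal f d \<mu> \<alpha> + julia_measure f d \<nu> for f d \<mu> \<alpha> \<nu> +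
 fixes \<kappa> b c :: real and q g :: nat and A A' :: "rsphere set"
 assumes bc: "0 < b" "0 < c" and mass: "y \<in> net \<Longrightarrow> c \<le> measure \<mu> (ball y r0)"
  and borel_A: "A \<in> sets borel" "A' \<in> sets borel"
  and visits: "b \<le> measure \<nu> {x. good \<kappa> t x \<and> (f ^^ t) x \<in> A}"
  and cost: "\<lbrakk>W \<in> comps (t + q) y; y \<in> net; x \<in> W; good \<kappa> t x\<rbrakk> \<Longrightarrow>
   real (card net) * measure \<mu> (W \<inter> (f ^^ t) -` A') \<le> exp (- (4 / b)) * measure \<mu> W"
  and gap: "q < g" "g - q \<le> k \<Longrightarrow> 4 / lam ^ k < r0 / 2"
   "\<lbrakk>g - q \<le> k; z \<in> A; dist z z' \<le> 4 / lam ^ k\<rbrakk> \<Longrightarrow> z' \<in> A'"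
begin

lemma borel_A' [measurable]: "A \<in> sets borel" "A' \<in> sets borel" by (fact borel_A)+

definition visit where "visit T = {x \<in> J. \<forall>t\<in>T. good \<kappa> t x \<and> fn t x \<in> A}"

definition vcomps where
 "vcomps T t y = {W \<in> comps (t + q) y. \<exists>x\<in>visit T. x \<in> W \<and> fn (t + q) x \<in> ball y (r0 / 2)}"

definition vcover where "vcover T t = (\<Union>y\<in>net. \<Union>(vcomps T t y))"

lemma vcomps_comps: "W \<in> vcomps T t y \<Longrightarrow> W \<in> comps (t + q) y" by (simp add: vcomps_def)

lemma finite_vcomps: "finite (vcomps T t y)" using finite_comps by (simp add: vcomps_def)

lemma open_vcover: "open (vcover T t)"
 unfolding vcover_def by (intro open_UN ballI open_Union) (use comps(1) vcomps_comps in blast)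

lemma disjoint_sub_comps: "\<W> \<subseteq> comps n y \<Longrightarrow> disjoint_family_on (\<lambda>W. W) \<W>"
 using comps_disjoint[of n y] by (auto simp: disjoint_family_on_def pairwise_def disjnt_def)

lemma sum_sub_comps_le:
 assumes "\<W> \<subseteq> comps n y" "\<Union>\<W> \<subseteq> G" "G \<in> sets borel"
 shows "(\<Sum>W\<in>\<W>. P.prob W) \<le> P.prob G"
proof (rule P.sum_measure_le)
 show "finite \<W>" using assms(1) finite_comps finite_subset by blast
 show "disjoint_family_on (\<lambda>W. W) \<W>" by (rule disjoint_sub_comps[OF assms(1)])
 show "(\<lambda>W. W) ` \<W> \<subseteq> sets \<mu>" using assms(1) comps(1) by auto
qed (use assms in auto)

text \<open>After a gap \<open>g\<close> the component around a point visiting at time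
  \<open>s\<close> lies inside one component for time \<open>t\<close>, and its \<open>t\<close>-th
  image lies in \<open>A'\<close>. The assumption \<open>cost\<close> then applies; its factor
  \<open>card net\<close> pays for the sum over centres.\<close>

lemma vcover_step:
 assumes t: "t \<in> T" "t + g \<le> s"
 shows "P.prob (vcover (insert s T) s) \<le> exp (- (4 / b)) * P.prob (vcover T t)"
proof -
 have "vcover (insert s T) s \<subseteq> (\<Union>y\<in>net. \<Union>W\<in>vcomps T t y. W \<inter> fn t -` A')"
 proof
  fix v assume "v \<in> vcover (insert s T) s"
  then obtain y' V x where V: "y' \<in> net" "V \<in> comps (s + q) y'" "x \<in> visit (insert s T)" "x \<in> V" "v \<in> V"
   by (auto simp: vcover_def vcomps_def)
  have x: "x \<in> visit T" "x \<in> J" "fn t x \<in> A" using V(3) t(1) by (auto simp: visit_def)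
  obtain y W where W: "y \<in> net" "W \<in> comps (t + q) y" "x \<in> W" "fn (t + q) x \<in> ball y (r0 / 2)"
   by (rule comps_ex[OF x(2)])
  have y'J: "y' \<in> J" using V net by blast
  have "V \<subseteq> W"
   by (rule comps_nested[OF V(2) y'J V(4) W(2-4)]) (use t gap(1) gap(2)[of "s + q - (t + q)"] in auto)
  moreover have "dist (fn t x) (fn t v) \<le> 4 / lam ^ (s + q - t)"
   by (rule comps_small[OF V(2) y'J V(4,5)]) (use t in simp)
  then have "fn t v \<in> A'" by (rule gap(3)[OF _ x(3), rotated]) (use t in simp)
  moreover have "W \<in> vcomps T t y" using W x by (auto simp: vcomps_def)
  ultimately show "v \<in> (\<Union>y\<in>net. \<Union>W\<in>vcomps T t y. W \<inter> fn t -` A')" using V(5) W(1) by blast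
 qed
 moreover have Wb: "W \<inter> fn t -` A' \<in> sets \<mu>" if "W \<in> vcomps T t y" for W y
  using comps(1)[OF vcomps_comps[OF that]] measurable_sets_borel[OF meas_pow' borel_A'(2), of t] by auto
 then have Ub: "(\<Union>W\<in>vcomps T t y. W \<inter> fn t -` A') \<in> sets \<mu>" for y
  using finite_vcomps by (intro sets.finite_UN) auto
 moreover have "(\<Union>y\<in>net. \<Union>W\<in>vcomps T t y. W \<inter> fn t -` A') \<in> sets \<mu>"
  by (rule sets.finite_UN[OF net(1) Ub])
 ultimately have "P.prob (vcover (insert s T) s) \<le> P.prob (\<Union>y\<in>net. \<Union>W\<in>vcomps T t y. W \<inter> fn t -` A')"
  by (intro P.finite_measure_mono)
 also have "... \<le> (\<Sum>y\<in>net. P.prob (\<Union>W\<in>vcomps T t y. W \<inter> fn t -` A'))"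
  using Ub net(1) by (intro P.finite_measure_subadditive_finite) auto
 also have "... \<le> (\<Sum>y\<in>net. exp (- (4 / b)) * P.prob (vcover T t) / real (card net))"
 proof (rule sum_mono)
  fix y assume y: "y \<in> net"
  have N: "0 < real (card net)" using y net(1) card_gt_0_iff[of net] by auto
  have "P.prob (\<Union>W\<in>vcomps T t y. W \<inter> fn t -` A') \<le> (\<Sum>W\<in>vcomps T t y. P.prob (W \<inter> fn t -` A'))"
   using Wb finite_vcomps by (intro P.finite_measure_subadditive_finite) auto
  also have "... \<le> (\<Sum>W\<in>vcomps T t y. exp (- (4 / b)) / real (card net) * P.prob W)"
  proof (rule sum_mono)
   fix W assume "W \<in> vcomps T t y"
   then obtain x where "W \<in> comps (t + q) y" "x \<in> W" "good \<kappa> t x" using t(1) by (auto simp: vcomps_def visit_def)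
   from cost[OF this(1) y this(2,3)] show "P.prob (W \<inter> fn t -` A') \<le> exp (- (4 / b)) / real (card net) * P.prob W"
    using N by (simp add: le_divide_eq mult.commute)
  qed
  also have "... = exp (- (4 / b)) / real (card net) * (\<Sum>W\<in>vcomps T t y. P.prob W)" by (rule sum_distrib_left[symmetric])
  also have "... \<le> exp (- (4 / b)) / real (card net) * P.prob (vcover T t)"
  proof (intro mult_left_mono sum_sub_comps_le[of _ "t + q" y])
   show "vcomps T t y \<subseteq> comps (t + q) y" using vcomps_comps by blast
   show "\<Union>(vcomps T t y) \<subseteq> vcover T t" using y by (auto simp: vcover_def)
  qed (use open_vcover N in auto)
  finally show "P.prob (\<Union>W\<in>vcomps T t y. W \<inter> fn t -` A') \<le> exp (- (4 / b)) * P.prob (vcover T t) / real (card net)" by simp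
 qed
 also have "... \<le> exp (- (4 / b)) * P.prob (vcover T t)" by simp
 finally show ?thesis .
qed

text \<open>Each time after the first brings one factor, which accounts for the exponent
  \<open>card T - 1\<close>.\<close>

lemma vcover_measure:
 assumes "finite T" "T \<noteq> {}" "\<And>s t. s \<in> T \<Longrightarrow> t \<in> T \<Longrightarrow> s < t \<Longrightarrow> s + g \<le> t"
 shows "P.prob (vcover T (Max T)) \<le> exp (- (4 / b)) ^ (card T - 1)"
 using assms
proof (induction T rule: finite_linorder_max_induct)
 case (insert s T)
 have mx: "Max (insert s T) = s" using insert(1,2) by (intro Max_eqI) auto
 have "s \<notin> T" using insert(2) by auto
 then have cd: "card (insert s T) - 1 = card T" using insert(1) by simp
 show ?case
 proof (cases "T = {}")
  case False
  define t where "t = Max T"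
  have t: "t \<in> T" using insert(1) False by (simp add: t_def)
  have "t + g \<le> s" using insert.prems(2)[of t s] insert(2) t by auto
  then have "P.prob (vcover (insert s T) s) \<le> exp (- (4 / b)) * P.prob (vcover T t)" by (rule vcover_step[OF t])
  also have "... \<le> exp (- (4 / b)) * exp (- (4 / b)) ^ (card T - 1)"
   unfolding t_def using insert.IH[OF False] insert.prems(2) by (intro mult_left_mono) auto
  also have "... = exp (- (4 / b)) ^ card T"
   using insert(1) False by (cases "card T") auto
  finally show ?thesis unfolding mx cd .
 qed (use mx in auto)
qed simp

context
 fixes m :: nat
begin

definition times where "times = (*) g ` {..<m}"
definition hits where "hits x = {t \<in> times. good \<kappa> t x \<and> fn t x \<in> A}"
definition often where "often = {x \<in> J. b * real m / 2 \<le> real (card (hits x))}"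
text \<open>The visiting times depend on the point, so all sets of times with the required frequency
  are taken together.\<close>

definition plus where "plus = (\<Union>T\<in>{T. T \<subseteq> times \<and> T \<noteq> {} \<and> b * real m / 2 \<le> real (card T)}. vcover T (Max T))"

lemma times: "finite times" "card times = m" "s \<in> times \<Longrightarrow> t \<in> times \<Longrightarrow> s < t \<Longrightarrow> s + g \<le> t"
proof -
 have g: "0 < g" using gap(1) by simp
 show "finite times" by (simp add: times_def)
 show "card times = m" using g by (simp add: times_def card_image inj_on_def)
 assume "s \<in> times" "t \<in> times" "s < t"
 then obtain i j where "s = g * i" "t = g * j" "i < j" using g by (auto simp: times_def)
 then show "s + g \<le> t" using mult_le_mono2[of "Suc i" j g] by simp
qed

text \<open>At most \<open>2 ^ m\<close> sets of times compete, each with mass at most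
  \<open>exp (4 / b - 2 * real m)\<close>, because \<open>card T\<close> is at least
  \<open>b * m / 2\<close>. The rate \<open>4 / b\<close> is chosen so that the entropy of this
  choice is outweighed.\<close>

lemma measure_plus: "P.prob plus \<le> exp (4 / b - real m)"
proof -
 define S where "S = {T. T \<subseteq> times \<and> T \<noteq> {} \<and> b * real m / 2 \<le> real (card T)}"
 have S: "finite S" "card S \<le> 2 ^ m"
 proof -
  have "S \<subseteq> Pow times" by (auto simp: S_def)
  then show "finite S" "card S \<le> 2 ^ m"
   using times(1) finite_subset card_mono[of "Pow times" S] by (auto simp: card_Pow times(2))
 qed
 have "P.prob plus \<le> (\<Sum>T\<in>S. P.prob (vcover T (Max T)))"
  unfolding plus_def S_def[symmetric] using S open_vcover by (intro P.finite_measure_subadditive_finite) auto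
 also have "... \<le> (\<Sum>T\<in>S. exp (4 / b - 2 * real m))"
 proof (rule sum_mono)
  fix T assume "T \<in> S"
  then have T: "T \<subseteq> times" "T \<noteq> {}" "b * real m / 2 \<le> real (card T)" by (auto simp: S_def)
  have fin: "finite T" using T times(1) finite_subset by blast
  have "P.prob (vcover T (Max T)) \<le> exp (- (4 / b)) ^ (card T - 1)"
   using T times(3) by (intro vcover_measure fin) auto
  also have "... = exp (real (card T - 1) * (- (4 / b)))" by (rule exp_of_nat_mult[symmetric])
  also have "real (card T - 1) * (- (4 / b)) = 4 / b - real (card T) * (4 / b)"
  proof -
   have "(x - 1) * - u = u - x * u" for x u :: real by (simp add: algebra_simps)
   moreover have "real (card T - 1) = real (card T) - 1" using fin T(2) card_gt_0_iff[of T] by (simp add: of_nat_diff)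
   ultimately show ?thesis by presburger
  qed
  also have "exp \<dots> \<le> exp (4 / b - 2 * real m)"
  proof -
   have "b * real m / 2 * (4 / b) \<le> real (card T) * (4 / b)" using T(3) bc by (intro mult_right_mono) auto
   then show ?thesis using bc by simp
  qed
  finally show "P.prob (vcover T (Max T)) \<le> exp (4 / b - 2 * real m)" .
 qed
 also have "... \<le> 2 ^ m * exp (4 / b - 2 * real m)" using S(2) by (simp add: mult_right_mono)
 also have "(2::real) ^ m \<le> exp 1 ^ m" using exp_ge_add_one_self[of 1] by (intro power_mono) auto
 then have "2 ^ m * exp (4 / b - 2 * real m) \<le> exp (real m) * exp (4 / b - 2 * real m)"
  by (intro mult_right_mono) (simp_all add: exp_of_nat_mult[of m 1, simplified])
 also have "... = exp (4 / b - real m)" by (simp add: exp_add[symmetric])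
 finally show ?thesis .
qed

lemma borel_visit [measurable]: "{x. good \<kappa> t x \<and> fn t x \<in> A} \<in> sets borel"
 using good_borel[of \<kappa> t] measurable_sets_borel[OF meas_pow borel_A'(1), of t]
 by (simp add: Collect_conj_eq vimage_def)

lemma card_hits: "real (card (hits x)) = (\<Sum>t\<in>times. indicator {x. good \<kappa> t x \<and> fn t x \<in> A} x)"
 unfolding hits_def using times(1) by (simp add: sum.inter_filter[symmetric] indicator_def of_bool_def Int_def sum.If_cases)

lemma borel_often [measurable]: "often \<in> sets borel"
proof -
 have [measurable]: "(\<lambda>x. real (card (hits x))) \<in> borel_measurable borel" unfolding card_hits by measurable
 have "often = J \<inter> {x \<in> space borel. b * real m / 2 \<le> real (card (hits x))}" by (auto simp: often_def)
 also have "... \<in> sets borel" using closed_J by (intro sets.Int) (auto intro: borel_closed)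
 finally show ?thesis .
qed

text \<open>The number of visits is at most \<open>m\<close> and has mean at least
  \<open>b * m\<close>, so it is at least half this mean with probability at least
  \<open>b / 2\<close>.\<close>

lemma measure_often: assumes m: "0 < m" shows "b / 2 \<le> prob often"
proof -
 have int: "integrable \<nu> (\<lambda>x. \<Sum>t\<in>times. indicator {x. good \<kappa> t x \<and> fn t x \<in> A} x :: real)"
  by (intro Bochner_Integration.integrable_sum) (simp add: emeasure_eq_measure)
 have "real m * b = (\<Sum>t\<in>times. b)" by (simp add: times(2))
 also have "... \<le> (\<Sum>t\<in>times. \<integral>x. indicator {x. good \<kappa> t x \<and> fn t x \<in> A} x \<partial>\<nu>)"
  by (intro sum_mono) (simp add: visits)
 also have "... = (\<integral>x. (\<Sum>t\<in>times. indicator {x. good \<kappa> t x \<and> fn t x \<in> A} x) \<partial>\<nu>)"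
  by (rule Bochner_Integration.integral_sum[symmetric]) (simp add: emeasure_eq_measure)
 also have "... \<le> (\<integral>x. b * real m / 2 + real m * indicator often x \<partial>\<nu>)"
 proof (rule integral_mono_AE[OF int])
  show "AE x in \<nu>. (\<Sum>t\<in>times. indicator {x. good \<kappa> t x \<and> fn t x \<in> A} x) \<le> b * real m / 2 + real m * indicator often x"
   using AE_J
  proof eventually_elim
   case (elim x)
   have "card (hits x) \<le> m" using card_mono[of times "hits x"] times by (auto simp: hits_def)
   moreover have "0 \<le> b * real m / 2" using bc by simp
   ultimately show ?case unfolding card_hits[symmetric] using elim by (auto simp: often_def indicator_def)
  qed
 qed (auto intro!: Bochner_Integration.integrable_add simp: emeasure_eq_measure)
 also have "... = b * real m / 2 + real m * prob often"
  by (subst Bochner_Integration.integral_add) (auto simp: emeasure_eq_measure)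
 finally have "real m * (b / 2) \<le> real m * prob often" by (simp add: field_simps)
 then show ?thesis using m by simp
qed

text \<open>Take the actual visiting times of \<open>x\<close> and their maximum \<open>t\<close>;
  the component at time \<open>g * m\<close> lies in the component for \<open>t\<close> by
  nesting.\<close>

lemma often_plus:
 assumes m: "0 < m" and x: "x \<in> often" "x \<in> V" and V: "V \<in> comps (g * m) y'" "y' \<in> net"
 shows "V \<subseteq> plus"
proof -
 define T where "T = hits x"
 have xJ: "x \<in> J" and cd: "b * real m / 2 \<le> real (card T)" using x(1) by (auto simp: often_def T_def)
 have "0 < b * real m / 2" using bc m by simp
 then have ne: "T \<noteq> {}" using cd by auto
 have sub: "T \<subseteq> times" by (auto simp: T_def hits_def)
 have fin: "finite T" using sub times(1) finite_subset by blast
 define t where "t = Max T"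
 have t: "t \<in> T" using fin ne by (simp add: t_def)
 have vis: "x \<in> visit T" using xJ by (auto simp: visit_def T_def hits_def)
 obtain i where i: "t = g * i" "i < m" using t sub by (auto simp: times_def)
 then have tg: "t + g \<le> g * m" using mult_le_mono2[of "Suc i" m g] by simp
 obtain y W where W: "y \<in> net" "W \<in> comps (t + q) y" "x \<in> W" "fn (t + q) x \<in> ball y (r0 / 2)" by (rule comps_ex[OF xJ])
 have "V \<subseteq> W"
  by (rule comps_nested[OF V(1) _ x(2) W(2-4)]) (use tg gap(1) gap(2)[of "g * m - (t + q)"] V(2) net in auto)
 moreover have "W \<subseteq> vcover T t" using W vis by (auto simp: vcover_def vcomps_def)
 moreover have "vcover T t \<subseteq> plus" using sub ne cd by (auto simp: plus_def t_def)
 ultimately show ?thesis by blast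
qed

end

text \<open>Components at time \<open>g * m\<close> are weighted by their \<mu>-mass, but half of
  the total weight is reserved for components meeting \<open>often\<close>. These lie in
  \<open>plus\<close>, whose mass is about \<open>exp (- m)\<close>, so renormalizing gains
  \<open>m\<close> on a set of \<nu>-measure at least \<open>b / 2\<close>: a gain of
  \<open>b / (2 * g)\<close> per unit of time.\<close>

lemma entropy_upper_strict:
 assumes P: "part P" shows "ent P \<le> \<alpha> * chi - b / (2 * real g)"
proof (rule le_of_eps[where C = "\<alpha> + 1"])
 fix e :: real assume e: "0 < e"
 obtain \<delta> C where \<delta>: "0 < \<delta>" "0 \<le> C" and cb:
  "\<And>n (I :: (rsphere \<times> rsphere set) set) V (w :: rsphere \<times> rsphere set \<Rightarrow> real) G K. \<lbrakk>finite I; \<And>i. i \<in> I \<Longrightarrow> 0 \<le> w i; sum w I \<le> 1; integrable \<nu> G;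
  AE x in \<nu>. \<exists>i\<in>I. x \<in> V i \<and> 0 < w i \<and> - ln (w i) \<le> G x;
  \<And>i. i \<in> I \<Longrightarrow> card {j\<in>{..<n}. \<exists>u\<in>V i. \<exists>v\<in>V i. \<delta> \<le> dist (fn j u) (fn j v)} \<le> K\<rbrakk> \<Longrightarrow>
  partition_entropy \<nu> (join P n) \<le> (\<integral>x. G x \<partial>\<nu>) + real n * e + C * real K"
  by (rule cover_bound[OF P e]) blast
 obtain k where k: "\<And>j. k \<le> j \<Longrightarrow> 4 / lam ^ j < \<delta>" using lam_small[OF \<delta>(1)] by blast
 obtain C2 where C2: "\<And>n. (\<Sum>i<n. E (tail (n - i))) \<le> real n * (chi + e) + C2" by (rule sum_E_tail_chi[OF e]) blast
 define N where "N = real (card net) + 1"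
 have N: "1 \<le> N" by (simp add: N_def)
 define C1 where "C1 = ln (2 * N) - ln c + 4 / b"
 define C3 where "C3 = \<bar>\<alpha> * C2 + C1 + C * real k\<bar>"
 have main: "partition_entropy \<nu> (join P (g * m)) \<le>
   \<alpha> * (real (g * m) * (chi + e) + C2) + C1 - real m * (b / 2) + real (g * m) * e + C * real k" if m: "0 < m" for m
 proof -
  define n where "n = g * m"
  define I where "I = Sigma net (comps n)"
  define hit where "hit V \<longleftrightarrow> V \<inter> often m \<noteq> {}" for V
  define p where "p = P.prob (plus m)"
  \<comment> \<open>The first summand covers every component; the second is \<mu> conditioned on
    \<open>plus\<close>. Both halves are spread over the centres of the net.\<close>
  define w where "w = (\<lambda>(y :: rsphere, V). P.prob V / (2 * N) + (if hit V then P.prob V / (2 * N * p) else 0))"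
  define G where "G x = \<alpha> * (\<Sum>i<n. le (tail (n - i)) (fn i x)) + C1 - real m * indicator (often m) x" for x
  have pl: "plus m \<in> sets borel" unfolding plus_def using open_vcover by (intro borel_open open_UN) auto
  have intG0: "integrable \<nu> (\<lambda>x. \<alpha> * (\<Sum>i<n. le (tail (n - i)) (fn i x)) + C1)"
   by (intro Bochner_Integration.integrable_add integrable_mult_right Bochner_Integration.integrable_sum le_int_pow tail(1) integrable_const)
  have intG1: "integrable \<nu> (\<lambda>x. real m * indicator (often m) x)"
   using borel_often[of m] by (intro integrable_mult_right) (auto simp: emeasure_eq_measure)
  have intG: "integrable \<nu> G" unfolding G_def[abs_def] by (rule Bochner_Integration.integrable_diff[OF intG0 intG1])
  have half: "real (card net) * (1 / (2 * N)) \<le> 1 / 2" using N by (simp add: N_def field_simps)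
  have "partition_entropy \<nu> (join P n) \<le> (\<integral>x. G x \<partial>\<nu>) + real n * e + C * real k"
  proof (rule cb[of I w G snd n k])
   show "finite I" unfolding I_def using net(1) finite_comps by blast
   show "0 \<le> w i" for i using N by (auto simp: w_def p_def split: prod.split)
   show "integrable \<nu> G" by (rule intG)
   have "sum w I = (\<Sum>y\<in>net. \<Sum>V\<in>comps n y. P.prob V / (2 * N) + (if hit V then P.prob V / (2 * N * p) else 0))"
    unfolding I_def w_def using net(1) finite_comps by (subst sum.Sigma) auto
   also have "... \<le> (\<Sum>y\<in>net. 1 / (2 * N) + 1 / (2 * N))"
   proof (rule sum_mono)
    fix y assume y: "y \<in> net"
    have fin: "finite (comps n y)" by (rule finite_comps)
    have "(\<Sum>V\<in>comps n y. P.prob V / (2 * N) + (if hit V then P.prob V / (2 * N * p) else 0))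
     = (\<Sum>V\<in>comps n y. P.prob V) / (2 * N) + (\<Sum>V\<in>{V \<in> comps n y. hit V}. P.prob V) / (2 * N * p)"
    proof -
     have "(\<Sum>V\<in>comps n y. if hit V then P.prob V / (2 * N * p) else 0) = (\<Sum>V\<in>comps n y. (if hit V then P.prob V else 0) / (2 * N * p))"
      by (intro sum.cong) auto
     then show ?thesis using fin by (simp add: sum.distrib sum_divide_distrib sum.inter_filter)
    qed
    also have "... \<le> 1 / (2 * N) + p / (2 * N * p)"
    proof (intro add_mono divide_right_mono)
     show "(\<Sum>V\<in>comps n y. P.prob V) \<le> 1" using sum_sub_comps_le[of "comps n y" n y UNIV] P.prob_space by simp
     show "(\<Sum>V\<in>{V \<in> comps n y. hit V}. P.prob V) \<le> p" unfolding p_def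
     proof (rule sum_sub_comps_le[of _ n y])
      have "V \<subseteq> plus m" if "V \<in> comps n y" "hit V" for V
      proof -
       obtain x where "x \<in> often m" "x \<in> V" using \<open>hit V\<close> by (auto simp: hit_def)
       from often_plus[OF m this] that(1) y show ?thesis by (simp add: n_def)
      qed
      then show "\<Union>{V \<in> comps n y. hit V} \<subseteq> plus m" by blast
     qed (use pl in auto)
    qed (use N in \<open>auto simp: p_def\<close>)
    \<comment> \<open>For \<open>p = 0\<close> division by zero gives 0, so the bound holds in that
      case as well.\<close>
    also have "p / (2 * N * p) \<le> 1 / (2 * N)" using N by (cases "p = 0") auto
    finally show "(\<Sum>V\<in>comps n y. P.prob V / (2 * N) + (if hit V then P.prob V / (2 * N * p) else 0)) \<le> 1 / (2 * N) + 1 / (2 * N)"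
     by simp
   qed
   also have "... = 2 * (real (card net) * (1 / (2 * N)))" by simp
   also have "... \<le> 1" using half by linarith
   finally show "sum w I \<le> 1" .
   show "AE x in \<nu>. \<exists>i\<in>I. x \<in> snd i \<and> 0 < w i \<and> - ln (w i) \<le> G x"
    using AE_J
   proof eventually_elim
    case (elim x)
    obtain y V where V: "y \<in> net" "V \<in> comps n y" "x \<in> V" by (rule comps_ex[OF elim])
    define Q where "Q = (\<Prod>i<n. D (fn i x) + tail (n - i))"
    have fac: "0 < D (fn i x) + tail (n - i)" for i using D_nonneg tail(1) by (intro add_nonneg_pos) auto
    then have Q: "0 < Q" by (simp add: Q_def prod_pos)
    have lnQ: "ln Q = (\<Sum>i<n. le (tail (n - i)) (fn i x))"
     unfolding Q_def le_def by (rule ln_prod) (use fac[THEN less_imp_neq] in auto)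
    have "c \<le> Q powr \<alpha> * P.prob V"
     using comps_measure[OF V(2) _ V(3)] mass[OF V(1)] V(1) net unfolding Q_def by force
    then have "0 < P.prob V" and "ln c \<le> ln (Q powr \<alpha> * P.prob V)"
     using bc(2) by (auto simp: zero_less_measure_iff intro!: ln_mono)
    then have muV: "0 < P.prob V" "ln c \<le> \<alpha> * ln Q + ln (P.prob V)"
     using Q by (auto simp: ln_mult ln_powr)
    have VI: "(y, V) \<in> I" using V by (simp add: I_def)
    show ?case
    proof (cases "x \<in> often m")
     case False
     have w: "P.prob V / (2 * N) \<le> w (y, V)" using N by (simp add: w_def p_def)
     have pos: "0 < P.prob V / (2 * N)" using muV N by simp
     have "ln (P.prob V / (2 * N)) \<le> ln (w (y, V))" using w pos by (intro ln_mono) auto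
     moreover have "ln (P.prob V / (2 * N)) = ln (P.prob V) - ln (2 * N)" using muV N by (subst ln_div) auto
     moreover have "0 \<le> 4 / b" using bc by simp
     moreover have "G x = \<alpha> * ln Q + (ln (2 * N) - ln c + 4 / b)" using False by (simp add: G_def C1_def lnQ)
     ultimately have "- ln (w (y, V)) \<le> G x" using muV(2) by linarith
     then show ?thesis using VI V(3) w pos by (intro bexI[of _ "(y, V)"]) auto
    next
     case True
     then have hit: "hit V" using V(3) by (auto simp: hit_def)
     have "V \<subseteq> plus m" by (rule often_plus[OF m True V(3) _ V(1)]) (use V(2) in \<open>simp add: n_def\<close>)
     then have "P.prob V \<le> p" unfolding p_def using pl by (intro P.finite_measure_mono) auto
     then have p: "0 < p" "ln p \<le> 4 / b - real m"
      using muV(1) measure_plus[of m, folded p_def] ln_mono[of p "exp (4 / b - real m)"] by auto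
     have w: "P.prob V / (2 * N * p) \<le> w (y, V)" using N hit by (simp add: w_def)
     have pos: "0 < P.prob V / (2 * N * p)" using muV N p by simp
     have "ln (P.prob V / (2 * N * p)) \<le> ln (w (y, V))" using w pos by (intro ln_mono) auto
     moreover have "ln (P.prob V / (2 * N * p)) = ln (P.prob V) - (ln (2 * N) + ln p)"
      using muV N p by (subst ln_div, subst ln_mult) auto
     moreover have "G x = \<alpha> * ln Q + (ln (2 * N) - ln c + 4 / b) - real m" using True by (simp add: G_def C1_def lnQ)
     ultimately have "- ln (w (y, V)) \<le> G x" using muV(2) p(2) by linarith
     then show ?thesis using VI V(3) w pos by (intro bexI[of _ "(y, V)"]) auto
    qed
   qed
   show "card {j \<in> {..<n}. \<exists>u\<in>snd i. \<exists>v\<in>snd i. \<delta> \<le> dist (fn j u) (fn j v)} \<le> k" if "i \<in> I" for i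
   proof -
    obtain y V where i: "i = (y, V)" "y \<in> net" "V \<in> comps n y" using \<open>i \<in> I\<close> by (auto simp: I_def)
    have "{j \<in> {..<n}. \<exists>u\<in>V. \<exists>v\<in>V. \<delta> \<le> dist (fn j u) (fn j v)} \<subseteq> {n - k..<n}"
    proof safe
     fix j u v assume j: "j < n" "u \<in> V" "v \<in> V" "\<delta> \<le> dist (fn j u) (fn j v)"
     have "dist (fn j u) (fn j v) \<le> 4 / lam ^ (n - j)"
      by (rule comps_small[OF i(3)]) (use i net j in auto)
     then have "\<not> k \<le> n - j" using k[of "n - j"] j(4) by linarith
     then show "j \<in> {n - k..<n}" using j(1) by auto
    qed
    then have "card {j \<in> {..<n}. \<exists>u\<in>V. \<exists>v\<in>V. \<delta> \<le> dist (fn j u) (fn j v)} \<le> card {n - k..<n}"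
     by (intro card_mono) auto
    then show ?thesis by (simp add: i(1))
   qed
  qed
  moreover have "(\<integral>x. G x \<partial>\<nu>) = \<alpha> * (\<Sum>i<n. E (tail (n - i))) + C1 - real m * prob (often m)"
  using intG1 le_int_pow tail(1) E_pow by (simp add: G_def)
  moreover have "real m * (b / 2) \<le> real m * prob (often m)" by (intro mult_left_mono measure_often m) simp
  moreover have "\<alpha> * (\<Sum>i<n. E (tail (n - i))) \<le> \<alpha> * (real n * (chi + e) + C2)" using C2 \<alpha> by (intro mult_left_mono) auto
  ultimately show ?thesis unfolding n_def by linarith
 qed
 have g: "0 < g" using gap(1) by simp
 have "real m * (real g * ent P) \<le> real m * (real g * (\<alpha> * chi + (\<alpha> + 1) * e) - b / 2) + C3" for m
 proof (cases "m = 0")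
  case False
  then have "real (g * m) * ent P \<le> partition_entropy \<nu> (join P (g * m))"
   using ent(2)[OF P, of "g * m"] g by (simp add: le_divide_eq mult.commute)
  also note main
  also have "\<alpha> * (real (g * m) * (chi + e) + C2) + C1 - real m * (b / 2) + real (g * m) * e + C * real k
   = real m * (real g * (\<alpha> * chi + (\<alpha> + 1) * e) - b / 2) + (\<alpha> * C2 + C1 + C * real k)"
   by (simp add: algebra_simps)
  also have "... \<le> real m * (real g * (\<alpha> * chi + (\<alpha> + 1) * e) - b / 2) + C3" by (simp add: C3_def)
  finally show ?thesis using False by (simp add: mult_ac)
 qed (simp add: C3_def)
 then have "real g * ent P \<le> real g * (\<alpha> * chi + (\<alpha> + 1) * e) - b / 2" by (rule le_of_linear_le)
 then show "ent P \<le> \<alpha> * chi - b / (2 * real g) + (\<alpha> + 1) * e" using g by (simp add: field_simps)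
qed (use \<alpha> in simp)

lemma metric_entropy_strict: "metric_entropy \<nu> f < ereal (\<alpha> * chi)"
proof -
 have "metric_entropy \<nu> f \<le> ereal (\<alpha> * chi - b / (2 * real g))" by (rule metric_entropy_le[OF entropy_upper_strict])
 also have "... < ereal (\<alpha> * chi)" using bc gap(1) by simp
 finally show ?thesis .
qed

end

text \<open>Positivity of ball masses is a property of \<mu> that is derived from an absolutely
  continuous measure. It is assumed here because \<nu> is now an arbitrary competitor.\<close>

locale charged_julia = conformal f d \<mu> \<alpha> + julia_measure f d \<nu> for f d \<mu> \<alpha> \<nu> +
 assumes charged: "y \<in> Julia f \<Longrightarrow> 0 < measure \<mu> (ball y r0)"
begin

text \<open>A compact \<mu>-null set \<open>A\<close> of positive \<nu>-measure has neighbourhoods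
  of arbitrarily small \<mu>-mass. With bounded distortion at good times, a visit near
  \<open>A\<close> occupies a tiny fraction of a component, which is the input of
  \<open>sparse_returns\<close>.\<close>

lemma entropy_strict:
 assumes nac: "\<not> absolutely_continuous \<mu> \<nu>"
 shows "metric_entropy \<nu> f < ereal (\<alpha> * chi)"
proof -
 obtain S where S: "S \<in> sets borel" "emeasure \<mu> S = 0" "emeasure \<nu> S \<noteq> 0"
  using nac by (auto simp: absolutely_continuous_def null_sets_def)
 have SJ [measurable]: "S \<inter> J \<in> sets borel" using S closed_J by auto
 have "prob (S \<inter> J) = prob S"
  by (rule finite_measure_eq_AE) (use AE_J S SJ in auto)
 then have "0 < prob (S \<inter> J)" using S(3) by (simp add: emeasure_eq_measure zero_less_measure_iff)
 then obtain A where A: "A \<subseteq> S \<inter> J" "compact A" "prob (S \<inter> J) - prob (S \<inter> J) < prob A"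
  using compact_approx[OF SJ, of "prob (S \<inter> J)"] by blast
 \<comment> \<open>Half the mass of \<open>A\<close>: times that are not good have probability at
   most \<open>b\<close>, so good visits still have probability at least \<open>b\<close>.\<close>
 define b where "b = prob A / 2"
 have b: "0 < b" using A(3) by (simp add: b_def)
 have Ab: "A \<in> sets borel" using compact_imp_closed[OF A(2)] by simp
 have "P.prob A \<le> P.prob S" using A S by (intro P.finite_measure_mono) auto
 then have A0: "P.prob A = 0" using S(2) by (simp add: P.emeasure_eq_measure measure_le_0_iff)
 obtain \<kappa> where \<kappa>: "0 < \<kappa>" "\<And>n. prob {x. \<not> good \<kappa> n x} \<le> b" by (rule good_mass[OF b]) blast
 obtain q where q: "\<And>n x y W. \<lbrakk>good \<kappa> n x; x \<in> W; W \<in> comps (n + q) y; y \<in> J\<rbrakk> \<Longrightarrow> tame n W (Dn n x)"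
  by (rule good_distortion[OF \<kappa>(1)]) blast
 define c where "c = Min (insert 1 ((\<lambda>y. P.prob (ball y r0)) ` net))"
 have c: "0 < c" "y \<in> net \<Longrightarrow> c \<le> P.prob (ball y r0)" for y
  using net(1,2) charged by (auto simp: c_def Min_gr_iff)
 define N where "N = real (card net) + 1"
 have N: "0 < N" "real (card net) \<le> N" by (auto simp: N_def)
 define c0 where "c0 = c / (L ^ q) powr \<alpha>"
 have Lp: "0 < (L ^ q) powr \<alpha>" using L(1) by simp
 have c0: "0 < c0" using c(1) Lp by (simp add: c0_def)
 \<comment> \<open>The distortion factor \<open>9 powr \<alpha>\<close>, the size of the net and the
   mass \<open>c0\<close> of the image are divided out in advance, so that a visit costs the factor
   \<open>exp (- (4 / b))\<close>.\<close>
 define \<eta> where "\<eta> = exp (- (4 / b)) * c0 / (9 powr \<alpha> * N)"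
 have \<eta>: "0 < \<eta>" using c0 N by (simp add: \<eta>_def)
 obtain \<rho> where \<rho>: "0 < \<rho>" "P.prob (\<Union>y\<in>A. ball y \<rho>) < P.prob A + \<eta>"
  by (rule compact_neighbourhood_measure[OF P.finite_measure_axioms sets_mu A(2) \<eta>]) blast
 define A' where "A' = (\<Union>y\<in>A. ball y \<rho>)"
 have A'b: "A' \<in> sets borel" unfolding A'_def by (intro borel_open open_UN ballI open_ball)
 have A': "P.prob A' \<le> \<eta>" using \<rho>(2) A0 by (simp add: A'_def)
 have mn: "0 < min (r0 / 2) \<rho>" using r0 \<rho>(1) by simp
 obtain k0 where k0: "\<And>m. k0 \<le> m \<Longrightarrow> 4 / lam ^ m < min (r0 / 2) \<rho>" using lam_small[OF mn] by blast
 \<comment> \<open>Gaps this long make pull-backs finer than the margin \<open>r0 / 2\<close> of the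
   net and than the width \<rho> of the neighbourhood \<open>A'\<close>, even after the
   \<open>q\<close> extra steps.\<close>
 define g where "g = k0 + q + 1"
 interpret R: sparse_returns f d \<mu> \<alpha> \<nu> \<kappa> b c q g A A'
 proof
  show "b \<le> prob {x. good \<kappa> t x \<and> fn t x \<in> A}" for t
  proof -
   have pre: "fn t -` A \<in> sets borel" using measurable_sets_borel[OF meas_pow Ab] by simp
   have bad: "{x. \<not> good \<kappa> t x} \<in> sets borel" using borel_comp[OF good_borel[of \<kappa> t]] by (simp add: Collect_neg_eq)
   have gd: "{x. good \<kappa> t x \<and> fn t x \<in> A} \<in> sets borel" using good_borel[of \<kappa> t] pre by (simp add: Collect_conj_eq vimage_def)
   have "2 * b = prob (fn t -` A)" by (simp add: b_def measure_pow[OF Ab])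
   also have "... \<le> prob ({x. good \<kappa> t x \<and> fn t x \<in> A} \<union> {x. \<not> good \<kappa> t x})"
    using gd bad by (intro finite_measure_mono) auto
   also have "... \<le> prob {x. good \<kappa> t x \<and> fn t x \<in> A} + prob {x. \<not> good \<kappa> t x}"
    using gd bad by (intro measure_Un_le) auto
   finally show ?thesis using \<kappa>(2)[of t] by linarith
  qed
 next
  fix W t y x assume W: "W \<in> comps (t + q) y" "y \<in> net" "x \<in> W" "good \<kappa> t x"
  have y: "y \<in> J" using W net by blast
  have tame: "tame t W (Dn t x)" by (rule q[OF W(4,3,1) y])
  have "c \<le> (L ^ q) powr \<alpha> * P.prob (fn t ` W)" using image_of_comps_measure[OF W(1), of UNIV] c(2)[OF W(2)] by simp
  then have "c0 \<le> P.prob (fn t ` W)" using Lp by (simp add: c0_def divide_le_eq mult.commute)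
  then have "P.prob (W \<inter> fn t -` A') * c0 \<le> P.prob (W \<inter> fn t -` A') * P.prob (fn t ` W)"
   by (intro mult_left_mono) auto
  also have "... \<le> 9 powr \<alpha> * P.prob W * P.prob (fn t ` W \<inter> A')"
   using distortion_ratio(1)[OF comps(1)[OF W(1)] tame A'b] .
  also have "... \<le> 9 powr \<alpha> * P.prob W * \<eta>"
  proof (intro mult_left_mono)
   have "P.prob (fn t ` W \<inter> A') \<le> P.prob A'" using A'b by (intro P.finite_measure_mono) auto
   then show "P.prob (fn t ` W \<inter> A') \<le> \<eta>" using A' by linarith
  qed simp
  also have "... = (exp (- (4 / b)) * P.prob W / N) * c0" using N by (simp add: \<eta>_def)
  finally have "P.prob (W \<inter> fn t -` A') \<le> exp (- (4 / b)) * P.prob W / N"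
   using c0 by (rule_tac mult_right_le_imp_le)
  then have "N * P.prob (W \<inter> fn t -` A') \<le> exp (- (4 / b)) * P.prob W" using N by (simp add: le_divide_eq mult.commute)
  moreover have "real (card net) * P.prob (W \<inter> fn t -` A') \<le> N * P.prob (W \<inter> fn t -` A')"
   using N by (intro mult_right_mono) auto
  ultimately show "real (card net) * P.prob (W \<inter> fn t -` A') \<le> exp (- (4 / b)) * P.prob W" by linarith
 next
  fix k z z' assume "g - q \<le> k" "z \<in> A" "dist z z' \<le> 4 / lam ^ k"
  moreover have "4 / lam ^ k < \<rho>" using k0[of k] \<open>g - q \<le> k\<close> by (simp add: g_def)
  ultimately show "z' \<in> A'" by (auto simp: A'_def intro!: bexI[of _ z])
 next
  fix k assume "g - q \<le> k"
  then show "4 / lam ^ k < r0 / 2" using k0[of k] by (simp add: g_def)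
 qed (use b c Ab A'b in \<open>auto simp: g_def\<close>)
 show ?thesis by (rule R.metric_entropy_strict)
qed

end

section \<open>The Fatou set carries no mass\<close>

text \<open>A Vitali-type convergence theorem: any Montel limit is the identity on the open set
  \<open>T\<close>, hence on the whole disc. Since this holds for every subsequence, convergence is
  uniform on the smaller disc.\<close>

lemma holomorphic_converge_id:
 fixes G :: "nat \<Rightarrow> complex \<Rightarrow> complex"
 assumes r: "0 < r" and G: "eventually (\<lambda>k. G k holomorphic_on ball a r \<and> (\<forall>z\<in>ball a r. norm (G k z) \<le> 2)) sequentially"
  and T: "open T" "T \<noteq> {}" "T \<subseteq> ball a r" "\<And>z. z \<in> T \<Longrightarrow> (\<lambda>k. G k z) \<longlonglongrightarrow> z" and e: "0 < e"
 shows "eventually (\<lambda>k. \<forall>z\<in>cball a (r / 2). norm (G k z - z) < e) sequentially"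
proof (rule ccontr)
 assume neg: "\<not> eventually (\<lambda>k. \<forall>z\<in>cball a (r / 2). norm (G k z - z) < e) sequentially"
 have "\<exists>k\<ge>n. (G k holomorphic_on ball a r \<and> (\<forall>z\<in>ball a r. norm (G k z) \<le> 2)) \<and> \<not> (\<forall>z\<in>cball a (r / 2). norm (G k z - z) < e)" for n
 proof (rule ccontr)
  assume H: "\<not> ?thesis"
  have "eventually (\<lambda>k. \<forall>z\<in>cball a (r / 2). norm (G k z - z) < e) sequentially"
   using eventually_conj[OF G eventually_ge_at_top[of n]] by (rule eventually_mono) (use H in blast)
  with neg show False by blast
 qed
 then obtain \<sigma> where \<sigma>: "\<And>n. n \<le> \<sigma> n" "\<And>n. G (\<sigma> n) holomorphic_on ball a r" "\<And>n z. z \<in> ball a r \<Longrightarrow> norm (G (\<sigma> n) z) \<le> 2"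
  "\<And>n. \<not> (\<forall>z\<in>cball a (r / 2). norm (G (\<sigma> n) z - z) < e)" by metis
 obtain g \<rho> where g: "g holomorphic_on ball a r" "strict_mono (\<rho> :: nat \<Rightarrow> nat)"
  "\<And>x. x \<in> ball a r \<Longrightarrow> (\<lambda>n. G (\<sigma> (\<rho> n)) x) \<longlonglongrightarrow> g x"
  "\<And>K. compact K \<Longrightarrow> K \<subseteq> ball a r \<Longrightarrow> uniform_limit K ((\<lambda>n. G (\<sigma> n)) \<circ> \<rho>) g sequentially"
 proof (rule Montel[of "ball a r" "range (\<lambda>n. G (\<sigma> n))" "\<lambda>n. G (\<sigma> n)"])
  show "\<And>h. h \<in> range (\<lambda>n. G (\<sigma> n)) \<Longrightarrow> h holomorphic_on ball a r" using \<sigma>(2) by auto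
  show "\<exists>B. \<forall>h\<in>range (\<lambda>n. G (\<sigma> n)). \<forall>z\<in>K. norm (h z) \<le> B" if "compact K" "K \<subseteq> ball a r" for K
   using \<sigma>(3) that(2) by (intro exI[of _ 2]) blast
 qed auto
 have "filterlim (\<lambda>n. \<sigma> (\<rho> n)) sequentially sequentially"
  by (rule filterlim_at_top_mono[OF filterlim_subseq[OF g(2)]]) (use \<sigma>(1) in auto)
 then have "(\<lambda>n. G (\<sigma> (\<rho> n)) z) \<longlonglongrightarrow> z" if "z \<in> T" for z using filterlim_compose[OF T(4)[OF that]] by blast
 then have gT: "g z = z" if "z \<in> T" for z using g(3)[of z] T(3) that LIMSEQ_unique by blast
 obtain t where t: "t \<in> T" using T(2) by blast
 have gid: "g z - z = 0" if "z \<in> ball a r" for z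
 proof (rule analytic_continuation[of "\<lambda>z. g z - z" "ball a r" T t])
  show "(\<lambda>z. g z - z) holomorphic_on ball a r" using g(1) by (intro holomorphic_intros)
  show "t islimpt T" using t T(1) by (simp add: open_imp_islimpt)
 qed (use t T(3) gT that in auto)
 have sub: "cball a (r / 2) \<subseteq> ball a r" using r by auto
 from uniform_limitD[OF g(4)[OF compact_cball sub] e]
 have "eventually (\<lambda>n. \<forall>z\<in>cball a (r / 2). dist (G (\<sigma> (\<rho> n)) z) (g z) < e) sequentially" by simp
 then obtain n where n: "\<forall>z\<in>cball a (r / 2). dist (G (\<sigma> (\<rho> n)) z) (g z) < e" using eventually_happens'[OF sequentially_bot] by blast
 have "norm (G (\<sigma> (\<rho> n)) z - z) < e" if "z \<in> cball a (r / 2)" for z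
  using n[rule_format, OF that] gid[of z] sub that by (auto simp: dist_norm)
 then show False using \<sigma>(4)[of "\<rho> n"] by blast
qed

context tce_map
begin

text \<open>Uniform convergence near \<open>p\<close>, phrased as a Cauchy condition so that
  iterates at two times can be compared directly.\<close>

definition ucauchy :: "(nat \<Rightarrow> nat) \<Rightarrow> rsphere \<Rightarrow> real \<Rightarrow> bool" where
 "ucauchy n p R \<longleftrightarrow> (\<forall>e>0. \<exists>K. \<forall>k\<ge>K. \<forall>k'\<ge>K. \<forall>u\<in>ball p R. dist ((f ^^ n k) u) ((f ^^ n k') u) < e)"

lemma fatou_cauchy:
 assumes p: "p \<notin> J"
 obtains R where "0 < R" "\<And>n :: nat \<Rightarrow> nat. \<exists>r :: nat \<Rightarrow> nat. strict_mono r \<and> ucauchy (\<lambda>k. n (r k)) p R"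
proof -
 obtain V where V: "open V" "normal_family_on V (range (\<lambda>n. f ^^ n))" "p \<in> V" using p by (auto simp: Julia_def Fatou_def)
 obtain R where R: "0 < R" "cball p R \<subseteq> V" using V(1,3) open_contains_cball by metis
 have cR: "compact (cball p R)" by (rule rsphere_compact) simp
 show ?thesis
 proof (rule that[OF R(1)])
  fix n :: "nat \<Rightarrow> nat"
  have "range (\<lambda>k. f ^^ n k) \<subseteq> range (\<lambda>n. f ^^ n)" by auto
  then obtain r h where r: "strict_mono r" "uniform_limit (cball p R) (\<lambda>k. f ^^ n (r k)) h sequentially"
   using V(2) R(2) cR unfolding normal_family_on_def by blast
  have cau: "\<exists>K. \<forall>k\<ge>K. \<forall>k'\<ge>K. \<forall>u\<in>ball p R. dist ((f ^^ n (r k)) u) ((f ^^ n (r k')) u) < e" if "0 < e" for e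
  proof -
   have "eventually (\<lambda>k. \<forall>u\<in>cball p R. dist ((f ^^ n (r k)) u) (h u) < e / 2) sequentially"
    using uniform_limitD[OF r(2), of "e / 2"] that by simp
   then obtain K where K: "\<forall>k\<ge>K. \<forall>u\<in>cball p R. dist ((f ^^ n (r k)) u) (h u) < e / 2"
    unfolding eventually_sequentially by blast
   have "dist ((f ^^ n (r k)) u) ((f ^^ n (r k')) u) < e" if "k \<ge> K" "k' \<ge> K" "u \<in> ball p R" for k k' u
   proof -
    have "u \<in> cball p R" using that(3) by simp
    then have "dist ((f ^^ n (r k)) u) (h u) < e / 2" "dist ((f ^^ n (r k')) u) (h u) < e / 2" using K that by blast+
    then show ?thesis using dist_triangle2[of "(f ^^ n (r k)) u" "(f ^^ n (r k')) u" "h u"] by linarith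
   qed
   then show ?thesis by blast
  qed
  have "ucauchy (\<lambda>k. n (r k)) p R" unfolding ucauchy_def by (intro allI impI) (rule cau)
  with r(1) show "\<exists>r. strict_mono r \<and> ucauchy (\<lambda>k. n (r k)) p R" by blast
 qed
qed

text \<open>Otherwise there are points tending to \<open>p\<close> with images at some times far
  from that of \<open>p\<close>. Along a uniformly Cauchy subsequence those iterates are close to
  one fixed iterate, which is continuous at \<open>p\<close>.\<close>

lemma fatou_equicontinuous:
 assumes p: "p \<notin> J" and s: "0 < s"
 obtains r where "0 < r" "\<And>n. (fn n) ` ball p r \<subseteq> ball (fn n p) s"
proof (rule ccontr)
 assume no: "\<not> thesis"
 have "\<exists>n u. dist p u < 1 / real (Suc j) \<and> s \<le> dist (fn n p) (fn n u)" for j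
 proof (rule ccontr)
  assume H: "\<not> (\<exists>n u. dist p u < 1 / real (Suc j) \<and> s \<le> dist (fn n p) (fn n u))"
  show False
   by (rule no[THEN notE], rule that[of "1 / real (Suc j)"]) (use H in \<open>auto simp: not_le\<close>)
 qed
 then obtain n u where nu: "\<And>j. dist p (u j) < 1 / real (Suc j)" "\<And>j. s \<le> dist ((f ^^ n j) p) ((f ^^ n j) (u j))" by metis
 obtain R where R: "0 < R" "\<And>n :: nat \<Rightarrow> nat. \<exists>r :: nat \<Rightarrow> nat. strict_mono r \<and> ucauchy (\<lambda>k. n (r k)) p R" by (rule fatou_cauchy[OF p]) blast
 obtain r where r: "strict_mono r" "ucauchy (\<lambda>k. n (r k)) p R" using R(2)[of n] by blast
 have "0 < s / 4" using s by simp
 then obtain K where K: "\<forall>k\<ge>K. \<forall>k'\<ge>K. \<forall>u\<in>ball p R. dist ((f ^^ n (r k)) u) ((f ^^ n (r k')) u) < s / 4"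
  using r(2) unfolding ucauchy_def by blast
 have "isCont (f ^^ n (r K)) p" using cont_pow[of UNIV] by (simp add: continuous_on_eq_continuous_at)
 then obtain \<delta> where \<delta>: "0 < \<delta>" "\<And>u. dist u p < \<delta> \<Longrightarrow> dist ((f ^^ n (r K)) u) ((f ^^ n (r K)) p) < s / 4"
  unfolding continuous_at_eps_delta using s by (metis zero_less_divide_iff zero_less_numeral)
 have "0 < min \<delta> R" using \<delta> R by simp
 then obtain j where j: "1 / real (Suc j) < min \<delta> R" by (rule nat_approx_posE)
 define k where "k = max K j"
 have "j \<le> r k" using seq_suble[OF r(1), of k] by (simp add: k_def)
 then have "1 / real (Suc (r k)) \<le> 1 / real (Suc j)" by (intro divide_left_mono) auto
 then have u: "dist p (u (r k)) < \<delta>" "dist p (u (r k)) < R" using nu(1)[of "r k"] j by auto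
 have kK: "K \<le> k" by (simp add: k_def)
 have 1: "dist ((f ^^ n (r k)) (u (r k))) ((f ^^ n (r K)) (u (r k))) < s / 4" using K kK u(2) by simp
 have 2: "dist ((f ^^ n (r k)) p) ((f ^^ n (r K)) p) < s / 4" using K kK R(1) by simp
 have 3: "dist ((f ^^ n (r K)) (u (r k))) ((f ^^ n (r K)) p) < s / 4" by (rule \<delta>(2)) (use u(1) in \<open>simp add: dist_commute\<close>)
 have "dist ((f ^^ n (r k)) p) ((f ^^ n (r k)) (u (r k))) \<le> dist ((f ^^ n (r k)) p) ((f ^^ n (r K)) p) +
   (dist ((f ^^ n (r K)) p) ((f ^^ n (r K)) (u (r k))) + dist ((f ^^ n (r K)) (u (r k))) ((f ^^ n (r k)) (u (r k))))"
  using dist_triangle dist_triangle[of "(f ^^ n (r K)) p" "(f ^^ n (r k)) (u (r k))" "(f ^^ n (r K)) (u (r k))"]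
  by (meson add_left_mono order_trans)
 then show False using 1 2 3 nu(2)[of "r k"] s by (simp add: dist_commute)
qed

text \<open>There are no rotation domains: the set where the iterates tend to the identity would be open
 and closed.\<close>

lemma iterates_not_id:
 fixes m :: "nat \<Rightarrow> nat"
 assumes m: "\<And>k. k \<le> m k" and r: "0 < r"
  and id: "\<And>e. 0 < e \<Longrightarrow> eventually (\<lambda>k. \<forall>w\<in>ball z r. dist ((f ^^ m k) w) w < e) sequentially"
 shows False
proof -
 define \<Omega> where "\<Omega> = {p. \<exists>r>0. \<forall>e>0. eventually (\<lambda>k. \<forall>w\<in>ball p r. dist ((f ^^ m k) w) w < e) sequentially}"
 have z: "z \<in> \<Omega>" using r id by (auto simp: \<Omega>_def)
 have op: "open \<Omega>"
 proof (subst open_contains_ball, safe)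
  fix p assume "p \<in> \<Omega>"
  then obtain s where s: "0 < s" "\<And>e. 0 < e \<Longrightarrow> eventually (\<lambda>k. \<forall>w\<in>ball p s. dist ((f ^^ m k) w) w < e) sequentially"
   by (auto simp: \<Omega>_def)
  have "v \<in> \<Omega>" if v: "v \<in> ball p s" for v
  proof -
   have sub: "ball v (s - dist p v) \<subseteq> ball p s"
   proof
    fix w assume "w \<in> ball v (s - dist p v)"
    then show "w \<in> ball p s" using dist_triangle[of p w v] by simp
   qed
   have "eventually (\<lambda>k. \<forall>w\<in>ball v (s - dist p v). dist ((f ^^ m k) w) w < e) sequentially" if "0 < e" for e
    by (rule eventually_mono[OF s(2)[OF that]]) (use sub in blast)
   then show ?thesis unfolding \<Omega>_def using v by (intro CollectI exI[of _ "s - dist p v"]) auto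
  qed
  then show "\<exists>e>0. ball p e \<subseteq> \<Omega>" using s(1) by blast
 qed
 have pw: "(\<lambda>k. (f ^^ m k) v) \<longlonglongrightarrow> v" if "v \<in> \<Omega>" for v
 proof -
  obtain s where s: "0 < s" "\<And>e. 0 < e \<Longrightarrow> eventually (\<lambda>k. \<forall>w\<in>ball v s. dist ((f ^^ m k) w) w < e) sequentially"
   using \<open>v \<in> \<Omega>\<close> by (auto simp: \<Omega>_def)
  show ?thesis
  proof (rule tendstoI)
   fix e :: real assume "0 < e"
   show "eventually (\<lambda>k. dist ((f ^^ m k) v) v < e) sequentially"
    by (rule eventually_mono[OF s(2)[OF \<open>0 < e\<close>]]) (use s(1) in simp)
  qed
 qed
 have "p \<in> \<Omega>" if p: "p \<in> closure \<Omega>" for p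
 proof (cases "p \<in> J")
  \<comment> \<open>A ball near a point of \<open>J\<close> whose iterates stay close to the
    identity would remain in a ball of radius \<open>r0\<close>, and then exponential shrinking
    would force its diameter to 0.\<close>
  case True
  have "0 < r0 / 4" using r0 by simp
  then obtain v where v: "v \<in> \<Omega>" "dist v p < r0 / 4" using p by (meson closure_approachable)
  obtain s where s: "0 < s" "\<And>e. 0 < e \<Longrightarrow> eventually (\<lambda>k. \<forall>w\<in>ball v s. dist ((f ^^ m k) w) w < e) sequentially"
   using v(1) by (auto simp: \<Omega>_def)
  define t where "t = min s (r0 / 4)"
  have t: "0 < t" "t \<le> s" "t \<le> r0 / 4" using s r0 by (auto simp: t_def)
  have "t / 2 < t" "t \<le> 1" using t r0 by auto
  then obtain y where y: "y \<in> ball v t" "t / 2 \<le> dist v y" using t(1) by (rule_tac rsphere_point_at[of "t / 2" t v]) auto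
  have con: "connected (ball v t)" using t r0 by (intro connected_ball_rsphere) auto
  have "eventually (\<lambda>k. \<forall>w\<in>ball v s. dist ((f ^^ m k) w) w < r0 / 4) sequentially" by (rule s(2)) (use r0 in simp)
  moreover have "eventually (\<lambda>k. 4 / lam ^ k < t / 2) sequentially"
   using order_tendstoD(2)[OF lam_pow_tendsto, of "t / 2"] t(1) by simp
  ultimately have "eventually (\<lambda>k. False) sequentially"
  proof eventually_elim
   case (elim k)
   have "(f ^^ m k) ` ball v t \<subseteq> ball p r0"
   proof safe
    fix w assume w: "w \<in> ball v t"
    have "dist ((f ^^ m k) w) w < r0 / 4" using elim(1) w t(2) by simp
    moreover have "dist p w \<le> dist p v + dist v w" by (rule dist_triangle)
    moreover have "dist p ((f ^^ m k) w) \<le> dist p w + dist w ((f ^^ m k) w)" by (rule dist_triangle)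
    ultimately have "dist p ((f ^^ m k) w) < r0" using v(2) w t(3) r0 by (simp add: dist_commute)
    then show "(f ^^ m k) w \<in> ball p r0" by simp
   qed
   from shrink[OF True con this _ y(1), of v] have "dist v y \<le> 4 / lam ^ m k" using t(1) by simp
   also have "... \<le> 4 / lam ^ k" using lam m[of k] by (intro divide_left_mono power_increasing) auto
   finally show False using elim(2) y(2) by linarith
  qed
  then show ?thesis by simp
 next
  \<comment> \<open>Equicontinuity keeps the iterates inside one chart around \<open>p\<close>,
    where they are bounded holomorphic functions tending to the identity on an open part;
    \<open>holomorphic_converge_id\<close> spreads this to a neighbourhood of
    \<open>p\<close>.\<close>
  case False
  obtain \<rho> where \<rho>: "0 < \<rho>" "\<And>n. (fn n) ` ball p \<rho> \<subseteq> ball (fn n p) (1 / 8)"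
   by (rule fatou_equicontinuous[OF False, of "1 / 8"]) auto
  define s where "s = min \<rho> (1 / 4)"
  have s: "0 < s" "s \<le> 1 / 4" "\<And>n. (fn n) ` ball p s \<subseteq> ball (fn n p) (1 / 8)"
  proof -
   show "0 < s" "s \<le> 1 / 4" using \<rho> by (auto simp: s_def)
   fix n have "ball p s \<subseteq> ball p \<rho>" by (intro subset_ball) (simp add: s_def)
   then show "fn n ` ball p s \<subseteq> ball (fn n p) (1 / 8)" using \<rho>(2)[of n] by blast
  qed
  obtain A a where A: "A \<in> charts" "A p = Fin a" "norm a \<le> 1" by (rule chart_ex)
  have Ap: "A (Fin a) = p" using A charts_invol by metis
  obtain v where v: "v \<in> \<Omega>" "dist v p < s / 40" using p s(1) by (meson closure_approachable divide_pos_pos zero_less_numeral)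
  obtain t where t: "0 < t" "\<And>e. 0 < e \<Longrightarrow> eventually (\<lambda>k. \<forall>w\<in>ball v t. dist ((f ^^ m k) w) w < e) sequentially"
   using v(1) by (auto simp: \<Omega>_def)
  define G where "G k = cr A (f ^^ m k) A" for k
  have inp: "A (Fin q) \<in> ball p s" if "q \<in> ball a (s / 4)" for q
  proof -
   have "Fin q \<in> ball (Fin a) s" by (rule subsetD[OF Fin_dist_chart(1)[OF A(3)] imageI[OF that]]) (use s(2) in simp)
   then show ?thesis using charts_dist[OF A(1), of "Fin a" "Fin q"] Ap by simp
  qed
  have coord: "\<exists>q. w = A (Fin q) \<and> norm q \<le> 2 \<and> norm (q - a) \<le> 5 / 2 * dist w p" if w: "w \<in> ball p (1 / 2)" for w
  proof -
   have d: "dist (A w) (Fin a) = dist w p" using charts_dist[OF A(1), of w p] A(2) by simp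
   then have "A w \<in> ball (Fin a) (1 / 2)" using w by (simp add: dist_commute)
   then have "A w \<in> Fin ` (ball a (5 / 2 * (1 / 2)) \<inter> ball 0 2)"
    by (rule subsetD[OF Fin_dist_chart(2)[OF A(3) order_refl]])
   then obtain q where q: "A w = Fin q" "norm q < 2" by auto
   have "norm (q - a) \<le> 5 / 2 * dist (Fin q) (Fin a)" using q A(3) by (intro norm_le_dist_Fin) auto
   then show ?thesis using q d charts_invol[OF A(1), of w] by (intro exI[of _ q]) auto
  qed
  have "eventually (\<lambda>k. \<forall>w\<in>ball v t. dist ((f ^^ m k) w) w < 1 / 8) sequentially" by (rule t(2)) simp
  then have stay: "eventually (\<lambda>k. \<forall>w\<in>ball p s. (f ^^ m k) w \<in> ball p (1 / 2)) sequentially"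
  proof eventually_elim
   case (elim k)
   show ?case
   proof
    fix w assume w: "w \<in> ball p s"
    have "v \<in> ball p s" using v(2) s(1) by (simp add: dist_commute)
    then have "dist ((f ^^ m k) p) ((f ^^ m k) v) < 1 / 8" "dist ((f ^^ m k) p) ((f ^^ m k) w) < 1 / 8"
     using s(3)[of "m k"] w by (auto simp: image_subset_iff)
    moreover have "dist ((f ^^ m k) v) v < 1 / 8" using elim t(1) by simp
    moreover have "dist p ((f ^^ m k) w) \<le> dist p v + dist v ((f ^^ m k) w)" by (rule dist_triangle)
    moreover have "dist v ((f ^^ m k) w) \<le> dist v ((f ^^ m k) v) + dist ((f ^^ m k) v) ((f ^^ m k) w)" by (rule dist_triangle)
    moreover have "dist ((f ^^ m k) v) ((f ^^ m k) w) \<le> dist ((f ^^ m k) v) ((f ^^ m k) p) + dist ((f ^^ m k) p) ((f ^^ m k) w)" by (rule dist_triangle)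
    ultimately show "(f ^^ m k) w \<in> ball p (1 / 2)" using v(2) s(2) by (simp add: dist_commute)
   qed
  qed
  have G: "(f ^^ m k) (A (Fin q)) = A (Fin (G k q)) \<and> norm (G k q) \<le> 2"
   if k: "\<forall>w\<in>ball p s. (f ^^ m k) w \<in> ball p (1 / 2)" and q: "q \<in> ball a (s / 4)" for k q
  using coord k inp q charts_invol A(1) by (fastforce simp: G_def cr_def)
  have hol: "G k holomorphic_on ball a (s / 4)"
   if k: "\<forall>w\<in>ball p s. (f ^^ m k) w \<in> ball p (1 / 2)" for k
   unfolding G_def
   by (rule sph_hol_holomorphic[OF hol_pow A(1) A(1)]) (use G[OF k] charts_invol[OF A(1)] in auto)
  obtain q0 where q0: "v = A (Fin q0)" "norm (q0 - a) \<le> 5 / 2 * dist v p"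
   using coord[of v] v(2) s by (auto simp: dist_commute)
  have "norm (q0 - a) < s / 4" using q0(2) v(2) s(1) by linarith
  then have z0: "q0 \<in> ball a (s / 4)" by (simp add: dist_norm norm_minus_commute)
  define T where "T = ball q0 (t / 4) \<inter> ball a (s / 4)"
  have near: "eventually (\<lambda>k. \<forall>q\<in>cball a (s / 4 / 2). norm (G k q - q) < e) sequentially" if e: "0 < e" for e
  proof (rule holomorphic_converge_id[of "s / 4" G a T, OF _ _ _ _ _ _ e])
   show "eventually (\<lambda>k. G k holomorphic_on ball a (s / 4) \<and> (\<forall>z\<in>ball a (s / 4). norm (G k z) \<le> 2)) sequentially"
    using stay by eventually_elim (use hol G in blast)
   have "q0 \<in> T" using z0 t(1) by (simp add: T_def)
   then show "T \<noteq> {}" by blast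
   fix q assume q: "q \<in> T"
   have qa: "q \<in> ball a (s / 4)" using q by (simp add: T_def)
   have "norm q \<le> norm a + norm (q - a)" using norm_triangle_ineq[of a "q - a"] by simp
   also have "norm (q - a) < 1" using qa s by (simp add: dist_norm norm_minus_commute)
   finally have n2: "norm q \<le> 2" using A(3) by simp
   have "dist v (A (Fin q)) = dist (Fin q0) (Fin q)" using q0(1) charts_dist[OF A(1)] by simp
   also have "... \<le> 4 * norm (q0 - q)" by (rule dist_Fin_le)
   also have "... < t" using q by (simp add: T_def dist_norm)
   finally have vb: "A (Fin q) \<in> ball v t" by simp
   show "(\<lambda>k. G k q) \<longlonglongrightarrow> q"
   proof (rule tendstoI)
    fix e :: real assume e: "0 < e"
    have "eventually (\<lambda>k. \<forall>w\<in>ball v t. dist ((f ^^ m k) w) w < e / 3) sequentially" by (rule t(2)) (use e in simp)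
    with stay show "eventually (\<lambda>k. dist (G k q) q < e) sequentially"
    proof eventually_elim
     case (elim k)
     have "norm (G k q - q) \<le> 5 / 2 * dist (Fin (G k q)) (Fin q)"
      using G[OF elim(1) qa] n2 by (intro norm_le_dist_Fin) auto
     also have "dist (Fin (G k q)) (Fin q) = dist ((f ^^ m k) (A (Fin q))) (A (Fin q))"
      using G[OF elim(1) qa] charts_dist[OF A(1)] by simp
     also have "... < e / 3" using elim(2) vb by blast
     finally show ?case using e by (simp add: dist_norm)
    qed
   qed
  qed (use s in \<open>auto simp: T_def\<close>)
  have "eventually (\<lambda>k. \<forall>w\<in>ball p (s / 20). dist ((f ^^ m k) w) w < e) sequentially" if e: "0 < e" for e
  proof -
   have "eventually (\<lambda>k. \<forall>q\<in>cball a (s / 4 / 2). norm (G k q - q) < e / 4) sequentially" by (rule near) (use e in simp)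
   with stay show ?thesis
   proof eventually_elim
    case (elim k)
    show ?case
    proof
     fix w assume w: "w \<in> ball p (s / 20)"
     then obtain q where q: "w = A (Fin q)" "norm (q - a) \<le> 5 / 2 * dist w p" using coord[of w] s by auto
     then have c: "q \<in> cball a (s / 4 / 2)" using w by (simp add: dist_norm norm_minus_commute dist_commute)
     then have b: "q \<in> ball a (s / 4)" using s(1) by simp
     have "dist ((f ^^ m k) w) w = dist (Fin (G k q)) (Fin q)"
      using G[OF elim(1) b] q(1) charts_dist[OF A(1)] by simp
     also have "... \<le> 4 * norm (G k q - q)" by (rule dist_Fin_le)
     also have "... < e" using elim(2) c by force
     finally show "dist ((f ^^ m k) w) w < e" .
    qed
   qed
  qed
  then show ?thesis unfolding \<Omega>_def using s(1) by (intro CollectI exI[of _ "s / 20"]) auto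
 qed
 then have "closed \<Omega>" using closure_subset_eq by blast
 then have all: "\<Omega> = UNIV" using rsphere_not_open_subset op z by blast
 \<comment> \<open>Convergence to the identity everywhere would separate two points with the same
   image, whose later iterates agree.\<close>
 obtain x y where xy: "x \<noteq> y" "f x = f y" using not_inj by (auto simp: inj_def)
 have "(f ^^ m k) x = (f ^^ m k) y" if "0 < k" for k
  using m[of k] that xy(2) by (cases "m k") (auto simp: funpow_swap1)
 then have "eventually (\<lambda>k. (f ^^ m k) x = (f ^^ m k) y) sequentially"
  using eventually_gt_at_top[of 0] by (rule eventually_mono[rotated]) blast
 from Lim_transform_eventually[OF pw[of x] this] have "(\<lambda>k. (f ^^ m k) y) \<longlonglongrightarrow> x" using all by simp
 then show False using pw[of y] all LIMSEQ_unique xy(1) by blast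
qed

end

section \<open>Recurrence, support and returning atoms\<close>

context inv_measure
begin

lemma finite_ball_cover: assumes "0 < e" obtains C where "finite C" "(\<Union>c\<in>C. ball c e) = (UNIV :: rsphere set)"
proof -
 have "x \<in> ball x e" for x :: rsphere using assms by simp
 then have "UNIV \<subseteq> (\<Union>c\<in>UNIV. ball (c :: rsphere) e)" by blast
 then obtain C where "C \<subseteq> UNIV" "finite C" "UNIV \<subseteq> (\<Union>c\<in>C. ball (c :: rsphere) e)"
  by (rule compactE_image[OF compact_rsphere, rotated]) auto
 then show ?thesis by (intro that[of C]) auto
qed

text \<open>Poincare recurrence for the members of finite covers by small balls: returning to a ball
  of radius \<open>e\<close> means returning within \<open>2 * e\<close> of the starting
  point.\<close>

lemma AE_recurrent: "AE x in \<nu>. \<forall>e>0. \<forall>N. \<exists>n\<ge>N. dist ((f ^^ n) x) x < e"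
proof -
 have null: "{x \<in> B. \<forall>n\<ge>N. (f ^^ n) x \<notin> B} \<in> null_sets \<nu>" if B: "B \<in> sets borel" and N: "0 < N" for B N
 proof -
  \<comment> \<open>The points of \<open>B\<close> that never return from time \<open>N\<close> on.
    Preimages of \<open>T\<close> under multiples of \<open>N\<close> are disjoint and have equal
    mass.\<close>
  define T where "T = {x \<in> B. \<forall>n\<ge>N. (f ^^ n) x \<notin> B}"
  have "T = B - (\<Union>n\<in>{N..}. (f ^^ n) -` B)" by (auto simp: T_def)
  then have T: "T \<in> sets borel" using measurable_sets_borel[OF meas_pow B] B by (simp add: sets.Diff sets.countable_UN'')
  have "prob T \<le> 0"
  proof (rule le_of_linear_le)
   fix k :: nat
   have dj: "disjoint_family_on (\<lambda>i. (f ^^ (i * N)) -` T) {..<k}"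
    unfolding disjoint_family_on_def
   proof (intro ballI impI)
    have aux: "(f ^^ (i * N)) -` T \<inter> (f ^^ (j * N)) -` T = {}" if "i < j" for i j
    proof -
     have "(f ^^ (j * N)) x = (f ^^ ((j - i) * N)) ((f ^^ (i * N)) x)" for x
      using that by (simp add: funpow_add[symmetric, THEN fun_cong, simplified] add_mult_distrib[symmetric])
     moreover have "N \<le> (j - i) * N" using that by (cases "j - i") auto
     ultimately show ?thesis by (auto simp: T_def)
    qed
    fix i j :: nat assume "i \<noteq> j"
    then show "(f ^^ (i * N)) -` T \<inter> (f ^^ (j * N)) -` T = {}" using aux[of i j] aux[of j i] by (cases "i < j") auto
   qed
   have "real k * prob T = (\<Sum>i<k. prob ((f ^^ (i * N)) -` T))" by (simp add: measure_pow[OF T])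
   also have "... \<le> prob UNIV"
    by (rule sum_measure_le[OF _ dj]) (use measurable_sets_borel[OF meas_pow T] in auto)
   finally show "real k * prob T \<le> real k * 0 + 1" by simp
  qed
  then have "prob T = 0" using measure_nonneg[of \<nu> T] by linarith
  then have "T \<in> null_sets \<nu>" using T by (simp add: null_sets_def emeasure_eq_measure)
  then show ?thesis unfolding T_def .
 qed
 have "AE x in \<nu>. \<exists>n\<ge>N. dist ((f ^^ n) x) x < 1 / real (Suc j)" for j N
 proof -
  define e where "e = 1 / real (Suc j) / 2"
  have e: "0 < e" "1 / real (Suc j) = 2 * e" by (simp_all add: e_def del: of_nat_Suc)
  obtain C where C: "finite C" "(\<Union>c\<in>C. ball c e) = (UNIV :: rsphere set)" by (rule finite_ball_cover[OF e(1)])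
  have "(\<Union>c\<in>C. {x \<in> ball c e. \<forall>n\<ge>Suc N. (f ^^ n) x \<notin> ball c e}) \<in> null_sets \<nu>"
   using C(1) by (intro null_sets_UN' null countable_finite) auto
  moreover have "{x \<in> space \<nu>. \<not> (\<exists>n\<ge>N. dist ((f ^^ n) x) x < 1 / real (Suc j))} \<subseteq>
   (\<Union>c\<in>C. {x \<in> ball c e. \<forall>n\<ge>Suc N. (f ^^ n) x \<notin> ball c e})"
  proof safe
   fix x assume H: "\<not> (\<exists>n\<ge>N. dist ((f ^^ n) x) x < 1 / real (Suc j))"
   obtain c where c: "c \<in> C" "x \<in> ball c e" using C(2) by blast
   have "(f ^^ n) x \<notin> ball c e" if "Suc N \<le> n" for n
   proof
    assume "(f ^^ n) x \<in> ball c e"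
    then have "dist ((f ^^ n) x) x < 1 / real (Suc j)"
     using c(2) dist_triangle[of "(f ^^ n) x" x c] unfolding e(2) by (simp add: dist_commute)
    then show False using H that by auto
   qed
   then show "x \<in> (\<Union>c\<in>C. {x \<in> ball c e. \<forall>n\<ge>Suc N. (f ^^ n) x \<notin> ball c e})" using c by blast
  qed
  ultimately show ?thesis by (rule AE_I')
 qed
 then have "AE x in \<nu>. \<forall>j N. \<exists>n\<ge>N. dist ((f ^^ n) x) x < 1 / real (Suc j)" by (simp add: AE_all_countable)
 then show ?thesis
 proof eventually_elim
  case (elim x)
  show ?case
  proof (intro allI impI)
   fix e :: real and N assume "0 < e"
   then obtain j where "1 / real (Suc j) < e" by (rule nat_approx_posE)
   moreover obtain n where "N \<le> n" "dist ((f ^^ n) x) x < 1 / real (Suc j)" using elim by blast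
   ultimately show "\<exists>n\<ge>N. dist ((f ^^ n) x) x < e" by (intro exI[of _ n]) auto
  qed
 qed
qed

lemma AE_in_support: "AE x in \<nu>. \<forall>r>0. 0 < prob (ball x r)"
proof -
 have "AE x in \<nu>. 0 < prob (ball x (1 / real (Suc j)))" for j
 proof -
  define e where "e = 1 / real (Suc j) / 2"
  have e: "0 < e" "1 / real (Suc j) = 2 * e" by (simp_all add: e_def del: of_nat_Suc)
  obtain C where C: "finite C" "(\<Union>c\<in>C. ball c e) = (UNIV :: rsphere set)" by (rule finite_ball_cover[OF e(1)])
  have "(\<Union>c\<in>{c \<in> C. prob (ball c e) = 0}. ball c e) \<in> null_sets \<nu>"
   using C(1) by (intro null_sets_UN' countable_finite) (auto simp: null_sets_def emeasure_eq_measure)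
  moreover have "{x \<in> space \<nu>. \<not> 0 < prob (ball x (1 / real (Suc j)))} \<subseteq> (\<Union>c\<in>{c \<in> C. prob (ball c e) = 0}. ball c e)"
  proof safe
   fix x assume H: "\<not> 0 < prob (ball x (1 / real (Suc j)))"
   obtain c where c: "c \<in> C" "x \<in> ball c e" using C(2) by blast
   have "ball c e \<subseteq> ball x (1 / real (Suc j))"
   proof
    fix u assume "u \<in> ball c e"
    then show "u \<in> ball x (1 / real (Suc j))" using c(2) dist_triangle[of x u c] unfolding e(2) by (simp add: dist_commute)
   qed
   then have "prob (ball c e) \<le> prob (ball x (1 / real (Suc j)))" by (intro finite_measure_mono) auto
   then have "prob (ball c e) = 0" using H measure_nonneg[of \<nu> "ball c e"] by linarith
   then show "x \<in> (\<Union>c\<in>{c \<in> C. prob (ball c e) = 0}. ball c e)" using c by blast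
  qed
  ultimately show ?thesis by (rule AE_I')
 qed
 then have "AE x in \<nu>. \<forall>j. 0 < prob (ball x (1 / real (Suc j)))" by (simp add: AE_all_countable)
 then show ?thesis
 proof eventually_elim
  case (elim x)
  show ?case
  proof (intro allI impI)
   fix r :: real assume "0 < r"
   then obtain j where "1 / real (Suc j) < r" by (rule nat_approx_posE)
   then have "prob (ball x (1 / real (Suc j))) \<le> prob (ball x r)" by (intro finite_measure_mono subset_ball) auto
   then show "0 < prob (ball x r)" using elim less_le_trans by blast
  qed
 qed
qed

text \<open>The forward orbit of an atom is finite, so a sufficiently close return is an exact
  one.\<close>

lemma atom_returns:
 assumes "0 < prob {z}" obtains \<delta> where "0 < \<delta>" "\<And>n. dist ((f ^^ n) z) z < \<delta> \<Longrightarrow> (f ^^ n) z = z"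
proof -
 obtain i s where per: "0 < s" "(f ^^ s) ((f ^^ i) z) = (f ^^ i) z" by (rule atom_preperiodic[OF assms])
 have "(f ^^ n) z \<in> (\<lambda>n. (f ^^ n) z) ` {..<i + s}" for n
 proof (induction n rule: less_induct)
  case (less n)
  show ?case
  proof (cases "n < i + s")
   case False
   have "(f ^^ n) z = (f ^^ (n - (i + s))) ((f ^^ s) ((f ^^ i) z))"
    using False by (simp add: funpow_add[symmetric, THEN fun_cong, simplified] add.commute)
   also have "... = (f ^^ (n - s)) z" unfolding per(2)
    using False by (simp add: funpow_add[symmetric, THEN fun_cong, simplified])
   finally show ?thesis using less.IH[of "n - s"] per(1) False by simp
  qed simp
 qed
 then have "range (\<lambda>n. (f ^^ n) z) \<subseteq> (\<lambda>n. (f ^^ n) z) ` {..<i + s}" by (rule image_subsetI)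
 then have "finite (range (\<lambda>n. (f ^^ n) z))" by (rule finite_subset) simp
 then obtain \<delta> where "0 < \<delta>" "\<forall>x\<in>range (\<lambda>n. (f ^^ n) z). x \<noteq> z \<longrightarrow> \<delta> \<le> dist z x" using finite_set_avoid by blast
 then show ?thesis using that[of \<delta>] by (force simp: dist_commute)
qed

end

context conformal_invariant
begin

text \<open>If iterates squeeze a fixed ball towards \<open>z\<close>, invariance concentrates its
  mass at \<open>z\<close>, which becomes an atom. Close returns are then exact, so \<open>z\<close>
  is fixed by an iterate; its derivative is at most 1/2 by Cauchy's estimate but equals 1 by
  \<open>atom_neutral\<close>.\<close>

lemma no_collapse:
 assumes pos: "\<And>r. 0 < r \<Longrightarrow> 0 < prob (ball z r)" and r: "0 < r" "r \<le> 1 / 2"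
  and collapse: "\<And>e. 0 < e \<Longrightarrow> \<exists>n. \<forall>u\<in>ball z r. dist z (fn n u) < e"
 shows False
proof -
 have "prob (ball z r) \<le> prob {z} + e" if e: "0 < e" for e
 proof -
  obtain \<rho> where \<rho>: "0 < \<rho>" "prob (\<Union>y\<in>{z}. ball y \<rho>) < prob {z} + e"
   by (rule compact_neighbourhood_measure[OF finite_measure_axioms sets_nu _ e, of "{z}"]) auto
  obtain n where n: "\<forall>u\<in>ball z r. dist z (fn n u) < \<rho>" using collapse[OF \<rho>(1)] by blast
  have "prob (ball z r) \<le> prob (fn n -` ball z \<rho>)"
   using n by (intro finite_measure_mono) (auto intro!: measurable_sets_borel[OF meas_pow])
  then show ?thesis using \<rho>(2) by (simp add: measure_pow)
 qed
 then have "prob (ball z r) \<le> prob {z}" by (rule field_le_epsilon)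
 then have atom: "0 < prob {z}" using pos[OF r(1)] by linarith
 obtain \<delta> where \<delta>: "0 < \<delta>" "\<And>n. dist (fn n z) z < \<delta> \<Longrightarrow> fn n z = z" by (rule atom_returns[OF atom]) blast
 \<comment> \<open>The bound \<open>r / 80\<close> makes the Cauchy estimate
   \<open>40 * e / r\<close> at most 1/2; the bound \<delta> makes the return exact.\<close>
 define e where "e = min \<delta> (r / 80)"
 have e: "0 < e" "e \<le> \<delta>" "e \<le> r / 80" using \<delta> r by (auto simp: e_def)
 obtain n where n: "\<forall>u\<in>ball z r. dist z (fn n u) < e" using collapse[OF e(1)] by blast
 have fz: "fn n z = z"
 proof (rule \<delta>(2))
  have "dist z (fn n z) < e" using n r(1) by simp
  then show "dist (fn n z) z < \<delta>" using e(2) by (simp add: dist_commute)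
 qed
 have "sph_deriv (fn n) z \<le> 40 * e / r"
  by (rule Cauchy_sphere[OF hol_pow r]) (use n fz e r in auto)
 also have "... \<le> 1 / 2" using e r by (simp add: field_simps)
 finally have "Dn n z \<le> 1 / 2" by (simp add: Dn_eq)
 moreover have "Dn n z = 1" by (rule atom_neutral[OF atom fz])
 ultimately show False by simp
qed

lemma fatou_null: "supported_on \<nu> J"
proof (rule ccontr)
 assume "\<not> supported_on \<nu> J"
 then have nJ: "\<not> (AE x in \<nu>. x \<in> J)"
  using AE_iff_null_sets[of "- J" \<nu>] closed_J by (auto simp: supported_on_def null_sets_def)
 have "\<exists>z. z \<notin> J \<and> (\<forall>e>0. \<forall>N. \<exists>n\<ge>N. dist (fn n z) z < e) \<and> (\<forall>r>0. 0 < prob (ball z r))"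
 proof (rule ccontr)
  assume H: "\<not> ?thesis"
  have "AE x in \<nu>. x \<in> J" using AE_recurrent AE_in_support by eventually_elim (use H in blast)
  with nJ show False by blast
 qed
 then obtain z where z: "z \<notin> J" "\<And>e N. 0 < e \<Longrightarrow> \<exists>n\<ge>N. dist (fn n z) z < e" "\<And>r. 0 < r \<Longrightarrow> 0 < prob (ball z r)"
  by blast
 have "\<exists>n. k \<le> n \<and> dist (fn n z) z < 1 / real (Suc k)" for k using z(2)[of "1 / real (Suc k)" k] by auto
 then obtain n where n: "\<And>k. k \<le> n k" "\<And>k. dist ((f ^^ n k) z) z < 1 / real (Suc k)" by metis
 obtain R where R: "0 < R" "\<And>n :: nat \<Rightarrow> nat. \<exists>r :: nat \<Rightarrow> nat. strict_mono r \<and> ucauchy (\<lambda>k. n (r k)) z R" by (rule fatou_cauchy[OF z(1)]) blast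
 obtain \<sigma> where \<sigma>: "strict_mono \<sigma>" "ucauchy (\<lambda>k. n (\<sigma> k)) z R" using R(2)[of n] by blast
 define N where "N k = n (\<sigma> k)" for k
 have Nk: "k \<le> N k" for k using n(1)[of "\<sigma> k"] seq_suble[OF \<sigma>(1), of k] by (simp add: N_def)
 have cauchy: "\<exists>K. \<forall>k\<ge>K. \<forall>k'\<ge>K. \<forall>u\<in>ball z R. dist ((f ^^ N k) u) ((f ^^ N k') u) < e" if "0 < e" for e
  using \<sigma>(2) that unfolding ucauchy_def N_def by blast
 have conv: "eventually (\<lambda>k. dist ((f ^^ N k) z) z < e) sequentially" if "0 < e" for e
 proof -
  obtain j where j: "1 / real (Suc j) < e" by (rule nat_approx_posE[OF \<open>0 < e\<close>])
  show ?thesis unfolding eventually_sequentially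
  proof (intro exI[of _ j] allI impI)
   fix k assume "j \<le> k"
   then have "1 / real (Suc (\<sigma> k)) \<le> 1 / real (Suc j)" using seq_suble[OF \<sigma>(1), of k] by (intro divide_left_mono) auto
   then show "dist ((f ^^ N k) z) z < e" using n(2)[of "\<sigma> k"] j by (simp add: N_def)
  qed
 qed
 obtain r1 where r1: "0 < r1" "\<And>n. (fn n) ` ball z r1 \<subseteq> ball (fn n z) (1 / 2)"
  by (rule fatou_equicontinuous[OF z(1), of "1 / 2"]) auto
 define r where "r = min (min r1 R) (1 / 2)"
 have r: "0 < r" "r \<le> R" "r \<le> 1 / 2" "\<And>n. (fn n) ` ball z r \<subseteq> ball (fn n z) (1 / 2)"
 proof -
  show "0 < r" "r \<le> R" "r \<le> 1 / 2" using r1(1) R(1) by (auto simp: r_def)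
  fix n have "ball z r \<subseteq> ball z r1" by (intro subset_ball) (simp add: r_def)
  then show "fn n ` ball z r \<subseteq> ball (fn n z) (1 / 2)" using r1(2)[of n] by blast
 qed
 show False
 proof (cases "\<forall>e>0. \<exists>K. \<forall>k\<ge>K. \<forall>u. dist z u \<le> r / 20 \<longrightarrow> dist ((f ^^ N k) z) ((f ^^ N k) u) < e")
  case True
  show False
  proof (rule no_collapse[OF z(3), of "r / 20"])
   fix e :: real assume e: "0 < e"
   then obtain K where K: "\<forall>k\<ge>K. \<forall>u. dist z u \<le> r / 20 \<longrightarrow> dist ((f ^^ N k) z) ((f ^^ N k) u) < e / 2" using True by (meson half_gt_zero)
   obtain K' where K': "\<forall>k\<ge>K'. dist ((f ^^ N k) z) z < e / 2" using conv[of "e / 2"] e by (auto simp: eventually_sequentially)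
   define k where "k = max K K'"
   have "dist z ((f ^^ N k) u) < e" if "u \<in> ball z (r / 20)" for u
   proof -
    have "dist ((f ^^ N k) z) ((f ^^ N k) u) < e / 2" "dist ((f ^^ N k) z) z < e / 2" using K K' that by (auto simp: k_def)
    then show ?thesis using dist_triangle[of z "(f ^^ N k) u" "(f ^^ N k) z"] by (simp add: dist_commute)
   qed
   then show "\<exists>n. \<forall>u\<in>ball z (r / 20). dist z (fn n u) < e" by blast
  qed (use r in auto)
 next
  case False
  \<comment> \<open>Images that do not shrink contain balls of one fixed radius, which are
    eventually close enough to \<open>z\<close> to cover a fixed ball around it.\<close>
  then obtain \<eta> where \<eta>: "0 < \<eta>" "\<And>K. \<exists>k\<ge>K. \<exists>u. dist z u \<le> r / 20 \<and> \<eta> \<le> dist ((f ^^ N k) z) ((f ^^ N k) u)"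
   by (auto simp: not_less)
  obtain \<rho> where \<rho>: "0 < \<rho>" "\<And>m x r. \<lbrakk>0 < r; r \<le> 1 / 2; fn m ` ball x r \<subseteq> ball (fn m x) (1 / 2);
   \<exists>u. dist x u \<le> r / 20 \<and> \<eta> \<le> dist (fn m x) (fn m u)\<rbrakk> \<Longrightarrow> ball (fn m x) \<rho> \<subseteq> fn m ` ball x r"
   by (rule large_image_contains_ball[of "1 / 2" \<eta>]) (use \<eta> in auto)
  have "\<exists>m\<ge>j. \<forall>w\<in>ball z (\<rho> / 2). dist (fn m w) w < 1 / real (Suc j)" for j
  proof -
   obtain K where K: "\<forall>k\<ge>K. \<forall>k'\<ge>K. \<forall>u\<in>ball z R. dist ((f ^^ N k) u) ((f ^^ N k') u) < 1 / real (Suc j)"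
    using cauchy[of "1 / real (Suc j)"] by auto
   obtain K' where K': "\<forall>k\<ge>K'. dist ((f ^^ N k) z) z < \<rho> / 2" using conv[of "\<rho> / 2"] \<rho>(1) by (auto simp: eventually_sequentially)
   obtain k where k: "max K K' \<le> k" "\<exists>u. dist z u \<le> r / 20 \<and> \<eta> \<le> dist ((f ^^ N k) z) ((f ^^ N k) u)" using \<eta>(2) by blast
   \<comment> \<open>Writing \<open>w\<close> as the image of \<open>u\<close> at time
     \<open>N k\<close>, the iterate of order \<open>m = N k' - N k\<close> takes it to the image of
     \<open>u\<close> at time \<open>N k'\<close>, which is close by the Cauchy property. Hence this
     iterate is almost the identity.\<close>
   define k' where "k' = max K (N k + j)"
   define m where "m = N k' - N k"
   have m: "j \<le> m" "N k' = m + N k" using Nk[of k'] by (auto simp: m_def k'_def)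
   have im: "ball ((f ^^ N k) z) \<rho> \<subseteq> (f ^^ N k) ` ball z r" by (rule \<rho>(2)[OF r(1,3,4) k(2)])
   have "dist (fn m w) w < 1 / real (Suc j)" if w: "w \<in> ball z (\<rho> / 2)" for w
   proof -
    have "dist ((f ^^ N k) z) z < \<rho> / 2" using K' k(1) by simp
    then have "w \<in> ball ((f ^^ N k) z) \<rho>" using w dist_triangle[of "(f ^^ N k) z" w z] by simp
    then obtain u where u: "u \<in> ball z r" "w = (f ^^ N k) u" using im by blast
    have "fn m w = (f ^^ N k') u" by (simp add: u(2) m(2) funpow_add)
    then show ?thesis using K[rule_format, of k' k u] k(1) u r(2) by (simp add: k'_def)
   qed
   then show ?thesis using m(1) by blast
  qed
  then obtain m where m: "\<And>j. j \<le> m j" "\<And>j w. w \<in> ball z (\<rho> / 2) \<Longrightarrow> dist ((f ^^ m j) w) w < 1 / real (Suc j)" by metis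
  show False
  proof (rule iterates_not_id[of m "\<rho> / 2" z, OF m(1)])
   fix e :: real assume "0 < e"
   then obtain j where j: "1 / real (Suc j) < e" by (rule nat_approx_posE)
   show "eventually (\<lambda>k. \<forall>w\<in>ball z (\<rho> / 2). dist ((f ^^ m k) w) w < e) sequentially"
    unfolding eventually_sequentially
   proof (intro exI[of _ j] allI impI ballI)
    fix k w assume "j \<le> k" "w \<in> ball z (\<rho> / 2)"
    then have "dist ((f ^^ m k) w) w < 1 / real (Suc k)" "1 / real (Suc k) \<le> 1 / real (Suc j)"
     using m(2) by (auto intro: divide_left_mono)
    then show "dist ((f ^^ m k) w) w < e" using j by linarith
   qed
  qed (use \<rho> in simp)
 qed
qed

end

section \<open>Equilibrium states\<close>

lemma (in ac_measure) entropy_le: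
 assumes "julia_measure f d \<nu>'"
 shows "metric_entropy \<nu>' f \<le> ereal (\<alpha> * julia_measure.chi f \<nu>')"
proof -
 interpret N: julia_measure f d \<nu>' by (rule assms)
 show ?thesis
 proof (rule ereal_le_epsilon2)
  fix e :: real assume e: "0 < e"
  define s where "s = \<alpha> + e / N.chi"
  have s: "\<alpha> < s" "s * N.chi = \<alpha> * N.chi + e"
   using divide_pos_pos[OF e N.chi_pos] N.chi_pos by (simp_all add: s_def distrib_right)
  have "metric_entropy \<nu>' f \<le> ereal (s * N.chi)"
   by (rule N.entropy_le_dimension[OF _ hausdorff_null[OF s(1)]]) (use \<alpha> s(1) in linarith)
  then show "metric_entropy \<nu>' f \<le> ereal (\<alpha> * N.chi) + ereal e" by (simp add: s(2))
 qed
qed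

text \<open>The lower bound comes from entropy: \<nu> has entropy at least
  \<open>\<alpha> * chi\<close>, while a null exponent \<open>s\<close> bounds it by
  \<open>s * chi\<close>, and \<open>chi\<close> is positive.\<close>

lemma (in ac_measure) hausdorff_dim_Julia: "hausdorff_dim J = ennreal \<alpha>"
proof (rule antisym)
 show "hausdorff_dim J \<le> ennreal \<alpha>"
 proof (rule ennreal_le_epsilon)
  fix e :: real assume e: "0 < e"
  have "hausdorff_dim J \<le> ennreal (\<alpha> + e)"
   unfolding hausdorff_dim_def by (rule INF_lower) (use \<alpha> e hausdorff_null[of "\<alpha> + e"] in auto)
  then show "hausdorff_dim J \<le> ennreal \<alpha> + ennreal e" using \<alpha> e by simp
 qed
 show "ennreal \<alpha> \<le> hausdorff_dim J"
  unfolding hausdorff_dim_def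
 proof (rule INF_greatest, safe)
  fix s assume s: "0 < s" "hausdorff_measure s J = 0"
  have "ereal (\<alpha> * chi) \<le> ereal (s * chi)" using entropy_ge entropy_le_dimension[OF s] by (rule order_trans)
  then show "ennreal \<alpha> \<le> ennreal s" using chi_pos by (simp add: ennreal_leI)
 qed
qed

theorem corollary8p4:
 fixes f :: "rsphere \<Rightarrow> rsphere" and d :: nat and \<mu> \<nu>\<^sub>0 :: "rsphere measure"
 assumes "rational_map f d" and "d \<ge> 2"
  and "TCE f"
  and "conformal_measure f (minimal_exponent f) \<mu>" and "prob_space \<mu>"
  and "invariant_prob f \<nu>\<^sub>0" and "absolutely_continuous \<mu> \<nu>\<^sub>0"
 shows "equilibrium_state f (enn2real (hausdorff_dim (Julia f))) \<nu>\<^sub>0 \<and>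
  (\<forall>\<nu>. equilibrium_state f (enn2real (hausdorff_dim (Julia f))) \<nu> \<longrightarrow> \<nu> = \<nu>\<^sub>0)"
proof -
 define \<alpha> where "\<alpha> = minimal_exponent f"
 have tce: "tce_map f d" using assms(1-3) by (intro tce_map.intro rational.intro tce_map_axioms.intro)
 have conf: "conformal f d \<mu> \<alpha>"
  using tce assms(4,5) unfolding \<alpha>_def by (intro conformal.intro conformal_axioms.intro)
 interpret C: conformal f d \<mu> \<alpha> by (rule conf)
 have inv: "inv_measure f \<nu>" if "invariant_prob f \<nu>" for \<nu> by (rule inv_measure.intro[OF that C.cont])
 have julia: "julia_measure f d \<nu>" if "invariant_prob f \<nu>" "supported_on \<nu> (Julia f)" for \<nu>
  by (intro julia_measure.intro julia_measure_axioms.intro tce inv that)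
 have ci: "conformal_invariant f d \<mu> \<alpha> \<nu>" if "invariant_prob f \<nu>" "absolutely_continuous \<mu> \<nu>" for \<nu>
  by (intro conformal_invariant.intro conformal_invariant_axioms.intro conf inv that)
 have ac: "ac_measure f d \<mu> \<alpha> \<nu>"
  if "invariant_prob f \<nu>" "supported_on \<nu> (Julia f)" "absolutely_continuous \<mu> \<nu>" for \<nu>
  by (rule ac_measure.intro[OF ci[OF that(1,3)] julia[OF that(1,2)]])
 have supp0: "supported_on \<nu>\<^sub>0 (Julia f)" by (rule conformal_invariant.fatou_null[OF ci[OF assms(6,7)]])
 interpret A: ac_measure f d \<mu> \<alpha> \<nu>\<^sub>0 by (rule ac[OF assms(6) supp0 assms(7)])
 have HD: "enn2real (hausdorff_dim (Julia f)) = \<alpha>" using A.hausdorff_dim_Julia C.\<alpha> by simp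
 have upper: "metric_entropy \<nu> f - ereal \<alpha> * lyapunov f \<nu> \<le> 0"
  if "invariant_prob f \<nu>" "supported_on \<nu> (Julia f)" for \<nu>
 proof -
  interpret N: julia_measure f d \<nu> by (rule julia[OF that])
  show ?thesis using A.entropy_le[OF julia[OF that]] by (simp add: N.lyapunov_eq ereal_minus_le)
 qed
 have zero: "metric_entropy \<nu>\<^sub>0 f - ereal \<alpha> * lyapunov f \<nu>\<^sub>0 = 0"
 proof -
  have "metric_entropy \<nu>\<^sub>0 f = ereal (\<alpha> * A.chi)"
   using A.entropy_ge A.entropy_le[OF A.julia_measure_axioms] by (rule antisym[rotated])
  then show ?thesis by (simp add: A.lyapunov_eq zero_ereal_def)
 qed
 have "equilibrium_state f \<alpha> \<nu>\<^sub>0"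
  unfolding equilibrium_state_def zero using upper assms(6) supp0 by blast
 moreover have "\<nu> = \<nu>\<^sub>0" if eq: "equilibrium_state f \<alpha> \<nu>" for \<nu>
 proof -
  have \<nu>: "invariant_prob f \<nu>" "supported_on \<nu> (Julia f)"
   and ge: "0 \<le> metric_entropy \<nu> f - ereal \<alpha> * lyapunov f \<nu>"
   using eq assms(6) supp0 zero unfolding equilibrium_state_def by auto
  \<comment> \<open>Full support of \<mu> on the Julia set was derived from
    \<open>\<nu>\<^sub>0\<close>; it now serves the arbitrary equilibrium state \<nu>.\<close>
  interpret N: charged_julia f d \<mu> \<alpha> \<nu>
  proof (rule charged_julia.intro[OF conf julia[OF \<nu>]], rule charged_julia_axioms.intro)
   fix y assume "y \<in> Julia f"
   then show "0 < measure \<mu> (ball y C.r0)" by (rule A.full_support[rotated 2]) (use C.r0 in auto)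
  qed
  have "ereal (\<alpha> * N.chi) \<le> metric_entropy \<nu> f"
   using ge N.metric_entropy_nonneg by (cases "metric_entropy \<nu> f") (auto simp: N.lyapunov_eq zero_ereal_def)
  then have "absolutely_continuous \<mu> \<nu>" using N.entropy_strict by fastforce
  then have "ac_measure f d \<mu> \<alpha> \<nu>" by (rule ac[OF \<nu>])
  then show ?thesis using ac_measure_unique A.ac_measure_axioms by blast
 qed
 ultimately show ?thesis unfolding HD by blast
qed

end
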